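(* Let $\Gamma$ be a metrized graph, let $\mu$ be a real-valued signed Borel measure on $\Gamma$ with $\mu(\Gamma)=1$ and $|\mu|(\Gamma)<\infty$, and let $\varphi_\mu:L^2(\Gamma)\to L^2(\Gamma)$ be the operator $\varphi_\mu(f)(x)=\int_\Gamma g_\mu(x,y)f(y)\,dy$. The map $\varphi_\mu$ has countably many eigenvalues $\alpha_i$, each of which is real and occurs with finite multiplicity. The nonzero eigenvalues can be ordered so that $|\alpha_1|\ge|\alpha_2|\ge\cdots$ and $\lim_{i\to\infty}|\alpha_i|=0$. The space $L^2(\Gamma)$ has an orthonormal basis consisting of eigenfunctions of $\varphi_\mu$, and each eigenfunction corresponding to a nonzero eigenvalue belongs to $\mathrm{BDV}_\mu(\Gamma)$.
   Context: A metrized graph $\Gamma$ is a compact connected metric space such that for each $p\in\Gamma$ there are a radius $r_p>0$ and an integer $n_p\ge 1$ such that $p$ has a neighborhood isometric to the star $\{te^{2\pi i k/n_p}\in\mathbb{C}: 0\le t<r_p,\ k\in\mathbb{Z}\}$ with the path metric. $\mathrm{Vec}(p)$ is the set of $n_p$ formal unit vectors at $p$ (one for each ray of the star); $p+t\vec v$ is the point at distance $t$ from $p$ in direction $\vec v$ (small $t\ge0$), and $d_{\vec v}f(p)=\lim_{t\to0^+}(f(p+t\vec v)-f(p))/t$. $dx$ is arc-length measure; $L^2(\Gamma)=L^2(\Gamma,dx)$. Kernel $g_\mu$: $\mathrm{CPA}(\Gamma)$ is the space of continuous piecewise affine functions $f:\Gamma\to\mathbb{C}$; for such $f$, $\Delta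 f=-\sum_{p}\big(\sum_{\vec v\in\mathrm{Vec}(p)}d_{\vec v}f(p)\big)\delta_p$. For $\zeta,y\in\Gamma$, $x\mapsto j_\zeta(x,y)$ is the unique function in $\mathrm{CPA}(\Gamma)$ with $\Delta_x j_\zeta(x,y)=\delta_y-\delta_\zeta$ and $j_\zeta(\zeta,y)=0$; $j_\zeta(x,y)$ is jointly continuous in $(\zeta,x,y)$ and symmetric in $x,y$. Put $j_\mu(x,y)=\int_\Gamma j_\zeta(x,y)\,d\mu(\zeta)$; the number $c_\mu=\int_\Gamma j_\mu(x,y)\,d\mu(x)$ does not depend on $y$, and $g_\mu(x,y)=j_\mu(x,y)-c_\mu$. The space $\mathrm{BDV}_\mu$: $\mathcal{D}(\Gamma)$ is the set of $f:\Gamma\to\mathbb{C}$ such that $d_{\vec v}f(p)$ exists (as a finite number) for all $p$ and all $\vec v\in\mathrm{Vec}(p)$. $\mathcal{A}$ is the Boolean algebra of subsets of $\Gamma$ generated by the connected open sets. For $S\in\mathcal{A}$, $b(S)$ is the (finite) set of points lying in the closures of both $S$ and $\Gamma\setminus S$; for $p\in b(S)$, $\mathrm{In}(p,S)$ is the set of $\vec v\in\mathrm{Vec}(p)$ with $p+t\vec v\in S$ for all sufficiently small $t>0$, and $\mathrm{Out}(p,S)=\mathrm{Vec}(p)\setminus\mathrm{In}(p,S)$. For $f\in\mathcal{D}(\Gamma)$ and $S\in\mathcal{A}$, $m_f(S)=\sum_{b\in b(S),\,b\notin S}\sum_{\vec v\in\mathrm{In}(b,S)}d_{\vec v}f(b)-\sum_{b\in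 b(S),\,b\in S}\sum_{\vec v\in\mathrm{Out}(b,S)}d_{\vec v}f(b)$. $\mathrm{BDV}(\Gamma)$ is the set of $f\in\mathcal{D}(\Gamma)$ for which there is $B>0$ with $\sum_i|m_f(S_i)|\le B$ for every countable family $\{S_i\}$ of pairwise disjoint sets in $\mathcal{A}$. $\mathrm{BDV}_\mu(\Gamma)=\{f\in\mathrm{BDV}(\Gamma):\int_\Gamma f\,d\mu=0\}$. A nonzero $f\in L^2(\Gamma)$ is an eigenfunction of $\varphi_\mu$ with eigenvalue $\alpha$ if $\varphi_\mu(f)=\alpha f$. *)

theory Defs
  imports "HOL-Analysis.Analysis"
begin

section \<open>Metrized graphs\<close>

text \<open>A metrized graph is a subset \<open>\<Gamma>\<close> of a metric space, with the induced metric. Functions on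
  \<open>\<Gamma>\<close> are total functions on the ambient type whose values off \<open>\<Gamma>\<close> are irrelevant.\<close>

definition star :: "nat \<Rightarrow> real \<Rightarrow> complex set" where
  "star n r = {of_real t * cis (2 * pi * of_int k / of_nat n) | t k. 0 \<le> t \<and> t < r}"

text \<open>The path metric of a star: two points on a common ray are joined by a segment of that ray,
  all others by a path through the centre \<open>0\<close>. (If \<open>z\<close> or \<open>w\<close> is \<open>0\<close>, both branches agree.)\<close>

definition star_dist :: "complex \<Rightarrow> complex \<Rightarrow> real" where
  "star_dist z w = (if sgn z = sgn w then dist z w else norm z + norm w)"

definition star_chart :: "'a::metric_space set \<Rightarrow> 'a \<Rightarrow> nat \<Rightarrow> real \<Rightarrow> (complex \<Rightarrow> 'a) \<Rightarrow> bool" where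
  "star_chart \<Gamma> p n r \<psi> \<longleftrightarrow> n \<ge> 1 \<and> r > 0 \<and> \<psi> 0 = p \<and> \<psi> ` star n r \<subseteq> \<Gamma> \<and>
     (\<forall>z\<in>star n r. \<forall>w\<in>star n r. dist (\<psi> z) (\<psi> w) = star_dist z w) \<and>
     (\<exists>U. openin (top_of_set \<Gamma>) U \<and> p \<in> U \<and> U \<subseteq> \<psi> ` star n r)"

definition metrized_graph :: "'a::metric_space set \<Rightarrow> bool" where
  "metrized_graph \<Gamma> \<longleftrightarrow> \<Gamma> \<noteq> {} \<and> compact \<Gamma> \<and> connected \<Gamma> \<and>
     (\<forall>p\<in>\<Gamma>. \<exists>n r \<psi>. star_chart \<Gamma> p n r \<psi>)"

text \<open>The integer \<open>n\<^sub>p\<close> is determined by \<open>p\<close>; another choice of radius and isometry only relabels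
  the formal unit vectors at \<open>p\<close>.\<close>

definition chosen_chart :: "'a::metric_space set \<Rightarrow> 'a \<Rightarrow> nat \<times> real \<times> (complex \<Rightarrow> 'a)" where
  "chosen_chart \<Gamma> p = (SOME (n, r, \<psi>). star_chart \<Gamma> p n r \<psi>)"

definition Vec :: "'a::metric_space set \<Rightarrow> 'a \<Rightarrow> complex set" where
  "Vec \<Gamma> p = (let (n, r, \<psi>) = chosen_chart \<Gamma> p
             in {cis (2 * pi * of_int k / of_nat n) | k :: int. True})"

text \<open>\<open>move \<Gamma> p v t\<close> is the point \<open>p + t v\<close>; it is meaningful for small \<open>t \<ge> 0\<close>.\<close>

definition move :: "'a::metric_space set \<Rightarrow> 'a \<Rightarrow> complex \<Rightarrow> real \<Rightarrow> 'a" where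
  "move \<Gamma> p v t = (let (n, r, \<psi>) = chosen_chart \<Gamma> p in \<psi> (of_real t * v))"

definition has_dir_deriv ::
    "'a::metric_space set \<Rightarrow> ('a \<Rightarrow> complex) \<Rightarrow> 'a \<Rightarrow> complex \<Rightarrow> complex \<Rightarrow> bool" where
  "has_dir_deriv \<Gamma> f p v l \<longleftrightarrow>
     ((\<lambda>t. (f (move \<Gamma> p v t) - f p) / of_real t) \<longlongrightarrow> l) (at_right 0)"

definition dir_deriv :: "'a::metric_space set \<Rightarrow> ('a \<Rightarrow> complex) \<Rightarrow> 'a \<Rightarrow> complex \<Rightarrow> complex" where
  "dir_deriv \<Gamma> f p v = (THE l. has_dir_deriv \<Gamma> f p v l)"

definition borel_on :: "'a::topological_space set \<Rightarrow> 'a measure" where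
  "borel_on \<Gamma> = restrict_space borel \<Gamma>"

definition segment_in :: "'a::metric_space set \<Rightarrow> real \<Rightarrow> real \<Rightarrow> (real \<Rightarrow> 'a) \<Rightarrow> bool" where
  "segment_in S a b \<gamma> \<longleftrightarrow> a \<le> b \<and> \<gamma> ` {a..b} \<subseteq> S \<and>
     (\<forall>s\<in>{a..b}. \<forall>t\<in>{a..b}. dist (\<gamma> s) (\<gamma> t) = \<bar>s - t\<bar>)"

text \<open>Arc-length measure: the Borel measure on \<open>\<Gamma>\<close> that gives each isometrically embedded interval
  its length.\<close>

definition arc_length :: "'a::metric_space set \<Rightarrow> 'a measure" where
  "arc_length \<Gamma> = (THE M. sets M = sets (borel_on \<Gamma>) \<and>
     (\<forall>a b \<gamma>. segment_in \<Gamma> a b \<gamma> \<longrightarrow> emeasure M (\<gamma> ` {a..b}) = ennreal (b - a)))"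


section \<open>Signed measures\<close>

definition signed_measure :: "'a measure \<Rightarrow> ('a set \<Rightarrow> real) \<Rightarrow> bool" where
  "signed_measure M \<mu> \<longleftrightarrow> \<mu> {} = 0 \<and>
     (\<forall>A :: nat \<Rightarrow> 'a set. range A \<subseteq> sets M \<longrightarrow> disjoint_family A \<longrightarrow>
        (\<lambda>i. \<mu> (A i)) sums \<mu> (\<Union>i. A i))"

definition total_variation :: "'a measure \<Rightarrow> ('a set \<Rightarrow> real) \<Rightarrow> 'a set \<Rightarrow> ennreal" where
  "total_variation M \<mu> A =
     (SUP P\<in>{P. finite P \<and> P \<subseteq> sets M \<and> partition_on A P}. \<Sum>E\<in>P. ennreal \<bar>\<mu> E\<bar>)"

text \<open>The Jordan decomposition \<open>\<mu> = \<mu>\<^sup>+ - \<mu>\<^sup>-\<close> with \<open>\<mu>\<^sup>+ = (\<bar>\<mu>\<bar> + \<mu>) / 2\<close> and \<open>\<mu>\<^sup>- = (\<bar>\<mu>\<bar> - \<mu>) / 2\<close>.\<close>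

definition pos_part :: "'a measure \<Rightarrow> ('a set \<Rightarrow> real) \<Rightarrow> 'a measure" where
  "pos_part M \<mu> = measure_of (space M) (sets M)
     (\<lambda>A. ennreal ((enn2real (total_variation M \<mu> A) + \<mu> A) / 2))"

definition neg_part :: "'a measure \<Rightarrow> ('a set \<Rightarrow> real) \<Rightarrow> 'a measure" where
  "neg_part M \<mu> = measure_of (space M) (sets M)
     (\<lambda>A. ennreal ((enn2real (total_variation M \<mu> A) - \<mu> A) / 2))"

definition signed_integral :: "'a measure \<Rightarrow> ('a set \<Rightarrow> real) \<Rightarrow> ('a \<Rightarrow> complex) \<Rightarrow> complex" where
  "signed_integral M \<mu> f = integral\<^sup>L (pos_part M \<mu>) f - integral\<^sup>L (neg_part M \<mu>) f"


section \<open>The kernel\<close>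

definition CPA :: "'a::metric_space set \<Rightarrow> ('a \<Rightarrow> complex) set" where
  "CPA \<Gamma> = {f. continuous_on \<Gamma> f \<and>
     (\<exists>X. finite X \<and> X \<subseteq> \<Gamma> \<and>
       (\<forall>a b \<gamma>. segment_in (\<Gamma> - X) a b \<gamma> \<longrightarrow>
          (\<exists>c m. \<forall>t\<in>{a..b}. f (\<gamma> t) = c + of_real t * m)))}"

definition slope_sum :: "'a::metric_space set \<Rightarrow> ('a \<Rightarrow> complex) \<Rightarrow> 'a \<Rightarrow> complex" where
  "slope_sum \<Gamma> f p = (\<Sum>v\<in>Vec \<Gamma> p. dir_deriv \<Gamma> f p v)"

text \<open>\<open>\<Delta> f\<close> as a set function on \<open>\<Gamma>\<close>; for \<open>f \<in> CPA \<Gamma>\<close> the sum is finite.\<close>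

definition laplacian :: "'a::metric_space set \<Rightarrow> ('a \<Rightarrow> complex) \<Rightarrow> 'a set \<Rightarrow> complex" where
  "laplacian \<Gamma> f A = - (\<Sum>p\<in>{p\<in>A. slope_sum \<Gamma> f p \<noteq> 0}. slope_sum \<Gamma> f p)"

text \<open>\<open>j_kernel \<Gamma> \<zeta> x y\<close> is \<open>j\<^sub>\<zeta>(x,y)\<close>. The function \<open>x \<mapsto> j\<^sub>\<zeta>(x,y)\<close> is unique only on \<open>\<Gamma>\<close>, so the
  description fixes its values outside \<open>\<Gamma>\<close> by extensionality.\<close>

definition j_kernel :: "'a::metric_space set \<Rightarrow> 'a \<Rightarrow> 'a \<Rightarrow> 'a \<Rightarrow> complex" where
  "j_kernel \<Gamma> \<zeta> x y = (THE f. f \<in> CPA \<Gamma> \<and> f \<in> extensional \<Gamma> \<and>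
     (\<forall>A\<in>sets (borel_on \<Gamma>). laplacian \<Gamma> f A = indicator A y - indicator A \<zeta>) \<and> f \<zeta> = 0) x"

definition j_mu :: "'a::metric_space set \<Rightarrow> ('a set \<Rightarrow> real) \<Rightarrow> 'a \<Rightarrow> 'a \<Rightarrow> complex" where
  "j_mu \<Gamma> \<mu> x y = signed_integral (borel_on \<Gamma>) \<mu> (\<lambda>\<zeta>. j_kernel \<Gamma> \<zeta> x y)"

definition c_mu :: "'a::metric_space set \<Rightarrow> ('a set \<Rightarrow> real) \<Rightarrow> complex" where
  "c_mu \<Gamma> \<mu> = (THE c. \<forall>y\<in>\<Gamma>. c = signed_integral (borel_on \<Gamma>) \<mu> (\<lambda>x. j_mu \<Gamma> \<mu> x y))"

definition g_mu :: "'a::metric_space set \<Rightarrow> ('a set \<Rightarrow> real) \<Rightarrow> 'a \<Rightarrow> 'a \<Rightarrow> complex" where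
  "g_mu \<Gamma> \<mu> x y = j_mu \<Gamma> \<mu> x y - c_mu \<Gamma> \<mu>"


section \<open>The space of functions of bounded differential variation\<close>

definition dir_differentiable :: "'a::metric_space set \<Rightarrow> ('a \<Rightarrow> complex) set" where
  "dir_differentiable \<Gamma> = {f. \<forall>p\<in>\<Gamma>. \<forall>v\<in>Vec \<Gamma> p. \<exists>l. has_dir_deriv \<Gamma> f p v l}"

definition graph_algebra :: "'a::metric_space set \<Rightarrow> 'a set set" where
  "graph_algebra \<Gamma> = algebra \<Gamma> hull {U. openin (top_of_set \<Gamma>) U \<and> connected U}"

definition bdry :: "'a::metric_space set \<Rightarrow> 'a set \<Rightarrow> 'a set" where
  "bdry \<Gamma> S = \<Gamma> \<inter> closure S \<inter> closure (\<Gamma> - S)"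

definition In_vec :: "'a::metric_space set \<Rightarrow> 'a \<Rightarrow> 'a set \<Rightarrow> complex set" where
  "In_vec \<Gamma> p S = {v\<in>Vec \<Gamma> p. eventually (\<lambda>t. move \<Gamma> p v t \<in> S) (at_right 0)}"

definition Out_vec :: "'a::metric_space set \<Rightarrow> 'a \<Rightarrow> 'a set \<Rightarrow> complex set" where
  "Out_vec \<Gamma> p S = Vec \<Gamma> p - In_vec \<Gamma> p S"

definition m_fun :: "'a::metric_space set \<Rightarrow> ('a \<Rightarrow> complex) \<Rightarrow> 'a set \<Rightarrow> complex" where
  "m_fun \<Gamma> f S =
     (\<Sum>b\<in>bdry \<Gamma> S - S. \<Sum>v\<in>In_vec \<Gamma> b S. dir_deriv \<Gamma> f b v) -
     (\<Sum>b\<in>bdry \<Gamma> S \<inter> S. \<Sum>v\<in>Out_vec \<Gamma> b S. dir_deriv \<Gamma> f b v)"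

text \<open>Sequences cover all countable families: a finite family is padded with \<open>{}\<close>, and
  \<open>m_fun \<Gamma> f {} = 0\<close>.\<close>

definition BDV :: "'a::metric_space set \<Rightarrow> ('a \<Rightarrow> complex) set" where
  "BDV \<Gamma> = {f\<in>dir_differentiable \<Gamma>. \<exists>B>0. \<forall>S :: nat \<Rightarrow> 'a set.
     range S \<subseteq> graph_algebra \<Gamma> \<longrightarrow> disjoint_family S \<longrightarrow>
     (\<Sum>i. ennreal (norm (m_fun \<Gamma> f (S i)))) \<le> ennreal B}"

definition BDV_mu :: "'a::metric_space set \<Rightarrow> ('a set \<Rightarrow> real) \<Rightarrow> ('a \<Rightarrow> complex) set" where
  "BDV_mu \<Gamma> \<mu> = {f\<in>BDV \<Gamma>. signed_integral (borel_on \<Gamma>) \<mu> f = 0}"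


section \<open>The integral operator on square-integrable functions\<close>

text \<open>Elements of \<open>L\<^sup>2\<close> are represented by square-integrable functions, with equality in \<open>L\<^sup>2\<close>
  rendered as equality almost everywhere.\<close>

definition L2 :: "'a::metric_space set \<Rightarrow> ('a \<Rightarrow> complex) set" where
  "L2 \<Gamma> = {f\<in>borel_measurable (arc_length \<Gamma>). integrable (arc_length \<Gamma>) (\<lambda>x. (norm (f x))\<^sup>2)}"

definition L2_inner :: "'a::metric_space set \<Rightarrow> ('a \<Rightarrow> complex) \<Rightarrow> ('a \<Rightarrow> complex) \<Rightarrow> complex" where
  "L2_inner \<Gamma> f g = integral\<^sup>L (arc_length \<Gamma>) (\<lambda>x. f x * cnj (g x))"

definition L2_norm :: "'a::metric_space set \<Rightarrow> ('a \<Rightarrow> complex) \<Rightarrow> real" where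
  "L2_norm \<Gamma> f = sqrt (integral\<^sup>L (arc_length \<Gamma>) (\<lambda>x. (norm (f x))\<^sup>2))"

text \<open>An orthonormal basis in the Hilbert space sense: its linear span is dense.\<close>

definition orthonormal_basis :: "'a::metric_space set \<Rightarrow> ('a \<Rightarrow> complex) set \<Rightarrow> bool" where
  "orthonormal_basis \<Gamma> E \<longleftrightarrow> E \<subseteq> L2 \<Gamma> \<and>
     (\<forall>e\<in>E. \<forall>e'\<in>E. L2_inner \<Gamma> e e' = (if e = e' then 1 else 0)) \<and>
     (\<forall>f\<in>L2 \<Gamma>. \<forall>\<epsilon>>0. \<exists>F c. finite F \<and> F \<subseteq> E \<and>
        L2_norm \<Gamma> (\<lambda>x. f x - (\<Sum>e\<in>F. c e * e x)) < \<epsilon>)"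

definition phi_mu ::
    "'a::metric_space set \<Rightarrow> ('a set \<Rightarrow> real) \<Rightarrow> ('a \<Rightarrow> complex) \<Rightarrow> 'a \<Rightarrow> complex" where
  "phi_mu \<Gamma> \<mu> f x = integral\<^sup>L (arc_length \<Gamma>) (\<lambda>y. g_mu \<Gamma> \<mu> x y * f y)"

definition eigenspace ::
    "'a::metric_space set \<Rightarrow> ('a set \<Rightarrow> real) \<Rightarrow> complex \<Rightarrow> ('a \<Rightarrow> complex) set" where
  "eigenspace \<Gamma> \<mu> \<alpha> = {f\<in>L2 \<Gamma>. AE x in arc_length \<Gamma>. phi_mu \<Gamma> \<mu> f x = \<alpha> * f x}"

definition eigenfunction ::
    "'a::metric_space set \<Rightarrow> ('a set \<Rightarrow> real) \<Rightarrow> complex \<Rightarrow> ('a \<Rightarrow> complex) \<Rightarrow> bool" where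
  "eigenfunction \<Gamma> \<mu> \<alpha> f \<longleftrightarrow> f \<in> eigenspace \<Gamma> \<mu> \<alpha> \<and> \<not> (AE x in arc_length \<Gamma>. f x = 0)"

definition eigenvalues :: "'a::metric_space set \<Rightarrow> ('a set \<Rightarrow> real) \<Rightarrow> complex set" where
  "eigenvalues \<Gamma> \<mu> = {\<alpha>. \<exists>f. eigenfunction \<Gamma> \<mu> \<alpha> f}"

definition finite_multiplicity ::
    "'a::metric_space set \<Rightarrow> ('a set \<Rightarrow> real) \<Rightarrow> complex \<Rightarrow> bool" where
  "finite_multiplicity \<Gamma> \<mu> \<alpha> \<longleftrightarrow>
     (\<exists>F. finite F \<and> F \<subseteq> eigenspace \<Gamma> \<mu> \<alpha> \<and>
        (\<forall>f\<in>eigenspace \<Gamma> \<mu> \<alpha>. \<exists>c. AE x in arc_length \<Gamma>. f x = (\<Sum>h\<in>F. c h * h x)))"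

end

theory Submission
  imports Defs "HOL-Complex_Analysis.Great_Picard"
begin

section \<open>Local geometry: small metric balls are stars\<close>

lemma Vec_unit: "v \<in> Vec \<Gamma> p \<Longrightarrow> norm v = 1"
  by (auto simp: Vec_def Let_def split: prod.splits)

definition star_ball :: "'a::metric_space set \<Rightarrow> 'a \<Rightarrow> real \<Rightarrow> bool" where
  "star_ball \<Gamma> p \<rho> \<longleftrightarrow> 0 < \<rho> \<and>
     (\<forall>v\<in>Vec \<Gamma> p. move \<Gamma> p v 0 = p \<and> (\<forall>t\<in>{0..\<rho>}. move \<Gamma> p v t \<in> \<Gamma>)) \<and>
     (\<forall>v\<in>Vec \<Gamma> p. \<forall>w\<in>Vec \<Gamma> p. \<forall>s\<in>{0..\<rho>}. \<forall>t\<in>{0..\<rho>}.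
        dist (move \<Gamma> p v s) (move \<Gamma> p w t) = (if v = w then \<bar>s - t\<bar> else s + t)) \<and>
     (\<forall>x\<in>\<Gamma>. dist p x \<le> \<rho> \<longrightarrow> (\<exists>v\<in>Vec \<Gamma> p. x = move \<Gamma> p v (dist p x)))"

locale metric_graph =
  fixes \<Gamma> :: "'a::metric_space set"
  assumes mg: "metrized_graph \<Gamma>"
begin

lemma compact_graph: "compact \<Gamma>" and connected_graph: "connected \<Gamma>" and graph_nonempty: "\<Gamma> \<noteq> {}"
  using mg by (auto simp: metrized_graph_def)

lemma closed_graph: "closed \<Gamma>"
  using compact_graph by (rule compact_imp_closed)

lemma chosen_chart:
  assumes "p \<in> \<Gamma>"
  obtains n r \<psi> where "chosen_chart \<Gamma> p = (n, r, \<psi>)" "star_chart \<Gamma> p n r \<psi>"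
proof -
  from mg assms obtain n r \<psi> where "star_chart \<Gamma> p n r \<psi>"
    unfolding metrized_graph_def by blast
  then have "case (n, r, \<psi>) of (n, r, \<psi>) \<Rightarrow> star_chart \<Gamma> p n r \<psi>" by simp
  then have "case chosen_chart \<Gamma> p of (n, r, \<psi>) \<Rightarrow> star_chart \<Gamma> p n r \<psi>"
    unfolding chosen_chart_def by (rule someI)
  then show thesis using that by (cases "chosen_chart \<Gamma> p") auto
qed

lemma Vec_finite: "p \<in> \<Gamma> \<Longrightarrow> finite (Vec \<Gamma> p)" and Vec_nonempty: "p \<in> \<Gamma> \<Longrightarrow> Vec \<Gamma> p \<noteq> {}"
proof -
  assume "p \<in> \<Gamma>"
  then obtain n r \<psi> where c: "chosen_chart \<Gamma> p = (n, r, \<psi>)" "star_chart \<Gamma> p n r \<psi>"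
    by (rule chosen_chart)
  have n: "n \<ge> 1" using c(2) by (simp add: star_chart_def)
  have V: "Vec \<Gamma> p = {cis (2 * pi * of_int k / of_nat n) | k :: int. True}"
    by (simp add: Vec_def c(1))
  have *: "cis (2 * pi * of_int k / of_nat n) = cis (2 * pi * of_int (k mod int n) / of_nat n)" for k :: int
  proof -
    have "real_of_int k = of_int (k div int n) * of_nat n + of_int (k mod int n)"
      by (metis div_mult_mod_eq of_int_add of_int_mult of_int_of_nat_eq)
    then have "2 * pi * of_int k / of_nat n
        = 2 * pi * of_int (k div int n) + 2 * pi * of_int (k mod int n) / of_nat n"
      using n by (simp add: field_simps)
    then have "cis (2 * pi * of_int k / of_nat n)
        = cis (2 * pi * of_int (k div int n)) * cis (2 * pi * of_int (k mod int n) / of_nat n)"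
      by (simp only: cis_mult)
    also have "cis (2 * pi * of_int (k div int n)) = 1"
      by (rule cis_multiple_2pi) simp
    finally show ?thesis by simp
  qed
  have "Vec \<Gamma> p \<subseteq> (\<lambda>k. cis (2 * pi * of_int k / of_nat n)) ` {0..<int n}"
  proof
    fix v assume "v \<in> Vec \<Gamma> p"
    then obtain k where "v = cis (2 * pi * of_int k / of_nat n)" unfolding V by blast
    moreover have "k mod int n \<in> {0..<int n}" using n by simp
    ultimately show "v \<in> (\<lambda>k. cis (2 * pi * of_int k / of_nat n)) ` {0..<int n}"
      using * by blast
  qed
  then show "finite (Vec \<Gamma> p)" by (rule finite_subset) simp
  show "Vec \<Gamma> p \<noteq> {}" unfolding V by blast
qed

lemma star_ball_exists:
  assumes p: "p \<in> \<Gamma>"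
  shows "\<exists>\<rho>. star_ball \<Gamma> p \<rho>"
proof -
  obtain n r \<psi> where c: "chosen_chart \<Gamma> p = (n, r, \<psi>)" "star_chart \<Gamma> p n r \<psi>"
    using p by (rule chosen_chart)
  have r: "r > 0" and \<psi>0: "\<psi> 0 = p" and \<psi>\<Gamma>: "\<psi> ` star n r \<subseteq> \<Gamma>"
    and iso: "\<And>z w. z \<in> star n r \<Longrightarrow> w \<in> star n r \<Longrightarrow> dist (\<psi> z) (\<psi> w) = star_dist z w"
    using c(2) by (auto simp: star_chart_def)
  obtain U where U: "openin (top_of_set \<Gamma>) U" "p \<in> U" "U \<subseteq> \<psi> ` star n r"
    using c(2) by (auto simp: star_chart_def)
  then obtain \<delta> where \<delta>: "\<delta> > 0" "\<And>x. x \<in> \<Gamma> \<Longrightarrow> dist x p < \<delta> \<Longrightarrow> x \<in> U"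
    unfolding openin_euclidean_subtopology_iff by blast
  have V: "Vec \<Gamma> p = {cis (2 * pi * of_int k / of_nat n) | k :: int. True}"
    by (simp add: Vec_def c(1))
  have mv: "move \<Gamma> p v t = \<psi> (of_real t * v)" for v t by (simp add: move_def c(1))
  have st: "star n r = {of_real t * v | t v. v \<in> Vec \<Gamma> p \<and> 0 \<le> t \<and> t < r}"
    unfolding star_def V by blast
  have sgnv: "sgn (of_real t * v) = (if t = 0 then 0 else v)" if "v \<in> Vec \<Gamma> p" "t \<ge> 0" for v t
    using that Vec_unit[OF that(1)] by (simp add: sgn_div_norm norm_mult scaleR_conv_of_real)
  have sd: "star_dist (of_real s * v) (of_real t * w) = (if v = w then \<bar>s - t\<bar> else s + t)"
    if "v \<in> Vec \<Gamma> p" "w \<in> Vec \<Gamma> p" "s \<ge> 0" "t \<ge> 0" for v w s t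
  proof -
    have nv: "norm v = 1" "norm w = 1" using that Vec_unit by auto
    have d: "dist (of_real s * v) (of_real t * v) = \<bar>s - t\<bar>"
      using nv norm_of_real[of "s - t", where ?'a = complex]
      by (simp add: dist_norm norm_mult flip: left_diff_distrib)
    have v0: "v \<noteq> 0" "w \<noteq> 0" using nv by auto
    show ?thesis
      using that nv d v0 by (auto simp: star_dist_def sgnv norm_mult)
  qed
  define \<rho> where "\<rho> = min (r/2) (\<delta>/2)"
  have \<rho>: "\<rho> > 0" "\<rho> < r" "\<rho> < \<delta>" using r \<delta>(1) by (auto simp: \<rho>_def)
  have inst: "of_real t * v \<in> star n r" if "v \<in> Vec \<Gamma> p" "t \<in> {0..\<rho>}" for v t
    unfolding st using that \<rho> by force
  have "\<exists>v\<in>Vec \<Gamma> p. x = move \<Gamma> p v (dist p x)" if x: "x \<in> \<Gamma>" "dist p x \<le> \<rho>" for x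
  proof -
    have "x \<in> U" using \<delta>(2) x \<rho> by (simp add: dist_commute)
    then obtain t v where tv: "v \<in> Vec \<Gamma> p" "0 \<le> t" "t < r" "x = \<psi> (of_real t * v)"
      using U(3) unfolding st by blast
    have "dist p x = star_dist (of_real 0 * v) (of_real t * v)"
      using iso[of "of_real 0 * v" "of_real t * v"] tv r unfolding st
      by (metis (mono_tags, lifting) \<psi>0 mem_Collect_eq mult_zero_left of_real_0 order_refl)
    also have "\<dots> = t" using sd[OF tv(1) tv(1), of 0 t] tv by simp
    finally show ?thesis using tv mv by auto
  qed
  moreover have "move \<Gamma> p v 0 = p" for v by (simp add: mv \<psi>0)
  moreover have "move \<Gamma> p v t \<in> \<Gamma>" if "v \<in> Vec \<Gamma> p" "t \<in> {0..\<rho>}" for v t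
    using inst[OF that] \<psi>\<Gamma> mv by auto
  moreover have "dist (move \<Gamma> p v s) (move \<Gamma> p w t) = (if v = w then \<bar>s - t\<bar> else s + t)"
    if "v \<in> Vec \<Gamma> p" "w \<in> Vec \<Gamma> p" "s \<in> {0..\<rho>}" "t \<in> {0..\<rho>}" for v w s t
    using iso[OF inst inst, of v s w t] sd[of v w s t] that mv by auto
  ultimately have "star_ball \<Gamma> p \<rho>" unfolding star_ball_def using \<rho>(1) by blast
  then show ?thesis ..
qed

lemma star_ball_move:
  assumes "star_ball \<Gamma> p \<rho>"
  shows "0 < \<rho>"
    and "v \<in> Vec \<Gamma> p \<Longrightarrow> move \<Gamma> p v 0 = p"
    and "v \<in> Vec \<Gamma> p \<Longrightarrow> 0 \<le> t \<Longrightarrow> t \<le> \<rho> \<Longrightarrow> move \<Gamma> p v t \<in> \<Gamma>"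
    and "v \<in> Vec \<Gamma> p \<Longrightarrow> 0 \<le> s \<Longrightarrow> s \<le> \<rho> \<Longrightarrow> 0 \<le> t \<Longrightarrow> t \<le> \<rho> \<Longrightarrow>
      dist (move \<Gamma> p v s) (move \<Gamma> p v t) = \<bar>s - t\<bar>"
    and "v \<in> Vec \<Gamma> p \<Longrightarrow> w \<in> Vec \<Gamma> p \<Longrightarrow> v \<noteq> w \<Longrightarrow> 0 \<le> s \<Longrightarrow> s \<le> \<rho> \<Longrightarrow> 0 \<le> t \<Longrightarrow> t \<le> \<rho> \<Longrightarrow>
      dist (move \<Gamma> p v s) (move \<Gamma> p w t) = s + t"
    and "x \<in> \<Gamma> \<Longrightarrow> dist p x \<le> \<rho> \<Longrightarrow> \<exists>v\<in>Vec \<Gamma> p. x = move \<Gamma> p v (dist p x)"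
  using assms unfolding star_ball_def by auto

lemma star_ball_dist:
  assumes "star_ball \<Gamma> p \<rho>" "v \<in> Vec \<Gamma> p" "0 \<le> t" "t \<le> \<rho>"
  shows "dist p (move \<Gamma> p v t) = t"
  using star_ball_move(4)[OF assms(1,2), of 0 t] star_ball_move(1,2)[OF assms(1)] assms by auto

lemma star_ball_segment:
  assumes "star_ball \<Gamma> p \<rho>" "v \<in> Vec \<Gamma> p" "0 \<le> a" "a \<le> b" "b \<le> \<rho>"
  shows "segment_in \<Gamma> a b (move \<Gamma> p v)"
  unfolding segment_in_def using star_ball_move[OF assms(1)] assms by auto

text \<open>An open sub-interval of a ray is open in the graph, even if it starts at the centre of the
  star: the other rays stay away from each of its points.\<close>

lemma ray_interval_open:
  assumes sb: "star_ball \<Gamma> p \<rho>" and v: "v \<in> Vec \<Gamma> p" and ab: "0 \<le> a" "b \<le> \<rho>"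
  shows "openin (top_of_set \<Gamma>) (move \<Gamma> p v ` {a<..<b})"
  unfolding openin_euclidean_subtopology_iff
proof (intro conjI ballI)
  show "move \<Gamma> p v ` {a<..<b} \<subseteq> \<Gamma>" using star_ball_move(3)[OF sb v] ab by auto
  fix x assume "x \<in> move \<Gamma> p v ` {a<..<b}"
  then obtain s where s: "a < s" "s < b" "x = move \<Gamma> p v s" by auto
  define \<eta> where "\<eta> = min (s - a) (b - s)"
  have \<eta>: "\<eta> > 0" "\<eta> \<le> s - a" "\<eta> \<le> b - s" using s by (auto simp: \<eta>_def)
  have "y \<in> move \<Gamma> p v ` {a<..<b}" if y: "y \<in> \<Gamma>" "dist y x < \<eta>" for y
  proof -
    have px: "dist p x = s" using star_ball_dist[OF sb v] s ab by auto
    have tri: "dist p y \<le> dist p x + dist y x" by (metis dist_commute dist_triangle)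
    then have py: "dist p y \<le> \<rho>" using px y \<eta> ab by linarith
    then obtain w where w: "w \<in> Vec \<Gamma> p" "y = move \<Gamma> p w (dist p y)"
      using star_ball_move(6)[OF sb y(1)] by blast
    have "w = v"
    proof (rule ccontr)
      assume "w \<noteq> v"
      then have "dist y x = dist p y + s"
        using star_ball_move(5)[OF sb w(1) v, of "dist p y" s] w s py ab by simp
      then show False using y \<eta> ab zero_le_dist[of p y] by linarith
    qed
    then have "dist y x = \<bar>dist p y - s\<bar>"
      using star_ball_move(4)[OF sb v, of "dist p y" s] w s py ab by simp
    then have "dist p y \<in> {a<..<b}" using y \<eta> by auto
    then show ?thesis using w \<open>w = v\<close> by auto
  qed
  then show "\<exists>\<delta>>0. \<forall>y\<in>\<Gamma>. dist y x < \<delta> \<longrightarrow> y \<in> move \<Gamma> p v ` {a<..<b}"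
    using \<eta> by blast
qed

lemma finite_star_cover:
  "\<exists>P \<rho>. finite P \<and> P \<subseteq> \<Gamma> \<and> (\<forall>p\<in>P. star_ball \<Gamma> p (\<rho> p)) \<and>
    (\<forall>x\<in>\<Gamma>. \<exists>p\<in>P. dist p x < \<rho> p)"
proof -
  have "\<forall>p\<in>\<Gamma>. \<exists>r. star_ball \<Gamma> p r" using star_ball_exists by blast
  then obtain \<rho> where \<rho>: "\<And>p. p \<in> \<Gamma> \<Longrightarrow> star_ball \<Gamma> p (\<rho> p)" by metis
  have "\<Gamma> \<subseteq> \<Union> ((\<lambda>p. ball p (\<rho> p)) ` \<Gamma>)" using star_ball_move(1)[OF \<rho>] by force
  then obtain P where "P \<subseteq> \<Gamma>" "finite P" "\<Gamma> \<subseteq> \<Union> ((\<lambda>p. ball p (\<rho> p)) ` P)"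
    using compactE_image[OF compact_graph, of \<Gamma> "\<lambda>p. ball p (\<rho> p)"] by (metis open_ball)
  then show ?thesis using \<rho> by (intro exI[of _ P] exI[of _ \<rho>]) (auto simp: subset_iff)
qed

end

lemma segment_inD:
  assumes "segment_in S a b \<gamma>"
  shows "a \<le> b" "\<And>t. a \<le> t \<Longrightarrow> t \<le> b \<Longrightarrow> \<gamma> t \<in> S"
    "\<And>s t. a \<le> s \<Longrightarrow> s \<le> b \<Longrightarrow> a \<le> t \<Longrightarrow> t \<le> b \<Longrightarrow> dist (\<gamma> s) (\<gamma> t) = \<bar>s - t\<bar>"
  using assms unfolding segment_in_def by auto

lemma segment_in_sub:
  assumes "segment_in S a b \<gamma>" "a \<le> c" "c \<le> d" "d \<le> b" "\<gamma> ` {c..d} \<subseteq> T"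
  shows "segment_in T c d \<gamma>"
  using assms unfolding segment_in_def by auto

lemma segment_in_shift:
  assumes "segment_in S a b \<gamma>"
  shows "segment_in S (a - c) (b - c) (\<lambda>t. \<gamma> (c + t))"
  using assms unfolding segment_in_def by auto

lemma segment_in_reverse:
  assumes "segment_in S a b \<gamma>"
  shows "segment_in S (c - b) (c - a) (\<lambda>t. \<gamma> (c - t))"
  using assms unfolding segment_in_def by auto

lemma segment_continuous: "segment_in S a b \<gamma> \<Longrightarrow> continuous_on {a..b} \<gamma>"
  by (rule continuous_onI) (auto simp: segment_in_def dist_real_def)

lemma segment_inj: "segment_in S a b \<gamma> \<Longrightarrow> inj_on \<gamma> {a..b}"
  by (rule inj_onI) (metis abs_eq_0 atLeastAtMost_iff dist_self right_minus_eq segment_inD(3))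

lemma segment_compact: "segment_in S a b \<gamma> \<Longrightarrow> compact (\<gamma> ` {a..b})"
  by (intro compact_continuous_image segment_continuous) auto

text \<open>An isometry between subsets of the line is a translation or a reflection.\<close>

lemma real_isometry_affine:
  fixes k :: "real \<Rightarrow> real"
  assumes iso: "\<And>s t. s \<in> A \<Longrightarrow> t \<in> A \<Longrightarrow> \<bar>k s - k t\<bar> = \<bar>s - t\<bar>"
  obtains c \<epsilon> where "\<epsilon> = 1 \<or> \<epsilon> = -1" "\<And>t. t \<in> A \<Longrightarrow> k t = c + \<epsilon> * t"
proof (cases "\<exists>s\<in>A. \<exists>t\<in>A. s \<noteq> t")
  case True
  then obtain s t where st: "s \<in> A" "t \<in> A" "s \<noteq> t" by blast
  have "k t - k s = t - s \<or> k t - k s = - (t - s)" using iso[OF st(2,1)] by linarith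
  then show thesis
  proof
    assume 1: "k t - k s = t - s"
    have "k x = (k s - s) + 1 * x" if "x \<in> A" for x
      using iso[OF that st(1)] iso[OF that st(2)] 1 st(3) by (auto simp: abs_if split: if_splits)
    then show thesis using that by blast
  next
    assume 1: "k t - k s = - (t - s)"
    have "k x = (k s + s) + (-1) * x" if "x \<in> A" for x
      using iso[OF that st(1)] iso[OF that st(2)] 1 st(3) by (auto simp: abs_if split: if_splits)
    then show thesis using that by blast
  qed
next
  case False
  show thesis
  proof (cases "A = {}")
    case False
    then obtain s where "s \<in> A" by blast
    then have "k x = (k s - s) + 1 * x" if "x \<in> A" for x using that \<open>\<not> (\<exists>s\<in>A. \<exists>t\<in>A. s \<noteq> t)\<close> by auto
    then show thesis using that by blast
  qed (use that[of 1 0] in auto)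
qed

section \<open>Finite models of a graph\<close>

text \<open>An edge is an isometric parametrization together with its length. Edges are oriented, and every
  model contains each edge in both orientations, so that sums over the edges starting at a vertex
  need no case distinction and reversal becomes an involution of the set of edges.\<close>

datatype 'a edge = Edge (param: "real \<Rightarrow> 'a") (len: real)

definition rev_edge :: "'a edge \<Rightarrow> 'a edge" where
  "rev_edge e = Edge (\<lambda>t. param e (len e - t)) (len e)"

definition start :: "'a edge \<Rightarrow> 'a" where "start e = param e 0"
definition target :: "'a edge \<Rightarrow> 'a" where "target e = param e (len e)"
definition inner_edge :: "'a edge \<Rightarrow> 'a set" where "inner_edge e = param e ` {0<..<len e}"
definition closed_edge :: "'a edge \<Rightarrow> 'a set" where "closed_edge e = param e ` {0..len e}"

lemma rev_edge_simps [simp]: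
  "len (rev_edge e) = len e" "rev_edge (rev_edge e) = e" "param (rev_edge e) t = param e (len e - t)"
  "start (rev_edge e) = target e" "target (rev_edge e) = start e"
  by (cases e; simp add: rev_edge_def start_def target_def)+

lemma image_reflect:
  fixes g :: "real \<Rightarrow> 'b"
  shows "(\<lambda>t. g (L - t)) ` {0<..<L} = g ` {0<..<L}" "(\<lambda>t. g (L - t)) ` {0..L} = g ` {0..L}"
proof -
  have "(\<lambda>t. g (L - t)) ` S = g ` ((\<lambda>t. L - t) ` S)" for S by auto
  moreover have "x \<in> (\<lambda>t. L - t) ` {0<..<L}" if "x \<in> {0<..<L}" for x
    using that by (intro image_eqI[of _ _ "L - x"]) auto
  then have "(\<lambda>t. L - t) ` {0<..<L} = {0<..<L}" by auto
  moreover have "(\<lambda>t. L - t) ` {0..L} = {0..L}" by simp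
  ultimately show "(\<lambda>t. g (L - t)) ` {0<..<L} = g ` {0<..<L}"
    "(\<lambda>t. g (L - t)) ` {0..L} = g ` {0..L}" by metis+
qed

lemma image_shift:
  fixes g :: "real \<Rightarrow> 'b"
  shows "(\<lambda>s. g (a + s)) ` {0<..<b - a} = g ` {a<..<b}"
proof -
  have "x \<in> (\<lambda>s. a + s) ` {0<..<b - a}" if "x \<in> {a<..<b}" for x
    using that by (intro image_eqI[of _ _ "x - a"]) auto
  then have "(\<lambda>s. a + s) ` {0<..<b - a} = {a<..<b}" by auto
  moreover have "(\<lambda>s. g (a + s)) ` {0<..<b - a} = g ` ((\<lambda>s. a + s) ` {0<..<b - a})" by auto
  ultimately show ?thesis by metis
qed

lemma inner_rev_edge [simp]: "inner_edge (rev_edge e) = inner_edge e"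
  and closed_rev_edge [simp]: "closed_edge (rev_edge e) = closed_edge e"
  unfolding inner_edge_def closed_edge_def by (simp_all add: image_reflect)

lemma closed_edge_eq: "0 < len e \<Longrightarrow> closed_edge e = insert (start e) (insert (target e) (inner_edge e))"
proof -
  assume "0 < len e"
  then have "{0..len e} = insert 0 (insert (len e) {0<..<len e})" by auto
  then show ?thesis by (auto simp: closed_edge_def inner_edge_def start_def target_def)
qed

definition graph_model :: "'a::metric_space set \<Rightarrow> 'a set \<Rightarrow> 'a edge set \<Rightarrow> bool" where
  "graph_model \<Gamma> V D \<longleftrightarrow> finite V \<and> V \<subseteq> \<Gamma> \<and> finite D \<and>
     (\<forall>e\<in>D. 0 < len e \<and> segment_in \<Gamma> 0 (len e) (param e) \<and> start e \<in> V \<and> target e \<in> V \<and>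
        inner_edge e \<inter> V = {} \<and> rev_edge e \<in> D) \<and>
     (\<forall>e\<in>D. \<forall>e'\<in>D. e' = e \<or> e' = rev_edge e \<or> inner_edge e \<inter> inner_edge e' = {}) \<and>
     \<Gamma> = V \<union> \<Union> (inner_edge ` D)"

lemma graph_modelD:
  assumes "graph_model \<Gamma> V D"
  shows "finite V" "V \<subseteq> \<Gamma>" "finite D" "\<And>e. e \<in> D \<Longrightarrow> 0 < len e"
    "\<And>e. e \<in> D \<Longrightarrow> segment_in \<Gamma> 0 (len e) (param e)" "\<And>e. e \<in> D \<Longrightarrow> start e \<in> V"
    "\<And>e. e \<in> D \<Longrightarrow> target e \<in> V" "\<And>e. e \<in> D \<Longrightarrow> inner_edge e \<inter> V = {}"
    "\<And>e. e \<in> D \<Longrightarrow> rev_edge e \<in> D"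
    "\<And>e e'. e \<in> D \<Longrightarrow> e' \<in> D \<Longrightarrow> e' = e \<or> e' = rev_edge e \<or> inner_edge e \<inter> inner_edge e' = {}"
    "\<Gamma> = V \<union> \<Union> (inner_edge ` D)"
  using assms unfolding graph_model_def by blast+

lemma connected_inner_edge: "segment_in S 0 (len e) (param e) \<Longrightarrow> connected (inner_edge e)"
  unfolding inner_edge_def
  by (intro connected_continuous_image continuous_on_subset[OF segment_continuous]) auto

lemma inner_edge_nonempty: "0 < len e \<Longrightarrow> inner_edge e \<noteq> {}"
  by (auto simp: inner_edge_def)

lemma closed_closed_edge: "segment_in S 0 (len e) (param e) \<Longrightarrow> closed (closed_edge e)"
  unfolding closed_edge_def by (intro compact_imp_closed segment_compact)

text \<open>Pieces of segments whose interiors are open and avoid the vertex set \<open>V\<close> are connected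
  components of the complement of \<open>V\<close>. Hence two of them are equal or disjoint, and choosing one
  parametrization of each yields a model.\<close>

lemma inner_edges_equal_or_disjoint:
  assumes V: "V \<subseteq> \<Gamma>"
    and e: "segment_in \<Gamma> 0 (len e) (param e)" "inner_edge e \<inter> V = {}"
    and e': "0 < len e'" "segment_in \<Gamma> 0 (len e') (param e')" "start e' \<in> V" "target e' \<in> V"
      "openin (top_of_set \<Gamma>) (inner_edge e')"
  shows "inner_edge e \<inter> inner_edge e' = {} \<or> inner_edge e \<subseteq> inner_edge e'"
proof -
  obtain O' where O': "open O'" "inner_edge e' = \<Gamma> \<inter> O'" using e'(5) by (auto simp: openin_open)
  have I: "inner_edge e \<subseteq> \<Gamma>" using segment_inD(2)[OF e(1)] by (auto simp: inner_edge_def)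
  have cl: "closed_edge e' = insert (start e') (insert (target e') (inner_edge e'))"
    using e'(1) by (rule closed_edge_eq)
  have "O' \<inter> (- closed_edge e') \<inter> inner_edge e = {}" using I O' cl by auto
  moreover have "inner_edge e \<subseteq> O' \<union> (- closed_edge e')" using e(2) e'(3,4) O' I cl by auto
  moreover have "open (- closed_edge e')" using closed_closed_edge[OF e'(2)] by auto
  ultimately have "O' \<inter> inner_edge e = {} \<or> (- closed_edge e') \<inter> inner_edge e = {}"
    using connectedD[OF connected_inner_edge[OF e(1)] O'(1), of "- closed_edge e'"] by blast
  then show ?thesis
  proof
    assume "(- closed_edge e') \<inter> inner_edge e = {}"
    then have *: "x \<in> closed_edge e'" if "x \<in> inner_edge e" for x using that by blast
    have "x \<in> inner_edge e'" if "x \<in> inner_edge e" for x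
    proof -
      have "x \<notin> V" using that e(2) by blast
      then show ?thesis using *[OF that] e'(3,4) by (auto simp: cl)
    qed
    then show ?thesis by blast
  qed (use O' in blast)
qed

lemma model_from_pieces:
  assumes V: "finite V" "V \<subseteq> \<Gamma>" and A: "finite A"
    and e: "\<And>e. e \<in> A \<Longrightarrow> 0 < len e" "\<And>e. e \<in> A \<Longrightarrow> segment_in \<Gamma> 0 (len e) (param e)"
      "\<And>e. e \<in> A \<Longrightarrow> start e \<in> V" "\<And>e. e \<in> A \<Longrightarrow> target e \<in> V"
      "\<And>e. e \<in> A \<Longrightarrow> inner_edge e \<inter> V = {}"
      "\<And>e. e \<in> A \<Longrightarrow> openin (top_of_set \<Gamma>) (inner_edge e)"
    and cover: "\<Gamma> \<subseteq> V \<union> \<Union> (inner_edge ` A)"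
  shows "\<exists>D. graph_model \<Gamma> V D"
proof -
  define r where "r I = (SOME e. e \<in> A \<and> inner_edge e = I)" for I
  have r: "r I \<in> A" "inner_edge (r I) = I" if "I \<in> inner_edge ` A" for I
  proof -
    have "\<exists>e. e \<in> A \<and> inner_edge e = I" using that by auto
    then have "r I \<in> A \<and> inner_edge (r I) = I" unfolding r_def by (rule someI_ex)
    then show "r I \<in> A" "inner_edge (r I) = I" by auto
  qed
  define D0 where "D0 = r ` (inner_edge ` A)"
  define D where "D = D0 \<union> rev_edge ` D0"
  have D0A: "D0 \<subseteq> A" unfolding D0_def using r(1) by blast
  have D0: "e1 = e2 \<or> inner_edge e1 \<inter> inner_edge e2 = {}" if e12: "e1 \<in> D0" "e2 \<in> D0" for e1 e2
  proof -
    obtain I1 I2 where I: "I1 \<in> inner_edge ` A" "I2 \<in> inner_edge ` A" "e1 = r I1" "e2 = r I2"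
      using e12 by (auto simp: D0_def)
    have A12: "e1 \<in> A" "e2 \<in> A" using e12 D0A by auto
    have "inner_edge e1 \<inter> inner_edge e2 = {} \<or> inner_edge e1 \<subseteq> inner_edge e2"
      using inner_edges_equal_or_disjoint[OF V(2) e(2)[OF A12(1)] e(5)[OF A12(1)]] e A12(2) by blast
    moreover have "inner_edge e2 \<inter> inner_edge e1 = {} \<or> inner_edge e2 \<subseteq> inner_edge e1"
      using inner_edges_equal_or_disjoint[OF V(2) e(2)[OF A12(2)] e(5)[OF A12(2)]] e A12(1) by blast
    ultimately have "inner_edge e1 \<inter> inner_edge e2 = {} \<or> inner_edge e1 = inner_edge e2" by blast
    then show ?thesis using I r by metis
  qed
  have base: "\<exists>e0\<in>D0. e = e0 \<or> e = rev_edge e0" if "e \<in> D" for e using that by (auto simp: D_def)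
  have "segment_in \<Gamma> 0 (len e) (param (rev_edge e))" if "e \<in> A" for e
    using segment_in_reverse[OF e(2)[OF that], of "len e"] by (simp add: rev_edge_def)
  note rev_seg = this
  have 1: "0 < len e \<and> segment_in \<Gamma> 0 (len e) (param e) \<and> start e \<in> V \<and> target e \<in> V \<and>
        inner_edge e \<inter> V = {} \<and> rev_edge e \<in> D" if "e \<in> D" for e
  proof -
    obtain e0 where e0: "e0 \<in> D0" "e = e0 \<or> e = rev_edge e0" using base[of e] \<open>e \<in> D\<close> by blast
    then have "e0 \<in> A" using D0A by blast
    then show ?thesis using e0 e[of e0] rev_seg[of e0]
      by (auto simp: D_def)
  qed
  have 2: "e' = e \<or> e' = rev_edge e \<or> inner_edge e \<inter> inner_edge e' = {}" if "e \<in> D" "e' \<in> D" for e e'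
  proof -
    obtain a b where ab: "a \<in> D0" "b \<in> D0" "e = a \<or> e = rev_edge a" "e' = b \<or> e' = rev_edge b"
      using base[OF \<open>e \<in> D\<close>] base[OF \<open>e' \<in> D\<close>] by blast
    then have "inner_edge e = inner_edge a" "inner_edge e' = inner_edge b" by auto
    then show ?thesis using D0[OF ab(1,2)] ab(3,4) by auto
  qed
  have "inner_edge ` A \<subseteq> inner_edge ` D0"
  proof
    fix I assume "I \<in> inner_edge ` A"
    then have "r I \<in> D0" "I = inner_edge (r I)" using r(2)[of I] unfolding D0_def by blast+
    then show "I \<in> inner_edge ` D0" by blast
  qed
  then have "\<Union> (inner_edge ` A) \<subseteq> \<Union> (inner_edge ` D0)" by (rule Union_mono)
  also have "\<dots> \<subseteq> \<Union> (inner_edge ` D)" unfolding D_def by blast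
  finally have "\<Gamma> \<subseteq> V \<union> \<Union> (inner_edge ` D)" using cover by blast
  moreover have "inner_edge x \<subseteq> \<Gamma>" if "x \<in> D" for x
  proof -
    have "inner_edge x \<subseteq> param x ` {0..len x}" unfolding inner_edge_def by (intro image_mono) auto
    also have "\<dots> \<subseteq> \<Gamma>" using 1[OF that] by (simp add: segment_in_def)
    finally show ?thesis .
  qed
  ultimately have 3: "\<Gamma> = V \<union> \<Union> (inner_edge ` D)" using V(2) by blast
  have "finite D" using A by (simp add: D_def D0_def)
  then have "graph_model \<Gamma> V D" unfolding graph_model_def
    by (rule conjI[OF V(1) conjI[OF V(2) conjI[OF _ conjI[OF ballI conjI[OF ballI 3]]]]])
       (assumption | rule 1 | rule ballI 2)+
  then show ?thesis ..
qed

context metric_graph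
begin

text \<open>The vertices of the model are the prescribed points, the centres of finitely many star balls
  covering the graph, and the tips of their rays. Cutting the rays at the vertices gives the edges.\<close>

lemma model_exists:
  assumes X: "finite X" "X \<subseteq> \<Gamma>"
  obtains V D where "graph_model \<Gamma> V D" "X \<subseteq> V"
proof -
  obtain P \<rho> where P: "finite P" "P \<subseteq> \<Gamma>" "\<And>p. p \<in> P \<Longrightarrow> star_ball \<Gamma> p (\<rho> p)"
    and cov: "\<And>x. x \<in> \<Gamma> \<Longrightarrow> \<exists>p\<in>P. dist p x < \<rho> p"
    using finite_star_cover by blast
  define V where "V = X \<union> P \<union> (\<Union>p\<in>P. (\<lambda>v. move \<Gamma> p v (\<rho> p)) ` Vec \<Gamma> p)"
  have fV: "finite (Vec \<Gamma> p)" if "p \<in> P" for p using Vec_finite P that by blast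
  have V: "finite V" using X P fV by (auto simp: V_def)
  have V\<Gamma>: "V \<subseteq> \<Gamma>" using X P star_ball_move(1,3)[OF P(3)] by (force simp: V_def)
  define T where "T p v = {t \<in> {0..\<rho> p}. move \<Gamma> p v t \<in> V}" for p v
  have T: "finite (T p v)" "0 \<in> T p v" "\<rho> p \<in> T p v" if pv: "p \<in> P" "v \<in> Vec \<Gamma> p" for p v
  proof -
    note sb = P(3)[OF pv(1)]
    have r0: "0 < \<rho> p" using sb by (rule star_ball_move)
    have "inj_on (move \<Gamma> p v) {0..\<rho> p}"
      using segment_inj[OF star_ball_segment[OF sb pv(2), of 0 "\<rho> p"]] r0 by simp
    then have "inj_on (move \<Gamma> p v) (T p v)" by (rule inj_on_subset) (auto simp: T_def)
    then show "finite (T p v)" using V by (intro inj_on_finite[of "move \<Gamma> p v" "T p v" V]) (auto simp: T_def)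
    show "0 \<in> T p v" "\<rho> p \<in> T p v" using r0 star_ball_move(2)[OF sb pv(2)] pv by (auto simp: T_def V_def)
  qed
  define K where "K = {(p, v, a, b). p \<in> P \<and> v \<in> Vec \<Gamma> p \<and> a \<in> T p v \<and> b \<in> T p v \<and> a < b \<and>
      (\<forall>t\<in>T p v. \<not> (a < t \<and> t < b))}"
  define ed where "ed = (\<lambda>(p, v, a, b). Edge (\<lambda>s. move \<Gamma> p v (a + s)) (b - a))"
  have "K \<subseteq> (SIGMA p:P. SIGMA v:Vec \<Gamma> p. T p v \<times> T p v)" by (auto simp: K_def)
  then have K: "finite K" by (rule finite_subset) (intro finite_SigmaI P fV finite_cartesian_product T)
  have inn: "inner_edge (ed (p, v, a, b)) = move \<Gamma> p v ` {a<..<b}" for p v a b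
  proof -
    show ?thesis unfolding inner_edge_def ed_def by (simp add: image_shift)
  qed
  have e: "0 < len e" "segment_in \<Gamma> 0 (len e) (param e)" "start e \<in> V" "target e \<in> V"
      "inner_edge e \<inter> V = {}" "openin (top_of_set \<Gamma>) (inner_edge e)" if "e \<in> ed ` K" for e
  proof -
    obtain p v a b where pv: "p \<in> P" "v \<in> Vec \<Gamma> p" and ab: "a \<in> T p v" "b \<in> T p v" "a < b"
      and gap: "\<forall>t\<in>T p v. \<not> (a < t \<and> t < b)" and e: "e = ed (p, v, a, b)"
      using \<open>e \<in> ed ` K\<close> by (auto simp: K_def)
    have ab': "0 \<le> a" "b \<le> \<rho> p" "move \<Gamma> p v a \<in> V" "move \<Gamma> p v b \<in> V" using ab by (auto simp: T_def)
    note sb = P(3)[OF pv(1)]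
    show "0 < len e" "start e \<in> V" "target e \<in> V"
      using ab ab' by (auto simp: e ed_def start_def target_def)
    show "segment_in \<Gamma> 0 (len e) (param e)"
      using segment_in_shift[OF star_ball_segment[OF sb pv(2), of a b], of a] ab ab' by (simp add: e ed_def)
    have "s \<in> T p v" if "a < s" "s < b" "move \<Gamma> p v s \<in> V" for s using that ab' by (simp add: T_def)
    then show "inner_edge e \<inter> V = {}" using gap unfolding e inn by auto
    show "openin (top_of_set \<Gamma>) (inner_edge e)" unfolding e inn using ray_interval_open[OF sb pv(2)] ab' by blast
  qed
  have "x \<in> V \<union> \<Union> (inner_edge ` ed ` K)" if x: "x \<in> \<Gamma>" for x
  proof (cases "x \<in> V")
    case False
    obtain p where p: "p \<in> P" "dist p x < \<rho> p" using cov x by blast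
    note sb = P(3)[OF p(1)]
    obtain v where v: "v \<in> Vec \<Gamma> p" "x = move \<Gamma> p v (dist p x)" using star_ball_move(6)[OF sb x] p by auto
    define t where "t = dist p x"
    have "p \<in> V" using p by (simp add: V_def)
    then have t: "0 < t" "t < \<rho> p" "x = move \<Gamma> p v t" "t \<notin> T p v"
      using False p v by (auto simp: t_def T_def)
    define a b where "a = Max {s \<in> T p v. s < t}" and "b = Min {s \<in> T p v. t < s}"
    have fin: "finite {s \<in> T p v. s < t}" "finite {s \<in> T p v. t < s}" using T(1)[OF p(1) v(1)] by auto
    have ne: "{s \<in> T p v. s < t} \<noteq> {}" "{s \<in> T p v. t < s} \<noteq> {}" using T(2,3)[OF p(1) v(1)] t by auto
    have a: "a \<in> T p v" "a < t" using Max_in[OF fin(1) ne(1)] by (auto simp: a_def)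
    have b: "b \<in> T p v" "t < b" using Min_in[OF fin(2) ne(2)] by (auto simp: b_def)
    have "\<not> (a < s \<and> s < b)" if s: "s \<in> T p v" for s
    proof (cases s t rule: linorder_cases)
      case less then show ?thesis using Max_ge[OF fin(1), of s] s unfolding a_def by auto
    next
      case equal then show ?thesis using s t by auto
    next
      case greater then show ?thesis using Min_le[OF fin(2), of s] s unfolding b_def by auto
    qed
    then have "(p, v, a, b) \<in> K" using p v a b by (auto simp: K_def)
    moreover have "x \<in> inner_edge (ed (p, v, a, b))" unfolding inn using t a b by auto
    ultimately show ?thesis by blast
  qed simp
  then have "\<exists>D. graph_model \<Gamma> V D" by (intro model_from_pieces[OF V V\<Gamma> _ e]) (use K in auto)
  then show thesis using that unfolding V_def by blast
qed

lemma closed_edge_subset: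
  assumes "graph_model \<Gamma> V D" "e \<in> D"
  shows "closed_edge e \<subseteq> \<Gamma>"
  using graph_modelD(5)[OF assms] by (auto simp: closed_edge_def segment_in_def)

lemma inner_edge_subset:
  assumes "graph_model \<Gamma> V D" "e \<in> D"
  shows "inner_edge e \<subseteq> \<Gamma>"
  using graph_modelD(11)[OF assms(1)] assms(2) by blast

lemma openin_inner_edge:
  assumes m: "graph_model \<Gamma> V D" and e: "e \<in> D"
  shows "openin (top_of_set \<Gamma>) (inner_edge e)"
proof -
  define C where "C = V \<union> (\<Union>e'\<in>{e'\<in>D. e' \<noteq> e \<and> e' \<noteq> rev_edge e}. closed_edge e')"
  have "closed C" unfolding C_def using graph_modelD[OF m]
    by (intro closed_Un closed_UN) (auto intro: finite_imp_closed closed_closed_edge)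
  moreover have "inner_edge e \<inter> closed_edge e' = {}" if "e' \<in> D" "e' \<noteq> e" "e' \<noteq> rev_edge e" for e'
    using graph_modelD(6,7)[OF m that(1)] graph_modelD(8)[OF m e] graph_modelD(10)[OF m e that(1)] that
    by (auto simp: closed_edge_eq[OF graph_modelD(4)[OF m that(1)]])
  then have "inner_edge e \<inter> C = {}" unfolding C_def using graph_modelD(8)[OF m e] by blast
  moreover have "\<Gamma> \<subseteq> C \<union> inner_edge e"
  proof
    fix x assume "x \<in> \<Gamma>"
    then consider "x \<in> V" | e' where "e' \<in> D" "x \<in> inner_edge e'" using graph_modelD(11)[OF m] by blast
    then show "x \<in> C \<union> inner_edge e"
    proof cases
      case 2
      then show ?thesis
        by (cases "e' = e \<or> e' = rev_edge e")
           (auto simp: C_def closed_edge_eq[OF graph_modelD(4)[OF m]])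
    qed (simp add: C_def)
  qed
  ultimately have "inner_edge e = \<Gamma> \<inter> (- C)" using inner_edge_subset[OF m e] by blast
  then show ?thesis using \<open>closed C\<close> by (metis openin_open_Int open_Compl)
qed

lemma segment_off_vertices_in_edge:
  assumes m: "graph_model \<Gamma> V D" and \<sigma>: "segment_in (\<Gamma> - V) a b \<sigma>"
  obtains e where "e \<in> D" "\<sigma> ` {a..b} \<subseteq> inner_edge e"
proof -
  have ab: "a \<le> b" and sub: "\<sigma> ` {a..b} \<subseteq> \<Gamma> - V" using \<sigma> by (auto simp: segment_in_def)
  then have "\<sigma> a \<in> \<Gamma> - V" by (simp add: image_subset_iff)
  then obtain e where e: "e \<in> D" "\<sigma> a \<in> inner_edge e" using graph_modelD(11)[OF m] by blast
  define C where "C = (\<Union>e'\<in>{e'\<in>D. e' \<noteq> e \<and> e' \<noteq> rev_edge e}. closed_edge e')"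
  have cl: "closed_edge e' \<subseteq> V \<union> inner_edge e'" if "e' \<in> D" for e'
    using closed_edge_eq[OF graph_modelD(4)[OF m that]] graph_modelD(6,7)[OF m that] by auto
  have "closed C" unfolding C_def using graph_modelD(3,5)[OF m]
    by (intro closed_UN) (auto intro: closed_closed_edge)
  moreover have "closed (closed_edge e)" using graph_modelD(5)[OF m e(1)] by (rule closed_closed_edge)
  moreover have "connected (\<sigma> ` {a..b})"
    using \<sigma> by (intro connected_continuous_image segment_continuous) auto
  moreover have "closed_edge e \<inter> C \<inter> \<sigma> ` {a..b} = {}"
    using cl e(1) graph_modelD(10)[OF m e(1)] sub unfolding C_def by blast
  moreover have "\<sigma> ` {a..b} \<subseteq> closed_edge e \<union> C"
  proof
    fix x assume "x \<in> \<sigma> ` {a..b}"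
    then obtain e' where e': "e' \<in> D" "x \<in> inner_edge e'" using sub graph_modelD(11)[OF m] by blast
    then show "x \<in> closed_edge e \<union> C"
      by (cases "e' = e \<or> e' = rev_edge e")
         (auto simp: C_def closed_edge_eq[OF graph_modelD(4)[OF m]] e(1))
  qed
  ultimately have "closed_edge e \<inter> \<sigma> ` {a..b} = {} \<or> C \<inter> \<sigma> ` {a..b} = {}"
    by (intro connected_closedD)
  moreover have "\<sigma> a \<in> closed_edge e \<inter> \<sigma> ` {a..b}"
    using e closed_edge_eq[OF graph_modelD(4)[OF m e(1)]] ab by auto
  ultimately have "\<sigma> ` {a..b} \<subseteq> closed_edge e" using \<open>\<sigma> ` {a..b} \<subseteq> closed_edge e \<union> C\<close> by blast
  then have "\<sigma> ` {a..b} \<subseteq> inner_edge e" using cl[OF e(1)] sub by blast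
  then show thesis using that e by blast
qed

lemma segment_affine_in_edge:
  assumes m: "graph_model \<Gamma> V D" and \<sigma>: "segment_in (\<Gamma> - V) a b \<sigma>"
  obtains e c \<epsilon> where "e \<in> D" "\<epsilon> = 1 \<or> \<epsilon> = -1"
    "\<And>t. t \<in> {a..b} \<Longrightarrow> c + \<epsilon> * t \<in> {0<..<len e} \<and> \<sigma> t = param e (c + \<epsilon> * t)"
proof -
  obtain e where e: "e \<in> D" "\<sigma> ` {a..b} \<subseteq> inner_edge e"
    using segment_off_vertices_in_edge[OF m \<sigma>] .
  then have "\<forall>t\<in>{a..b}. \<exists>s\<in>{0<..<len e}. \<sigma> t = param e s" by (auto simp: inner_edge_def)
  then obtain k where k: "\<And>t. t \<in> {a..b} \<Longrightarrow> k t \<in> {0<..<len e} \<and> \<sigma> t = param e (k t)" by metis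
  have "\<bar>k s - k t\<bar> = \<bar>s - t\<bar>" if "s \<in> {a..b}" "t \<in> {a..b}" for s t
    using segment_inD(3)[OF graph_modelD(5)[OF m e(1)], of "k s" "k t"] k[OF that(1)] k[OF that(2)]
      segment_inD(3)[OF \<sigma>, of s t] that by auto
  then obtain c \<epsilon> where "\<epsilon> = 1 \<or> \<epsilon> = -1" "\<And>t. t \<in> {a..b} \<Longrightarrow> k t = c + \<epsilon> * t"
    using real_isometry_affine[of "{a..b}" k] by metis
  then show thesis using that e k by metis
qed

end

section \<open>Directions at a vertex and edges starting there\<close>

context metric_graph
begin

text \<open>The formal unit vectors at a point correspond to the segments that cover a neighbourhood of it.
  The ray in a given direction lies on one segment by connectedness, and it runs along this
  segment with the right parameter because both parameters are the distance from the point.\<close>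

lemma directions_bij:
  assumes p: "p \<in> \<Gamma>" and H: "finite H" "\<And>e. e \<in> H \<Longrightarrow> 0 < len e"
      "\<And>e. e \<in> H \<Longrightarrow> segment_in \<Gamma> 0 (len e) (param e)" "\<And>e. e \<in> H \<Longrightarrow> start e = p"
    and disj: "\<And>e e'. e \<in> H \<Longrightarrow> e' \<in> H \<Longrightarrow> e \<noteq> e' \<Longrightarrow> inner_edge e \<inter> inner_edge e' = {}"
    and U: "openin (top_of_set \<Gamma>) U" "p \<in> U" "U \<subseteq> insert p (\<Union> (inner_edge ` H))"
  shows "\<exists>b. bij_betw b (Vec \<Gamma> p) H \<and>
    (\<forall>v\<in>Vec \<Gamma> p. eventually (\<lambda>t. move \<Gamma> p v t = param (b v) t) (at_right 0))"
proof -
  obtain \<rho> where sb: "star_ball \<Gamma> p \<rho>" using star_ball_exists[OF p] by blast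
  obtain \<delta> where \<delta>: "\<delta> > 0" "\<And>x. x \<in> \<Gamma> \<Longrightarrow> dist x p < \<delta> \<Longrightarrow> x \<in> U"
    using U unfolding openin_euclidean_subtopology_iff by blast
  define \<epsilon> where "\<epsilon> = Min (insert \<rho> (insert \<delta> (len ` H))) / 2"
  have "Min (insert \<rho> (insert \<delta> (len ` H))) > 0"
    using H(1,2) \<delta> star_ball_move(1)[OF sb] by (subst Min_gr_iff) auto
  moreover have "Min (insert \<rho> (insert \<delta> (len ` H))) \<le> x" if "x \<in> insert \<rho> (insert \<delta> (len ` H))" for x
    using that H(1) by (intro Min_le) auto
  ultimately have \<epsilon>: "0 < \<epsilon>" "\<epsilon> < \<rho>" "\<epsilon> < \<delta>" "\<And>e. e \<in> H \<Longrightarrow> \<epsilon> < len e"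
    unfolding \<epsilon>_def by (smt (verit) field_sum_of_halves image_eqI insertCI)+
  have dpar: "dist p (param e s) = s" if "e \<in> H" "0 \<le> s" "s \<le> len e" for e s
    using segment_inD(3)[OF H(3)[OF that(1)], of 0 s] H(4)[OF that(1)] that by (simp add: start_def)
  note dmove = star_ball_dist[OF sb]
  have inn: "param e t \<in> inner_edge e" if "e \<in> H" "0 < t" "t \<le> \<epsilon>" for e t
    using that \<epsilon>(4)[OF that(1)] by (auto simp: inner_edge_def)
  have on: "\<exists>e\<in>H. move \<Gamma> p v t = param e t" if v: "v \<in> Vec \<Gamma> p" and t: "0 < t" "t \<le> \<epsilon>" for v t
  proof -
    have d: "dist p (move \<Gamma> p v t) = t" using dmove v t \<epsilon> by simp
    then have "move \<Gamma> p v t \<in> U" "move \<Gamma> p v t \<noteq> p"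
      using \<delta>(2) star_ball_move(3)[OF sb v] t \<epsilon> by (auto simp: dist_commute)
    then obtain e where e: "e \<in> H" "move \<Gamma> p v t \<in> inner_edge e" using U(3) by blast
    then obtain s where "0 < s" "s < len e" "move \<Gamma> p v t = param e s" by (auto simp: inner_edge_def)
    then show ?thesis using d dpar[of e s] e by auto
  qed
  have "\<exists>e\<in>H. \<forall>t\<in>{0<..\<epsilon>}. move \<Gamma> p v t = param e t" if v: "v \<in> Vec \<Gamma> p" for v
  proof -
    obtain e0 where e0: "e0 \<in> H" "move \<Gamma> p v \<epsilon> = param e0 \<epsilon>" using on[OF v] \<epsilon> by blast
    define Q where "Q = move \<Gamma> p v ` {0<..\<epsilon>}"
    define S where "S = param e0 ` {0..\<epsilon>}"
    define T where "T = (\<Union>e\<in>H - {e0}. param e ` {0..\<epsilon>})"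
    have "closed (param e ` {0..\<epsilon>})" if "e \<in> H" for e
    proof -
      have "segment_in \<Gamma> 0 \<epsilon> (param e)"
        using \<epsilon>(1) \<epsilon>(4)[OF that] H(3)[OF that] by (intro segment_in_sub[OF H(3)[OF that]]) (auto simp: segment_in_def)
      then show ?thesis by (intro compact_imp_closed segment_compact)
    qed
    then have cl: "closed S" "closed T" unfolding S_def T_def using e0 H(1) by (auto intro!: closed_UN)
    have Q: "connected Q" unfolding Q_def
      by (rule connected_continuous_image[OF continuous_on_subset[OF segment_continuous[OF star_ball_segment[OF sb v, of 0 \<rho>]]]])
         (use \<epsilon> in auto)
    have QS: "t = s" if "0 < t" "t \<le> \<epsilon>" "0 \<le> s" "s \<le> \<epsilon>" "e \<in> H" "move \<Gamma> p v t = param e s" for s t e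
      using dmove[OF v, of t] dpar[OF that(5), of s] that \<epsilon>(1,2) \<epsilon>(4)[OF that(5)] by auto
    have "S \<inter> T \<inter> Q = {}"
    proof (rule ccontr)
      assume "S \<inter> T \<inter> Q \<noteq> {}"
      then obtain q where q: "q \<in> S" "q \<in> T" "q \<in> Q" by blast
      obtain t where t: "0 < t" "t \<le> \<epsilon>" "move \<Gamma> p v t = q" using q(3) by (auto simp: Q_def)
      obtain s where s: "0 \<le> s" "s \<le> \<epsilon>" "q = param e0 s" using q(1) by (auto simp: S_def)
      obtain e where e: "e \<in> H" "e \<noteq> e0" "q \<in> param e ` {0..\<epsilon>}" using q(2) by (auto simp: T_def)
      then obtain s' where s': "0 \<le> s'" "s' \<le> \<epsilon>" "q = param e s'" by auto
      have "s = t" "s' = t"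
        using QS[OF t(1,2) s(1,2) e0(1)] QS[OF t(1,2) s'(1,2) e(1)] t(3) s(3) s'(3) by auto
      then have "param e0 t = param e t" using s(3) s'(3) by simp
      then show False using disj[OF e(1) e0(1) e(2)] inn[OF e(1) t(1,2)] inn[OF e0(1) t(1,2)] by auto
    qed
    moreover have "Q \<subseteq> S \<union> T"
    proof
      fix q assume "q \<in> Q"
      then obtain t where t: "0 < t" "t \<le> \<epsilon>" "q = move \<Gamma> p v t" unfolding Q_def by auto
      then obtain e where e: "e \<in> H" "q = param e t" using on[OF v] by blast
      then have "q \<in> param e ` {0..\<epsilon>}" using t by auto
      then show "q \<in> S \<union> T" unfolding S_def T_def using e by blast
    qed
    moreover have "move \<Gamma> p v \<epsilon> \<in> S" unfolding S_def e0(2) using \<epsilon>(1) by (intro imageI) auto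
    moreover have "move \<Gamma> p v \<epsilon> \<in> Q" unfolding Q_def using \<epsilon>(1) by (intro imageI) auto
    ultimately have TQ: "T \<inter> Q = {}" using connected_closedD[OF Q, of S T] cl by blast
    have "move \<Gamma> p v t = param e0 t" if t: "t \<in> {0<..\<epsilon>}" for t
    proof -
      obtain e where e: "e \<in> H" "move \<Gamma> p v t = param e t" using on[OF v] t by auto
      have "e = e0"
      proof (rule ccontr)
        assume "e \<noteq> e0"
        moreover have "param e t \<in> param e ` {0..\<epsilon>}" using t by auto
        ultimately have "move \<Gamma> p v t \<in> T" unfolding T_def e(2) using e(1) by blast
        moreover have "move \<Gamma> p v t \<in> Q" unfolding Q_def using t by blast
        ultimately show False using TQ by blast
      qed
      then show ?thesis using e by simp
    qed
    then show ?thesis using e0 by blast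
  qed
  then obtain b where b: "\<And>v. v \<in> Vec \<Gamma> p \<Longrightarrow> b v \<in> H"
    "\<And>v t. v \<in> Vec \<Gamma> p \<Longrightarrow> t \<in> {0<..\<epsilon>} \<Longrightarrow> move \<Gamma> p v t = param (b v) t" by metis
  have "inj_on b (Vec \<Gamma> p)"
  proof (rule inj_onI, rule ccontr)
    fix v w assume vw: "v \<in> Vec \<Gamma> p" "w \<in> Vec \<Gamma> p" "b v = b w" "v \<noteq> w"
    then have "move \<Gamma> p v \<epsilon> = move \<Gamma> p w \<epsilon>" using b(2) \<epsilon> by simp
    then show False using star_ball_move(5)[OF sb vw(1,2,4), of \<epsilon> \<epsilon>] \<epsilon> by simp
  qed
  moreover have "b ` Vec \<Gamma> p = H"
  proof
    show "H \<subseteq> b ` Vec \<Gamma> p"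
    proof
      fix e assume e: "e \<in> H"
      have *: "dist p (param e \<epsilon>) = \<epsilon>" using dpar e \<epsilon>(1) \<epsilon>(4)[OF e] by simp
      moreover have "param e \<epsilon> \<in> \<Gamma>" using segment_inD(2)[OF H(3)[OF e]] \<epsilon>(1) \<epsilon>(4)[OF e] by simp
      ultimately obtain v where v: "v \<in> Vec \<Gamma> p" "param e \<epsilon> = move \<Gamma> p v \<epsilon>"
        using star_ball_move(6)[OF sb, of "param e \<epsilon>"] \<epsilon> by auto
      then have "param e \<epsilon> = param (b v) \<epsilon>" using b(2) \<epsilon> by simp
      then have "e = b v" using disj[OF e b(1)[OF v(1)]] inn[OF e, of \<epsilon>] inn[OF b(1)[OF v(1)], of \<epsilon>] \<epsilon>(1) by auto
      then show "e \<in> b ` Vec \<Gamma> p" using v by auto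
    qed
  qed (use b(1) in auto)
  moreover have "eventually (\<lambda>t. move \<Gamma> p v t = param (b v) t) (at_right 0)" if "v \<in> Vec \<Gamma> p" for v
    using b(2)[OF that] \<epsilon>(1) by (intro eventually_at_rightI[of 0 \<epsilon>]) auto
  ultimately show ?thesis unfolding bij_betw_def by blast
qed

lemma vertex_directions:
  assumes m: "graph_model \<Gamma> V D" and p: "p \<in> V"
  shows "\<exists>b. bij_betw b (Vec \<Gamma> p) {e\<in>D. start e = p} \<and>
    (\<forall>v\<in>Vec \<Gamma> p. eventually (\<lambda>t. move \<Gamma> p v t = param (b v) t) (at_right 0))"
proof (rule directions_bij)
  note M = graph_modelD[OF m]
  show "p \<in> \<Gamma>" using M(2) p by blast
  show "finite {e\<in>D. start e = p}" using M(3) by simp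
  fix e assume e: "e \<in> {e\<in>D. start e = p}"
  then show "0 < len e" "segment_in \<Gamma> 0 (len e) (param e)" "start e = p" using M by auto
  fix e' assume e': "e' \<in> {e\<in>D. start e = p}" "e \<noteq> e'"
  have "target e \<noteq> start e"
    using segment_inD(3)[OF M(5), of e 0 "len e"] M(4)[of e] e by (auto simp: start_def target_def)
  then have "e' \<noteq> rev_edge e" using e e' by auto
  then show "inner_edge e \<inter> inner_edge e' = {}" using M(10)[of e e'] e e' by auto
next
  note M = graph_modelD[OF m]
  define C where "C = (V - {p}) \<union> (\<Union>e\<in>{e\<in>D. start e \<noteq> p \<and> target e \<noteq> p}. closed_edge e)"
  have "closed C" unfolding C_def using M(1,3,5)
    by (intro closed_Un closed_UN) (auto intro: finite_imp_closed closed_closed_edge)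
  then show "openin (top_of_set \<Gamma>) (\<Gamma> \<inter> - C)" by (intro openin_open_Int) auto
  have "p \<notin> closed_edge e" if "e \<in> D" "start e \<noteq> p" "target e \<noteq> p" for e
    using that p M(8)[OF that(1)] by (auto simp: closed_edge_eq[OF M(4)[OF that(1)]])
  then show "p \<in> \<Gamma> \<inter> - C" using p M(2) by (auto simp: C_def)
  show "\<Gamma> \<inter> - C \<subseteq> insert p (\<Union> (inner_edge ` {e\<in>D. start e = p}))"
  proof
    fix x assume x: "x \<in> \<Gamma> \<inter> - C"
    show "x \<in> insert p (\<Union> (inner_edge ` {e\<in>D. start e = p}))"
    proof (cases "x = p")
      case False
      then obtain e where e: "e \<in> D" "x \<in> inner_edge e" using x M(11) by (auto simp: C_def)
      then have "x \<in> closed_edge e" by (auto simp: closed_edge_eq[OF M(4)])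
      then have "start e = p \<or> target e = p" using x e by (auto simp: C_def)
      then show ?thesis
      proof
        assume "target e = p"
        then have "rev_edge e \<in> {e\<in>D. start e = p}" "x \<in> inner_edge (rev_edge e)" using M(9)[OF e(1)] e by auto
        then show ?thesis by blast
      qed (use e in auto)
    qed simp
  qed
qed

end

section \<open>Piecewise affine functions on a model\<close>

definition slope :: "('a \<Rightarrow> 'b::real_normed_field) \<Rightarrow> 'a edge \<Rightarrow> 'b" where
  "slope f e = (f (target e) - f (start e)) / of_real (len e)"

definition vertex_slope :: "'a edge set \<Rightarrow> ('a \<Rightarrow> 'b::real_normed_field) \<Rightarrow> 'a \<Rightarrow> 'b" where
  "vertex_slope D f p = (\<Sum>e\<in>{e\<in>D. start e = p}. slope f e)"

definition edge_affine :: "'a edge set \<Rightarrow> ('a \<Rightarrow> complex) \<Rightarrow> bool" where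
  "edge_affine D f \<longleftrightarrow> (\<forall>e\<in>D. \<forall>t\<in>{0..len e}. f (param e t) = f (start e) + of_real t * slope f e)"

lemma slope_rev: "slope f (rev_edge e) = - slope f e"
  by (simp add: slope_def minus_divide_left)

lemma dir_deriv_unique: "has_dir_deriv \<Gamma> f p v l \<Longrightarrow> dir_deriv \<Gamma> f p v = l"
  unfolding dir_deriv_def has_dir_deriv_def
  by (rule the_equality) (auto intro: tendsto_unique[OF trivial_limit_at_right_real])

text \<open>A continuous function on a closed interval that is affine on all compact subintervals of the
  interior is affine.\<close>

lemma affine_on_closed_interval:
  fixes g :: "real \<Rightarrow> complex"
  assumes L: "0 < L" and cont: "continuous_on {0..L} g"
    and aff: "\<And>s t. 0 < s \<Longrightarrow> s < t \<Longrightarrow> t < L \<Longrightarrow> \<exists>c m. \<forall>x\<in>{s..t}. g x = c + of_real x * m"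
    and x: "x \<in> {0..L}"
  shows "g x = g 0 + of_real x * ((g L - g 0) / of_real L)"
proof -
  have "of_real L * g x = of_real (L - x) * g 0 + of_real x * g L"
  proof (cases "x = 0 \<or> x = L")
    case False
    then have x': "0 < x" "x < L" using x by auto
    define s t where "s n = x / real (n + 2)" and "t n = L - (L - x) / real (n + 2)" for n
    have frac: "0 < y / real (n + 2)" "y / real (n + 2) < y" if "0 < y" for y n
      using that by (auto simp: divide_less_eq)
    have st: "0 < s n" "s n < x" "x < t n" "t n < L" for n
      using frac[of x n] frac[of "L - x" n] x' unfolding s_def t_def by linarith+
    have eq: "of_real (t n - s n) * g x = of_real (t n - x) * g (s n) + of_real (x - s n) * g (t n)" for n
    proof -
      obtain c m where "\<forall>y\<in>{s n..t n}. g y = c + of_real y * m" using aff[of "s n" "t n"] st[of n] by auto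
      then have "g x = c + of_real x * m" "g (s n) = c + of_real (s n) * m" "g (t n) = c + of_real (t n) * m"
        using st[of n] by auto
      then show ?thesis by (simp add: algebra_simps)
    qed
    have lim: "(\<lambda>n. y / real (n + 2)) \<longlonglongrightarrow> 0" for y
      using LIMSEQ_ignore_initial_segment[OF lim_const_over_n[of y], of 2] by simp
    have s0: "s \<longlonglongrightarrow> 0" unfolding s_def by (rule lim)
    have tL: "t \<longlonglongrightarrow> L" unfolding t_def using tendsto_diff[OF tendsto_const[of L] lim[of "L - x"]] by simp
    have gs: "(\<lambda>n. g (s n)) \<longlonglongrightarrow> g 0" "(\<lambda>n. g (t n)) \<longlonglongrightarrow> g L"
    proof -
      have "s n \<in> {0..L}" "t n \<in> {0..L}" for n using st[of n] x' by auto
      then show "(\<lambda>n. g (s n)) \<longlonglongrightarrow> g 0" "(\<lambda>n. g (t n)) \<longlonglongrightarrow> g L"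
        using L by (auto intro!: continuous_on_tendsto_compose[OF cont] s0 tL always_eventually)
    qed
    have "(\<lambda>n. of_real (t n - s n) * g x) \<longlonglongrightarrow> of_real (L - 0) * g x"
      by (intro tendsto_intros s0 tL)
    moreover have "(\<lambda>n. of_real (t n - x) * g (s n) + of_real (x - s n) * g (t n))
        \<longlonglongrightarrow> of_real (L - x) * g 0 + of_real (x - 0) * g L"
      by (intro tendsto_intros s0 tL gs)
    ultimately show ?thesis unfolding eq using LIMSEQ_unique by fastforce
  qed auto
  then show ?thesis using L by (simp add: field_simps)
qed

lemma bij_betw_restrict:
  assumes b: "bij_betw b A B" and I: "I \<subseteq> A" "\<And>v. v \<in> A \<Longrightarrow> v \<in> I \<longleftrightarrow> W (b v)"
  shows "bij_betw b I {e\<in>B. W e}"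
proof -
  have "b ` I = {e\<in>B. W e}" using I bij_betw_imp_surj_on[OF b] by blast
  then show ?thesis using bij_betw_subset[OF b I(1)] by simp
qed

context metric_graph
begin

lemma edge_affine_dir_deriv:
  assumes m: "graph_model \<Gamma> V D" and f: "edge_affine D f" and p: "p \<in> V"
  shows "\<exists>b. bij_betw b (Vec \<Gamma> p) {e\<in>D. start e = p} \<and>
    (\<forall>v\<in>Vec \<Gamma> p. eventually (\<lambda>t. move \<Gamma> p v t = param (b v) t) (at_right 0) \<and>
       has_dir_deriv \<Gamma> f p v (slope f (b v)))"
proof -
  obtain b where b: "bij_betw b (Vec \<Gamma> p) {e\<in>D. start e = p}"
    and mv: "\<And>v. v \<in> Vec \<Gamma> p \<Longrightarrow> eventually (\<lambda>t. move \<Gamma> p v t = param (b v) t) (at_right 0)"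
    using vertex_directions[OF m p] by blast
  have "has_dir_deriv \<Gamma> f p v (slope f (b v))" if v: "v \<in> Vec \<Gamma> p" for v
  proof -
    have e: "b v \<in> D" "start (b v) = p" using bij_betwE[OF b] v by auto
    have "eventually (\<lambda>t. t \<in> {0<..<len (b v)}) (at_right 0)"
      using graph_modelD(4)[OF m e(1)] by (intro eventually_at_right_real)
    then have "eventually (\<lambda>t. (f (move \<Gamma> p v t) - f p) / of_real t = slope f (b v)) (at_right 0)"
      using mv[OF v]
    proof eventually_elim
      case (elim t)
      then have "f (move \<Gamma> p v t) = f p + of_real t * slope f (b v)"
        using f e unfolding edge_affine_def by auto
      then show ?case using elim by simp
    qed
    then show ?thesis unfolding has_dir_deriv_def by (rule tendsto_eventually)
  qed
  then show ?thesis using b mv by blast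
qed

lemma slope_sum_vertex:
  assumes m: "graph_model \<Gamma> V D" and f: "edge_affine D f" and p: "p \<in> V"
  shows "slope_sum \<Gamma> f p = vertex_slope D f p"
proof -
  obtain b where b: "bij_betw b (Vec \<Gamma> p) {e\<in>D. start e = p}"
    and d: "\<And>v. v \<in> Vec \<Gamma> p \<Longrightarrow> has_dir_deriv \<Gamma> f p v (slope f (b v))"
    using edge_affine_dir_deriv[OF assms] by blast
  have "slope_sum \<Gamma> f p = (\<Sum>v\<in>Vec \<Gamma> p. slope f (b v))"
    unfolding slope_sum_def by (intro sum.cong refl dir_deriv_unique d)
  also have "\<dots> = vertex_slope D f p"
    unfolding vertex_slope_def by (rule sum.reindex_bij_betw[OF b])
  finally show ?thesis .
qed

text \<open>An interior point of an edge has exactly the two directions along the edge.\<close>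

lemma slope_sum_inner:
  assumes m: "graph_model \<Gamma> V D" and f: "edge_affine D f" and p: "p \<in> \<Gamma> - V"
  shows "slope_sum \<Gamma> f p = 0"
proof -
  obtain e where e: "e \<in> D" "p \<in> inner_edge e" using p graph_modelD(11)[OF m] by blast
  then obtain a where a: "0 < a" "a < len e" "p = param e a" by (auto simp: inner_edge_def)
  note seg = graph_modelD(5)[OF m e(1)]
  define e1 where "e1 = Edge (\<lambda>t. param e (a + t)) (len e - a)"
  define e2 where "e2 = Edge (\<lambda>t. param e (a - t)) a"
  define s where "s = slope f e"
  have sub: "param e ` {a..len e} \<subseteq> \<Gamma>" "param e ` {0..a} \<subseteq> \<Gamma>"
    using segment_inD(2)[OF seg] a by (auto simp: image_subset_iff)
  have s1: "segment_in \<Gamma> 0 (len e - a) (\<lambda>t. param e (a + t))"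
    using a segment_in_shift[OF segment_in_sub[OF seg, of a "len e" \<Gamma>], of a] sub by auto
  have s2: "segment_in \<Gamma> 0 a (\<lambda>t. param e (a - t))"
    using a segment_in_reverse[OF segment_in_sub[OF seg, of 0 a \<Gamma>], of a] sub by auto
  have inj: "x = y" if "param e x = param e y" "0 \<le> x" "x \<le> len e" "0 \<le> y" "y \<le> len e" for x y
    using inj_onD[OF segment_inj[OF seg] that(1)] that(2-5) by simp
  have disj: "inner_edge e1 \<inter> inner_edge e2 = {}"
  proof (rule ccontr)
    assume "inner_edge e1 \<inter> inner_edge e2 \<noteq> {}"
    then obtain x where "x \<in> inner_edge e1" "x \<in> inner_edge e2" by blast
    then obtain t u where "0 < t" "t < len e - a" "x = param e (a + t)" "0 < u" "u < a" "x = param e (a - u)"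
      unfolding inner_edge_def e1_def e2_def by auto
    then show False using inj[of "a + t" "a - u"] a by auto
  qed
  have ne: "e1 \<noteq> e2" using disj inner_edge_nonempty[of e1] a by (auto simp: e1_def)
  have "\<exists>b. bij_betw b (Vec \<Gamma> p) {e1, e2} \<and>
    (\<forall>v\<in>Vec \<Gamma> p. eventually (\<lambda>t. move \<Gamma> p v t = param (b v) t) (at_right 0))"
  proof (rule directions_bij)
    show "p \<in> \<Gamma>" using p by simp
    show "openin (top_of_set \<Gamma>) (inner_edge e)" by (rule openin_inner_edge[OF m e(1)])
    show "inner_edge e \<subseteq> insert p (\<Union> (inner_edge ` {e1, e2}))"
    proof
      fix x assume "x \<in> inner_edge e"
      then obtain t where t: "0 < t" "t < len e" "x = param e t" by (auto simp: inner_edge_def)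
      consider "t = a" | "t > a" | "t < a" by linarith
      then show "x \<in> insert p (\<Union> (inner_edge ` {e1, e2}))"
      proof cases
        case 2
        then have "x \<in> inner_edge e1" unfolding inner_edge_def e1_def using t
          by (intro image_eqI[of _ _ "t - a"]) auto
        then show ?thesis by simp
      next
        case 3
        then have "x \<in> inner_edge e2" unfolding inner_edge_def e2_def using t
          by (intro image_eqI[of _ _ "a - t"]) auto
        then show ?thesis by simp
      qed (use a t in simp)
    qed
    fix h assume h: "h \<in> {e1, e2}"
    then show "0 < len h" "segment_in \<Gamma> 0 (len h) (param h)" "start h = p"
      using a s1 s2 by (auto simp: e1_def e2_def start_def)
    fix h' assume "h' \<in> {e1, e2}" "h \<noteq> h'"
    then show "inner_edge h \<inter> inner_edge h' = {}" using h disj by auto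
  qed (use e in auto)
  then obtain b where b: "bij_betw b (Vec \<Gamma> p) {e1, e2}"
    and mv: "\<And>v. v \<in> Vec \<Gamma> p \<Longrightarrow> eventually (\<lambda>t. move \<Gamma> p v t = param (b v) t) (at_right 0)"
    by blast
  define \<sigma> where "\<sigma> h = (if h = e1 then s else - s)" for h
  have aff: "f (param e t) = f (start e) + of_real t * s" if "0 \<le> t" "t \<le> len e" for t
    using f e(1) that by (auto simp: edge_affine_def s_def)
  have "has_dir_deriv \<Gamma> f p v (\<sigma> (b v))" if v: "v \<in> Vec \<Gamma> p" for v
  proof -
    have bv: "b v \<in> {e1, e2}" using bij_betwE[OF b] v by auto
    have "eventually (\<lambda>t. t \<in> {0<..<min a (len e - a)}) (at_right 0)"
      using a by (intro eventually_at_right_real) auto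
    then have "eventually (\<lambda>t. (f (move \<Gamma> p v t) - f p) / of_real t = \<sigma> (b v)) (at_right 0)"
      using mv[OF v]
    proof eventually_elim
      case (elim t)
      then have "param (b v) t = param e (a + t) \<and> \<sigma> (b v) = s \<or> param (b v) t = param e (a - t) \<and> \<sigma> (b v) = - s"
        using bv ne by (auto simp: e1_def e2_def \<sigma>_def)
      then have "f (move \<Gamma> p v t) = f p + of_real t * \<sigma> (b v)"
        using aff[of a] aff[of "a + t"] aff[of "a - t"] elim a by (auto simp: algebra_simps)
      then show ?case using elim by simp
    qed
    then show ?thesis unfolding has_dir_deriv_def by (rule tendsto_eventually)
  qed
  then have "slope_sum \<Gamma> f p = (\<Sum>v\<in>Vec \<Gamma> p. \<sigma> (b v))"
    unfolding slope_sum_def by (intro sum.cong refl dir_deriv_unique)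
  also have "\<dots> = (\<Sum>h\<in>{e1, e2}. \<sigma> h)" by (rule sum.reindex_bij_betw[OF b])
  also have "\<dots> = 0" using ne by (simp add: \<sigma>_def)
  finally show ?thesis .
qed

lemma CPA_edge_affine:
  assumes f: "f \<in> CPA \<Gamma>"
  obtains X where "finite X" "X \<subseteq> \<Gamma>" "\<And>V D. graph_model \<Gamma> V D \<Longrightarrow> X \<subseteq> V \<Longrightarrow> edge_affine D f"
proof -
  obtain X where cont: "continuous_on \<Gamma> f" and X: "finite X" "X \<subseteq> \<Gamma>"
    and aff: "\<And>a b \<gamma>. segment_in (\<Gamma> - X) a b \<gamma> \<Longrightarrow> \<exists>c m. \<forall>t\<in>{a..b}. f (\<gamma> t) = c + of_real t * m"
    using f unfolding CPA_def by blast
  have "edge_affine D f" if m: "graph_model \<Gamma> V D" and XV: "X \<subseteq> V" for V D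
    unfolding edge_affine_def
  proof (intro ballI)
    fix e t assume e: "e \<in> D" and t: "t \<in> {0..len e}"
    note seg = graph_modelD(5)[OF m e]
    define g where "g = (\<lambda>s. f (param e s))"
    have "continuous_on {0..len e} g" unfolding g_def
      by (rule continuous_on_compose2[OF cont segment_continuous[OF seg]]) (use seg in \<open>simp add: segment_in_def\<close>)
    moreover have "\<exists>c m. \<forall>x\<in>{s..u}. g x = c + of_real x * m" if "0 < s" "s < u" "u < len e" for s u
    proof -
      have "param e ` {s..u} \<subseteq> inner_edge e" unfolding inner_edge_def using that by (intro image_mono) auto
      then have "param e ` {s..u} \<subseteq> \<Gamma> - X"
        using graph_modelD(8)[OF m e] inner_edge_subset[OF m e] XV by blast
      then have "segment_in (\<Gamma> - X) s u (param e)"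
        using that by (intro segment_in_sub[OF seg]) auto
      then show ?thesis unfolding g_def by (rule aff)
    qed
    ultimately have "g t = g 0 + of_real t * ((g (len e) - g 0) / of_real (len e))"
      using graph_modelD(4)[OF m e] t by (intro affine_on_closed_interval)
    then show "f (param e t) = f (start e) + of_real t * slope f e"
      by (simp add: g_def slope_def start_def target_def)
  qed
  then show thesis using that X by blast
qed

lemma closed_edges_cover:
  assumes m: "graph_model \<Gamma> V D"
  shows "\<Gamma> = V \<union> (\<Union>e\<in>D. closed_edge e)"
proof -
  have "inner_edge e \<subseteq> closed_edge e" if "e \<in> D" for e
    using closed_edge_eq[OF graph_modelD(4)[OF m that]] by blast
  then show ?thesis using graph_modelD(2,11)[OF m] closed_edge_subset[OF m] by blast
qed

lemma edge_affine_continuous: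
  assumes m: "graph_model \<Gamma> V D" and f: "edge_affine D f"
  shows "continuous_on \<Gamma> f"
proof -
  have "continuous_on (closed_edge e) f" if e: "e \<in> D" for e
  proof -
    have "f x = f (start e) + of_real (dist (start e) x) * slope f e" if "x \<in> closed_edge e" for x
    proof -
      obtain t where t: "t \<in> {0..len e}" "x = param e t" using \<open>x \<in> closed_edge e\<close> by (auto simp: closed_edge_def)
      then have "dist (start e) x = t"
        using segment_inD(3)[OF graph_modelD(5)[OF m e], of 0 t] by (simp add: start_def)
      then show ?thesis using f e t by (auto simp: edge_affine_def)
    qed
    moreover have "continuous_on (closed_edge e) (\<lambda>x. f (start e) + of_real (dist (start e) x) * slope f e)"
      by (intro continuous_intros)
    ultimately show ?thesis by (simp cong: continuous_on_cong)
  qed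
  then have "continuous_on (\<Union>e\<in>D. closed_edge e) f"
    using graph_modelD(3,5)[OF m] by (intro continuous_on_closed_Union) (auto intro: closed_closed_edge)
  moreover have "closed (\<Union>e\<in>D. closed_edge e)"
    using graph_modelD(3,5)[OF m] by (intro closed_UN) (auto intro: closed_closed_edge)
  moreover have "closed V" "continuous_on V f"
    using graph_modelD(1)[OF m] by (auto intro: finite_imp_closed continuous_on_finite)
  ultimately show ?thesis using closed_edges_cover[OF m] continuous_on_closed_Un by metis
qed

lemma edge_affine_CPA:
  assumes m: "graph_model \<Gamma> V D" and f: "edge_affine D f"
  shows "f \<in> CPA \<Gamma>"
proof -
  have "\<exists>c m. \<forall>t\<in>{a..b}. f (\<sigma> t) = c + of_real t * m" if \<sigma>: "segment_in (\<Gamma> - V) a b \<sigma>" for a b \<sigma>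
  proof -
    obtain e c \<epsilon> where e: "e \<in> D"
      "\<And>t. t \<in> {a..b} \<Longrightarrow> c + \<epsilon> * t \<in> {0<..<len e} \<and> \<sigma> t = param e (c + \<epsilon> * t)"
      using segment_affine_in_edge[OF m \<sigma>] by metis
    have "f (\<sigma> t) = (f (start e) + of_real c * slope f e) + of_real t * (of_real \<epsilon> * slope f e)"
      if "t \<in> {a..b}" for t
      using e(2)[OF that] f e(1) unfolding edge_affine_def by (auto simp: algebra_simps)
    then show ?thesis by blast
  qed
  then show ?thesis unfolding CPA_def
    using edge_affine_continuous[OF assms] graph_modelD(1,2)[OF m] by blast
qed

lemma CPA_common_model:
  assumes "f \<in> CPA \<Gamma>" "g \<in> CPA \<Gamma>" "finite X" "X \<subseteq> \<Gamma>"
  obtains V D where "graph_model \<Gamma> V D" "X \<subseteq> V" "edge_affine D f" "edge_affine D g"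
proof -
  obtain Y where Y: "finite Y" "Y \<subseteq> \<Gamma>" "\<And>V D. graph_model \<Gamma> V D \<Longrightarrow> Y \<subseteq> V \<Longrightarrow> edge_affine D f"
    using CPA_edge_affine[OF assms(1)] by metis
  obtain Z where Z: "finite Z" "Z \<subseteq> \<Gamma>" "\<And>V D. graph_model \<Gamma> V D \<Longrightarrow> Z \<subseteq> V \<Longrightarrow> edge_affine D g"
    using CPA_edge_affine[OF assms(2)] by metis
  have "finite (X \<union> Y \<union> Z)" "X \<union> Y \<union> Z \<subseteq> \<Gamma>" using Y Z assms(3,4) by auto
  then obtain V D where "graph_model \<Gamma> V D" "X \<union> Y \<union> Z \<subseteq> V" using model_exists by metis
  then show thesis by (intro that[of V D] Y(3) Z(3)) auto
qed

lemma slope_linear: "slope (\<lambda>x. a * f x + b * g x + c) e = a * slope f e + b * slope g e"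
  by (simp add: slope_def diff_divide_distrib add_divide_distrib algebra_simps)

lemma edge_affine_linear:
  "edge_affine D f \<Longrightarrow> edge_affine D g \<Longrightarrow> edge_affine D (\<lambda>x. a * f x + b * g x + c)"
  unfolding edge_affine_def slope_linear by (simp add: algebra_simps)

lemma CPA_linear:
  assumes "f \<in> CPA \<Gamma>" "g \<in> CPA \<Gamma>"
  shows "(\<lambda>x. a * f x + b * g x + c) \<in> CPA \<Gamma>"
    and "p \<in> \<Gamma> \<Longrightarrow> slope_sum \<Gamma> (\<lambda>x. a * f x + b * g x + c) p = a * slope_sum \<Gamma> f p + b * slope_sum \<Gamma> g p"
proof -
  show "(\<lambda>x. a * f x + b * g x + c) \<in> CPA \<Gamma>"
  proof -
    obtain V D where "graph_model \<Gamma> V D" "edge_affine D f" "edge_affine D g"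
      using CPA_common_model[OF assms, of "{}"] by auto
    then show ?thesis by (intro edge_affine_CPA edge_affine_linear)
  qed
  assume "p \<in> \<Gamma>"
  then obtain V D where m: "graph_model \<Gamma> V D" "{p} \<subseteq> V" "edge_affine D f" "edge_affine D g"
    using CPA_common_model[OF assms, of "{p}"] by auto
  then show "slope_sum \<Gamma> (\<lambda>x. a * f x + b * g x + c) p = a * slope_sum \<Gamma> f p + b * slope_sum \<Gamma> g p"
    using slope_sum_vertex[OF m(1,3), of p] slope_sum_vertex[OF m(1,4), of p]
      slope_sum_vertex[OF m(1) edge_affine_linear[OF m(3,4)], of p a b c]
    by (simp add: vertex_slope_def slope_linear sum.distrib sum_distrib_left)
qed

lemma CPA_dir_deriv:
  assumes "f \<in> CPA \<Gamma>" "p \<in> \<Gamma>" "v \<in> Vec \<Gamma> p"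
  shows "has_dir_deriv \<Gamma> f p v (dir_deriv \<Gamma> f p v)"
proof -
  obtain V D where m: "graph_model \<Gamma> V D" "{p} \<subseteq> V" "edge_affine D f"
    using CPA_common_model[OF assms(1,1), of "{p}"] assms(2) by auto
  then obtain l where "has_dir_deriv \<Gamma> f p v l"
    using edge_affine_dir_deriv[OF m(1,3), of p] assms(3) by auto
  then show ?thesis by (simp add: dir_deriv_unique)
qed

section \<open>The differential variation of a piecewise affine function\<close>

text \<open>Every edge whose interior avoids the boundary of \<open>S\<close> lies in \<open>S\<close> or in its complement. Summing
  the slopes over all edges inside \<open>S\<close>, in both orientations, gives \<open>0\<close>; this turns the slopes
  into \<open>S\<close> at boundary points outside \<open>S\<close> into the slope sums at the vertices in \<open>S\<close>.\<close>

lemma m_fun_CPA: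
  assumes f: "f \<in> CPA \<Gamma>" and S: "S \<subseteq> \<Gamma>" "finite (bdry \<Gamma> S)"
    and T: "finite T" "T \<subseteq> \<Gamma>" "\<And>p. p \<in> \<Gamma> - T \<Longrightarrow> slope_sum \<Gamma> f p = 0"
  shows "m_fun \<Gamma> f S = - (\<Sum>p\<in>T \<inter> S. slope_sum \<Gamma> f p)"
proof -
  have bd: "bdry \<Gamma> S \<subseteq> \<Gamma>" by (auto simp: bdry_def)
  obtain V D where m: "graph_model \<Gamma> V D" and BV: "bdry \<Gamma> S \<union> T \<subseteq> V" and fa: "edge_affine D f"
    using CPA_common_model[OF f f, of "bdry \<Gamma> S \<union> T"] S(2) bd T by auto
  note M = graph_modelD[OF m]
  define W where "W e \<longleftrightarrow> inner_edge e \<subseteq> S" for e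
  have in_or_out: "inner_edge e \<subseteq> S \<or> inner_edge e \<subseteq> \<Gamma> - S" if e: "e \<in> D" for e
  proof -
    have "closure S \<inter> closure (\<Gamma> - S) \<inter> inner_edge e = {}"
      using inner_edge_subset[OF m e] M(8)[OF e] BV by (auto simp: bdry_def)
    moreover have "inner_edge e \<subseteq> closure S \<union> closure (\<Gamma> - S)"
      using inner_edge_subset[OF m e] closure_subset[of S] closure_subset[of "\<Gamma> - S"] by blast
    ultimately have "closure S \<inter> inner_edge e = {} \<or> closure (\<Gamma> - S) \<inter> inner_edge e = {}"
      by (intro connected_closedD connected_inner_edge[OF M(5)[OF e]]) auto
    then show ?thesis
      using inner_edge_subset[OF m e] closure_subset[of S] closure_subset[of "\<Gamma> - S"] by blast
  qed
  have clos: "p \<in> closure (inner_edge e)" if "e \<in> D" "start e = p" for e p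
  proof -
    have "param e ` closure {0<..<len e} \<subseteq> closure (inner_edge e)" unfolding inner_edge_def
      using M(4)[OF that(1)] segment_continuous[OF M(5)[OF that(1)]]
      by (intro continuous_image_closure_subset[of "{0..len e}"]) auto
    then show ?thesis using that M(4)[OF that(1)] by (auto simp: start_def)
  qed
  have key: "(\<Sum>v\<in>In_vec \<Gamma> p S. dir_deriv \<Gamma> f p v) = (\<Sum>e\<in>{e\<in>D. start e = p \<and> W e}. slope f e)
      \<and> (\<Sum>v\<in>Out_vec \<Gamma> p S. dir_deriv \<Gamma> f p v) = (\<Sum>e\<in>{e\<in>D. start e = p \<and> \<not> W e}. slope f e)"
    if p: "p \<in> V" for p
  proof -
    obtain b where b: "bij_betw b (Vec \<Gamma> p) {e\<in>D. start e = p}"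
      and d: "\<And>v. v \<in> Vec \<Gamma> p \<Longrightarrow> eventually (\<lambda>t. move \<Gamma> p v t = param (b v) t) (at_right 0) \<and>
       has_dir_deriv \<Gamma> f p v (slope f (b v))"
      using edge_affine_dir_deriv[OF m fa p] by blast
    have *: "v \<in> In_vec \<Gamma> p S \<longleftrightarrow> W (b v)" if v: "v \<in> Vec \<Gamma> p" for v
    proof -
      have e: "b v \<in> D" using bij_betwE[OF b] v by auto
      have "eventually (\<lambda>t. t \<in> {0<..<len (b v)}) (at_right 0)"
        using M(4)[OF e] by (intro eventually_at_right_real)
      then have ev: "eventually (\<lambda>t. move \<Gamma> p v t \<in> inner_edge (b v)) (at_right 0)"
        using d[OF v, THEN conjunct1] by eventually_elim (auto simp: inner_edge_def)
      show ?thesis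
      proof
        assume "W (b v)"
        then have "eventually (\<lambda>t. move \<Gamma> p v t \<in> S) (at_right 0)"
          unfolding W_def using ev by (auto elim: eventually_mono)
        then show "v \<in> In_vec \<Gamma> p S" using v by (simp add: In_vec_def)
      next
        assume "v \<in> In_vec \<Gamma> p S"
        then have "eventually (\<lambda>t. move \<Gamma> p v t \<in> S) (at_right 0)" by (simp add: In_vec_def)
        then have "eventually (\<lambda>t. move \<Gamma> p v t \<in> inner_edge (b v) \<inter> S) (at_right 0)"
          using ev by eventually_elim auto
        then obtain t where "move \<Gamma> p v t \<in> inner_edge (b v) \<inter> S"
          using eventually_happens'[OF trivial_limit_at_right_real] by blast
        then show "W (b v)" using in_or_out[OF e] unfolding W_def by blast
      qed
    qed
    have sub: "In_vec \<Gamma> p S \<subseteq> Vec \<Gamma> p" "Out_vec \<Gamma> p S \<subseteq> Vec \<Gamma> p" by (auto simp: In_vec_def Out_vec_def)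
    have bin: "bij_betw b (In_vec \<Gamma> p S) {e\<in>D. start e = p \<and> W e}"
      using bij_betw_restrict[OF b sub(1) *] by (simp add: conj_assoc)
    have out: "v \<in> Out_vec \<Gamma> p S \<longleftrightarrow> \<not> W (b v)" if v: "v \<in> Vec \<Gamma> p" for v
      using *[OF v] v by (simp add: Out_vec_def)
    have bout: "bij_betw b (Out_vec \<Gamma> p S) {e\<in>D. start e = p \<and> \<not> W e}"
      using bij_betw_restrict[OF b sub(2) out] by (simp add: conj_assoc)
    have dd: "dir_deriv \<Gamma> f p v = slope f (b v)" if "v \<in> Vec \<Gamma> p" for v
      using d[OF that] by (simp add: dir_deriv_unique)
    show ?thesis
      using sum.reindex_bij_betw[OF bin, of "slope f"] sum.reindex_bij_betw[OF bout, of "slope f"] dd sub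
      by (metis (no_types, lifting) subsetD sum.cong)
  qed
  define w where "w e = (if W e then slope f e else 0)" for e
  define w' where "w' e = (if W e then 0 else slope f e)" for e
  have split: "(\<Sum>e\<in>{e\<in>D. start e = p \<and> W e}. slope f e) = (\<Sum>e\<in>{e\<in>D. start e = p}. w e)"
    "(\<Sum>e\<in>{e\<in>D. start e = p \<and> \<not> W e}. slope f e) = (\<Sum>e\<in>{e\<in>D. start e = p}. w' e)" for p
    using M(3) by (auto simp: w_def w'_def sum.If_cases Int_def conj_ac intro!: sum.mono_neutral_cong_left)
  have no_in: "(\<Sum>e\<in>{e\<in>D. start e = p}. w e) = 0" if p: "p \<in> V - S - bdry \<Gamma> S" for p
  proof (intro sum.neutral ballI)
    fix e assume e: "e \<in> {e\<in>D. start e = p}"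
    have "p \<in> \<Gamma>" using p M(2) by blast
    then have "p \<in> closure (\<Gamma> - S)" using p closure_subset[of "\<Gamma> - S"] by blast
    then have "p \<notin> closure S" using p \<open>p \<in> \<Gamma>\<close> by (auto simp: bdry_def)
    then show "w e = 0" using clos[of e p] e closure_mono[of "inner_edge e" S] by (auto simp: w_def W_def)
  qed
  have no_out: "(\<Sum>e\<in>{e\<in>D. start e = p}. w' e) = 0" if p: "p \<in> V \<inter> S - bdry \<Gamma> S" for p
  proof (intro sum.neutral ballI)
    fix e assume e: "e \<in> {e\<in>D. start e = p}"
    have "p \<in> \<Gamma>" using p M(2) by blast
    moreover have "p \<in> closure S" using p closure_subset[of S] by blast
    ultimately have "p \<notin> closure (\<Gamma> - S)" using p by (auto simp: bdry_def)
    then show "w' e = 0" using clos[of e p] e closure_mono[of "inner_edge e" "\<Gamma> - S"] in_or_out[of e]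
      by (auto simp: w'_def W_def)
  qed
  have "(\<Sum>e\<in>D. w e) = (\<Sum>e\<in>D. w (rev_edge e))"
    by (rule sum.reindex_bij_witness[of _ rev_edge rev_edge]) (use M(9) in auto)
  also have "\<dots> = - (\<Sum>e\<in>D. w e)" by (simp add: w_def W_def slope_rev sum_negf[symmetric] cong: if_cong)
       (auto intro!: sum.cong)
  finally have total: "(\<Sum>e\<in>D. w e) = 0" by simp
  have group: "(\<Sum>e\<in>D. h e) = (\<Sum>p\<in>V. \<Sum>e\<in>{e\<in>D. start e = p}. h e)" for h :: "'a edge \<Rightarrow> complex"
    using M(1,3,6) by (intro sum.group[symmetric]) auto
  have fV: "finite V" by (rule M(1))
  have "m_fun \<Gamma> f S = (\<Sum>p\<in>bdry \<Gamma> S - S. \<Sum>e\<in>{e\<in>D. start e = p}. w e) - (\<Sum>p\<in>bdry \<Gamma> S \<inter> S. \<Sum>e\<in>{e\<in>D. start e = p}. w' e)"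
    unfolding m_fun_def
    by (intro arg_cong2[where f = "(-)"] sum.cong refl) (use key split BV in auto)
  also have "(\<Sum>p\<in>bdry \<Gamma> S - S. \<Sum>e\<in>{e\<in>D. start e = p}. w e) = (\<Sum>p\<in>V - S. \<Sum>e\<in>{e\<in>D. start e = p}. w e)"
    using BV fV no_in by (intro sum.mono_neutral_left) auto
  also have "(\<Sum>p\<in>bdry \<Gamma> S \<inter> S. \<Sum>e\<in>{e\<in>D. start e = p}. w' e) = (\<Sum>p\<in>V \<inter> S. \<Sum>e\<in>{e\<in>D. start e = p}. w' e)"
    using BV fV no_out by (intro sum.mono_neutral_left) auto
  also have "(\<Sum>p\<in>V - S. \<Sum>e\<in>{e\<in>D. start e = p}. w e) = - (\<Sum>p\<in>V \<inter> S. \<Sum>e\<in>{e\<in>D. start e = p}. w e)"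
    using total group[of w] sum.Int_Diff[OF fV, of "\<lambda>p. \<Sum>e\<in>{e\<in>D. start e = p}. w e" S]
    by (simp add: eq_neg_iff_add_eq_0 add.commute)
  also have "- (\<Sum>p\<in>V \<inter> S. \<Sum>e\<in>{e\<in>D. start e = p}. w e) - (\<Sum>p\<in>V \<inter> S. \<Sum>e\<in>{e\<in>D. start e = p}. w' e)
      = - (\<Sum>p\<in>V \<inter> S. vertex_slope D f p)"
  proof -
    have "(\<Sum>p\<in>V \<inter> S. \<Sum>e\<in>{e\<in>D. start e = p}. w e) + (\<Sum>p\<in>V \<inter> S. \<Sum>e\<in>{e\<in>D. start e = p}. w' e)
        = (\<Sum>p\<in>V \<inter> S. vertex_slope D f p)"
      unfolding vertex_slope_def sum.distrib[symmetric]
      by (intro sum.cong refl) (simp add: w_def w'_def)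
    from this[symmetric] show ?thesis by (simp only: minus_add_distrib diff_conv_add_uminus)
  qed
  also have "(\<Sum>p\<in>V \<inter> S. vertex_slope D f p) = (\<Sum>p\<in>V \<inter> S. slope_sum \<Gamma> f p)"
    by (intro sum.cong refl) (simp add: slope_sum_vertex[OF m fa])
  also have "\<dots> = (\<Sum>p\<in>T \<inter> S. slope_sum \<Gamma> f p)"
    using BV fV T M(2) by (intro sum.mono_neutral_right) auto
  finally show ?thesis .
qed

end

section \<open>Green's formula and potentials on a model\<close>

lemma vertex_slope_linear:
  "vertex_slope D (\<lambda>x. \<Sum>q\<in>Q. c q * f q x) p = (\<Sum>q\<in>Q. c q * vertex_slope D (f q) p)"
proof -
  have "slope (\<lambda>x. \<Sum>q\<in>Q. c q * f q x) e = (\<Sum>q\<in>Q. c q * slope (f q) e)" for e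
    by (simp add: slope_def sum_divide_distrib right_diff_distrib flip: sum_subtractf)
  then show ?thesis
    unfolding vertex_slope_def by (simp add: sum_distrib_left) (rule sum.swap)
qed

lemma vertex_slope_cong:
  assumes m: "graph_model \<Gamma> V D" and "\<And>x. x \<in> V \<Longrightarrow> f x = g x"
  shows "vertex_slope D f p = vertex_slope D g p"
  unfolding vertex_slope_def slope_def using assms(2) graph_modelD(6,7)[OF m] by (intro sum.cong) auto

lemma sum_over_starts:
  assumes m: "graph_model \<Gamma> V D"
  shows "(\<Sum>p\<in>V. g p * vertex_slope D f p) = (\<Sum>e\<in>D. g (start e) * slope f e)"
proof -
  have "(\<Sum>p\<in>V. g p * vertex_slope D f p) = (\<Sum>p\<in>V. \<Sum>e\<in>{e\<in>D. start e = p}. g (start e) * slope f e)"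
    unfolding vertex_slope_def by (intro sum.cong refl) (simp add: sum_distrib_left)
  also have "\<dots> = (\<Sum>e\<in>D. g (start e) * slope f e)"
    using graph_modelD(1,3,6)[OF m] by (intro sum.group) auto
  finally show ?thesis .
qed

text \<open>Reversing all edges replaces \<open>g (start e)\<close> by \<open>- g (target e)\<close>; the energy form is the average of
  the two expressions.\<close>

lemma green:
  assumes m: "graph_model \<Gamma> V D"
  shows "2 * (\<Sum>p\<in>V. g p * vertex_slope D f p) = - (\<Sum>e\<in>D. (g (target e) - g (start e)) * slope f e)"
proof -
  have "(\<Sum>e\<in>D. g (start e) * slope f e) = (\<Sum>e\<in>D. g (start (rev_edge e)) * slope f (rev_edge e))"
    by (rule sum.reindex_bij_witness[of _ rev_edge rev_edge]) (use graph_modelD(9)[OF m] in auto)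
  also have "\<dots> = - (\<Sum>e\<in>D. g (target e) * slope f e)" by (simp add: slope_rev sum_negf)
  finally show ?thesis unfolding sum_over_starts[OF m]
    by (simp add: left_diff_distrib sum_subtractf)
qed

lemma green_symmetric:
  assumes m: "graph_model \<Gamma> V D"
  shows "(\<Sum>p\<in>V. g p * vertex_slope D f p) = (\<Sum>p\<in>V. f p * vertex_slope D g p)"
proof -
  have "(\<Sum>e\<in>D. (g (target e) - g (start e)) * slope f e) = (\<Sum>e\<in>D. (f (target e) - f (start e)) * slope g e)"
    by (intro sum.cong refl) (simp add: slope_def mult.commute)
  then have "2 * (\<Sum>p\<in>V. g p * vertex_slope D f p) = 2 * (\<Sum>p\<in>V. f p * vertex_slope D g p)"
    unfolding green[OF m] by simp
  then show ?thesis by simp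
qed

text \<open>The affine extension of a function on the vertices.\<close>

definition interpolate :: "'a set \<Rightarrow> 'a edge set \<Rightarrow> ('a \<Rightarrow> complex) \<Rightarrow> 'a \<Rightarrow> complex" where
  "interpolate V D F x = (if x \<in> V then F x else
     (let (e, t) = (SOME (e, t). e \<in> D \<and> t \<in> {0<..<len e} \<and> x = param e t)
      in F (start e) + of_real t * slope F e))"

lemma interpolate_inner:
  assumes m: "graph_model \<Gamma> V D" and e: "e \<in> D" and t: "t \<in> {0<..<len e}"
  shows "interpolate V D F (param e t) = F (start e) + of_real t * slope F e"
proof -
  note M = graph_modelD[OF m]
  define x where "x = param e t"
  have xe: "x \<in> inner_edge e" using t by (auto simp: x_def inner_edge_def)
  then have xV: "x \<notin> V" using M(8)[OF e] by blast
  obtain e' t' where et: "(SOME (e, t). e \<in> D \<and> t \<in> {0<..<len e} \<and> x = param e t) = (e', t')"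
    by (cases "SOME (e, t). e \<in> D \<and> t \<in> {0<..<len e} \<and> x = param e t") auto
  have "case (e, t) of (e, t) \<Rightarrow> e \<in> D \<and> t \<in> {0<..<len e} \<and> x = param e t" using e t by (simp add: x_def)
  then have "case SOME (e, t). e \<in> D \<and> t \<in> {0<..<len e} \<and> x = param e t of
      (e, t) \<Rightarrow> e \<in> D \<and> t \<in> {0<..<len e} \<and> x = param e t" by (rule someI)
  then have e': "e' \<in> D" "t' \<in> {0<..<len e'}" "x = param e' t'" unfolding et by auto
  then have "x \<in> inner_edge e'" by (auto simp: inner_edge_def)
  then have "e' = e \<or> e' = rev_edge e" using M(10)[OF e e'(1)] xe by blast
  then have "F (start e') + of_real t' * slope F e' = F (start e) + of_real t * slope F e"
  proof
    assume 1: "e' = e"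
    then have "t' = t" using inj_onD[OF segment_inj[OF M(5)[OF e]], of t' t] e' t by (auto simp: x_def)
    then show ?thesis using 1 by simp
  next
    assume 1: "e' = rev_edge e"
    then have "len e - t' = t"
      using inj_onD[OF segment_inj[OF M(5)[OF e]], of "len e - t'" t] e' t by (auto simp: x_def)
    then have t': "t' = len e - t" by simp
    have "F (start e') + of_real t' * slope F e' = F (target e) - of_real (len e - t) * slope F e"
      by (simp add: 1 slope_rev t')
    moreover have "F (target e) = F (start e) + of_real (len e) * slope F e"
      using M(4)[OF e] by (simp add: slope_def)
    ultimately show ?thesis by (simp add: algebra_simps)
  qed
  then show ?thesis using xV et unfolding interpolate_def x_def by simp
qed

lemma interpolate_model:
  assumes m: "graph_model \<Gamma> V D"
  shows "edge_affine D (interpolate V D F)"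
    and "vertex_slope D (interpolate V D F) p = vertex_slope D F p"
proof -
  note M = graph_modelD[OF m]
  have V: "interpolate V D F x = F x" if "x \<in> V" for x using that by (simp add: interpolate_def)
  have sl: "slope (interpolate V D F) e = slope F e" if "e \<in> D" for e
    using V M(6,7)[OF that] by (simp add: slope_def)
  have "interpolate V D F (param e t) = interpolate V D F (start e) + of_real t * slope (interpolate V D F) e"
    if e: "e \<in> D" and t: "t \<in> {0..len e}" for e t
  proof -
    have L: "0 < len e" using M(4)[OF e] .
    have st: "interpolate V D F (start e) = F (start e)" using V M(6)[OF e] by simp
    consider "t = 0" | "t = len e" | "t \<in> {0<..<len e}" using t by fastforce
    then show ?thesis
    proof cases
      case 1 then show ?thesis using st sl[OF e] by (simp add: start_def)
    next
      case 2
      then have "interpolate V D F (param e t) = F (target e)" using V M(7)[OF e] by (simp add: target_def)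
      then show ?thesis using 2 st sl[OF e] L by (simp add: slope_def)
    next
      case 3 then show ?thesis using interpolate_inner[OF m e 3, of F] st sl[OF e] by simp
    qed
  qed
  then show "edge_affine D (interpolate V D F)" by (simp add: edge_affine_def)
  show "vertex_slope D (interpolate V D F) p = vertex_slope D F p" by (intro vertex_slope_cong[OF m] V)
qed

text \<open>Gaussian elimination: a square linear system with trivial kernel is solvable.\<close>

lemma square_system_solvable:
  fixes a :: "'r \<Rightarrow> 'c \<Rightarrow> 'f::field"
  assumes "finite C" "finite R" "card R = card C"
    and "\<And>F. (\<And>p. p \<in> R \<Longrightarrow> (\<Sum>q\<in>C. a p q * F q) = 0) \<Longrightarrow> (\<And>q. q \<in> C \<Longrightarrow> F q = 0)"
  shows "\<exists>F. \<forall>p\<in>R. (\<Sum>q\<in>C. a p q * F q) = b p"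
  using assms
proof (induction C arbitrary: R a b rule: finite_induct)
  case empty
  then show ?case by simp
next
  case (insert w C)
  have "\<exists>p0\<in>R. a p0 w \<noteq> 0"
  proof (rule ccontr)
    assume "\<not> (\<exists>p0\<in>R. a p0 w \<noteq> 0)"
    then have z: "a p w = 0" if "p \<in> R" for p using that by blast
    have "(\<Sum>q\<in>insert w C. a p q * of_bool (q = w)) = 0" if "p \<in> R" for p
      using insert.hyps z[OF that] by (auto intro!: sum.neutral)
    from insert.prems(3)[of "\<lambda>q. of_bool (q = w)", OF this, of w] show False by simp
  qed
  then obtain p0 where p0: "p0 \<in> R" "a p0 w \<noteq> 0" by blast
  define R' where "R' = R - {p0}"
  define a' where "a' p q = a p q - a p w / a p0 w * a p0 q" for p q
  define b' where "b' p = b p - a p w / a p0 w * b p0" for p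
  define lift where "lift F c q = (if q = w then (c - (\<Sum>q\<in>C. a p0 q * F q)) / a p0 w else F q)" for F c q
  have lift: "(\<Sum>q\<in>insert w C. a p q * lift F c q) = a p w / a p0 w * c + (\<Sum>q\<in>C. a' p q * F q)" for p F c
  proof -
    have "(\<Sum>q\<in>C. a p q * lift F c q) = (\<Sum>q\<in>C. a p q * F q)"
      using insert.hyps(2) by (intro sum.cong refl) (auto simp: lift_def)
    then have "(\<Sum>q\<in>insert w C. a p q * lift F c q)
        = a p w * ((c - (\<Sum>q\<in>C. a p0 q * F q)) / a p0 w) + (\<Sum>q\<in>C. a p q * F q)"
      using insert.hyps by (simp add: lift_def)
    also have "(\<Sum>q\<in>C. a p q * F q) = (\<Sum>q\<in>C. a' p q * F q) + a p w / a p0 w * (\<Sum>q\<in>C. a p0 q * F q)"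
      unfolding a'_def by (simp add: left_diff_distrib sum_subtractf sum_distrib_left mult.assoc)
    finally show ?thesis by (simp add: diff_divide_distrib right_diff_distrib)
  qed
  have a'p0: "a' p0 q = 0" for q using p0 by (simp add: a'_def)
  have "finite R'" "card R' = card C" using insert.prems insert.hyps p0 by (auto simp: R'_def)
  moreover have "F q = 0" if F: "\<And>p. p \<in> R' \<Longrightarrow> (\<Sum>q\<in>C. a' p q * F q) = 0" and q: "q \<in> C" for F q
  proof -
    have "(\<Sum>q\<in>insert w C. a p q * lift F 0 q) = 0" if "p \<in> R" for p
      unfolding lift using that F[of p] a'p0 by (cases "p = p0") (auto simp: R'_def)
    then have "lift F 0 q = 0" using insert.prems(3) q by blast
    moreover have "q \<noteq> w" using q insert.hyps by blast
    ultimately show ?thesis by (simp add: lift_def)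
  qed
  ultimately obtain F where F: "\<forall>p\<in>R'. (\<Sum>q\<in>C. a' p q * F q) = b' p"
    using insert.IH[of R' a' b'] by blast
  have "(\<Sum>q\<in>insert w C. a p q * lift F (b p0) q) = b p" if "p \<in> R" for p
    unfolding lift using that F a'p0 p0 by (cases "p = p0") (auto simp: R'_def b'_def)
  then show ?case by blast
qed

definition potential :: "'a::metric_space set \<Rightarrow> 'a \<Rightarrow> 'a \<Rightarrow> ('a \<Rightarrow> complex) \<Rightarrow> bool" where
  "potential \<Gamma> \<zeta> y f \<longleftrightarrow> f \<in> CPA \<Gamma> \<and> f \<zeta> = 0 \<and>
     (\<forall>p\<in>\<Gamma>. slope_sum \<Gamma> f p = of_bool (p = \<zeta>) - of_bool (p = y))"

context metric_graph
begin

text \<open>If all slope sums vanish, then so does the energy; hence the function is constant on each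
  edge, its range is finite, and connectedness makes it constant.\<close>

lemma constant_if_harmonic:
  assumes m: "graph_model \<Gamma> V D" and f: "edge_affine D f"
    and h: "\<And>p. p \<in> V \<Longrightarrow> vertex_slope D f p = 0"
  shows "f constant_on \<Gamma>"
proof -
  note M = graph_modelD[OF m]
  have "0 = (\<Sum>e\<in>D. (cnj (f (target e)) - cnj (f (start e))) * slope f e)"
    using green[OF m, of "\<lambda>x. cnj (f x)" f] h by simp
  also have "\<dots> = (\<Sum>e\<in>D. of_real ((norm (f (target e) - f (start e)))\<^sup>2 / len e))"
    by (intro sum.cong refl)
       (simp add: slope_def mult.commute flip: complex_cnj_diff complex_norm_square)
  finally have "(\<Sum>e\<in>D. (norm (f (target e) - f (start e)))\<^sup>2 / len e) = 0"
    by (metis of_real_eq_0_iff of_real_sum)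
  then have eq: "f (target e) = f (start e)" if "e \<in> D" for e
    using sum_nonneg_eq_0_iff[OF M(3), of "\<lambda>e. (norm (f (target e) - f (start e)))\<^sup>2 / len e"] M(4)
      that by (force simp: less_imp_le)
  have "f ` \<Gamma> \<subseteq> f ` V"
  proof
    fix z assume "z \<in> f ` \<Gamma>"
    then obtain x where x: "x \<in> \<Gamma>" "z = f x" by blast
    show "z \<in> f ` V"
    proof (cases "x \<in> V")
      case False
      then obtain e where e: "e \<in> D" "x \<in> inner_edge e" using x M(11) by blast
      then obtain t where "t \<in> {0<..<len e}" "x = param e t" unfolding inner_edge_def by blast
      then have "f x = f (start e)" using f e eq[OF e(1)] by (auto simp: edge_affine_def slope_def)
      then show ?thesis using x M(6)[OF e(1)] by auto
    qed (use x in auto)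
  qed
  then have "finite (f ` \<Gamma>)" using M(1) by (meson finite_imageI finite_subset)
  then show ?thesis
    by (intro continuous_finite_range_constant connected_graph edge_affine_continuous[OF m f])
qed

lemma vertex_potential_exists:
  assumes m: "graph_model \<Gamma> V D" and \<zeta>: "\<zeta> \<in> V" and y: "y \<in> V"
  shows "\<exists>F :: 'a \<Rightarrow> real. F \<zeta> = 0 \<and> (\<forall>p\<in>V. vertex_slope D F p = of_bool (p = \<zeta>) - of_bool (p = y))"
proof -
  note M = graph_modelD[OF m]
  \<comment> \<open>Adding the value at \<open>\<zeta>\<close> to the equation at \<open>\<zeta>\<close> makes the system injective; since slope sums
    add up to zero over all vertices, every solution vanishes at \<open>\<zeta>\<close>.\<close>
  define a :: "'a \<Rightarrow> 'a \<Rightarrow> real" where "a p q = vertex_slope D (\<lambda>x. of_bool (x = q)) p + of_bool (p = \<zeta> \<and> q = \<zeta>)" for p q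
  have a: "(\<Sum>q\<in>V. a p q * F q) = vertex_slope D F p + of_bool (p = \<zeta>) * F \<zeta>" for p F
  proof -
    have "F x = (\<Sum>q\<in>V. F q * of_bool (x = q))" if "x \<in> V" for x
      using that M(1) by (simp add: of_bool_def if_distrib[of "\<lambda>c. F _ * c"] sum.delta cong: if_cong)
    then have "vertex_slope D F p = vertex_slope D (\<lambda>x. \<Sum>q\<in>V. F q * of_bool (x = q)) p"
      by (intro vertex_slope_cong[OF m])
    moreover have "(\<Sum>q\<in>V. of_bool (p = \<zeta> \<and> q = \<zeta>) * F q) = of_bool (p = \<zeta>) * F \<zeta>"
      using M(1) \<zeta> by (cases "p = \<zeta>") (simp_all add: of_bool_def if_distrib[of "\<lambda>c. c * F _"] sum.delta cong: if_cong)
    moreover have "(\<Sum>q\<in>V. a p q * F q) = (\<Sum>q\<in>V. vertex_slope D (\<lambda>x. of_bool (x = q)) p * F q)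
        + (\<Sum>q\<in>V. of_bool (p = \<zeta> \<and> q = \<zeta>) * F q)"
      unfolding a_def by (simp only: distrib_right sum.distrib)
    ultimately show ?thesis unfolding vertex_slope_linear by (simp only: mult.commute[of "F _"])
  qed
  have tot: "(\<Sum>p\<in>V. vertex_slope D F p) = 0" for F :: "'a \<Rightarrow> real"
    using green[OF m, of "\<lambda>_. 1" F] by simp
  have tot2: "(\<Sum>p\<in>V. of_bool (p = \<zeta>) * c) = c" for c :: real
    using M(1) \<zeta> by (simp add: of_bool_def if_distrib[of "\<lambda>x. x * c"] sum.delta cong: if_cong)
  have "F q = 0" if F: "\<And>p. p \<in> V \<Longrightarrow> (\<Sum>q\<in>V. a p q * F q) = 0" and q: "q \<in> V" for F q
  proof -
    have eq: "vertex_slope D F p + of_bool (p = \<zeta>) * F \<zeta> = 0" if "p \<in> V" for p using F[OF that] by (simp add: a)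
    then have "(\<Sum>p\<in>V. vertex_slope D F p + of_bool (p = \<zeta>) * F \<zeta>) = 0" by simp
    then have F0: "F \<zeta> = 0" using tot[of F] tot2[of "F \<zeta>"] by (simp add: sum.distrib)
    then have "vertex_slope D F p = 0" if "p \<in> V" for p using eq[OF that] by simp
    moreover have "vertex_slope D (\<lambda>x. complex_of_real (F x)) p = of_real (vertex_slope D F p)" for p
      by (simp add: vertex_slope_def slope_def)
    ultimately have "vertex_slope D (interpolate V D (\<lambda>x. of_real (F x))) p = 0" if "p \<in> V" for p
      using that by (simp add: interpolate_model(2)[OF m])
    then have "interpolate V D (\<lambda>x. of_real (F x)) constant_on \<Gamma>"
      by (intro constant_if_harmonic[OF m] interpolate_model(1)[OF m])
    then have "interpolate V D (\<lambda>x. of_real (F x)) q = interpolate V D (\<lambda>x. of_real (F x)) \<zeta>"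
      using q \<zeta> M(2) unfolding constant_on_def by (metis subsetD)
    then show ?thesis using q \<zeta> F0 by (simp add: interpolate_def)
  qed
  then obtain F where F: "\<forall>p\<in>V. (\<Sum>q\<in>V. a p q * F q) = of_bool (p = \<zeta>) - of_bool (p = y)"
    using square_system_solvable[of V V a "\<lambda>p. of_bool (p = \<zeta>) - of_bool (p = y)"] M(1) by blast
  then have "(\<Sum>p\<in>V. vertex_slope D F p + of_bool (p = \<zeta>) * F \<zeta>) = (\<Sum>p\<in>V. of_bool (p = \<zeta>) - of_bool (p = y))"
    by (intro sum.cong) (simp_all add: a)
  also have "\<dots> = 0" using \<zeta> y M(1) by (simp add: sum_subtractf of_bool_def sum.delta cong: if_cong)
  finally have "F \<zeta> = 0" using tot[of F] tot2[of "F \<zeta>"] by (simp add: sum.distrib)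
  then show ?thesis using F by (intro exI[of _ F]) (simp add: a)
qed

lemma potential_exists:
  assumes \<zeta>: "\<zeta> \<in> \<Gamma>" and y: "y \<in> \<Gamma>"
  shows "\<exists>f. potential \<Gamma> \<zeta> y f \<and> (\<forall>x\<in>\<Gamma>. f x \<in> \<real>)"
proof -
  obtain V D where m: "graph_model \<Gamma> V D" and V: "{\<zeta>, y} \<subseteq> V"
    using model_exists[of "{\<zeta>, y}"] \<zeta> y by auto
  note M = graph_modelD[OF m]
  obtain F :: "'a \<Rightarrow> real" where F: "F \<zeta> = 0" "\<And>p. p \<in> V \<Longrightarrow> vertex_slope D F p = of_bool (p = \<zeta>) - of_bool (p = y)"
    using vertex_potential_exists[OF m, of \<zeta> y] V by auto
  define f where "f = interpolate V D (\<lambda>x. of_real (F x))"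
  have fa: "edge_affine D f" unfolding f_def by (rule interpolate_model(1)[OF m])
  have fV: "f x = of_real (F x)" if "x \<in> V" for x using that by (simp add: f_def interpolate_def)
  have "slope_sum \<Gamma> f p = of_bool (p = \<zeta>) - of_bool (p = y)" if p: "p \<in> \<Gamma>" for p
  proof (cases "p \<in> V")
    case True
    have "vertex_slope D (\<lambda>x. complex_of_real (F x)) p = of_real (vertex_slope D F p)"
      by (simp add: vertex_slope_def slope_def)
    then show ?thesis
      using slope_sum_vertex[OF m fa True] F(2)[OF True] interpolate_model(2)[OF m] by (simp add: f_def)
  next
    case False
    then show ?thesis using slope_sum_inner[OF m fa, of p] p V by auto
  qed
  moreover have "f x \<in> \<real>" if x: "x \<in> \<Gamma>" for x
  proof (cases "x \<in> V")
    case False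
    then obtain e where e: "e \<in> D" "x \<in> inner_edge e" using x M(11) by blast
    then obtain t where t: "t \<in> {0<..<len e}" "x = param e t" unfolding inner_edge_def by blast
    then have "f x = f (start e) + of_real t * slope f e" using fa e(1) by (simp add: edge_affine_def)
    then show ?thesis using fV M(6,7)[OF e(1)] by (simp add: slope_def)
  qed (simp add: fV)
  ultimately show ?thesis unfolding potential_def
    using edge_affine_CPA[OF m fa] fV[of \<zeta>] V F(1) by (intro exI[of _ f]) auto
qed

lemma potential_unique:
  assumes "potential \<Gamma> \<zeta> y f" "potential \<Gamma> \<zeta> y g" "\<zeta> \<in> \<Gamma>" "x \<in> \<Gamma>"
  shows "f x = g x"
proof -
  define h where "h = (\<lambda>x. 1 * f x + (-1) * g x + 0)"
  have h: "h \<in> CPA \<Gamma>" unfolding h_def using assms(1,2) by (intro CPA_linear) (auto simp: potential_def)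
  have s: "slope_sum \<Gamma> h p = 0" if "p \<in> \<Gamma>" for p
    using CPA_linear(2)[of f g p 1 "-1" 0] assms(1,2) that by (auto simp: potential_def h_def)
  obtain V D where m: "graph_model \<Gamma> V D" and ha: "edge_affine D h"
    using CPA_common_model[OF h h, of "{}"] by auto
  have "vertex_slope D h p = 0" if "p \<in> V" for p
    using s[of p] slope_sum_vertex[OF m ha that] that graph_modelD(2)[OF m] by auto
  then have "h constant_on \<Gamma>" by (rule constant_if_harmonic[OF m ha])
  then have "h x = h \<zeta>" using assms(3,4) unfolding constant_on_def by metis
  then show ?thesis using assms(1,2) by (simp add: h_def potential_def)
qed

lemma dir_deriv_cong:
  assumes eq: "\<And>x. x \<in> \<Gamma> \<Longrightarrow> f x = g x" and p: "p \<in> \<Gamma>" and v: "v \<in> Vec \<Gamma> p"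
  shows "has_dir_deriv \<Gamma> f p v l \<longleftrightarrow> has_dir_deriv \<Gamma> g p v l" "dir_deriv \<Gamma> f p v = dir_deriv \<Gamma> g p v"
proof -
  obtain \<rho> where sb: "star_ball \<Gamma> p \<rho>" using star_ball_exists[OF p] by blast
  have "eventually (\<lambda>t. t \<in> {0<..<\<rho>}) (at_right 0)"
    using star_ball_move(1)[OF sb] by (intro eventually_at_right_real)
  then have ev: "eventually (\<lambda>t. (f (move \<Gamma> p v t) - f p) / of_real t = (g (move \<Gamma> p v t) - g p) / of_real t) (at_right 0)"
    by eventually_elim (use eq p star_ball_move(3)[OF sb v] in auto)
  have *: "has_dir_deriv \<Gamma> f p v l \<longleftrightarrow> has_dir_deriv \<Gamma> g p v l" for l
    unfolding has_dir_deriv_def by (rule tendsto_cong[OF ev])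
  show "has_dir_deriv \<Gamma> f p v l \<longleftrightarrow> has_dir_deriv \<Gamma> g p v l" by (rule *)
  show "dir_deriv \<Gamma> f p v = dir_deriv \<Gamma> g p v" unfolding dir_deriv_def * ..
qed

lemma potential_cong:
  assumes eq: "\<And>x. x \<in> \<Gamma> \<Longrightarrow> f x = g x" and f: "potential \<Gamma> \<zeta> y f" and \<zeta>: "\<zeta> \<in> \<Gamma>"
  shows "potential \<Gamma> \<zeta> y g"
proof -
  have "slope_sum \<Gamma> f p = slope_sum \<Gamma> g p" if "p \<in> \<Gamma>" for p
    unfolding slope_sum_def by (intro sum.cong refl dir_deriv_cong(2)[OF eq that])
  moreover have "g \<in> CPA \<Gamma>"
  proof -
    obtain X where X: "continuous_on \<Gamma> f" "finite X" "X \<subseteq> \<Gamma>"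
      "\<And>a b \<gamma>. segment_in (\<Gamma> - X) a b \<gamma> \<Longrightarrow> \<exists>c m. \<forall>t\<in>{a..b}. f (\<gamma> t) = c + of_real t * m"
      using f unfolding potential_def CPA_def by blast
    have "\<exists>c m. \<forall>t\<in>{a..b}. g (\<gamma> t) = c + of_real t * m" if s: "segment_in (\<Gamma> - X) a b \<gamma>" for a b \<gamma>
    proof -
      have "\<gamma> t \<in> \<Gamma>" if "t \<in> {a..b}" for t using segment_inD(2)[OF s] that by auto
      then show ?thesis using X(4)[OF s] eq by metis
    qed
    moreover have "continuous_on \<Gamma> g" using X(1) eq by (simp cong: continuous_on_cong)
    ultimately show ?thesis unfolding CPA_def using X(2,3) by blast
  qed
  ultimately show ?thesis using f eq[OF \<zeta>] by (simp add: potential_def)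
qed

lemma laplacian_iff_slope_sum:
  assumes "\<zeta> \<in> \<Gamma>" "y \<in> \<Gamma>"
  shows "(\<forall>A\<in>sets (borel_on \<Gamma>). laplacian \<Gamma> f A = indicator A y - indicator A \<zeta>) \<longleftrightarrow>
    (\<forall>p\<in>\<Gamma>. slope_sum \<Gamma> f p = of_bool (p = \<zeta>) - of_bool (p = y))"
proof
  assume L: "\<forall>A\<in>sets (borel_on \<Gamma>). laplacian \<Gamma> f A = indicator A y - indicator A \<zeta>"
  show "\<forall>p\<in>\<Gamma>. slope_sum \<Gamma> f p = of_bool (p = \<zeta>) - of_bool (p = y)"
  proof
    fix p assume p: "p \<in> \<Gamma>"
    have "{p} \<in> sets (borel_on \<Gamma>)" using p by (auto simp: borel_on_def sets_restrict_space intro!: image_eqI[of _ _ "{p}"])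
    then have "laplacian \<Gamma> f {p} = indicator {p} y - indicator {p} \<zeta>" using L by blast
    moreover have "{q \<in> {p}. slope_sum \<Gamma> f q \<noteq> 0} = (if slope_sum \<Gamma> f p = 0 then {} else {p})" by auto
    then have "laplacian \<Gamma> f {p} = - slope_sum \<Gamma> f p" by (simp add: laplacian_def)
    ultimately have "- slope_sum \<Gamma> f p = indicator {p} y - indicator {p} \<zeta>" by simp
    then have "slope_sum \<Gamma> f p = indicator {p} \<zeta> - indicator {p} y" by (metis minus_diff_eq minus_minus)
    then show "slope_sum \<Gamma> f p = of_bool (p = \<zeta>) - of_bool (p = y)" by (auto simp: indicator_def)
  qed
next
  assume S: "\<forall>p\<in>\<Gamma>. slope_sum \<Gamma> f p = of_bool (p = \<zeta>) - of_bool (p = y)"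
  show "\<forall>A\<in>sets (borel_on \<Gamma>). laplacian \<Gamma> f A = indicator A y - indicator A \<zeta>"
  proof
    fix A assume "A \<in> sets (borel_on \<Gamma>)"
    then have A: "A \<subseteq> \<Gamma>" by (auto simp: borel_on_def sets_restrict_space)
    have "(\<Sum>p\<in>{p\<in>A. slope_sum \<Gamma> f p \<noteq> 0}. slope_sum \<Gamma> f p) = (\<Sum>p\<in>A \<inter> {\<zeta>, y}. of_bool (p = \<zeta>) - of_bool (p = y))"
      using S A by (intro sum.mono_neutral_cong_left) auto
    also have "\<dots> = indicator A \<zeta> - indicator A y"
      by (cases "\<zeta> \<in> A"; cases "y \<in> A"; cases "\<zeta> = y") (auto simp: indicator_def Int_insert_right)
    finally show "laplacian \<Gamma> f A = indicator A y - indicator A \<zeta>" by (simp add: laplacian_def)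
  qed
qed

lemma j_kernel_potential:
  assumes "\<zeta> \<in> \<Gamma>" "y \<in> \<Gamma>"
  shows "potential \<Gamma> \<zeta> y (\<lambda>x. j_kernel \<Gamma> \<zeta> x y)"
proof -
  define P where "P = (\<lambda>f. f \<in> CPA \<Gamma> \<and> f \<in> extensional \<Gamma> \<and>
     (\<forall>A\<in>sets (borel_on \<Gamma>). laplacian \<Gamma> f A = indicator A y - indicator A \<zeta>) \<and> f \<zeta> = 0)"
  have P: "P f \<longleftrightarrow> potential \<Gamma> \<zeta> y f \<and> f \<in> extensional \<Gamma>" for f
    unfolding P_def potential_def laplacian_iff_slope_sum[OF assms] by blast
  obtain f where f: "potential \<Gamma> \<zeta> y f" using potential_exists[OF assms] by blast
  have "potential \<Gamma> \<zeta> y (restrict f \<Gamma>)" by (rule potential_cong[OF _ f assms(1)]) simp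
  then have "P (restrict f \<Gamma>)" unfolding P by simp
  moreover have "g = restrict f \<Gamma>" if "P g" for g
  proof (rule extensionalityI[of _ \<Gamma>])
    show "g \<in> extensional \<Gamma>" "restrict f \<Gamma> \<in> extensional \<Gamma>" using that P by auto
    show "g x = restrict f \<Gamma> x" if "x \<in> \<Gamma>" for x
      using potential_unique[OF _ f assms(1) that, of g] \<open>P g\<close> P that by simp
  qed
  ultimately have "P (THE f. P f)" by (rule theI)
  then have "potential \<Gamma> \<zeta> y (THE f. P f)" using P by blast
  moreover have "(THE f. P f) = (\<lambda>x. j_kernel \<Gamma> \<zeta> x y)" by (simp add: j_kernel_def P_def)
  ultimately show ?thesis by simp
qed

lemma j_kernel_eqI:
  "potential \<Gamma> \<zeta> y f \<Longrightarrow> \<zeta> \<in> \<Gamma> \<Longrightarrow> y \<in> \<Gamma> \<Longrightarrow> x \<in> \<Gamma> \<Longrightarrow> j_kernel \<Gamma> \<zeta> x y = f x"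
  using potential_unique[OF j_kernel_potential] by blast

lemma j_kernel_real:
  assumes "\<zeta> \<in> \<Gamma>" "x \<in> \<Gamma>" "y \<in> \<Gamma>"
  shows "j_kernel \<Gamma> \<zeta> x y \<in> \<real>"
  using potential_exists[OF assms(1,3)] j_kernel_eqI assms by metis

lemma j_kernel_symmetric:
  assumes z: "\<zeta> \<in> \<Gamma>" and x: "x \<in> \<Gamma>" and y: "y \<in> \<Gamma>"
  shows "j_kernel \<Gamma> \<zeta> x y = j_kernel \<Gamma> \<zeta> y x"
proof -
  define f where "f = (\<lambda>p. j_kernel \<Gamma> \<zeta> p y)"
  define g where "g = (\<lambda>p. j_kernel \<Gamma> \<zeta> p x)"
  have f: "potential \<Gamma> \<zeta> y f" and g: "potential \<Gamma> \<zeta> x g"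
    unfolding f_def g_def using j_kernel_potential z x y by auto
  then have "f \<in> CPA \<Gamma>" "g \<in> CPA \<Gamma>" by (simp_all add: potential_def)
  then obtain V D where m: "graph_model \<Gamma> V D" and V: "{\<zeta>, x, y} \<subseteq> V"
    and fa: "edge_affine D f" and ga: "edge_affine D g"
    using CPA_common_model[of f g "{\<zeta>, x, y}"] z x y by blast
  have V\<Gamma>: "V \<subseteq> \<Gamma>" and fV: "finite V" using graph_modelD[OF m] by auto
  have eval: "(\<Sum>p\<in>V. h p * vertex_slope D k p) = h \<zeta> - h w"
    if k: "potential \<Gamma> \<zeta> w k" "edge_affine D k" and w: "w \<in> V" for h k w
  proof -
    have "vertex_slope D k p = of_bool (p = \<zeta>) - of_bool (p = w)" if "p \<in> V" for p
    proof -
      have "slope_sum \<Gamma> k p = of_bool (p = \<zeta>) - of_bool (p = w)" using k(1) that V\<Gamma> by (auto simp: potential_def)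
      then show ?thesis using slope_sum_vertex[OF m k(2) that] by simp
    qed
    then have "(\<Sum>p\<in>V. h p * vertex_slope D k p) = (\<Sum>p\<in>V. h p * (of_bool (p = \<zeta>) - of_bool (p = w)))"
      by simp
    also have "\<dots> = (\<Sum>p\<in>V. if p = \<zeta> then h p else 0) - (\<Sum>p\<in>V. if p = w then h p else 0)"
      unfolding sum_subtractf[symmetric] by (intro sum.cong refl) auto
    also have "\<dots> = h \<zeta> - h w" using V w fV by (simp add: sum.delta)
    finally show ?thesis .
  qed
  have "g \<zeta> - g y = f \<zeta> - f x"
    using green_symmetric[OF m, of g f] eval[OF f fa, of g] eval[OF g ga, of f] V by simp
  then show ?thesis using f g by (simp add: potential_def f_def g_def)
qed

text \<open>All kernels \<open>j\<^sub>\<zeta>\<close> are expressed by the one with a fixed base point.\<close>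

lemma j_kernel_change_base:
  assumes o: "o' \<in> \<Gamma>" and z: "\<zeta> \<in> \<Gamma>" and x: "x \<in> \<Gamma>" and y: "y \<in> \<Gamma>"
  shows "j_kernel \<Gamma> \<zeta> x y = j_kernel \<Gamma> o' x y - j_kernel \<Gamma> o' x \<zeta> - j_kernel \<Gamma> o' \<zeta> y + j_kernel \<Gamma> o' \<zeta> \<zeta>"
proof -
  define f where "f = (\<lambda>p. j_kernel \<Gamma> o' p y)"
  define g where "g = (\<lambda>p. j_kernel \<Gamma> o' p \<zeta>)"
  have f: "potential \<Gamma> o' y f" and g: "potential \<Gamma> o' \<zeta> g"
    unfolding f_def g_def using j_kernel_potential o z y by auto
  define h where "h = (\<lambda>p. 1 * f p + (-1) * g p + (g \<zeta> - f \<zeta>))"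
  have "h \<in> CPA \<Gamma>" unfolding h_def using f g by (intro CPA_linear) (auto simp: potential_def)
  moreover have "slope_sum \<Gamma> h p = of_bool (p = \<zeta>) - of_bool (p = y)" if "p \<in> \<Gamma>" for p
    using CPA_linear(2)[of f g p 1 "-1" "g \<zeta> - f \<zeta>"] f g that by (auto simp: potential_def h_def)
  ultimately have "potential \<Gamma> \<zeta> y h" by (simp add: potential_def h_def)
  then show ?thesis using j_kernel_eqI[OF _ z y x] by (simp add: h_def f_def g_def)
qed

end

section \<open>Functions that are Lipschitz along segments\<close>

definition segment_lipschitz :: "'a::metric_space set \<Rightarrow> real \<Rightarrow> ('a \<Rightarrow> 'b::real_normed_vector) \<Rightarrow> bool" where
  "segment_lipschitz \<Gamma> C f \<longleftrightarrow> (\<forall>a b \<sigma>. segment_in \<Gamma> a b \<sigma> \<longrightarrow>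
     (\<forall>s\<in>{a..b}. \<forall>t\<in>{a..b}. norm (f (\<sigma> s) - f (\<sigma> t)) \<le> C * \<bar>s - t\<bar>))"

lemma lipschitz_off_finite_set:
  fixes g :: "real \<Rightarrow> complex"
  assumes "finite T" "c \<le> d" "continuous_on {c..d} g"
    and "\<And>c' d'. c < c' \<Longrightarrow> c' < d' \<Longrightarrow> d' < d \<Longrightarrow> {c'..d'} \<inter> T = {} \<Longrightarrow> norm (g c' - g d') \<le> d' - c'"
  shows "norm (g c - g d) \<le> d - c"
  using assms
proof (induction T arbitrary: c d rule: finite_induct)
  case (empty c d)
  show ?case
  proof (cases "c = d")
    case False
    then have cd: "c < d" using empty by simp
    define s t where "s n = c + (d - c) / real (n + 3)" and "t n = d - (d - c) / real (n + 3)" for n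
    have frac: "0 < (d - c) / real (n + 3)" "2 * ((d - c) / real (n + 3)) < d - c" for n
    proof -
      define q where "q = (d - c) / real (n + 3)"
      have "0 < q" using cd by (simp add: q_def)
      then have "2 * q < real (n + 3) * q" by (intro mult_strict_right_mono) auto
      also have "\<dots> = d - c" by (simp add: q_def)
      finally have "2 * q < d - c" .
      then show "2 * ((d - c) / real (n + 3)) < d - c" by (simp only: q_def)
      show "0 < (d - c) / real (n + 3)" using cd by simp
    qed
    have st: "c < s n" "s n < t n" "t n < d" for n
      using frac[of n] unfolding s_def t_def by linarith+
    have lim: "(\<lambda>n. (d - c) / real (n + 3)) \<longlonglongrightarrow> 0"
      using LIMSEQ_ignore_initial_segment[OF lim_const_over_n[of "d - c"], of 3] by simp
    have s: "s \<longlonglongrightarrow> c" and t: "t \<longlonglongrightarrow> d"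
      unfolding s_def t_def using tendsto_add[OF tendsto_const[of c] lim] tendsto_diff[OF tendsto_const[of d] lim] by auto
    have in': "s n \<in> {c..d}" "t n \<in> {c..d}" for n using st[of n] by auto
    have gs: "(\<lambda>n. g (s n)) \<longlonglongrightarrow> g c" "(\<lambda>n. g (t n)) \<longlonglongrightarrow> g d"
      using cd in' by (auto intro!: continuous_on_tendsto_compose[OF empty.prems(2)] s t always_eventually)
    have "norm (g (s n) - g (t n)) \<le> t n - s n" for n using empty.prems(3)[of "s n" "t n"] st[of n] by simp
    then show ?thesis
      by (intro LIMSEQ_le[OF tendsto_norm[OF tendsto_diff[OF gs]] tendsto_diff[OF t s]]) auto
  qed simp
next
  case (insert x T c d)
  show ?case
  proof (cases "x \<in> {c<..<d}")
    case True
    have "norm (g c - g x) \<le> x - c"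
    proof (rule insert.IH)
      show "continuous_on {c..x} g" using True by (intro continuous_on_subset[OF insert.prems(2)]) auto
    qed (use True insert.prems(3) in auto)
    moreover have "norm (g x - g d) \<le> d - x"
    proof (rule insert.IH)
      show "continuous_on {x..d} g" using True by (intro continuous_on_subset[OF insert.prems(2)]) auto
    qed (use True insert.prems(3) in auto)
    ultimately show ?thesis using norm_triangle_ineq[of "g c - g x" "g x - g d"] by simp
  next
    case False
    show ?thesis
    proof (rule insert.IH)
      fix c' d' assume *: "c < c'" "c' < d'" "d' < d" "{c'..d'} \<inter> T = {}"
      then have "x \<notin> {c'..d'}" using False by auto
      then show "norm (g c' - g d') \<le> d' - c'" using insert.prems(3) * by auto
    qed (use insert.prems in auto)
  qed
qed

context metric_graph
begin

text \<open>The slopes of a potential are bounded by \<open>1\<close>: the indicator function of the vertices at or above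
  a level picks out, in Green's formula, the edges crossing that level, all with the same sign,
  and the total flow across the level is at most \<open>1\<close>.\<close>

lemma potential_slope_le_1:
  assumes f: "potential \<Gamma> \<zeta> y f" and real: "\<And>x. x \<in> \<Gamma> \<Longrightarrow> f x \<in> \<real>"
    and m: "graph_model \<Gamma> V D" and fa: "edge_affine D f" and V: "\<zeta> \<in> V" "y \<in> V" and e: "e \<in> D"
  shows "norm (slope f e) \<le> 1"
proof -
  note M = graph_modelD[OF m]
  define u where "u = (\<lambda>x. Re (f x))"
  have fu: "f p = of_real (u p)" if "p \<in> V" for p
  proof -
    have "f p \<in> \<real>" using real that M(2) by blast
    then show ?thesis by (simp add: u_def of_real_Re)
  qed
  have sl: "slope f e = of_real (slope u e)" if "e \<in> D" for e
    using fu M(6,7)[OF that] by (simp add: slope_def)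
  have vs: "vertex_slope D u p = of_bool (p = \<zeta>) - of_bool (p = y)" if p: "p \<in> V" for p
  proof -
    have "complex_of_real (vertex_slope D u p) = vertex_slope D f p"
      unfolding vertex_slope_def of_real_sum by (intro sum.cong refl) (simp add: sl)
    also have "\<dots> = slope_sum \<Gamma> f p" using slope_sum_vertex[OF m fa p] by simp
    also have "\<dots> = of_real (of_bool (p = \<zeta>) - of_bool (p = y))" using f p M(2) by (auto simp: potential_def)
    finally show ?thesis by (simp only: of_real_eq_iff)
  qed
  have up: "slope u e \<le> 1" if e: "e \<in> D" and lt: "u (start e) < u (target e)" for e
  proof -
    define g :: "'a \<Rightarrow> real" where "g p = of_bool (u (target e) \<le> u p)" for p
    have nonneg: "0 \<le> (g (target e') - g (start e')) * slope u e'" if "e' \<in> D" for e'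
      using M(4)[OF that] by (auto simp: g_def slope_def zero_le_mult_iff zero_le_divide_iff divide_le_0_iff)
    have "(\<Sum>p\<in>V. g p * vertex_slope D u p) = (\<Sum>p\<in>V. (if p = \<zeta> then g p else 0) - (if p = y then g p else 0))"
      by (intro sum.cong refl) (simp add: vs)
    also have "\<dots> = g \<zeta> - g y" using V M(1) by (simp add: sum_subtractf sum.delta)
    finally have "(\<Sum>e\<in>D. (g (target e) - g (start e)) * slope u e) = 2 * (g y - g \<zeta>)"
      using green[OF m, of g u] by simp
    also have "\<dots> \<le> 2" by (simp add: g_def)
    finally have le: "(\<Sum>e\<in>D. (g (target e) - g (start e)) * slope u e) \<le> 2" .
    have ne: "e \<noteq> rev_edge e"
    proof
      assume "e = rev_edge e"
      then have "start e = start (rev_edge e)" by simp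
      then show False using lt by simp
    qed
    have "2 * slope u e = (\<Sum>e\<in>{e, rev_edge e}. (g (target e) - g (start e)) * slope u e)"
      using ne lt by (simp add: g_def slope_rev)
    also have "\<dots> \<le> (\<Sum>e\<in>D. (g (target e) - g (start e)) * slope u e)"
      using nonneg e M(3,9) by (intro sum_mono2) auto
    finally show ?thesis using le by simp
  qed
  consider "u (start e) < u (target e)" | "u (target e) < u (start e)" | "u (start e) = u (target e)" by linarith
  then have "\<bar>slope u e\<bar> \<le> 1"
  proof cases
    case 1
    then have "0 \<le> slope u e" using M(4)[OF e] by (simp add: slope_def)
    then show ?thesis using up[OF e 1] by simp
  next
    case 2
    then have "slope u e \<le> 0" using M(4)[OF e] by (simp add: slope_def divide_le_0_iff)
    then show ?thesis using up[OF M(9)[OF e]] 2 by (simp add: slope_rev)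
  qed (simp add: slope_def)
  then show ?thesis using sl[OF e] by simp
qed

lemma potential_lipschitz:
  assumes f: "potential \<Gamma> \<zeta> y f" and real: "\<And>x. x \<in> \<Gamma> \<Longrightarrow> f x \<in> \<real>" and z: "\<zeta> \<in> \<Gamma>" "y \<in> \<Gamma>"
  shows "segment_lipschitz \<Gamma> 1 f"
proof -
  have fC: "f \<in> CPA \<Gamma>" using f by (simp add: potential_def)
  obtain V D where m: "graph_model \<Gamma> V D" and V: "{\<zeta>, y} \<subseteq> V" and fa: "edge_affine D f"
    using CPA_common_model[OF fC fC, of "{\<zeta>, y}"] z by auto
  have main: "norm (f (\<sigma> s) - f (\<sigma> t)) \<le> t - s" if \<sigma>: "segment_in \<Gamma> a b \<sigma>" and st: "a \<le> s" "s \<le> t" "t \<le> b" for a b \<sigma> s t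
  proof -
    define g where "g = (\<lambda>t. f (\<sigma> t))"
    define T where "T = {t\<in>{a..b}. \<sigma> t \<in> V}"
    have "inj_on \<sigma> T" by (rule inj_on_subset[OF segment_inj[OF \<sigma>]]) (auto simp: T_def)
    then have T: "finite T" using graph_modelD(1)[OF m] by (intro inj_on_finite[of \<sigma> T V]) (auto simp: T_def)
    have "continuous_on {a..b} g" unfolding g_def
      by (rule continuous_on_compose2[OF edge_affine_continuous[OF m fa] segment_continuous[OF \<sigma>]])
         (use \<sigma> in \<open>simp add: segment_in_def\<close>)
    then have cont: "continuous_on {s..t} g" using st by (elim continuous_on_subset) auto
    have "norm (g s - g t) \<le> t - s"
    proof (rule lipschitz_off_finite_set[OF T st(2) cont])
      fix c d assume cd: "s < c" "c < d" "d < t" "{c..d} \<inter> T = {}"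
      have "\<sigma> ` {c..d} \<subseteq> \<Gamma> - V"
        using cd st segment_inD(2)[OF \<sigma>] by (force simp: T_def)
      then have seg: "segment_in (\<Gamma> - V) c d \<sigma>" using cd st by (intro segment_in_sub[OF \<sigma>]) auto
      obtain e k \<epsilon> where e: "e \<in> D" "\<epsilon> = 1 \<or> \<epsilon> = -1"
        "\<And>t. t \<in> {c..d} \<Longrightarrow> k + \<epsilon> * t \<in> {0<..<len e} \<and> \<sigma> t = param e (k + \<epsilon> * t)"
        using segment_affine_in_edge[OF m seg] by metis
      have g: "g t = f (start e) + of_real (k + \<epsilon> * t) * slope f e" if "t \<in> {c..d}" for t
        using e(3)[OF that] fa e(1) unfolding g_def edge_affine_def by auto
      have "g c - g d = of_real (\<epsilon> * (c - d)) * slope f e"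
        using g[of c] g[of d] cd(2) by (simp add: algebra_simps)
      then have "norm (g c - g d) = \<bar>\<epsilon> * (c - d)\<bar> * norm (slope f e)" by (simp add: norm_mult del: of_real_mult of_real_diff)
      also have "\<bar>\<epsilon> * (c - d)\<bar> = d - c" using e(2) cd(2) by auto
      also have "(d - c) * norm (slope f e) \<le> (d - c) * 1"
        using potential_slope_le_1[OF f real m fa _ _ e(1)] V cd(2) by (intro mult_left_mono) auto
      finally show "norm (g c - g d) \<le> d - c" by simp
    qed
    then show ?thesis by (simp add: g_def)
  qed
  show ?thesis unfolding segment_lipschitz_def
  proof (intro allI impI ballI)
    fix a b \<sigma> s t assume *: "segment_in \<Gamma> a b \<sigma>" "s \<in> {a..b}" "t \<in> {a..b}"
    show "norm (f (\<sigma> s) - f (\<sigma> t)) \<le> 1 * \<bar>s - t\<bar>"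
      using main[OF *(1), of s t] main[OF *(1), of t s] * by (cases "s \<le> t") (auto simp: norm_minus_commute)
  qed
qed

lemma segment_lipschitz_local:
  assumes f: "segment_lipschitz \<Gamma> C f" and sb: "star_ball \<Gamma> p \<rho>" and x: "x \<in> \<Gamma>" "dist p x \<le> \<rho>"
  shows "norm (f x - f p) \<le> C * dist p x"
proof -
  obtain v where v: "v \<in> Vec \<Gamma> p" "x = move \<Gamma> p v (dist p x)" using star_ball_move(6)[OF sb x] by blast
  have "norm (f (move \<Gamma> p v (dist p x)) - f (move \<Gamma> p v 0)) \<le> C * \<bar>dist p x - 0\<bar>"
    using star_ball_segment[OF sb v(1), of 0 \<rho>] star_ball_move(1)[OF sb] x(2)
    by (intro f[unfolded segment_lipschitz_def, rule_format, of 0 \<rho>]) auto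
  then show ?thesis using v star_ball_move(2)[OF sb v(1)] by simp
qed

lemma segment_lipschitz_continuous:
  assumes f: "segment_lipschitz \<Gamma> C f" and C: "0 \<le> C"
  shows "continuous_on \<Gamma> f"
  unfolding continuous_on_iff
proof (intro ballI allI impI)
  fix p and e :: real assume p: "p \<in> \<Gamma>" and e: "0 < e"
  obtain \<rho> where sb: "star_ball \<Gamma> p \<rho>" using star_ball_exists[OF p] by blast
  define d where "d = min \<rho> (e / (C + 1))"
  have d: "0 < d" using star_ball_move(1)[OF sb] e C by (simp add: d_def)
  have "dist (f x) (f p) < e" if x: "x \<in> \<Gamma>" "dist x p < d" for x
  proof -
    have "norm (f x - f p) \<le> C * dist p x"
      using x by (intro segment_lipschitz_local[OF f sb]) (auto simp: d_def dist_commute)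
    also have "\<dots> \<le> (C + 1) * dist p x" by (intro mult_right_mono) auto
    also have "\<dots> < (C + 1) * (e / (C + 1))"
      using x C by (intro mult_strict_left_mono) (auto simp: d_def dist_commute)
    also have "\<dots> = e" using C by simp
    finally show ?thesis by (simp add: dist_norm)
  qed
  then show "\<exists>d>0. \<forall>x\<in>\<Gamma>. dist x p < d \<longrightarrow> dist (f x) (f p) < e" using d by blast
qed

text \<open>A symmetric kernel whose sections are uniformly Lipschitz along segments is jointly continuous,
  hence bounded.\<close>

lemma lipschitz_kernel_bounded:
  fixes K :: "'a \<Rightarrow> 'a \<Rightarrow> real"
  assumes lip: "\<And>y. y \<in> \<Gamma> \<Longrightarrow> segment_lipschitz \<Gamma> C (\<lambda>x. K x y)" and C: "0 \<le> C"
    and sym: "\<And>x y. x \<in> \<Gamma> \<Longrightarrow> y \<in> \<Gamma> \<Longrightarrow> K x y = K y x"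
  shows "\<exists>B\<ge>0. \<forall>x\<in>\<Gamma>. \<forall>y\<in>\<Gamma>. \<bar>K x y\<bar> \<le> B"
proof -
  obtain P \<rho> where P: "finite P" "P \<subseteq> \<Gamma>" "\<forall>p\<in>P. star_ball \<Gamma> p (\<rho> p)" "\<forall>x\<in>\<Gamma>. \<exists>p\<in>P. dist p x < \<rho> p"
    using finite_star_cover by blast
  define B where "B = (\<Sum>p\<in>P. \<Sum>q\<in>P. \<bar>K p q\<bar> + C * \<rho> p + C * \<rho> q)"
  have \<rho>: "0 < \<rho> p" if "p \<in> P" for p using star_ball_move(1) P(3) that by blast
  have nn: "0 \<le> \<bar>K p q\<bar> + C * \<rho> p + C * \<rho> q" if "p \<in> P" "q \<in> P" for p q
    using \<rho>[OF that(1)] \<rho>[OF that(2)] C by (intro add_nonneg_nonneg mult_nonneg_nonneg) auto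
  have "\<bar>K x y\<bar> \<le> B" if x: "x \<in> \<Gamma>" and y: "y \<in> \<Gamma>" for x y
  proof -
    obtain p q where pq: "p \<in> P" "dist p x < \<rho> p" "q \<in> P" "dist q y < \<rho> q" using P(4) x y by blast
    have pq\<Gamma>: "p \<in> \<Gamma>" "q \<in> \<Gamma>" using pq P(2) by auto
    have 1: "\<bar>K x y - K p y\<bar> \<le> C * dist p x"
      using segment_lipschitz_local[OF lip[OF y], of p "\<rho> p" x] P(3) pq x by simp
    have 2: "\<bar>K y p - K q p\<bar> \<le> C * dist q y"
      using segment_lipschitz_local[OF lip[OF pq\<Gamma>(1)], of q "\<rho> q" y] P(3) pq y by simp
    have "C * dist p x \<le> C * \<rho> p" "C * dist q y \<le> C * \<rho> q" using pq C by (auto intro!: mult_left_mono)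
    then have "\<bar>K x y\<bar> \<le> \<bar>K p q\<bar> + C * \<rho> p + C * \<rho> q"
      using 1 2 sym[OF y pq\<Gamma>(1)] sym[OF pq\<Gamma>(2,1)] by linarith
    also have "\<dots> \<le> (\<Sum>q\<in>P. \<bar>K p q\<bar> + C * \<rho> p + C * \<rho> q)"
      using member_le_sum[of q P "\<lambda>q. \<bar>K p q\<bar> + C * \<rho> p + C * \<rho> q"] nn[OF pq(1)] P(1) pq(3) by auto
    also have "\<dots> \<le> B" unfolding B_def
      using member_le_sum[of p P "\<lambda>p. \<Sum>q\<in>P. \<bar>K p q\<bar> + C * \<rho> p + C * \<rho> q"] nn P(1) pq(1)
      by (auto intro!: sum_nonneg)
    finally show ?thesis .
  qed
  moreover have "0 \<le> B" unfolding B_def using nn by (intro sum_nonneg) auto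
  ultimately show ?thesis by blast
qed

definition open_segment_in :: "'a edge \<Rightarrow> bool" where
  "open_segment_in e \<longleftrightarrow> 0 < len e \<and> segment_in \<Gamma> 0 (len e) (param e) \<and>
      (\<forall>a b. 0 \<le> a \<longrightarrow> b \<le> len e \<longrightarrow> openin (top_of_set \<Gamma>) (param e ` {a<..<b}))"

lemma finite_segment_cover:
  "\<exists>S. finite S \<and> \<Gamma> = (\<Union>e\<in>S. closed_edge e) \<and> (\<forall>e\<in>S. open_segment_in e)"
proof -
  obtain P \<rho> where P: "finite P" "P \<subseteq> \<Gamma>" "\<forall>p\<in>P. star_ball \<Gamma> p (\<rho> p)" "\<forall>x\<in>\<Gamma>. \<exists>p\<in>P. dist p x < \<rho> p"
    using finite_star_cover by blast
  define S where "S = (\<Union>p\<in>P. (\<lambda>v. Edge (move \<Gamma> p v) (\<rho> p)) ` Vec \<Gamma> p)"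
  have S: "open_segment_in e" if e: "e \<in> S" for e
  proof -
    obtain p v where pv: "p \<in> P" "v \<in> Vec \<Gamma> p" "e = Edge (move \<Gamma> p v) (\<rho> p)" using e by (auto simp: S_def)
    have sb: "star_ball \<Gamma> p (\<rho> p)" using P(3) pv(1) by blast
    then show ?thesis
      using star_ball_move(1)[OF sb] star_ball_segment[OF sb pv(2), of 0 "\<rho> p"] ray_interval_open[OF sb pv(2)] pv(3)
      by (simp add: open_segment_in_def)
  qed
  have "x \<in> (\<Union>e\<in>S. closed_edge e)" if x: "x \<in> \<Gamma>" for x
  proof -
    obtain p where p: "p \<in> P" "dist p x < \<rho> p" using P(4) x by blast
    have sb: "star_ball \<Gamma> p (\<rho> p)" using P(3) p(1) by blast
    obtain v where v: "v \<in> Vec \<Gamma> p" "x = move \<Gamma> p v (dist p x)" using star_ball_move(6)[OF sb x] p by auto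
    then have "x \<in> closed_edge (Edge (move \<Gamma> p v) (\<rho> p))" using p unfolding closed_edge_def
      by (intro image_eqI[of _ _ "dist p x"]) auto
    then show ?thesis using p v by (auto simp: S_def)
  qed
  moreover have "closed_edge e \<subseteq> \<Gamma>" if "e \<in> S" for e using S[OF that] by (simp add: closed_edge_def segment_in_def open_segment_in_def)
  ultimately have "\<Gamma> = (\<Union>e\<in>S. closed_edge e)" by blast
  moreover have "finite S" unfolding S_def using P Vec_finite by (intro finite_UN_I finite_imageI) auto
  ultimately show ?thesis using S by blast
qed

text \<open>The theorem of Arzela and Ascoli is applied to one segment of a finite cover after the other.\<close>

lemma segment_lipschitz_compact:
  fixes f :: "nat \<Rightarrow> 'a \<Rightarrow> complex"
  assumes bd: "\<And>n x. x \<in> \<Gamma> \<Longrightarrow> norm (f n x) \<le> B" and lip: "\<And>n. segment_lipschitz \<Gamma> C (f n)" and C: "0 \<le> C"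
  shows "\<exists>r h. strict_mono r \<and> uniform_limit \<Gamma> (\<lambda>n. f (r n)) h sequentially"
proof -
  obtain S where S: "finite S" "\<Gamma> = (\<Union>e\<in>S. closed_edge e)"
    and op: "\<forall>e\<in>S. open_segment_in e"
    using finite_segment_cover by blast
  have seg: "\<And>e. e \<in> S \<Longrightarrow> segment_in \<Gamma> 0 (len e) (param e)" using op by (simp add: open_segment_in_def)
  have "\<exists>r. strict_mono (r :: nat \<Rightarrow> nat) \<and> uniformly_Cauchy_on (\<Union>e\<in>S'. closed_edge e) (\<lambda>n. f (r n))" if "S' \<subseteq> S" for S'
    using finite_subset[OF that S(1)] that
  proof (induction S' rule: finite_induct)
    case empty
    then show ?case by (intro exI[of _ id]) (simp add: strict_mono_def uniformly_Cauchy_on_def)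
  next
    case (insert e S')
    then obtain r where r: "strict_mono r" "uniformly_Cauchy_on (\<Union>e\<in>S'. closed_edge e) (\<lambda>n. f (r n))" by auto
    have sg: "segment_in \<Gamma> 0 (len e) (param e)" using seg insert.prems by blast
    define F where "F n t = f (r n) (param e t)" for n t
    have Fbd: "norm (F n t) \<le> B" if "t \<in> {0..len e}" for n t
      unfolding F_def using bd segment_inD(2)[OF sg] that by auto
    have Flip: "norm (F n s - F n t) \<le> C * \<bar>s - t\<bar>" if "s \<in> {0..len e}" "t \<in> {0..len e}" for n s t
      using lip[of "r n"] sg that unfolding segment_lipschitz_def F_def by blast
    have "\<exists>d>0. \<forall>n t. t \<in> {0..len e} \<and> norm (s - t) < d \<longrightarrow> norm (F n s - F n t) < \<epsilon>"
      if s: "s \<in> {0..len e}" and \<epsilon>: "0 < \<epsilon>" for s \<epsilon>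
    proof (intro exI[of _ "\<epsilon> / (C + 1)"] conjI allI impI)
      show "0 < \<epsilon> / (C + 1)" using \<epsilon> C by simp
      fix n t assume t: "t \<in> {0..len e} \<and> norm (s - t) < \<epsilon> / (C + 1)"
      have "norm (F n s - F n t) \<le> C * \<bar>s - t\<bar>" using Flip s t by blast
      also have "\<dots> \<le> (C + 1) * \<bar>s - t\<bar>" by (intro mult_right_mono) auto
      also have "\<dots> < (C + 1) * (\<epsilon> / (C + 1))" using t C by (intro mult_strict_left_mono) auto
      also have "\<dots> = \<epsilon>" using C by simp
      finally show "norm (F n s - F n t) < \<epsilon>" .
    qed
    then obtain g k where k: "strict_mono (k :: nat \<Rightarrow> nat)"
      "\<And>\<epsilon>. 0 < \<epsilon> \<Longrightarrow> \<exists>N. \<forall>n t. n \<ge> N \<and> t \<in> {0..len e} \<longrightarrow> norm (F (k n) t - g t) < \<epsilon>"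
      using Arzela_Ascoli[of "{0..len e}" F B] Fbd compact_Icc by metis
    have km: "n \<le> k n" for n using seq_suble[OF k(1)] .
    have "uniformly_Cauchy_on (\<Union>e\<in>insert e S'. closed_edge e) (\<lambda>n. f (r (k n)))"
      unfolding uniformly_Cauchy_on_def
    proof (intro allI impI)
      fix \<epsilon> :: real assume \<epsilon>: "0 < \<epsilon>"
      obtain N1 where N1: "\<forall>x\<in>(\<Union>e\<in>S'. closed_edge e). \<forall>m\<ge>N1. \<forall>n\<ge>N1. dist (f (r m) x) (f (r n) x) < \<epsilon>"
        using r(2) \<epsilon> unfolding uniformly_Cauchy_on_def by blast
      obtain N2 where N2: "\<forall>n t. n \<ge> N2 \<and> t \<in> {0..len e} \<longrightarrow> norm (F (k n) t - g t) < \<epsilon> / 2"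
        using k(2)[of "\<epsilon> / 2"] \<epsilon> by auto
      show "\<exists>N. \<forall>x\<in>(\<Union>e\<in>insert e S'. closed_edge e). \<forall>m\<ge>N. \<forall>n\<ge>N. dist (f (r (k m)) x) (f (r (k n)) x) < \<epsilon>"
      proof (intro exI[of _ "max N1 N2"] ballI allI impI)
        fix x m n assume x: "x \<in> (\<Union>e\<in>insert e S'. closed_edge e)" and mn: "max N1 N2 \<le> m" "max N1 N2 \<le> n"
        show "dist (f (r (k m)) x) (f (r (k n)) x) < \<epsilon>"
        proof (cases "x \<in> closed_edge e")
          case True
          then obtain t where t: "t \<in> {0..len e}" "x = param e t" unfolding closed_edge_def by blast
          have "norm (F (k m) t - g t) < \<epsilon> / 2" "norm (F (k n) t - g t) < \<epsilon> / 2" using N2 t mn by auto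
          then have "dist (F (k m) t) (F (k n) t) < \<epsilon>"
            using dist_triangle_half_l[of "F (k m) t" "g t" \<epsilon> "F (k n) t"] by (simp add: dist_norm)
          then show ?thesis using t by (simp add: F_def)
        next
          case False
          then have "x \<in> (\<Union>e\<in>S'. closed_edge e)" using x by auto
          moreover have "N1 \<le> k m" "N1 \<le> k n" using mn km[of m] km[of n] by auto
          ultimately show ?thesis using N1 by blast
        qed
      qed
    qed
    moreover have "strict_mono (\<lambda>n. r (k n))" using strict_mono_o[OF r(1) k(1)] by (simp add: o_def)
    ultimately show ?case by (intro exI[of _ "\<lambda>n. r (k n)"]) simp
  qed
  from this[OF order_refl] obtain r where r: "strict_mono r" "uniformly_Cauchy_on \<Gamma> (\<lambda>n. f (r n))"
    unfolding S(2)[symmetric] by blast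
  then have "uniformly_convergent_on \<Gamma> (\<lambda>n. f (r n))" by (intro Cauchy_uniformly_convergent)
  then show ?thesis using r(1) unfolding uniformly_convergent_on_def by blast
qed

end

section \<open>Arc length\<close>

lemma affine_image_emeasure:
  fixes c \<epsilon> :: real
  assumes "\<epsilon> = 1 \<or> \<epsilon> = -1" and K: "K \<in> sets borel" and K': "(\<lambda>t. c + \<epsilon> * t) ` K \<in> sets borel"
  shows "emeasure lborel ((\<lambda>t. c + \<epsilon> * t) ` K) = emeasure lborel K"
proof -
  have "(\<lambda>t. c + \<epsilon> * t) ` K = (\<lambda>x. \<epsilon> *\<^sub>R x + c) ` K" by (simp add: add.commute)
  then have "emeasure lebesgue ((\<lambda>t. c + \<epsilon> * t) ` K) = emeasure lebesgue K"
    using emeasure_lebesgue_affine[of \<epsilon> c K] assms(1) by auto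
  then show ?thesis using K K' by simp
qed

context metric_graph
begin

lemma space_borel_on [simp]: "space (borel_on \<Gamma>) = \<Gamma>"
  by (simp add: borel_on_def space_restrict_space)

lemma sets_borel_on: "A \<in> sets (borel_on \<Gamma>) \<longleftrightarrow> A \<subseteq> \<Gamma> \<and> A \<in> sets borel"
  unfolding borel_on_def using closed_graph by (simp add: sets_restrict_space_iff borel_closed)

lemma openin_borel_on: "openin (top_of_set \<Gamma>) A \<Longrightarrow> A \<in> sets (borel_on \<Gamma>)"
  using closed_graph by (auto simp: sets_borel_on openin_open borel_closed borel_open)

lemma closed_borel_on: "closed A \<Longrightarrow> A \<subseteq> \<Gamma> \<Longrightarrow> A \<in> sets (borel_on \<Gamma>)"
  by (simp add: sets_borel_on borel_closed)

lemma continuous_measurable: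
  fixes f :: "'a \<Rightarrow> 'b::topological_space"
  shows "continuous_on \<Gamma> f \<Longrightarrow> f \<in> borel_measurable (borel_on \<Gamma>)"
  unfolding borel_on_def by (rule borel_measurable_continuous_on_restrict)

lemma segment_preimage_borel:
  assumes \<gamma>: "segment_in \<Gamma> a b \<gamma>" and A: "A \<in> sets (borel_on \<Gamma>)"
  shows "{t\<in>{a..b}. \<gamma> t \<in> A} \<in> sets borel"
proof -
  have "\<gamma> \<in> borel_measurable (restrict_space borel {a..b})"
    by (rule borel_measurable_continuous_on_restrict[OF segment_continuous[OF \<gamma>]])
  moreover have "A \<in> sets borel" using A by (simp add: sets_borel_on)
  ultimately have "\<gamma> -` A \<inter> space (restrict_space borel {a..b}) \<in> sets (restrict_space borel {a..b})"
    by (rule measurable_sets)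
  moreover have "\<gamma> -` A \<inter> space (restrict_space borel {a..b}) = {t\<in>{a..b}. \<gamma> t \<in> A}"
    by (auto simp: space_restrict_space)
  ultimately show ?thesis by (simp add: sets_restrict_space_iff)
qed

text \<open>A finite measure is determined by its values on points and on open pieces of finitely many
  segments that cover the graph. On a single segment the distance from its start is a coordinate, so
  this reduces to the fact that a measure on the line is determined by its values on rays.\<close>

lemma measure_determined_by_segments:
  assumes N: "sets N1 = sets (borel_on \<Gamma>)" "sets N2 = sets (borel_on \<Gamma>)" "finite_measure N1" "finite_measure N2"
    and pt: "\<And>x. x \<in> \<Gamma> \<Longrightarrow> emeasure N1 {x} = emeasure N2 {x}"
    and cover: "finite S" "\<Gamma> = (\<Union>e\<in>S. closed_edge e)" "\<forall>e\<in>S. open_segment_in e"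
    and seg: "\<And>e a b. e \<in> S \<Longrightarrow> 0 \<le> a \<Longrightarrow> a < b \<Longrightarrow> b \<le> len e \<Longrightarrow>
      emeasure N1 (param e ` {a<..<b}) = emeasure N2 (param e ` {a<..<b})"
  shows "N1 = N2"
proof -
  have piece: "open_segment_in e" if "e \<in> S" for e using cover(3) that by blast
  have "\<And>e. e \<in> S \<Longrightarrow> 0 < len e" "\<And>e. e \<in> S \<Longrightarrow> segment_in \<Gamma> 0 (len e) (param e)"
    "\<And>e a b. e \<in> S \<Longrightarrow> 0 \<le> a \<Longrightarrow> b \<le> len e \<Longrightarrow> openin (top_of_set \<Gamma>) (param e ` {a<..<b})"
    using piece unfolding open_segment_in_def by blast+
  note S = cover(1,2) this
  interpret N1: finite_measure N1 by fact
  interpret N2: finite_measure N2 by fact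
  have pts: "{x} \<in> sets (borel_on \<Gamma>)" if "x \<in> \<Gamma>" for x using that by (intro closed_borel_on) auto
  have ins: "emeasure N ({s} \<union> X) = emeasure N {s} + emeasure N X"
    if "s \<in> \<Gamma>" "s \<notin> X" "X \<in> sets (borel_on \<Gamma>)" "sets N = sets (borel_on \<Gamma>)" for N s X
    using that pts by (intro plus_emeasure[symmetric]) auto
  have single: "emeasure N1 A = emeasure N2 A" if e: "e \<in> S" and A: "A \<in> sets (borel_on \<Gamma>)" "A \<subseteq> closed_edge e" for e A
  proof -
    define E where "E = closed_edge e"
    define \<kappa> where "\<kappa> = dist (start e)"
    note sg = S(4)[OF e] and L = S(3)[OF e]
    have E\<Gamma>: "E \<subseteq> \<Gamma>" using sg by (simp add: E_def closed_edge_def segment_in_def)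
    have E: "E \<in> sets (borel_on \<Gamma>)" unfolding E_def
      using closed_closed_edge[OF sg] E\<Gamma> by (intro closed_borel_on) (auto simp: E_def)
    have \<kappa>e: "\<kappa> (param e t) = t" if "0 \<le> t" "t \<le> len e" for t
      using segment_inD(3)[OF sg, of 0 t] that by (simp add: \<kappa>_def start_def)
    have \<kappa>m: "\<kappa> \<in> borel_measurable (borel_on \<Gamma>)" unfolding \<kappa>_def
      by (intro continuous_measurable continuous_intros)
    define R where "R N = distr (restrict_space N E) borel \<kappa>" for N
    have R: "emeasure (R N) B = emeasure N (\<kappa> -` B \<inter> E)" if B: "B \<in> sets borel" and sN: "sets N = sets (borel_on \<Gamma>)" for N B
    proof -
      have sp: "space N = \<Gamma>" using sets_eq_imp_space_eq[OF sN] by simp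
      have "\<kappa> \<in> measurable (restrict_space N E) borel"
      proof (rule measurable_restrict_space1)
        show "\<kappa> \<in> borel_measurable N" unfolding measurable_cong_sets[OF sN refl] by (rule \<kappa>m)
      qed
      then have "emeasure (R N) B = emeasure (restrict_space N E) (\<kappa> -` B \<inter> space (restrict_space N E))"
        unfolding R_def using B by (rule emeasure_distr)
      also have "\<dots> = emeasure N (\<kappa> -` B \<inter> E)"
        using E sN sp E\<Gamma> by (subst emeasure_restrict_space) (auto simp: space_restrict_space Int_absorb2 intro!: arg_cong[where f = "emeasure N"])
      finally show ?thesis .
    qed
    have ray: "emeasure N1 (\<kappa> -` {x<..} \<inter> E) = emeasure N2 (\<kappa> -` {x<..} \<inter> E)" for x
    proof -
      have eq: "\<kappa> -` {x<..} \<inter> E = param e ` ({0..len e} \<inter> {x<..})"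
        using \<kappa>e unfolding E_def closed_edge_def by auto
      have ends: "start e \<in> \<Gamma>" "target e \<in> \<Gamma>"
        using segment_inD(2)[OF sg] L by (auto simp: start_def target_def)
      have inj: "inj_on (param e) {0..len e}" by (rule segment_inj[OF sg])
      have out: "param e s \<notin> param e ` {z<..<len e}" if s: "s \<in> {0..len e}" "s \<notin> {z<..<len e}" and z: "0 \<le> z" for s z
      proof
        assume "param e s \<in> param e ` {z<..<len e}"
        then obtain t where t: "t \<in> {z<..<len e}" "param e s = param e t" by blast
        then have "s = t" using inj_onD[OF inj t(2) s(1)] z by auto
        then show False using t(1) s(2) by simp
      qed
      have ne: "param e 0 \<noteq> param e (len e)" using inj_onD[OF inj, of 0 "len e"] L by auto
      consider "x < 0" | "0 \<le> x" "x < len e" | "len e \<le> x" by linarith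
      then show ?thesis
      proof cases
        case 1
        have "{0..len e} \<inter> {x<..} = insert 0 (insert (len e) {0<..<len e})" using 1 L by auto
        then have im: "\<kappa> -` {x<..} \<inter> E = {start e} \<union> ({target e} \<union> param e ` {0<..<len e})"
          unfolding eq by (auto simp: start_def target_def)
        have d: "start e \<notin> {target e} \<union> param e ` {0<..<len e}" "target e \<notin> param e ` {0<..<len e}"
          unfolding start_def target_def using out[of 0 0] out[of "len e" 0] ne L by auto
        have o: "param e ` {0<..<len e} \<in> sets (borel_on \<Gamma>)" using S(5)[OF e, of 0 "len e"] by (intro openin_borel_on) auto
        have "emeasure N (\<kappa> -` {x<..} \<inter> E) = emeasure N {start e} + (emeasure N {target e} + emeasure N (param e ` {0<..<len e}))"
          if sN: "sets N = sets (borel_on \<Gamma>)" for N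
        proof -
          have "{target e} \<union> param e ` {0<..<len e} \<in> sets (borel_on \<Gamma>)"
            by (rule sets.Un[OF pts[OF ends(2)] o])
          then show ?thesis unfolding im
            by (simp only: ins[OF ends(1) d(1) _ sN] ins[OF ends(2) d(2) o sN])
        qed
        then show ?thesis using N pt ends seg[OF e, of 0 "len e"] L by simp
      next
        case 2
        have "{0..len e} \<inter> {x<..} = insert (len e) {x<..<len e}" using 2 by auto
        then have im: "\<kappa> -` {x<..} \<inter> E = {target e} \<union> param e ` {x<..<len e}"
          unfolding eq by (simp add: target_def)
        have d: "target e \<notin> param e ` {x<..<len e}"
          unfolding target_def using out[of "len e" x] L 2 by auto
        have o: "param e ` {x<..<len e} \<in> sets (borel_on \<Gamma>)" using S(5)[OF e, of x "len e"] 2 by (intro openin_borel_on) auto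
        have "emeasure N (\<kappa> -` {x<..} \<inter> E) = emeasure N {target e} + emeasure N (param e ` {x<..<len e})"
          if sN: "sets N = sets (borel_on \<Gamma>)" for N
          unfolding im by (rule ins[OF ends(2) d o sN])
        then show ?thesis using N pt ends seg[OF e, of x "len e"] 2 by simp
      next
        case 3
        then have "{0..len e} \<inter> {x<..} = {}" by auto
        then show ?thesis unfolding eq by simp
      qed
    qed
    have "R N1 = R N2"
    proof (rule measure_eqI_lessThan)
      show "sets (R N1) = sets borel" "sets (R N2) = sets borel" by (simp_all add: R_def)
      show "emeasure (R N1) {x<..} < \<infinity>" for x
      proof -
        have "emeasure (R N1) {x<..} = emeasure N1 (\<kappa> -` {x<..} \<inter> E)" by (rule R[OF _ N(1)]) simp
        then show ?thesis by (simp add: less_top[symmetric])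
      qed
      show "emeasure (R N1) {x<..} = emeasure (R N2) {x<..}" for x using R[OF _ N(1)] R[OF _ N(2)] ray by simp
    qed
    define B where "B = {t\<in>{0..len e}. param e t \<in> A}"
    have B: "B \<in> sets borel" unfolding B_def by (rule segment_preimage_borel[OF sg A(1)])
    have "A = \<kappa> -` B \<inter> E"
    proof (intro set_eqI iffI)
      fix x assume x: "x \<in> A"
      then obtain t where "t \<in> {0..len e}" "x = param e t" using A(2) unfolding closed_edge_def by blast
      then show "x \<in> \<kappa> -` B \<inter> E" using x A(2) \<kappa>e by (auto simp: B_def E_def)
    next
      fix x assume x: "x \<in> \<kappa> -` B \<inter> E"
      then have "x \<in> param e ` {0..len e}" by (simp add: E_def closed_edge_def)
      then obtain t where "t \<in> {0..len e}" "x = param e t" by blast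
      then show "x \<in> A" using x \<kappa>e by (auto simp: B_def)
    qed
    then show ?thesis using R[OF B N(1)] R[OF B N(2)] \<open>R N1 = R N2\<close> by simp
  qed
  have "emeasure N1 A = emeasure N2 A" if "S' \<subseteq> S" "A \<in> sets (borel_on \<Gamma>)" "A \<subseteq> (\<Union>e\<in>S'. closed_edge e)" for S' A
    using finite_subset[OF that(1) S(1)] that
  proof (induction S' arbitrary: A rule: finite_induct)
    case (insert e S')
    have E: "closed_edge e \<in> sets (borel_on \<Gamma>)" using insert.prems(1) S(2) closed_closed_edge[OF S(4)]
      by (intro closed_borel_on) auto
    have A12: "A \<inter> closed_edge e \<in> sets (borel_on \<Gamma>)" "A - closed_edge e \<in> sets (borel_on \<Gamma>)"
      using insert.prems(2) E by auto
    have "emeasure N A = emeasure N (A \<inter> closed_edge e) + emeasure N (A - closed_edge e)" if "sets N = sets (borel_on \<Gamma>)" for N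
      using A12 that by (subst plus_emeasure) (auto simp: Int_Diff_Un)
    moreover have "emeasure N1 (A \<inter> closed_edge e) = emeasure N2 (A \<inter> closed_edge e)"
      using insert.prems(1) A12 by (intro single) auto
    moreover have "emeasure N1 (A - closed_edge e) = emeasure N2 (A - closed_edge e)"
      using insert.prems A12 by (intro insert.IH) auto
    ultimately show ?case using N by simp
  qed simp
  note agree = this[OF order_refl, folded S(2)]
  show ?thesis
  proof (rule measure_eqI)
    show "sets N1 = sets N2" using N(1,2) by simp
    fix A assume "A \<in> sets N1"
    then have "A \<in> sets (borel_on \<Gamma>)" using N(1) by simp
    then show "emeasure N1 A = emeasure N2 A" using sets_borel_on by (intro agree) auto
  qed
qed

definition is_arc_length :: "'a measure \<Rightarrow> bool" where
  "is_arc_length M \<longleftrightarrow> sets M = sets (borel_on \<Gamma>) \<and>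
     (\<forall>a b \<gamma>. segment_in \<Gamma> a b \<gamma> \<longrightarrow> emeasure M (\<gamma> ` {a..b}) = ennreal (b - a))"

text \<open>The measure of a Borel set is the sum of the Lebesgue measures of its coordinate images on the
  segments of a cover, each segment without its predecessors. Two isometric parametrizations differ
  by an isometry between subsets of the line, which preserves Lebesgue measure.\<close>

lemma arc_length_exists: "\<exists>M. is_arc_length M"
proof -
  obtain S where S: "finite S" "\<Gamma> = (\<Union>e\<in>S. closed_edge e)"
    and op: "\<forall>e\<in>S. open_segment_in e"
    using finite_segment_cover by blast
  have Sseg: "\<And>e. e \<in> S \<Longrightarrow> segment_in \<Gamma> 0 (len e) (param e)" using op by (simp add: open_segment_in_def)
  obtain es n where es: "S = es ` {i. i < (n::nat)}" using finite_imp_nat_seg_image_inj_on[OF S(1)] by metis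
  have sg: "segment_in \<Gamma> 0 (len (es i)) (param (es i))" if "i < n" for i using Sseg es that by blast
  define w where "w i = closed_edge (es i) - (\<Union>j<i. closed_edge (es j))" for i
  have w: "w i \<in> sets (borel_on \<Gamma>)" if "i < n" for i
  proof -
    have "closed_edge (es j) \<in> sets (borel_on \<Gamma>)" if "j < n" for j
      using sg[OF that] closed_closed_edge[OF sg[OF that]] by (intro closed_borel_on) (auto simp: closed_edge_def segment_in_def)
    then show ?thesis unfolding w_def using that by (intro sets.Diff sets.finite_UN) auto
  qed
  have wd: "w i \<inter> w j = {}" if "i \<noteq> j" for i j
    using that by (cases i j rule: linorder_cases) (auto simp: w_def)
  have wcov: "\<Gamma> = (\<Union>i<n. w i)"
  proof -
    have "x \<in> (\<Union>i<n. w i)" if "x \<in> \<Gamma>" for x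
    proof -
      have "\<exists>i. i < n \<and> x \<in> closed_edge (es i)" using that S(2) es by auto
      then have "\<exists>i. (i < n \<and> x \<in> closed_edge (es i)) \<and> (\<forall>j<i. \<not> (j < n \<and> x \<in> closed_edge (es j)))"
        by (rule exists_least_iff[THEN iffD1])
      then obtain i where "i < n" "x \<in> closed_edge (es i)" "\<forall>j<i. \<not> (j < n \<and> x \<in> closed_edge (es j))" by blast
      then have "x \<in> w i" by (auto simp: w_def)
      then show ?thesis using \<open>i < n\<close> by blast
    qed
    moreover have "w i \<subseteq> \<Gamma>" if "i < n" for i using w[OF that] by (simp add: sets_borel_on)
    ultimately show ?thesis by blast
  qed
  define pre where "pre i A = {t\<in>{0..len (es i)}. param (es i) t \<in> A \<inter> w i}" for i A
  have pre: "pre i A \<in> sets borel" if "i < n" "A \<in> sets (borel_on \<Gamma>)" for i A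
    unfolding pre_def using w[OF that(1)] that(2) by (intro segment_preimage_borel[OF sg[OF that(1)]]) auto
  define \<nu> where "\<nu> A = (\<Sum>i<n. emeasure lborel (pre i A))" for A
  define M where "M = measure_of \<Gamma> (sets (borel_on \<Gamma>)) \<nu>"
  have sM: "sets M = sets (borel_on \<Gamma>)" unfolding M_def
    using sets.sigma_sets_eq[of "borel_on \<Gamma>"] sets.space_closed[of "borel_on \<Gamma>"] by (simp add: sets_measure_of)
  have em: "emeasure M A = \<nu> A" if A: "A \<in> sets (borel_on \<Gamma>)" for A
    unfolding M_def
  proof (rule emeasure_measure_of_sigma[OF _ _ _ A])
    show "sigma_algebra \<Gamma> (sets (borel_on \<Gamma>))" using sets.sigma_algebra_axioms[of "borel_on \<Gamma>"] by simp
    show "positive (sets (borel_on \<Gamma>)) \<nu>" by (simp add: positive_def \<nu>_def pre_def)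
    show "countably_additive (sets (borel_on \<Gamma>)) \<nu>"
    proof (rule countably_additiveI)
      fix B :: "nat \<Rightarrow> 'a set" assume B: "range B \<subseteq> sets (borel_on \<Gamma>)" "disjoint_family B"
      have "(\<Sum>k. \<nu> (B k)) = (\<Sum>i<n. \<Sum>k. emeasure lborel (pre i (B k)))"
        unfolding \<nu>_def by (rule suminf_sum) (rule summableI)
      also have "\<dots> = (\<Sum>i<n. emeasure lborel (pre i (\<Union>k. B k)))"
      proof (rule sum.cong[OF refl])
        fix i assume "i \<in> {..<n}"
        then have "range (\<lambda>k. pre i (B k)) \<subseteq> sets lborel" using pre B(1) by auto
        moreover have "disjoint_family (\<lambda>k. pre i (B k))" using B(2) by (auto simp: disjoint_family_on_def pre_def)
        ultimately have "(\<Sum>k. emeasure lborel (pre i (B k))) = emeasure lborel (\<Union>k. pre i (B k))"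
          by (rule suminf_emeasure)
        also have "(\<Union>k. pre i (B k)) = pre i (\<Union>k. B k)" by (auto simp: pre_def)
        finally show "(\<Sum>k. emeasure lborel (pre i (B k))) = emeasure lborel (pre i (\<Union>k. B k))" .
      qed
      finally show "(\<Sum>k. \<nu> (B k)) = \<nu> (\<Union>k. B k)" by (simp add: \<nu>_def)
    qed
  qed
  have "emeasure M (\<gamma> ` {a..b}) = ennreal (b - a)" if \<gamma>: "segment_in \<Gamma> a b \<gamma>" for a b \<gamma>
  proof -
    have im: "\<gamma> ` {a..b} \<in> sets (borel_on \<Gamma>)"
      using \<gamma> compact_imp_closed[OF segment_compact[OF \<gamma>]] by (intro closed_borel_on) (auto simp: segment_in_def)
    have ab: "a \<le> b" using \<gamma> by (simp add: segment_in_def)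
    define Q where "Q i = {t\<in>{a..b}. \<gamma> t \<in> w i}" for i
    have Q: "Q i \<in> sets borel" if "i < n" for i unfolding Q_def by (rule segment_preimage_borel[OF \<gamma> w[OF that]])
    have "emeasure lborel (pre i (\<gamma> ` {a..b})) = emeasure lborel (Q i)" if i: "i < n" for i
    proof -
      define K where "K = pre i (\<gamma> ` {a..b})"
      have K: "K \<in> sets borel" unfolding K_def by (rule pre[OF i im])
      have "\<exists>s\<in>{a..b}. \<gamma> s = param (es i) t" if "t \<in> K" for t
      proof -
        have "param (es i) t \<in> \<gamma> ` {a..b}" using that by (simp add: K_def pre_def)
        then show ?thesis by (metis imageE)
      qed
      then obtain \<phi> where \<phi>: "\<And>t. t \<in> K \<Longrightarrow> \<phi> t \<in> {a..b} \<and> \<gamma> (\<phi> t) = param (es i) t" by metis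
      have "\<bar>\<phi> s - \<phi> t\<bar> = \<bar>s - t\<bar>" if st: "s \<in> K" "t \<in> K" for s t
      proof -
        have "\<bar>\<phi> s - \<phi> t\<bar> = dist (\<gamma> (\<phi> s)) (\<gamma> (\<phi> t))" using segment_inD(3)[OF \<gamma>, of "\<phi> s" "\<phi> t"] \<phi>[OF st(1)] \<phi>[OF st(2)] by simp
        also have "\<dots> = dist (param (es i) s) (param (es i) t)" using \<phi> st by simp
        also have "\<dots> = \<bar>s - t\<bar>" using segment_inD(3)[OF sg[OF i], of s t] st by (simp add: K_def pre_def)
        finally show ?thesis .
      qed
      then obtain c \<epsilon> where c: "\<epsilon> = 1 \<or> \<epsilon> = -1" "\<And>t. t \<in> K \<Longrightarrow> \<phi> t = c + \<epsilon> * t"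
        using real_isometry_affine[of K \<phi>] by metis
      have "Q i = (\<lambda>t. c + \<epsilon> * t) ` K"
      proof (intro set_eqI iffI)
        fix s assume s: "s \<in> Q i"
        then have "\<gamma> s \<in> w i" "s \<in> {a..b}" by (auto simp: Q_def)
        then have "\<gamma> s \<in> param (es i) ` {0..len (es i)}" by (auto simp: w_def closed_edge_def)
        then obtain t where t: "t \<in> {0..len (es i)}" "\<gamma> s = param (es i) t" by blast
        have "param (es i) t \<in> \<gamma> ` {a..b}" using t(2) \<open>s \<in> {a..b}\<close> by (metis imageI)
        then have tK: "t \<in> K" using t \<open>\<gamma> s \<in> w i\<close> by (simp add: K_def pre_def)
        have "\<phi> t = s" using \<phi>[OF tK] t(2) inj_onD[OF segment_inj[OF \<gamma>], of "\<phi> t" s] \<open>s \<in> {a..b}\<close> by simp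
        then show "s \<in> (\<lambda>t. c + \<epsilon> * t) ` K" using c(2)[OF tK] tK by (intro image_eqI[of _ _ t]) auto
      next
        fix s assume "s \<in> (\<lambda>t. c + \<epsilon> * t) ` K"
        then obtain t where tK: "t \<in> K" "s = \<phi> t" using c(2) by auto
        then show "s \<in> Q i" using \<phi>[OF tK(1)] by (simp add: Q_def K_def pre_def)
      qed
      then show ?thesis using affine_image_emeasure[OF c(1) K, of c] Q[OF i] by (simp add: K_def)
    qed
    then have "emeasure M (\<gamma> ` {a..b}) = (\<Sum>i<n. emeasure lborel (Q i))" using em[OF im] by (simp add: \<nu>_def)
    also have "\<dots> = emeasure lborel (\<Union>i<n. Q i)"
      using Q wd by (intro sum_emeasure) (auto simp: disjoint_family_on_def Q_def)
    also have "(\<Union>i<n. Q i) = {a..b}" using wcov segment_inD(2)[OF \<gamma>] by (auto simp: Q_def)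
    finally show ?thesis using ab by simp
  qed
  then show ?thesis unfolding is_arc_length_def using sM by blast
qed

lemma is_arc_length_finite:
  assumes M: "is_arc_length M"
  shows "finite_measure M"
proof -
  obtain S where S: "finite S" "\<Gamma> = (\<Union>e\<in>S. closed_edge e)"
    and op: "\<forall>e\<in>S. open_segment_in e"
    using finite_segment_cover by blast
  have seg: "\<And>e. e \<in> S \<Longrightarrow> segment_in \<Gamma> 0 (len e) (param e)" using op by (simp add: open_segment_in_def)
  have sM: "sets M = sets (borel_on \<Gamma>)" using M by (simp add: is_arc_length_def)
  have cs: "closed_edge e \<in> sets M" if "e \<in> S" for e
    unfolding sM using seg[OF that] closed_closed_edge[OF seg[OF that]] S(2) that by (intro closed_borel_on) auto
  have "emeasure M \<Gamma> \<le> (\<Sum>e\<in>S. emeasure M (closed_edge e))"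
    unfolding S(2) using cs S(1) by (intro emeasure_subadditive_finite) auto
  also have "\<dots> = (\<Sum>e\<in>S. ennreal (len e - 0))"
    using M seg by (intro sum.cong refl) (auto simp: is_arc_length_def closed_edge_def)
  also have "\<dots> = ennreal (\<Sum>e\<in>S. len e - 0)"
    using op by (intro sum_ennreal) (auto simp: open_segment_in_def less_imp_le)
  finally have "emeasure M \<Gamma> \<noteq> \<infinity>" by (auto simp: top_unique)
  then show ?thesis using sets_eq_imp_space_eq[OF sM] by (intro finite_measureI) simp
qed

lemma is_arc_length_open_piece:
  assumes M: "is_arc_length M" and \<gamma>: "segment_in \<Gamma> a b \<gamma>" and ab: "a < b"
    and o: "\<gamma> ` {a<..<b} \<in> sets M"
  shows "emeasure M (\<gamma> ` {a<..<b}) = ennreal (b - a)" "emeasure M {\<gamma> a} = 0"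
proof -
  have pt: "emeasure M {\<gamma> t} = 0" if "t \<in> {a..b}" for t
  proof -
    have "segment_in \<Gamma> t t \<gamma>" using segment_inD(2)[OF \<gamma>] that by (auto simp: segment_in_def)
    then have "emeasure M (\<gamma> ` {t..t}) = ennreal (t - t)" using M unfolding is_arc_length_def by blast
    then show ?thesis by simp
  qed
  show "emeasure M {\<gamma> a} = 0" using pt ab by simp
  have sM: "sets M = sets (borel_on \<Gamma>)" using M by (simp add: is_arc_length_def)
  have ends: "{\<gamma> a, \<gamma> b} \<in> sets M" unfolding sM using segment_inD(2)[OF \<gamma>] ab by (intro closed_borel_on) auto
  have "emeasure M {\<gamma> a, \<gamma> b} \<le> emeasure M {\<gamma> a} + emeasure M {\<gamma> b}"
  proof -
    have "{\<gamma> a} \<in> sets M" "{\<gamma> b} \<in> sets M"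
      unfolding sM using segment_inD(2)[OF \<gamma>] ab by (auto intro!: closed_borel_on)
    then have "emeasure M ({\<gamma> a} \<union> {\<gamma> b}) \<le> emeasure M {\<gamma> a} + emeasure M {\<gamma> b}"
      by (rule emeasure_subadditive)
    then show ?thesis by (simp add: insert_commute)
  qed
  then have e0: "emeasure M {\<gamma> a, \<gamma> b} = 0" using pt ab by simp
  have "\<gamma> ` {a..b} = \<gamma> ` {a<..<b} \<union> {\<gamma> a, \<gamma> b}"
  proof -
    have "{a..b} = {a<..<b} \<union> {a, b}" using ab by auto
    then show ?thesis by (simp add: image_Un)
  qed
  moreover have "emeasure M (\<gamma> ` {a<..<b} \<union> {\<gamma> a, \<gamma> b}) = emeasure M (\<gamma> ` {a<..<b})"
    using e0 ends o by (intro emeasure_Un_null_set) (auto simp: null_sets_def)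
  ultimately show "emeasure M (\<gamma> ` {a<..<b}) = ennreal (b - a)"
    using M \<gamma> unfolding is_arc_length_def by metis
qed

lemma arc_length_unique:
  assumes M: "is_arc_length M" and N: "is_arc_length N"
  shows "M = N"
proof -
  obtain S where S: "finite S" "\<Gamma> = (\<Union>e\<in>S. closed_edge e)" "\<forall>e\<in>S. open_segment_in e"
    using finite_segment_cover by blast
  have pt: "emeasure M {x} = 0" if M: "is_arc_length M" and x: "x \<in> \<Gamma>" for M x
  proof -
    have "segment_in \<Gamma> 0 0 (\<lambda>_. x)" using x by (simp add: segment_in_def)
    then have "emeasure M ((\<lambda>_. x) ` {0..0::real}) = ennreal (0 - 0)" using M unfolding is_arc_length_def by blast
    then show ?thesis by simp
  qed
  show ?thesis
  proof (rule measure_determined_by_segments[OF _ _ _ _ _ S])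
    fix e a b assume e: "e \<in> S" "0 \<le> a" "a < b" "b \<le> len e"
    have sg: "segment_in \<Gamma> 0 (len e) (param e)" using S(3) e(1) by (simp add: open_segment_in_def)
    have seg: "segment_in \<Gamma> a b (param e)" using e by (intro segment_in_sub[OF sg]) (use sg in \<open>auto simp: segment_in_def\<close>)
    have "openin (top_of_set \<Gamma>) (param e ` {a<..<b})" using S(3) e by (simp add: open_segment_in_def)
    then have "param e ` {a<..<b} \<in> sets (borel_on \<Gamma>)" by (rule openin_borel_on)
    then show "emeasure M (param e ` {a<..<b}) = emeasure N (param e ` {a<..<b})"
      using is_arc_length_open_piece(1)[OF M seg e(3)] is_arc_length_open_piece(1)[OF N seg e(3)] M N
      by (simp add: is_arc_length_def)
  qed (use M N pt is_arc_length_finite in \<open>auto simp: is_arc_length_def\<close>)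
qed

lemma arc_length: "is_arc_length (arc_length \<Gamma>)"
proof -
  have "\<exists>!M. is_arc_length M" using arc_length_exists arc_length_unique by blast
  then have "is_arc_length (THE M. is_arc_length M)" by (rule theI')
  then show ?thesis unfolding arc_length_def is_arc_length_def .
qed

lemma sets_arc_length [measurable_cong]: "sets (arc_length \<Gamma>) = sets (borel_on \<Gamma>)"
  using arc_length by (simp add: is_arc_length_def)

lemma space_arc_length [simp]: "space (arc_length \<Gamma>) = \<Gamma>"
  using sets_eq_imp_space_eq[OF sets_arc_length] by simp

lemma arc_length_segment: "segment_in \<Gamma> a b \<gamma> \<Longrightarrow> emeasure (arc_length \<Gamma>) (\<gamma> ` {a..b}) = ennreal (b - a)"
  using arc_length by (simp add: is_arc_length_def)

sublocale arc: finite_measure "arc_length \<Gamma>"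
  by (rule is_arc_length_finite[OF arc_length])

lemma arc_length_point: "x \<in> \<Gamma> \<Longrightarrow> emeasure (arc_length \<Gamma>) {x} = 0"
  using arc_length_segment[of 0 0 "\<lambda>_. x"] by (simp add: segment_in_def)

lemma arc_length_open_positive:
  assumes U: "openin (top_of_set \<Gamma>) U" "U \<noteq> {}"
  shows "emeasure (arc_length \<Gamma>) U \<noteq> 0"
proof -
  obtain p where p: "p \<in> U" using U(2) by blast
  then have p\<Gamma>: "p \<in> \<Gamma>" using openin_imp_subset[OF U(1)] by blast
  obtain \<rho> where sb: "star_ball \<Gamma> p \<rho>" using star_ball_exists[OF p\<Gamma>] by blast
  obtain \<delta> where \<delta>: "\<delta> > 0" "\<And>x. x \<in> \<Gamma> \<Longrightarrow> dist x p < \<delta> \<Longrightarrow> x \<in> U"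
    using U(1) p unfolding openin_euclidean_subtopology_iff by blast
  obtain v where v: "v \<in> Vec \<Gamma> p" using Vec_nonempty[OF p\<Gamma>] by blast
  define r where "r = min \<rho> (\<delta> / 2)"
  have r: "0 < r" "r \<le> \<rho>" "r < \<delta>" using star_ball_move(1)[OF sb] \<delta>(1) by (auto simp: r_def)
  have seg: "segment_in \<Gamma> 0 r (move \<Gamma> p v)" using star_ball_segment[OF sb v, of 0 r] r by simp
  have "move \<Gamma> p v ` {0..r} \<subseteq> U"
    using \<delta>(2) star_ball_dist[OF sb v] star_ball_move(3)[OF sb v] r by (auto simp: dist_commute)
  then have "emeasure (arc_length \<Gamma>) (move \<Gamma> p v ` {0..r}) \<le> emeasure (arc_length \<Gamma>) U"
    using openin_borel_on[OF U(1)] by (intro emeasure_mono) (simp_all add: sets_arc_length)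
  moreover have "emeasure (arc_length \<Gamma>) (move \<Gamma> p v ` {0..r}) = ennreal r" using arc_length_segment[OF seg] by simp
  ultimately show ?thesis using r(1) by auto
qed

end

section \<open>The Jordan decomposition of a signed measure\<close>

locale finite_signed_measure =
  fixes M :: "'a measure" and \<mu> :: "'a set \<Rightarrow> real"
  assumes signed: "signed_measure M \<mu>" and fin: "total_variation M \<mu> (space M) < \<infinity>"
begin

lemma mu_empty [simp]: "\<mu> {} = 0"
  using signed by (simp add: signed_measure_def)

lemma mu_sums: "range A \<subseteq> sets M \<Longrightarrow> disjoint_family A \<Longrightarrow> (\<lambda>i. \<mu> (A i)) sums \<mu> (\<Union>i. A i)" for A :: "nat \<Rightarrow> 'a set"
  using signed by (simp add: signed_measure_def)

abbreviation tv :: "'a set \<Rightarrow> ennreal" where "tv \<equiv> total_variation M \<mu>"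

definition parts :: "'a set \<Rightarrow> 'a set set set" where
  "parts A = {P. finite P \<and> P \<subseteq> sets M \<and> partition_on A P}"

lemma tv_eq: "tv A = (SUP P\<in>parts A. \<Sum>E\<in>P. ennreal \<bar>\<mu> E\<bar>)"
  by (simp add: total_variation_def parts_def)

lemma parts_nonempty: "A \<in> sets M \<Longrightarrow> (if A = {} then {} else {A}) \<in> parts A"
  by (auto simp: parts_def partition_on_def)

lemma mu_le_tv: "A \<in> sets M \<Longrightarrow> ennreal \<bar>\<mu> A\<bar> \<le> tv A"
proof (cases "A = {}")
  case False
  assume "A \<in> sets M"
  then have "{A} \<in> parts A" using parts_nonempty[of A] False by simp
  then have "(\<Sum>E\<in>{A}. ennreal \<bar>\<mu> E\<bar>) \<le> tv A" unfolding tv_eq by (rule SUP_upper)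
  then show ?thesis by simp
qed simp

lemma tv_superadditive_aux:
  assumes A: "A \<in> sets M" and B: "B \<in> sets M" and d: "A \<inter> B = {}" and P: "P \<in> parts A" and Q: "Q \<in> parts B"
  shows "(\<Sum>E\<in>P. ennreal \<bar>\<mu> E\<bar>) + (\<Sum>E\<in>Q. ennreal \<bar>\<mu> E\<bar>) \<le> tv (A \<union> B)"
proof -
  have PQ: "finite P" "finite Q" "partition_on A P" "partition_on B Q" "P \<subseteq> sets M" "Q \<subseteq> sets M"
    using P Q by (auto simp: parts_def)
  have "E \<notin> Q" if "E \<in> P" for E
  proof
    assume "E \<in> Q"
    then have "E \<subseteq> A \<inter> B" "E \<noteq> {}" using that PQ(3,4) by (auto simp: partition_on_def)
    then show False using d by auto
  qed
  then have dPQ: "P \<inter> Q = {}" by blast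
  have "disjoint (P \<union> Q)"
  proof (rule disjointI)
    fix E F assume EF: "E \<in> P \<union> Q" "F \<in> P \<union> Q" "E \<noteq> F"
    have sub: "G \<subseteq> A" if "G \<in> P" for G using PQ(3) that by (auto simp: partition_on_def)
    have sub': "G \<subseteq> B" if "G \<in> Q" for G using PQ(4) that by (auto simp: partition_on_def)
    consider "E \<in> P" "F \<in> P" | "E \<in> Q" "F \<in> Q" | "E \<in> P" "F \<in> Q" | "E \<in> Q" "F \<in> P" using EF by blast
    then show "E \<inter> F = {}"
    proof cases
      case 1 then show ?thesis using PQ(3) EF(3) by (auto simp: partition_on_def disjoint_def)
    next
      case 2 then show ?thesis using PQ(4) EF(3) by (auto simp: partition_on_def disjoint_def)
    next
      case 3 then show ?thesis using sub[of E] sub'[of F] d by blast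
    next
      case 4 then show ?thesis using sub[of F] sub'[of E] d by blast
    qed
  qed
  moreover have "\<Union> (P \<union> Q) = A \<union> B" using PQ(3,4) by (simp add: partition_on_def)
  moreover have "{} \<notin> P \<union> Q" using PQ(3,4) by (simp add: partition_on_def)
  ultimately have "partition_on (A \<union> B) (P \<union> Q)" by (simp add: partition_on_def)
  then have "P \<union> Q \<in> parts (A \<union> B)" using PQ by (simp add: parts_def)
  then have "(\<Sum>E\<in>P \<union> Q. ennreal \<bar>\<mu> E\<bar>) \<le> tv (A \<union> B)" unfolding tv_eq by (rule SUP_upper)
  then show ?thesis unfolding sum.union_disjoint[OF PQ(1,2) dPQ] .
qed

lemma tv_superadditive:
  assumes A: "A \<in> sets M" and B: "B \<in> sets M" and d: "A \<inter> B = {}"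
  shows "tv A + tv B \<le> tv (A \<union> B)"
proof -
  have ne: "parts A \<noteq> {}" "parts B \<noteq> {}" using parts_nonempty[OF A] parts_nonempty[OF B] by auto
  have "(\<Sum>E\<in>P. ennreal \<bar>\<mu> E\<bar>) + tv B \<le> tv (A \<union> B)" if P: "P \<in> parts A" for P
  proof -
    have "tv B + (\<Sum>E\<in>P. ennreal \<bar>\<mu> E\<bar>) = (SUP Q\<in>parts B. (\<Sum>E\<in>Q. ennreal \<bar>\<mu> E\<bar>) + (\<Sum>E\<in>P. ennreal \<bar>\<mu> E\<bar>))"
      unfolding tv_eq by (rule ennreal_SUP_add_left[symmetric, OF ne(2)])
    also have "\<dots> \<le> tv (A \<union> B)"
      using tv_superadditive_aux[OF A B d P] by (intro SUP_least) (simp add: add.commute)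
    finally show ?thesis by (simp add: add.commute)
  qed
  then have "(SUP P\<in>parts A. (\<Sum>E\<in>P. ennreal \<bar>\<mu> E\<bar>) + tv B) \<le> tv (A \<union> B)" by (rule SUP_least)
  also have "(SUP P\<in>parts A. (\<Sum>E\<in>P. ennreal \<bar>\<mu> E\<bar>) + tv B) = tv A + tv B"
    unfolding tv_eq[of A] by (rule ennreal_SUP_add_left[OF ne(1)])
  finally show ?thesis .
qed

lemma tv_mono: "A \<in> sets M \<Longrightarrow> B \<in> sets M \<Longrightarrow> A \<subseteq> B \<Longrightarrow> tv A \<le> tv B"
  using tv_superadditive[of A "B - A"] by (metis Diff_disjoint Diff_partition add_increasing2 order_trans
    sets.Diff zero_le order_refl)

lemma tv_finite: "A \<in> sets M \<Longrightarrow> tv A \<noteq> top"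
  using tv_mono[of A "space M"] sets.sets_into_space[of A M] fin by (auto simp: top_unique)

lemma abs_le_suminf:
  assumes "f sums s"
  shows "ennreal \<bar>s\<bar> \<le> (\<Sum>i. ennreal \<bar>f i\<bar>)"
proof (cases "(\<Sum>i. ennreal \<bar>f i\<bar>) = top")
  case False
  then have sm: "summable (\<lambda>i. \<bar>f i\<bar>)" by (intro summable_suminf_not_top) auto
  have "\<bar>s\<bar> \<le> (\<Sum>i. \<bar>f i\<bar>)" using summable_rabs[OF sm] sums_unique[OF assms] by simp
  then have "ennreal \<bar>s\<bar> \<le> ennreal (\<Sum>i. \<bar>f i\<bar>)" by (rule ennreal_leI)
  also have "\<dots> = (\<Sum>i. ennreal \<bar>f i\<bar>)" by (rule suminf_ennreal2[OF _ sm, symmetric]) simp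
  finally show ?thesis .
qed simp

text \<open>The total variation is countably additive: a partition of a union is refined by intersecting it
  with the pieces, and partitions of finitely many pieces combine to one of their union.\<close>

lemma tv_countably_additive:
  fixes A :: "nat \<Rightarrow> 'a set"
  assumes A: "range A \<subseteq> sets M" and d: "disjoint_family A"
  shows "(\<Sum>i. tv (A i)) = tv (\<Union>i. A i)"
proof (rule antisym)
  have Ai: "A i \<in> sets M" for i using A by auto
  have U: "(\<Union>i<n. A i) \<in> sets M" "(\<Union>i. A i) \<in> sets M" for n using Ai by auto
  have "(\<Sum>i<n. tv (A i)) \<le> tv (\<Union>i<n. A i)" for n
  proof (induction n)
    case (Suc n)
    have "A i \<inter> A n = {}" if "i < n" for i using disjoint_family_onD[OF d UNIV_I UNIV_I, of i n] that by simp
    then have "(\<Union>i<n. A i) \<inter> A n = {}" by blast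
    then have "tv (\<Union>i<n. A i) + tv (A n) \<le> tv ((\<Union>i<n. A i) \<union> A n)" by (intro tv_superadditive U Ai)
    moreover have "(\<Union>i<n. A i) \<union> A n = (\<Union>i<Suc n. A i)" by (auto simp: lessThan_Suc)
    ultimately show ?case using Suc by (simp add: add.commute) (meson add_mono order_refl order_trans)
  qed simp
  then have "(\<Sum>i<n. tv (A i)) \<le> tv (\<Union>i. A i)" for n
    using tv_mono[OF U(1)[of n] U(2)] by (meson UN_mono order_refl order_trans subset_UNIV)
  then show "(\<Sum>i. tv (A i)) \<le> tv (\<Union>i. A i)" by (intro suminf_le_const summableI)
next
  have Ai: "A i \<in> sets M" for i using A by auto
  have "(\<Sum>E\<in>P. ennreal \<bar>\<mu> E\<bar>) \<le> (\<Sum>i. tv (A i))" if P: "P \<in> parts (\<Union>i. A i)" for P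
  proof -
    have P': "finite P" "P \<subseteq> sets M" "\<Union>P = (\<Union>i. A i)" "disjoint P" using P by (auto simp: parts_def partition_on_def)
    have "ennreal \<bar>\<mu> E\<bar> \<le> (\<Sum>i. ennreal \<bar>\<mu> (E \<inter> A i)\<bar>)" if E: "E \<in> P" for E
    proof -
      have "E = (\<Union>i. E \<inter> A i)" using P'(3) E by blast
      moreover have "(\<lambda>i. \<mu> (E \<inter> A i)) sums \<mu> (\<Union>i. E \<inter> A i)"
      proof (rule mu_sums)
        show "range (\<lambda>i. E \<inter> A i) \<subseteq> sets M" using E P'(2) Ai by auto
        show "disjoint_family (\<lambda>i. E \<inter> A i)" using d unfolding disjoint_family_on_def by blast
      qed
      ultimately show ?thesis using abs_le_suminf by metis
    qed
    then have "(\<Sum>E\<in>P. ennreal \<bar>\<mu> E\<bar>) \<le> (\<Sum>E\<in>P. \<Sum>i. ennreal \<bar>\<mu> (E \<inter> A i)\<bar>)" by (rule sum_mono)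
    also have "\<dots> = (\<Sum>i. \<Sum>E\<in>P. ennreal \<bar>\<mu> (E \<inter> A i)\<bar>)" by (intro suminf_sum[symmetric] summableI)
    also have "\<dots> \<le> (\<Sum>i. tv (A i))"
    proof (intro suminf_le summableI)
      fix i
      define g where "g E = E \<inter> A i" for E
      have "(\<Sum>E\<in>P. ennreal \<bar>\<mu> (g E)\<bar>) = (\<Sum>F\<in>g ` P. ennreal \<bar>\<mu> F\<bar>)"
      proof (rule sum.reindex_nontrivial[OF P'(1), symmetric, unfolded o_def])
        fix E F assume "E \<in> P" "F \<in> P" "E \<noteq> F" "g E = g F"
        then have "g E = {}" using P'(4) unfolding g_def disjoint_def by blast
        then show "ennreal \<bar>\<mu> (g E)\<bar> = 0" by simp
      qed
      also have "\<dots> = (\<Sum>F\<in>g ` P - {{}}. ennreal \<bar>\<mu> F\<bar>)"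
        using P'(1) by (intro sum.mono_neutral_right) auto
      also have "g ` P - {{}} \<in> parts (A i)"
      proof -
        have "disjoint (g ` P - {{}})"
        proof (rule disjointI)
          fix X Y assume XY: "X \<in> g ` P - {{}}" "Y \<in> g ` P - {{}}" "X \<noteq> Y"
          then obtain E F where "E \<in> P" "F \<in> P" "X = E \<inter> A i" "Y = F \<inter> A i" by (auto simp: g_def)
          then show "X \<inter> Y = {}" using P'(4) XY(3) unfolding disjoint_def by blast
        qed
        moreover have "\<Union> (g ` P - {{}}) = A i"
        proof -
          have "\<Union> (g ` P - {{}}) = \<Union> (g ` P)" by blast
          also have "\<dots> = \<Union>P \<inter> A i" unfolding g_def by blast
          also have "\<dots> = A i" unfolding P'(3) by blast
          finally show ?thesis .
        qed
        ultimately have "partition_on (A i) (g ` P - {{}})" by (auto simp: partition_on_def)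
        then show ?thesis using P'(1,2) Ai by (auto simp: parts_def g_def)
      qed
      then have "(\<Sum>F\<in>g ` P - {{}}. ennreal \<bar>\<mu> F\<bar>) \<le> tv (A i)" unfolding tv_eq by (rule SUP_upper)
      finally show "(\<Sum>E\<in>P. ennreal \<bar>\<mu> (E \<inter> A i)\<bar>) \<le> tv (A i)" by (simp add: g_def)
    qed
    finally show ?thesis .
  qed
  then show "tv (\<Union>i. A i) \<le> (\<Sum>i. tv (A i))" unfolding tv_eq[of "\<Union>i. A i"] by (rule SUP_least)
qed

definition tvr :: "'a set \<Rightarrow> real" where "tvr A = enn2real (tv A)"

lemma tvr: "A \<in> sets M \<Longrightarrow> ennreal (tvr A) = tv A"
  using tv_finite[of A] by (simp add: tvr_def less_top)

lemma mu_le_tvr: "A \<in> sets M \<Longrightarrow> \<bar>\<mu> A\<bar> \<le> tvr A"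
  using mu_le_tv[of A] tvr[of A] by (metis abs_ge_zero ennreal_le_iff enn2real_nonneg tvr_def)

lemma tvr_sums:
  assumes "range A \<subseteq> sets M" "disjoint_family A"
  shows "(\<lambda>i. tvr (A i)) sums tvr (\<Union>i. A i)"
proof -
  have Ai: "A i \<in> sets M" and U: "(\<Union>i. A i) \<in> sets M" for i using assms(1) by auto
  have "(\<Sum>i. ennreal (tvr (A i))) = ennreal (tvr (\<Union>i. A i))"
    using tv_countably_additive[OF assms] by (simp add: tvr[OF Ai] tvr[OF U])
  moreover from this have "summable (\<lambda>i. tvr (A i))"
    by (intro summable_suminf_not_top) (auto simp: tvr_def)
  ultimately have sm: "summable (\<lambda>i. tvr (A i))" and eq: "(\<Sum>i. ennreal (tvr (A i))) = ennreal (tvr (\<Union>i. A i))"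
    by auto
  have nn: "0 \<le> tvr B" for B by (simp add: tvr_def)
  have "ennreal (\<Sum>i. tvr (A i)) = ennreal (tvr (\<Union>i. A i))"
    using suminf_ennreal2[OF nn sm] eq by simp
  then have "(\<Sum>i. tvr (A i)) = tvr (\<Union>i. A i)"
    using nn suminf_nonneg[OF sm nn] by (simp add: ennreal_inj)
  then show ?thesis using summable_sums[OF sm] by simp
qed

lemma part_measure:
  assumes c: "c = 1 \<or> c = -1"
  defines "N \<equiv> measure_of (space M) (sets M) (\<lambda>A. ennreal ((tvr A + c * \<mu> A) / 2))"
  shows "sets N = sets M" "space N = space M" "finite_measure N"
    "A \<in> sets M \<Longrightarrow> measure N A = (tvr A + c * \<mu> A) / 2"
proof -
  show sN: "sets N = sets M" "space N = space M" by (auto simp: N_def)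
  have nn: "0 \<le> (tvr A + c * \<mu> A) / 2" if "A \<in> sets M" for A using mu_le_tvr[OF that] c by auto
  have tv0: "tvr {} = 0"
  proof -
    have "parts {} = {{}}" by (auto simp: parts_def partition_on_empty)
    then have "tv {} = 0" by (simp add: tv_eq)
    then show ?thesis by (simp add: tvr_def)
  qed
  have em: "emeasure N A = ennreal ((tvr A + c * \<mu> A) / 2)" if "A \<in> sets M" for A
    unfolding N_def
  proof (rule emeasure_measure_of_sigma)
    show "sigma_algebra (space M) (sets M)" by (rule sets.sigma_algebra_axioms)
    show "positive (sets M) (\<lambda>A. ennreal ((tvr A + c * \<mu> A) / 2))" by (simp add: positive_def tv0)
    show "countably_additive (sets M) (\<lambda>A. ennreal ((tvr A + c * \<mu> A) / 2))"
    proof (rule countably_additiveI)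
      fix A :: "nat \<Rightarrow> 'a set" assume A: "range A \<subseteq> sets M" "disjoint_family A" "(\<Union>i. A i) \<in> sets M"
      have "(\<lambda>i. (tvr (A i) + c * \<mu> (A i)) / 2) sums ((tvr (\<Union>i. A i) + c * \<mu> (\<Union>i. A i)) / 2)"
        by (intro sums_divide sums_add sums_mult tvr_sums mu_sums A)
      then show "(\<Sum>i. ennreal ((tvr (A i) + c * \<mu> (A i)) / 2)) = ennreal ((tvr (\<Union>i. A i) + c * \<mu> (\<Union>i. A i)) / 2)"
        using A(1) by (intro suminf_ennreal_eq nn) auto
    qed
  qed (rule that)
  show "finite_measure N" by (rule finite_measureI) (simp add: sN em)
  show "A \<in> sets M \<Longrightarrow> measure N A = (tvr A + c * \<mu> A) / 2" using em nn by (simp add: measure_def)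
qed

lemma pos_part_measure:
  "sets (pos_part M \<mu>) = sets M" "space (pos_part M \<mu>) = space M" "finite_measure (pos_part M \<mu>)"
  "A \<in> sets M \<Longrightarrow> measure (pos_part M \<mu>) A = (tvr A + \<mu> A) / 2"
  using part_measure[of 1] by (simp_all add: pos_part_def tvr_def)

lemma neg_part_measure:
  "sets (neg_part M \<mu>) = sets M" "space (neg_part M \<mu>) = space M" "finite_measure (neg_part M \<mu>)"
  "A \<in> sets M \<Longrightarrow> measure (neg_part M \<mu>) A = (tvr A - \<mu> A) / 2"
  using part_measure[of "-1"] by (simp_all add: neg_part_def tvr_def)

lemma mu_eq_parts: "A \<in> sets M \<Longrightarrow> \<mu> A = measure (pos_part M \<mu>) A - measure (neg_part M \<mu>) A"
  using pos_part_measure(4)[of A] neg_part_measure(4)[of A] by simp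

end

section \<open>Square-integrable functions on a finite measure space\<close>

definition l2 :: "'a measure \<Rightarrow> ('a \<Rightarrow> complex) set" where
  "l2 M = {f \<in> borel_measurable M. integrable M (\<lambda>x. (norm (f x))\<^sup>2)}"

definition ip :: "'a measure \<Rightarrow> ('a \<Rightarrow> complex) \<Rightarrow> ('a \<Rightarrow> complex) \<Rightarrow> complex" where
  "ip M f g = integral\<^sup>L M (\<lambda>x. f x * cnj (g x))"

definition l2norm :: "'a measure \<Rightarrow> ('a \<Rightarrow> complex) \<Rightarrow> real" where
  "l2norm M f = sqrt (integral\<^sup>L M (\<lambda>x. (norm (f x))\<^sup>2))"

lemma mult_cnj_eq: "z * cnj z = of_real ((norm z)\<^sup>2)"
  by (rule complex_norm_square[symmetric])

lemma borel_measurable_cnj [measurable (raw)]: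
  "g \<in> borel_measurable M \<Longrightarrow> (\<lambda>x. cnj (g x)) \<in> borel_measurable M"
  by (rule measurable_compose[OF _ borel_measurable_continuous_onI]) (auto intro: continuous_intros)

lemma l2_measurable: "f \<in> l2 M \<Longrightarrow> f \<in> borel_measurable M"
  by (simp add: l2_def)

lemma l2norm_nonneg [simp]: "0 \<le> l2norm M f"
  by (simp add: l2norm_def)

lemma l2norm_sq: "(l2norm M f)\<^sup>2 = integral\<^sup>L M (\<lambda>x. (norm (f x))\<^sup>2)"
  by (simp add: l2norm_def)

lemma ip_integrable:
  assumes f: "f \<in> l2 M" and g: "g \<in> l2 M"
  shows "integrable M (\<lambda>x. f x * cnj (g x))"
proof (rule Bochner_Integration.integrable_bound)
  have [measurable]: "f \<in> borel_measurable M" "g \<in> borel_measurable M" using f g l2_measurable by auto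
  show "integrable M (\<lambda>x. (norm (f x))\<^sup>2 + (norm (g x))\<^sup>2)" using f g by (auto simp: l2_def)
  show "(\<lambda>x. f x * cnj (g x)) \<in> borel_measurable M" by measurable
  have "norm (f x * cnj (g x)) \<le> norm ((norm (f x))\<^sup>2 + (norm (g x))\<^sup>2)" for x
  proof -
    have "2 * norm (f x) * norm (g x) \<le> (norm (f x))\<^sup>2 + (norm (g x))\<^sup>2" by (rule sum_squares_bound)
    moreover have "0 \<le> norm (f x) * norm (g x)" by simp
    ultimately have "norm (f x) * norm (g x) \<le> (norm (f x))\<^sup>2 + (norm (g x))\<^sup>2" by linarith
    then show ?thesis by (simp add: norm_mult)
  qed
  then show "AE x in M. norm (f x * cnj (g x)) \<le> norm ((norm (f x))\<^sup>2 + (norm (g x))\<^sup>2)" by simp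
qed

lemma l2_lincomb:
  assumes f: "f \<in> l2 M" and g: "g \<in> l2 M"
  shows "(\<lambda>x. a * f x + b * g x) \<in> l2 M"
proof -
  have [measurable]: "f \<in> borel_measurable M" "g \<in> borel_measurable M" using f g l2_measurable by auto
  have "(norm (a * f x + b * g x))\<^sup>2 \<le> norm (2 * (norm a)\<^sup>2 * (norm (f x))\<^sup>2 + 2 * (norm b)\<^sup>2 * (norm (g x))\<^sup>2)" for x
  proof -
    have "norm (a * f x + b * g x) \<le> norm a * norm (f x) + norm b * norm (g x)"
      by (metis norm_mult norm_triangle_ineq)
    then have "(norm (a * f x + b * g x))\<^sup>2 \<le> (norm a * norm (f x) + norm b * norm (g x))\<^sup>2"
      by (rule power_mono) simp
    also have "\<dots> \<le> 2 * (norm a * norm (f x))\<^sup>2 + 2 * (norm b * norm (g x))\<^sup>2"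
      using sum_squares_bound[of "norm a * norm (f x)" "norm b * norm (g x)"] by (simp add: power2_sum)
    finally show ?thesis by (simp add: power_mult_distrib mult.assoc)
  qed
  note bd = this
  have "integrable M (\<lambda>x. 2 * (norm a)\<^sup>2 * (norm (f x))\<^sup>2 + 2 * (norm b)\<^sup>2 * (norm (g x))\<^sup>2)"
    using f g by (auto simp: l2_def)
  then have "integrable M (\<lambda>x. (norm (a * f x + b * g x))\<^sup>2)"
  proof (rule Bochner_Integration.integrable_bound)
    show "(\<lambda>x. (norm (a * f x + b * g x))\<^sup>2) \<in> borel_measurable M" by measurable
  qed (intro AE_I2, subst real_norm_def, subst abs_of_nonneg, simp, rule bd)
  then show ?thesis by (simp add: l2_def)
qed

lemma l2_zero: "(\<lambda>x. 0) \<in> l2 M" by (simp add: l2_def)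

lemma l2_scale: "f \<in> l2 M \<Longrightarrow> (\<lambda>x. a * f x) \<in> l2 M"
  using l2_lincomb[of f M f a 0] by simp

lemma l2_add: "f \<in> l2 M \<Longrightarrow> g \<in> l2 M \<Longrightarrow> (\<lambda>x. f x + g x) \<in> l2 M"
  using l2_lincomb[of f M g 1 1] by simp

lemma l2_diff: "f \<in> l2 M \<Longrightarrow> g \<in> l2 M \<Longrightarrow> (\<lambda>x. f x - g x) \<in> l2 M"
  using l2_lincomb[of f M g 1 "-1"] by simp

lemma l2_sum: "(\<And>e. e \<in> F \<Longrightarrow> f e \<in> l2 M) \<Longrightarrow> (\<lambda>x. \<Sum>e\<in>F. c e * f e x) \<in> l2 M"
proof (induction F rule: infinite_finite_induct)
  case (insert e F)
  then have "(\<lambda>x. c e * f e x) \<in> l2 M" "(\<lambda>x. \<Sum>e\<in>F. c e * f e x) \<in> l2 M" by (auto intro: l2_scale)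
  then show ?case using insert.hyps l2_add by fastforce
qed (auto intro: l2_zero)

lemma ip_cnj: "cnj (ip M f g) = ip M g f"
  using Bochner_Integration.integral_cnj[of M "\<lambda>x. f x * cnj (g x)"] by (simp add: ip_def mult.commute)

lemma ip_lincomb_left:
  assumes "f \<in> l2 M" "g \<in> l2 M" "h \<in> l2 M"
  shows "ip M (\<lambda>x. a * f x + b * g x) h = a * ip M f h + b * ip M g h"
proof -
  have "ip M (\<lambda>x. a * f x + b * g x) h = (\<integral>x. a * (f x * cnj (h x)) + b * (g x * cnj (h x)) \<partial>M)"
    unfolding ip_def by (intro Bochner_Integration.integral_cong) (auto simp: algebra_simps)
  also have "\<dots> = a * ip M f h + b * ip M g h" unfolding ip_def
    by (subst Bochner_Integration.integral_add) (auto intro!: ip_integrable assms)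
  finally show ?thesis .
qed

lemma ip_lincomb_right:
  assumes "f \<in> l2 M" "g \<in> l2 M" "h \<in> l2 M"
  shows "ip M h (\<lambda>x. a * f x + b * g x) = cnj a * ip M h f + cnj b * ip M h g"
  using ip_lincomb_left[OF assms, of a b] by (metis complex_cnj_add complex_cnj_mult ip_cnj)

lemma ip_scale_left: "f \<in> l2 M \<Longrightarrow> h \<in> l2 M \<Longrightarrow> ip M (\<lambda>x. a * f x) h = a * ip M f h"
  using ip_lincomb_left[of f M f h a 0] by simp

lemma ip_scale_right: "f \<in> l2 M \<Longrightarrow> h \<in> l2 M \<Longrightarrow> ip M h (\<lambda>x. a * f x) = cnj a * ip M h f"
  using ip_lincomb_right[of f M f h a 0] by simp

lemma ip_add_left: "f \<in> l2 M \<Longrightarrow> g \<in> l2 M \<Longrightarrow> h \<in> l2 M \<Longrightarrow> ip M (\<lambda>x. f x + g x) h = ip M f h + ip M g h"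
  using ip_lincomb_left[of f M g h 1 1] by simp

lemma ip_diff_left: "f \<in> l2 M \<Longrightarrow> g \<in> l2 M \<Longrightarrow> h \<in> l2 M \<Longrightarrow> ip M (\<lambda>x. f x - g x) h = ip M f h - ip M g h"
  using ip_lincomb_left[of f M g h 1 "-1"] by simp

lemma ip_diff_right: "f \<in> l2 M \<Longrightarrow> g \<in> l2 M \<Longrightarrow> h \<in> l2 M \<Longrightarrow> ip M h (\<lambda>x. f x - g x) = ip M h f - ip M h g"
  using ip_lincomb_right[of f M g h 1 "-1"] by simp

lemma ip_zero [simp]: "ip M (\<lambda>x. 0) h = 0" "ip M h (\<lambda>x. 0) = 0"
  by (simp_all add: ip_def)

lemma ip_sum_left:
  assumes "\<And>e. e \<in> F \<Longrightarrow> f e \<in> l2 M" "h \<in> l2 M"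
  shows "ip M (\<lambda>x. \<Sum>e\<in>F. c e * f e x) h = (\<Sum>e\<in>F. c e * ip M (f e) h)"
  using assms(1)
proof (induction F rule: infinite_finite_induct)
  case (insert e F)
  have "(\<lambda>x. \<Sum>e\<in>F. c e * f e x) \<in> l2 M" using insert.prems by (intro l2_sum) auto
  moreover have "(\<lambda>x. c e * f e x) \<in> l2 M" using insert.prems by (auto intro: l2_scale)
  ultimately have "ip M (\<lambda>x. c e * f e x + (\<Sum>e\<in>F. c e * f e x)) h
      = ip M (\<lambda>x. c e * f e x) h + ip M (\<lambda>x. \<Sum>e\<in>F. c e * f e x) h"
    using assms(2) by (intro ip_add_left)
  then show ?case using insert by (simp add: ip_scale_left assms)
qed auto

lemma ip_cong_AE:
  assumes "AE x in M. f x = f' x" "AE x in M. g x = g' x"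
    "f \<in> borel_measurable M" "f' \<in> borel_measurable M" "g \<in> borel_measurable M" "g' \<in> borel_measurable M"
  shows "ip M f g = ip M f' g'"
  unfolding ip_def using assms by (intro integral_cong_AE) (measurable, auto elim: AE_mp)

lemma ip_self: "ip M f f = of_real ((l2norm M f)\<^sup>2)"
proof -
  have "(\<lambda>x. f x * cnj (f x)) = (\<lambda>x. of_real ((norm (f x))\<^sup>2))" by (intro ext mult_cnj_eq)
  then show ?thesis unfolding ip_def l2norm_sq by (simp only: integral_complex_of_real)
qed

lemma l2norm_cong_AE:
  assumes "AE x in M. f x = g x" "f \<in> borel_measurable M" "g \<in> borel_measurable M"
  shows "l2norm M f = l2norm M g"
  unfolding l2norm_def using assms by (intro arg_cong[where f = sqrt] integral_cong_AE) (auto elim: AE_mp)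

lemma l2norm_eq_0_iff: "f \<in> l2 M \<Longrightarrow> l2norm M f = 0 \<longleftrightarrow> (AE x in M. f x = 0)"
  unfolding l2norm_def l2_def by (simp add: integral_nonneg_eq_0_iff_AE)

lemma l2norm_scale: "l2norm M (\<lambda>x. a * f x) = norm a * l2norm M f"
  unfolding l2norm_def by (simp add: norm_mult power_mult_distrib real_sqrt_mult)

lemma Cauchy_Schwarz:
  assumes f: "f \<in> l2 M" and g: "g \<in> l2 M"
  shows "norm (ip M f g) \<le> l2norm M f * l2norm M g"
proof (cases "l2norm M g = 0")
  case True
  then have "AE x in M. g x = 0" using l2norm_eq_0_iff[OF g] by simp
  then have "ip M f g = ip M f (\<lambda>x. 0)"
    using f g by (intro ip_cong_AE) (auto simp: l2_measurable)
  then show ?thesis using True by simp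
next
  case False
  define c where "c = ip M f g / of_real ((l2norm M g)\<^sup>2)"
  define r where "r = (\<lambda>x. f x - c * g x)"
  have cg: "(\<lambda>x. c * g x) \<in> l2 M" using g by (rule l2_scale)
  have r: "r \<in> l2 M" unfolding r_def using f cg by (rule l2_diff)
  have "ip M r g = ip M f g - c * ip M g g"
    unfolding r_def using ip_diff_left[OF f cg g] ip_scale_left[OF g g] by simp
  then have rg: "ip M r g = 0" using False by (simp add: ip_self c_def)
  have "ip M r r = ip M r f - cnj c * ip M r g"
    using ip_diff_right[OF f cg r] ip_scale_right[OF g r] by (simp add: r_def)
  also have "\<dots> = ip M f f - c * ip M g f"
    using rg ip_diff_left[OF f cg f] ip_scale_left[OF g f] by (simp add: r_def)
  also have "c * ip M g f = of_real ((norm (ip M f g))\<^sup>2 / (l2norm M g)\<^sup>2)"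
    by (simp add: c_def mult_cnj_eq flip: ip_cnj[of M f g])
  finally have "(l2norm M r)\<^sup>2 = (l2norm M f)\<^sup>2 - (norm (ip M f g))\<^sup>2 / (l2norm M g)\<^sup>2"
    unfolding ip_self by (metis of_real_diff of_real_eq_iff)
  then have "(norm (ip M f g))\<^sup>2 / (l2norm M g)\<^sup>2 \<le> (l2norm M f)\<^sup>2"
    by (metis diff_ge_0_iff_ge zero_le_power2)
  then have "(norm (ip M f g))\<^sup>2 \<le> (l2norm M f * l2norm M g)\<^sup>2"
    using False by (simp add: field_simps power_mult_distrib)
  then show ?thesis by (rule power2_le_imp_le) simp
qed

lemma l2norm_triangle:
  assumes f: "f \<in> l2 M" and g: "g \<in> l2 M"
  shows "l2norm M (\<lambda>x. f x + g x) \<le> l2norm M f + l2norm M g"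
proof (rule power2_le_imp_le)
  have fg: "(\<lambda>x. f x + g x) \<in> l2 M" using f g by (rule l2_add)
  have "ip M (\<lambda>x. f x + g x) (\<lambda>x. f x + g x) = ip M f f + ip M g g + (ip M f g + cnj (ip M f g))"
    using ip_lincomb_left[OF f g fg, of 1 1] ip_lincomb_right[OF f g f, of 1 1] ip_lincomb_right[OF f g g, of 1 1]
      ip_cnj[of M f g] by simp
  also have "\<dots> = of_real ((l2norm M f)\<^sup>2 + (l2norm M g)\<^sup>2 + 2 * Re (ip M f g))"
    by (simp only: ip_self complex_add_cnj of_real_add)
  finally have "(l2norm M (\<lambda>x. f x + g x))\<^sup>2 = (l2norm M f)\<^sup>2 + (l2norm M g)\<^sup>2 + 2 * Re (ip M f g)"
    unfolding ip_self by (simp only: of_real_eq_iff)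
  also have "\<dots> \<le> (l2norm M f)\<^sup>2 + (l2norm M g)\<^sup>2 + 2 * (l2norm M f * l2norm M g)"
    using Cauchy_Schwarz[OF f g] complex_Re_le_cmod[of "ip M f g"] by linarith
  finally show "(l2norm M (\<lambda>x. f x + g x))\<^sup>2 \<le> (l2norm M f + l2norm M g)\<^sup>2" by (simp add: power2_sum)
qed simp

lemma l2norm_triangle_diff:
  assumes "f \<in> l2 M" "g \<in> l2 M" "h \<in> l2 M"
  shows "l2norm M (\<lambda>x. f x - h x) \<le> l2norm M (\<lambda>x. f x - g x) + l2norm M (\<lambda>x. g x - h x)"
  using l2norm_triangle[of "\<lambda>x. f x - g x" M "\<lambda>x. g x - h x"] assms l2_diff by fastforce

definition orthonormal :: "'a measure \<Rightarrow> ('a \<Rightarrow> complex) set \<Rightarrow> bool" where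
  "orthonormal M F \<longleftrightarrow> F \<subseteq> l2 M \<and> (\<forall>e\<in>F. \<forall>e'\<in>F. ip M e e' = (if e = e' then 1 else 0))"

definition proj :: "'a measure \<Rightarrow> ('a \<Rightarrow> complex) set \<Rightarrow> ('a \<Rightarrow> complex) \<Rightarrow> 'a \<Rightarrow> complex" where
  "proj M F f = (\<lambda>x. \<Sum>e\<in>F. ip M f e * e x)"

lemma proj_l2: "orthonormal M F \<Longrightarrow> proj M F f \<in> l2 M"
  unfolding proj_def orthonormal_def by (intro l2_sum) auto

lemma proj_orthogonal:
  assumes F: "orthonormal M F" "finite F" and f: "f \<in> l2 M" and e: "e \<in> F"
  shows "ip M (\<lambda>x. f x - proj M F f x) e = 0"
proof -
  have el: "e \<in> l2 M" using F e by (auto simp: orthonormal_def)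
  have "ip M (proj M F f) e = (\<Sum>e'\<in>F. ip M f e' * ip M e' e)"
    unfolding proj_def using F el by (intro ip_sum_left) (auto simp: orthonormal_def)
  also have "\<dots> = (\<Sum>e'\<in>F. if e' = e then ip M f e' else 0)"
    using F e by (intro sum.cong refl) (auto simp: orthonormal_def)
  also have "\<dots> = ip M f e" using F(2) e by (simp add: sum.delta)
  finally show ?thesis using ip_diff_left[OF f proj_l2[OF F(1)] el] by simp
qed

lemma proj_norm:
  assumes F: "orthonormal M F" "finite F" and f: "f \<in> l2 M"
  shows "(l2norm M (\<lambda>x. f x - proj M F f x))\<^sup>2 = (l2norm M f)\<^sup>2 - (\<Sum>e\<in>F. (norm (ip M f e))\<^sup>2)"
proof -
  define r where "r = (\<lambda>x. f x - proj M F f x)"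
  note p = proj_l2[OF F(1), of f]
  have r: "r \<in> l2 M" unfolding r_def using f p by (rule l2_diff)
  have Fl: "e \<in> l2 M" if "e \<in> F" for e using F that by (auto simp: orthonormal_def)
  have "ip M (proj M F f) r = (\<Sum>e\<in>F. ip M f e * ip M e r)"
    unfolding proj_def by (intro ip_sum_left Fl r)
  also have "\<dots> = 0"
  proof (intro sum.neutral ballI)
    fix e assume "e \<in> F"
    then have "ip M e r = 0" using proj_orthogonal[OF F f] ip_cnj[of M r e] by (simp add: r_def)
    then show "ip M f e * ip M e r = 0" by simp
  qed
  finally have "ip M r r = ip M f r" using ip_diff_left[OF f p r] by (simp add: r_def)
  also have "\<dots> = ip M f f - ip M f (proj M F f)" using ip_diff_right[OF f p f] by (simp add: r_def)
  also have "ip M f (proj M F f) = cnj (ip M (proj M F f) f)" by (simp add: ip_cnj)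
  also have "ip M (proj M F f) f = (\<Sum>e\<in>F. ip M f e * ip M e f)"
    unfolding proj_def by (intro ip_sum_left Fl f)
  also have "\<dots> = (\<Sum>e\<in>F. of_real ((norm (ip M f e))\<^sup>2))"
    by (intro sum.cong refl) (simp add: mult_cnj_eq flip: ip_cnj[of M f])
  finally have "complex_of_real ((l2norm M r)\<^sup>2) = of_real ((l2norm M f)\<^sup>2 - (\<Sum>e\<in>F. (norm (ip M f e))\<^sup>2))"
    by (simp add: ip_self)
  then show ?thesis unfolding r_def by (simp only: of_real_eq_iff)
qed

lemma Bessel:
  assumes "orthonormal M F" "finite F" "f \<in> l2 M"
  shows "(\<Sum>e\<in>F. (norm (ip M f e))\<^sup>2) \<le> (l2norm M f)\<^sup>2"
  using proj_norm[OF assms] by (metis diff_ge_0_iff_ge zero_le_power2)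

lemma orthonormal_subset: "orthonormal M F \<Longrightarrow> F' \<subseteq> F \<Longrightarrow> orthonormal M F'"
  unfolding orthonormal_def by blast

text \<open>A bound on the size of orthonormal subsets of a subspace yields an orthonormal basis: take one of
  maximal size.\<close>

lemma finite_orthonormal_basis:
  assumes U: "U \<subseteq> l2 M" "\<And>f g a b. f \<in> U \<Longrightarrow> g \<in> U \<Longrightarrow> (\<lambda>x. a * f x + b * g x) \<in> U" "(\<lambda>x. 0) \<in> U"
    and bound: "\<And>F. finite F \<Longrightarrow> F \<subseteq> U \<Longrightarrow> orthonormal M F \<Longrightarrow> card F \<le> N"
  shows "\<exists>F. finite F \<and> F \<subseteq> U \<and> orthonormal M F \<and> (\<forall>f\<in>U. AE x in M. f x = proj M F f x)"
proof -
  define P where "P F \<longleftrightarrow> finite F \<and> F \<subseteq> U \<and> orthonormal M F" for F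
  have P0: "P {}" by (simp add: P_def orthonormal_def)
  have "\<forall>F. P F \<longrightarrow> card F \<le> N" using bound by (simp add: P_def)
  then have "\<exists>k. (\<exists>F. P F \<and> card F = k) \<and> (\<forall>j. (\<exists>F. P F \<and> card F = j) \<longrightarrow> j \<le> k)"
    using P0 by (intro ex_has_greatest_nat[where k = 0 and b = "Suc N"]) (auto simp: le_Suc_eq less_Suc_eq_le)
  then obtain F where F: "P F" "\<And>F'. P F' \<Longrightarrow> card F' \<le> card F" by auto
  have on: "orthonormal M F" "finite F" and FU: "F \<subseteq> U" using F(1) by (auto simp: P_def)
  have "AE x in M. f x = proj M F f x" if f: "f \<in> U" for f
  proof (rule ccontr)
    assume *: "\<not> (AE x in M. f x = proj M F f x)"
    have fl: "f \<in> l2 M" using f U(1) by blast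
    define r where "r = (\<lambda>x. f x - proj M F f x)"
    have r: "r \<in> l2 M" unfolding r_def using fl proj_l2[OF on(1)] by (rule l2_diff)
    have rn: "l2norm M r \<noteq> 0" using * l2norm_eq_0_iff[OF r] by (simp add: r_def)
    have "proj M F' f \<in> U" if "F' \<subseteq> F" "finite F'" for F'
      using that(2,1)
    proof (induction F' rule: finite_induct)
      case empty
      then show ?case using U(3) by (simp add: proj_def)
    next
      case (insert e F')
      then have "(\<lambda>x. ip M f e * e x + 1 * proj M F' f x) \<in> U" using FU by (intro U(2)) auto
      then show ?case using insert.hyps by (simp add: proj_def)
    qed
    then have pU: "proj M F f \<in> U" using on(2) by blast
    have rU: "r \<in> U" using U(2)[OF f pU, of 1 "-1"] by (simp add: r_def)
    define e where "e = (\<lambda>x. of_real (1 / l2norm M r) * r x)"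
    have eU: "e \<in> U" unfolding e_def using U(2)[OF rU rU, of "of_real (1 / l2norm M r)" 0] by (simp only: mult_zero_left add_0_right)
    have el: "e \<in> l2 M" using eU U(1) by blast
    have "l2norm M e = 1" unfolding e_def l2norm_scale using rn by (simp add: norm_divide)
    then have ee: "ip M e e = 1" by (simp add: ip_self)
    have eo: "ip M e e' = 0 \<and> ip M e' e = 0" if "e' \<in> F" for e'
    proof -
      have e'l: "e' \<in> l2 M" using that FU U(1) by blast
      have "ip M r e' = 0" using proj_orthogonal[OF on fl that] by (simp add: r_def)
      then have "ip M e e' = 0" unfolding e_def ip_scale_left[OF r e'l] by simp
      then show ?thesis using ip_cnj[of M e e'] by simp
    qed
    have eF: "e \<notin> F" using eo ee by auto
    have "P (insert e F)" using on eU FU eo ee el by (auto simp: P_def orthonormal_def)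
    then have "card (insert e F) \<le> card F" by (rule F(2))
    then show False using eF on(2) by simp
  qed
  then show ?thesis using on FU by blast
qed

text \<open>Completeness: a subsequence with summable increments converges almost everywhere, and Fatou's
  lemma turns this into convergence in mean.\<close>

lemma (in finite_measure) l2_integrable: "f \<in> l2 M \<Longrightarrow> integrable M f"
proof (rule Bochner_Integration.integrable_bound)
  assume f: "f \<in> l2 M"
  show "integrable M (\<lambda>x. 1 + (norm (f x))\<^sup>2)" using f by (auto simp: l2_def)
  show "f \<in> borel_measurable M" using f by (rule l2_measurable)
  have "norm (f x) \<le> norm (1 + (norm (f x))\<^sup>2)" for x
  proof -
    have "0 \<le> (norm (f x) - 1 / 2)\<^sup>2" by simp
    then have "norm (f x) \<le> 1 + (norm (f x))\<^sup>2" by (simp add: power2_eq_square algebra_simps)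
    then show ?thesis by simp
  qed
  then show "AE x in M. norm (f x) \<le> norm (1 + (norm (f x))\<^sup>2)" by simp
qed

lemma (in finite_measure) bounded_l2:
  assumes "f \<in> borel_measurable M" "\<And>x. x \<in> space M \<Longrightarrow> norm (f x) \<le> B"
  shows "f \<in> l2 M"
proof -
  have "integrable M (\<lambda>x. (norm (f x))\<^sup>2)"
  proof (rule integrable_const_bound[of _ "B\<^sup>2"])
    have "(norm (f x))\<^sup>2 \<le> B\<^sup>2" if "x \<in> space M" for x using assms(2)[OF that] by (intro power_mono) auto
    then show "AE x in M. norm ((norm (f x))\<^sup>2) \<le> B\<^sup>2" by (intro AE_I2) simp
  qed (use assms(1) in measurable)
  then show ?thesis using assms(1) by (simp add: l2_def)
qed

lemma (in finite_measure) l1_le_l2norm: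
  assumes f: "f \<in> l2 M"
  shows "(\<integral>x. norm (f x) \<partial>M) \<le> sqrt (measure M (space M)) * l2norm M f"
proof -
  define g where "g = (\<lambda>x. complex_of_real (norm (f x)))"
  have [measurable]: "f \<in> borel_measurable M" using f by (rule l2_measurable)
  have g: "g \<in> l2 M" using f by (simp add: l2_def g_def)
  have one: "(\<lambda>x. 1) \<in> l2 M" by (simp add: l2_def)
  have "ip M g (\<lambda>x. 1) = of_real (\<integral>x. norm (f x) \<partial>M)" by (simp add: ip_def g_def)
  then have "(\<integral>x. norm (f x) \<partial>M) \<le> norm (ip M g (\<lambda>x. 1))" by simp
  also have "\<dots> \<le> l2norm M g * l2norm M (\<lambda>x. 1)" by (rule Cauchy_Schwarz[OF g one])
  also have "\<dots> = sqrt (measure M (space M)) * l2norm M f" by (simp add: l2norm_def g_def)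
  finally show ?thesis .
qed

lemma (in finite_measure) l2_complete:
  fixes S :: "nat \<Rightarrow> 'a \<Rightarrow> complex"
  assumes S: "\<And>n. S n \<in> l2 M"
    and cauchy: "\<And>\<epsilon>. 0 < \<epsilon> \<Longrightarrow> \<exists>N. \<forall>m\<ge>N. \<forall>n\<ge>N. l2norm M (\<lambda>x. S m x - S n x) \<le> \<epsilon>"
  shows "\<exists>s\<in>l2 M. (\<lambda>n. l2norm M (\<lambda>x. S n x - s x)) \<longlonglongrightarrow> 0"
proof -
  have [measurable]: "S n \<in> borel_measurable M" for n using S by (rule l2_measurable)
  have "\<exists>N. \<forall>m\<ge>N. \<forall>n\<ge>N. l2norm M (\<lambda>x. S m x - S n x) \<le> (1/2)^k" for k :: nat
    by (intro cauchy) simp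
  then obtain N where N: "\<And>k m n. m \<ge> N k \<Longrightarrow> n \<ge> N k \<Longrightarrow> l2norm M (\<lambda>x. S m x - S n x) \<le> (1/2)^k" by metis
  define r where "r k = k + (\<Sum>j\<le>k. N j)" for k
  have rN: "N k \<le> r j" if "k \<le> j" for k j
    using that member_le_sum[of k "{..j}" N] by (simp add: r_def)
  have rk: "k \<le> r k" for k by (simp add: r_def)
  define d where "d k = (\<lambda>x. S (r (Suc k)) x - S (r k) x)" for k
  have d: "d k \<in> l2 M" for k unfolding d_def by (intro l2_diff S)
  have dn: "l2norm M (d k) \<le> (1/2)^k" for k unfolding d_def by (intro N rN) auto
  have d1: "(\<integral>x. norm (d k x) \<partial>M) \<le> sqrt (measure M (space M)) * (1/2)^k" for k
    using l1_le_l2norm[OF d, of k] mult_left_mono[OF dn[of k], of "sqrt (measure M (space M))"] by simp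
  have "integrable M (d k)" for k using d by (rule l2_integrable)
  have sg: "summable (\<lambda>k. sqrt (measure M (space M)) * (1/2)^k)" by (intro summable_mult summable_geometric) simp
  have "AE x in M. summable (\<lambda>k. norm (d k x))"
  proof -
    have "(\<integral>\<^sup>+x. (\<Sum>k. ennreal (norm (d k x))) \<partial>M) = (\<Sum>k. \<integral>\<^sup>+x. ennreal (norm (d k x)) \<partial>M)"
      using l2_measurable[OF d] by (intro nn_integral_suminf) measurable
    also have "\<dots> = (\<Sum>k. ennreal (\<integral>x. norm (d k x) \<partial>M))"
      using \<open>\<And>k. integrable M (d k)\<close> by (intro suminf_cong nn_integral_eq_integral) auto
    also have "\<dots> \<le> (\<Sum>k. ennreal (sqrt (measure M (space M)) * (1/2)^k))"
      by (intro suminf_le ennreal_leI d1) auto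
    also have "\<dots> < \<infinity>" using sg by (simp add: suminf_ennreal_eq[OF _ summable_sums] less_top)
    finally have fin: "(\<integral>\<^sup>+x. (\<Sum>k. ennreal (norm (d k x))) \<partial>M) \<noteq> \<infinity>" by simp
    have "(\<lambda>x. \<Sum>k. ennreal (norm (d k x))) \<in> borel_measurable M" using l2_measurable[OF d] by measurable
    then have "AE x in M. (\<Sum>k. ennreal (norm (d k x))) \<noteq> \<infinity>" using fin by (rule nn_integral_PInf_AE)
    then show ?thesis by eventually_elim (auto intro: summable_suminf_not_top)
  qed
  then have conv: "AE x in M. (\<lambda>k. S (r k) x) \<longlonglongrightarrow> lim (\<lambda>k. S (r k) x)"
  proof eventually_elim
    case (elim x)
    have "(\<Sum>k<n. d k x) = S (r n) x - S (r 0) x" for n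
      by (induction n) (simp_all add: d_def)
    moreover have "summable (\<lambda>k. d k x)" using elim by (rule summable_norm_cancel)
    ultimately have "(\<lambda>n. S (r n) x - S (r 0) x) \<longlonglongrightarrow> (\<Sum>k. d k x)"
      using summable_LIMSEQ[of "\<lambda>k. d k x"] by simp
    then have "(\<lambda>n. (S (r n) x - S (r 0) x) + S (r 0) x) \<longlonglongrightarrow> (\<Sum>k. d k x) + S (r 0) x"
      by (intro tendsto_intros)
    then have "convergent (\<lambda>n. S (r n) x)" by (auto simp: convergent_def)
    then show ?case by (simp add: convergent_LIMSEQ_iff)
  qed
  define s where "s = (\<lambda>x. lim (\<lambda>k. S (r k) x))"
  have [measurable]: "s \<in> borel_measurable M" unfolding s_def by measurable
  have fatou: "integrable M (\<lambda>x. (norm (S n x - s x))\<^sup>2) \<and> l2norm M (\<lambda>x. S n x - s x) \<le> (1/2)^k" if n: "n \<ge> N k" for n k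
  proof -
    have "(\<integral>\<^sup>+x. ennreal ((norm (S n x - s x))\<^sup>2) \<partial>M) = (\<integral>\<^sup>+x. liminf (\<lambda>j. ennreal ((norm (S n x - S (r j) x))\<^sup>2)) \<partial>M)"
    proof (rule nn_integral_cong_AE)
      show "AE x in M. ennreal ((norm (S n x - s x))\<^sup>2) = liminf (\<lambda>j. ennreal ((norm (S n x - S (r j) x))\<^sup>2))"
        using conv
      proof eventually_elim
        case (elim x)
        then have "(\<lambda>j. ennreal ((norm (S n x - S (r j) x))\<^sup>2)) \<longlonglongrightarrow> ennreal ((norm (S n x - s x))\<^sup>2)"
          unfolding s_def by (intro tendsto_intros tendsto_ennrealI)
        then show ?case by (rule lim_imp_Liminf[OF trivial_limit_sequentially, symmetric])
      qed
    qed
    also have "\<dots> \<le> liminf (\<lambda>j. \<integral>\<^sup>+x. ennreal ((norm (S n x - S (r j) x))\<^sup>2) \<partial>M)"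
      by (rule nn_integral_liminf) measurable
    also have "\<dots> \<le> ennreal (((1/2)^k)\<^sup>2)"
    proof -
      have "(\<integral>\<^sup>+x. ennreal ((norm (S n x - S (r j) x))\<^sup>2) \<partial>M) \<le> ennreal (((1/2)^k)\<^sup>2)" if j: "j \<ge> k" for j
      proof -
        have "(\<integral>\<^sup>+x. ennreal ((norm (S n x - S (r j) x))\<^sup>2) \<partial>M) = ennreal ((l2norm M (\<lambda>x. S n x - S (r j) x))\<^sup>2)"
          unfolding l2norm_sq using l2_diff[OF S S, of n "r j"]
          by (intro nn_integral_eq_integral) (auto simp: l2_def)
        also have "\<dots> \<le> ennreal (((1/2)^k)\<^sup>2)"
          using N[OF n rN[OF j]] by (intro ennreal_leI power_mono) auto
        finally show ?thesis .
      qed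
      then have "eventually (\<lambda>j. (\<integral>\<^sup>+x. ennreal ((norm (S n x - S (r j) x))\<^sup>2) \<partial>M) \<le> ennreal (((1/2)^k)\<^sup>2)) sequentially"
        by (rule eventually_sequentiallyI)
      from Liminf_mono[OF this] show ?thesis by (simp add: Liminf_const)
    qed
    finally have le: "(\<integral>\<^sup>+x. ennreal ((norm (S n x - s x))\<^sup>2) \<partial>M) \<le> ennreal (((1/2)^k)\<^sup>2)" .
    have int: "integrable M (\<lambda>x. (norm (S n x - s x))\<^sup>2)"
      using le by (intro integrableI_bounded) (auto simp: le_less_trans[OF _ ennreal_less_top])
    then have "ennreal ((l2norm M (\<lambda>x. S n x - s x))\<^sup>2) \<le> ennreal (((1/2)^k)\<^sup>2)"
      using le unfolding l2norm_sq by (subst nn_integral_eq_integral[symmetric]) auto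
    then have "(l2norm M (\<lambda>x. S n x - s x))\<^sup>2 \<le> ((1/2)^k)\<^sup>2" by (simp add: ennreal_le_iff)
    then have "l2norm M (\<lambda>x. S n x - s x) \<le> (1/2)^k" by (rule power2_le_imp_le) simp
    then show ?thesis using int by blast
  qed
  have "(\<lambda>x. S (N 0) x - s x) \<in> l2 M" using fatou[of 0 "N 0"] by (simp add: l2_def)
  then have "(\<lambda>x. S (N 0) x - (S (N 0) x - s x)) \<in> l2 M" by (rule l2_diff[OF S])
  then have s: "s \<in> l2 M" by simp
  have "(\<lambda>n. l2norm M (\<lambda>x. S n x - s x)) \<longlonglongrightarrow> 0"
  proof (rule LIMSEQ_I)
    fix \<epsilon> :: real assume "0 < \<epsilon>"
    then obtain k where k: "(1/2::real)^k < \<epsilon>" using real_arch_pow_inv[of \<epsilon> "1/2"] by auto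
    then show "\<exists>no. \<forall>n\<ge>no. norm (l2norm M (\<lambda>x. S n x - s x) - 0) < \<epsilon>"
      using fatou[of k] by (intro exI[of _ "N k"]) (auto intro: le_less_trans)
  qed
  then show ?thesis using s by blast
qed

lemma orthonormal_norm:
  assumes "orthonormal M F" "e \<in> F"
  shows "l2norm M e = 1"
proof -
  have "complex_of_real ((l2norm M e)\<^sup>2) = ip M e e" by (rule ip_self[symmetric])
  also have "\<dots> = of_real 1" using assms by (simp add: orthonormal_def)
  finally have "(l2norm M e)\<^sup>2 = 1" by (simp only: of_real_eq_iff)
  then have "sqrt ((l2norm M e)\<^sup>2) = 1" by simp
  then show ?thesis by simp
qed

lemma proj_self:
  assumes F: "orthonormal M F" "finite F" and f: "f \<in> l2 M"
  shows "(l2norm M (proj M F f))\<^sup>2 = (\<Sum>e\<in>F. (norm (ip M f e))\<^sup>2)"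
proof -
  have Fl: "e \<in> l2 M" if "e \<in> F" for e using F that by (auto simp: orthonormal_def)
  note p = proj_l2[OF F(1), of f]
  have "ip M (proj M F f) (proj M F f) = (\<Sum>e\<in>F. ip M f e * ip M e (proj M F f))"
    by (subst (1) proj_def) (intro ip_sum_left Fl p)
  also have "\<dots> = (\<Sum>e\<in>F. of_real ((norm (ip M f e))\<^sup>2))"
  proof (intro sum.cong refl)
    fix e assume e: "e \<in> F"
    have "ip M (proj M F f) e = ip M f e"
      using proj_orthogonal[OF F f e] ip_diff_left[OF f p Fl[OF e]] by simp
    then have "ip M e (proj M F f) = cnj (ip M f e)" using ip_cnj by metis
    then show "ip M f e * ip M e (proj M F f) = of_real ((norm (ip M f e))\<^sup>2)"
      by (simp only: mult_cnj_eq)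
  qed
  finally show ?thesis unfolding ip_self by (simp only: of_real_sum[symmetric] of_real_eq_iff)
qed

lemma (in finite_measure) l2norm_le_bound:
  assumes f: "f \<in> borel_measurable M" and B: "\<And>x. x \<in> space M \<Longrightarrow> norm (f x) \<le> B" and "0 \<le> B"
  shows "l2norm M f \<le> sqrt (measure M (space M)) * B"
proof (rule power2_le_imp_le)
  have "(\<integral>x. (norm (f x))\<^sup>2 \<partial>M) \<le> (\<integral>x. B\<^sup>2 \<partial>M)"
    using bounded_l2[OF f B] B by (intro integral_mono) (auto simp: l2_def intro!: power_mono)
  then show "(l2norm M f)\<^sup>2 \<le> (sqrt (measure M (space M)) * B)\<^sup>2"
    by (simp add: l2norm_sq power_mult_distrib)
qed (use assms in simp)

section \<open>Integral operators with a symmetric kernel\<close>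

locale symmetric_kernel = finite_measure M for M :: "'a measure" +
  fixes G :: "'a \<Rightarrow> 'a \<Rightarrow> real" and C :: real
  assumes kernel_measurable: "(\<lambda>(x, y). G x y) \<in> borel_measurable (M \<Otimes>\<^sub>M M)"
    and kernel_bounded: "\<And>x y. x \<in> space M \<Longrightarrow> y \<in> space M \<Longrightarrow> \<bar>G x y\<bar> \<le> C"
    and kernel_symmetric: "\<And>x y. x \<in> space M \<Longrightarrow> y \<in> space M \<Longrightarrow> G x y = G y x"
    and C_nonneg: "0 \<le> C"
begin

definition T :: "('a \<Rightarrow> complex) \<Rightarrow> 'a \<Rightarrow> complex" where
  "T f x = (\<integral>y. of_real (G x y) * f y \<partial>M)"

definition eig :: "complex \<Rightarrow> ('a \<Rightarrow> complex) set" where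
  "eig \<alpha> = {f \<in> l2 M. AE x in M. T f x = \<alpha> * f x}"

definition total :: real where "total = measure M (space M)"

lemma total_nonneg: "0 \<le> total" by (simp add: total_def)

lemma kernel_section: "x \<in> space M \<Longrightarrow> G x \<in> borel_measurable M"
  using measurable_Pair2[OF kernel_measurable] by simp

lemma kernel_section_l2: "x \<in> space M \<Longrightarrow> (\<lambda>y. complex_of_real (G x y)) \<in> l2 M"
  using kernel_section[of x] kernel_bounded[of x] by (intro bounded_l2[where B = C]) (auto intro: measurable)

lemma kernel_section_norm: "x \<in> space M \<Longrightarrow> l2norm M (\<lambda>y. complex_of_real (G x y)) \<le> sqrt total * C"
  unfolding total_def using kernel_section[of x] kernel_bounded[of x] C_nonneg by (intro l2norm_le_bound) auto

lemma T_eq_ip: "T f x = ip M f (\<lambda>y. complex_of_real (G x y))"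
  by (simp add: T_def ip_def mult.commute)

lemma T_lincomb:
  "f \<in> l2 M \<Longrightarrow> g \<in> l2 M \<Longrightarrow> x \<in> space M \<Longrightarrow> T (\<lambda>x. a * f x + b * g x) x = a * T f x + b * T g x"
  unfolding T_eq_ip by (intro ip_lincomb_left kernel_section_l2)

lemma T_cong_AE:
  assumes "AE x in M. f x = g x" "f \<in> l2 M" "g \<in> l2 M" "x \<in> space M"
  shows "T f x = T g x"
  unfolding T_eq_ip using assms kernel_section_l2[of x]
  by (intro ip_cong_AE) (auto simp: l2_measurable)

lemma T_bound:
  assumes f: "f \<in> l2 M" and x: "x \<in> space M"
  shows "norm (T f x) \<le> sqrt total * C * l2norm M f"
proof -
  have "norm (T f x) \<le> l2norm M f * l2norm M (\<lambda>y. complex_of_real (G x y))"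
    unfolding T_eq_ip using f x by (intro Cauchy_Schwarz kernel_section_l2)
  also have "\<dots> \<le> l2norm M f * (sqrt total * C)" using x by (intro mult_left_mono kernel_section_norm) auto
  finally show ?thesis by (simp add: mult_ac)
qed

lemma T_measurable: "f \<in> l2 M \<Longrightarrow> T f \<in> borel_measurable M"
proof -
  assume "f \<in> l2 M"
  then have [measurable]: "f \<in> borel_measurable M" by (rule l2_measurable)
  note kernel_measurable[measurable]
  show ?thesis unfolding T_def by measurable
qed

lemma T_l2: "f \<in> l2 M \<Longrightarrow> T f \<in> l2 M"
  using T_measurable T_bound by (rule bounded_l2)

lemma T_norm:
  assumes f: "f \<in> l2 M"
  shows "l2norm M (T f) \<le> total * C * l2norm M f"
proof -
  have "l2norm M (T f) \<le> sqrt total * (sqrt total * C * l2norm M f)"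
    unfolding total_def by (intro l2norm_le_bound T_measurable T_bound[unfolded total_def] f) (use C_nonneg in auto)
  then show ?thesis using total_nonneg by (simp add: mult.assoc[symmetric])
qed

lemma T_symmetric:
  assumes f: "f \<in> l2 M" and g: "g \<in> l2 M"
  shows "ip M (T f) g = ip M f (T g)"
proof -
  interpret P: pair_sigma_finite M M ..
  have [measurable]: "f \<in> borel_measurable M" "g \<in> borel_measurable M" using f g l2_measurable by auto
  note kernel_measurable[measurable]
  have Gs [measurable]: "x \<in> space M \<Longrightarrow> G x \<in> borel_measurable M" for x by (rule kernel_section)
  note fi = l2_integrable[OF f] and gi = l2_integrable[OF g]
  define h where "h = (\<lambda>(x, y). of_real (G x y) * f y * cnj (g x))"
  have hm: "h \<in> borel_measurable (M \<Otimes>\<^sub>M M)" unfolding h_def by measurable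
  have bd: "norm (h (x, y)) \<le> C * norm (g x) * norm (f y)" if "x \<in> space M" "y \<in> space M" for x y
    using mult_right_mono[OF kernel_bounded[OF that], of "norm (f y) * norm (g x)"]
    by (simp add: h_def norm_mult mult_ac)
  have inner: "integrable M (\<lambda>y. h (x, y))" if x: "x \<in> space M" for x
  proof (rule Bochner_Integration.integrable_bound)
    show "integrable M (\<lambda>y. C * norm (g x) * norm (f y))" using fi by simp
    show "(\<lambda>y. h (x, y)) \<in> borel_measurable M" using measurable_Pair2[OF hm x] .
    show "AE y in M. norm (h (x, y)) \<le> norm (C * norm (g x) * norm (f y))"
      using bd[OF x] C_nonneg by (intro AE_I2) auto
  qed
  have hi: "integrable (M \<Otimes>\<^sub>M M) h"
  proof (rule P.Fubini_integrable[OF hm])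
    show "integrable M (\<lambda>x. \<integral>y. norm (h (x, y)) \<partial>M)"
    proof (rule Bochner_Integration.integrable_bound)
      show "integrable M (\<lambda>x. C * (\<integral>y. norm (f y) \<partial>M) * norm (g x))" using gi by simp
      show "(\<lambda>x. \<integral>y. norm (h (x, y)) \<partial>M) \<in> borel_measurable M" using hm by measurable
      have "(\<integral>y. norm (h (x, y)) \<partial>M) \<le> (\<integral>y. C * norm (g x) * norm (f y) \<partial>M)" if x: "x \<in> space M" for x
        using inner[OF x] fi bd[OF x] by (intro integral_mono) auto
      then show "AE x in M. norm (\<integral>y. norm (h (x, y)) \<partial>M) \<le> norm (C * (\<integral>y. norm (f y) \<partial>M) * norm (g x))"
        by (intro AE_I2) (auto simp: mult_ac intro!: order_trans[OF _ abs_ge_self])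
    qed
    show "AE x in M. integrable M (\<lambda>y. h (x, y))" using inner by (intro AE_I2)
  qed
  have "ip M (T f) g = (\<integral>x. \<integral>y. h (x, y) \<partial>M \<partial>M)"
    unfolding ip_def T_def h_def by simp
  also have "\<dots> = (\<integral>y. \<integral>x. h (x, y) \<partial>M \<partial>M)"
    using P.Fubini_integral[of "\<lambda>x y. h (x, y)"] hi by simp
  also have "\<dots> = (\<integral>y. f y * cnj (T g y) \<partial>M)"
  proof (intro Bochner_Integration.integral_cong refl)
    fix y assume y: "y \<in> space M"
    have "(\<integral>x. h (x, y) \<partial>M) = (\<integral>x. f y * cnj (of_real (G y x) * g x) \<partial>M)"
      using y by (intro Bochner_Integration.integral_cong refl) (simp add: h_def kernel_symmetric mult_ac)
    also have "\<dots> = f y * cnj (T g y)" by (simp add: T_def flip: Bochner_Integration.integral_cnj del: complex_cnj_mult)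
    finally show "(\<integral>x. h (x, y) \<partial>M) = f y * cnj (T g y)" .
  qed
  finally show ?thesis by (simp add: ip_def)
qed

lemma eig_l2: "f \<in> eig \<alpha> \<Longrightarrow> f \<in> l2 M" by (simp add: eig_def)

lemma eig_lincomb:
  assumes f: "f \<in> eig \<alpha>" and g: "g \<in> eig \<alpha>"
  shows "(\<lambda>x. a * f x + b * g x) \<in> eig \<alpha>"
proof -
  have "AE x in M. T f x = \<alpha> * f x" "AE x in M. T g x = \<alpha> * g x" using f g by (auto simp: eig_def)
  moreover have "AE x in M. x \<in> space M" by (rule AE_space)
  ultimately have "AE x in M. T (\<lambda>x. a * f x + b * g x) x = \<alpha> * (a * f x + b * g x)"
    by eventually_elim (simp add: T_lincomb[OF eig_l2[OF f] eig_l2[OF g]] algebra_simps)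
  then show ?thesis using l2_lincomb[OF eig_l2[OF f] eig_l2[OF g]] by (simp add: eig_def)
qed

lemma eig_zero: "(\<lambda>x. 0) \<in> eig \<alpha>"
  by (simp add: eig_def l2_zero T_def)

lemma eig_ip:
  assumes f: "f \<in> eig \<alpha>" and g: "g \<in> l2 M"
  shows "ip M (T f) g = \<alpha> * ip M f g" "ip M g (T f) = cnj \<alpha> * ip M g f"
proof -
  have fl: "f \<in> l2 M" using f by (rule eig_l2)
  have "ip M (T f) g = ip M (\<lambda>x. \<alpha> * f x) g"
    using f g l2_scale[OF fl, of \<alpha>] by (intro ip_cong_AE) (auto simp: eig_def l2_measurable T_measurable)
  then show "ip M (T f) g = \<alpha> * ip M f g" using ip_scale_left[OF fl g] by simp
  then show "ip M g (T f) = cnj \<alpha> * ip M g f" using ip_cnj by (metis complex_cnj_mult)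
qed

lemma eig_norm: "f \<in> eig \<alpha> \<Longrightarrow> l2norm M (T f) = norm \<alpha> * l2norm M f"
  unfolding l2norm_scale[symmetric]
  by (intro l2norm_cong_AE) (auto simp: eig_def l2_measurable T_measurable intro: l2_measurable[OF l2_scale])

lemma eigenvalue_real:
  assumes f: "f \<in> eig \<alpha>" "l2norm M f \<noteq> 0"
  shows "\<alpha> \<in> \<real>"
proof -
  note fl = eig_l2[OF f(1)]
  have "\<alpha> * ip M f f = cnj \<alpha> * ip M f f"
    using T_symmetric[OF fl fl] eig_ip[OF f(1) fl] by simp
  then have "cnj \<alpha> = \<alpha>" using f(2) by (simp add: ip_self)
  then show ?thesis by (simp add: Reals_cnj_iff)
qed

lemma eig_orthogonal:
  assumes f: "f \<in> eig \<alpha>" and g: "g \<in> eig \<beta>" and ab: "\<alpha> \<noteq> \<beta>"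
  shows "ip M f g = 0"
proof (cases "l2norm M g = 0")
  case True
  then show ?thesis using Cauchy_Schwarz[OF eig_l2[OF f] eig_l2[OF g]] by simp
next
  case False
  then have "cnj \<beta> = \<beta>" using eigenvalue_real[OF g] by (simp add: Reals_cnj_iff)
  then have "\<alpha> * ip M f g = \<beta> * ip M f g"
    using T_symmetric[OF eig_l2[OF f] eig_l2[OF g]] eig_ip[OF f eig_l2[OF g]] eig_ip[OF g eig_l2[OF f]] by simp
  then show ?thesis using ab by simp
qed

text \<open>The values at a point \<open>x\<close> of the images of an orthonormal family are the Fourier coefficients of
  the section of the kernel at \<open>x\<close>. Bessel's inequality, integrated over \<open>x\<close>, therefore bounds the
  sum of the squares of the eigenvalues.\<close>

lemma eigenvalue_square_sum:
  assumes F: "finite F" "orthonormal M F" and a: "\<And>e. e \<in> F \<Longrightarrow> e \<in> eig (a e)"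
  shows "(\<Sum>e\<in>F. (norm (a e))\<^sup>2) \<le> (total * C)\<^sup>2"
proof -
  have Fl: "e \<in> l2 M" if "e \<in> F" for e using F that by (auto simp: orthonormal_def)
  have n1: "l2norm M e = 1" if "e \<in> F" for e using F(2) that by (rule orthonormal_norm)
  have pt: "(\<Sum>e\<in>F. (norm (T e x))\<^sup>2) \<le> total * C\<^sup>2" if x: "x \<in> space M" for x
  proof -
    have "norm (T e x) = norm (ip M (\<lambda>y. complex_of_real (G x y)) e)" for e
      unfolding T_eq_ip using ip_cnj[of M e] by (metis complex_mod_cnj)
    then have "(\<Sum>e\<in>F. (norm (T e x))\<^sup>2) \<le> (l2norm M (\<lambda>y. complex_of_real (G x y)))\<^sup>2"
      using Bessel[OF F(2,1) kernel_section_l2[OF x]] by simp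
    also have "\<dots> \<le> (sqrt total * C)\<^sup>2" using kernel_section_norm[OF x] by (intro power_mono) auto
    finally show ?thesis using total_nonneg by (simp add: power_mult_distrib)
  qed
  have int: "integrable M (\<lambda>x. (norm (T e x))\<^sup>2)" if "e \<in> F" for e using T_l2[OF Fl[OF that]] by (simp add: l2_def)
  have "(\<Sum>e\<in>F. (norm (a e))\<^sup>2) = (\<Sum>e\<in>F. (l2norm M (T e))\<^sup>2)"
    using eig_norm[OF a] n1 by simp
  also have "\<dots> = (\<integral>x. (\<Sum>e\<in>F. (norm (T e x))\<^sup>2) \<partial>M)"
    unfolding l2norm_sq using int by (intro Bochner_Integration.integral_sum[symmetric])
  also have "\<dots> \<le> (\<integral>x. total * C\<^sup>2 \<partial>M)" using int pt by (intro integral_mono) auto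
  also have "\<dots> = (total * C)\<^sup>2" by (simp add: total_def power_mult_distrib power2_eq_square)
  finally show ?thesis .
qed

lemma eigen_card_bound:
  assumes F: "finite F" "orthonormal M F" and a: "\<And>e. e \<in> F \<Longrightarrow> \<exists>\<alpha>. e \<in> eig \<alpha> \<and> \<epsilon> \<le> norm \<alpha>" and e: "0 < \<epsilon>"
  shows "card F \<le> nat \<lceil>(total * C)\<^sup>2 / \<epsilon>\<^sup>2\<rceil>"
proof -
  obtain a where a: "\<And>e. e \<in> F \<Longrightarrow> e \<in> eig (a e)" "\<And>e. e \<in> F \<Longrightarrow> \<epsilon> \<le> norm (a e)" using a by metis
  have "real (card F) * \<epsilon>\<^sup>2 = (\<Sum>e\<in>F. \<epsilon>\<^sup>2)" by simp
  also have "\<dots> \<le> (\<Sum>e\<in>F. (norm (a e))\<^sup>2)" using a(2) e by (intro sum_mono power_mono) auto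
  also have "\<dots> \<le> (total * C)\<^sup>2" by (rule eigenvalue_square_sum[OF F a(1)])
  finally have "real (card F) \<le> (total * C)\<^sup>2 / \<epsilon>\<^sup>2" using e by (simp add: pos_le_divide_eq)
  then show ?thesis by linarith
qed

end

text \<open>Compactness of the operator, in the form in which the theorem of Arzela and Ascoli provides it.\<close>

locale compact_symmetric_kernel = symmetric_kernel +
  assumes compact: "\<And>f :: nat \<Rightarrow> 'a \<Rightarrow> complex. (\<And>n. f n \<in> l2 M) \<Longrightarrow> (\<And>n. l2norm M (f n) \<le> 1) \<Longrightarrow>
    \<exists>r h. strict_mono r \<and> uniform_limit (space M) (\<lambda>n. T (f (r n))) h sequentially"
begin

text \<open>On the orthogonal complement of eigenfunctions, a maximizing sequence \<open>f\<^sub>n\<close> of unit vectors for the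
  norm of \<open>T f\<close> satisfies \<open>T\<^sup>2 f\<^sub>n - \<kappa>\<^sup>2 f\<^sub>n \<rightarrow> 0\<close>, where \<open>\<kappa>\<close> is the supremum. By compactness \<open>T f\<^sub>n\<close> converges
  along a subsequence, and its limit \<open>h\<close> is an eigenvector of \<open>T\<^sup>2\<close> for \<open>\<kappa>\<^sup>2\<close>. Then \<open>T h + \<kappa> h\<close> is
  an eigenvector of \<open>T\<close> for \<open>\<kappa>\<close>, unless it vanishes, and then \<open>h\<close> is one for \<open>- \<kappa>\<close>.\<close>

lemma eigenvector_exists:
  assumes F: "\<And>e. e \<in> F \<Longrightarrow> \<exists>\<alpha>. e \<in> eig \<alpha>" and \<epsilon>: "0 \<le> \<epsilon>"
    and f0: "f0 \<in> l2 M" "\<And>e. e \<in> F \<Longrightarrow> ip M f0 e = 0" "\<epsilon> * l2norm M f0 < l2norm M (T f0)"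
  shows "\<exists>v \<alpha>. v \<in> eig \<alpha> \<and> l2norm M v \<noteq> 0 \<and> (\<forall>e\<in>F. ip M v e = 0) \<and> \<epsilon> < norm \<alpha>"
proof -
  define W where "W = {f \<in> l2 M. \<forall>e\<in>F. ip M f e = 0}"
  have Fl: "e \<in> l2 M" if "e \<in> F" for e using F[OF that] eig_l2 by blast
  have Wl: "f \<in> l2 M" if "f \<in> W" for f using that by (simp add: W_def)
  have Wlin: "(\<lambda>x. a * f x + b * g x) \<in> W" if "f \<in> W" "g \<in> W" for f g a b
  proof -
    have "ip M (\<lambda>x. a * f x + b * g x) e = 0" if "e \<in> F" for e
      using ip_lincomb_left[OF Wl[OF \<open>f \<in> W\<close>] Wl[OF \<open>g \<in> W\<close>] Fl[OF that]] \<open>f \<in> W\<close> \<open>g \<in> W\<close> that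
      by (simp add: W_def)
    then show ?thesis using l2_lincomb[OF Wl Wl] that by (simp add: W_def)
  qed
  have WT: "T f \<in> W" if f: "f \<in> W" for f
  proof -
    have "ip M (T f) e = 0" if e: "e \<in> F" for e
    proof -
      obtain \<alpha> where "e \<in> eig \<alpha>" using F[OF e] by blast
      then show ?thesis using T_symmetric[OF Wl[OF f] Fl[OF e]] eig_ip(2)[of e \<alpha> f] f e by (auto simp: W_def)
    qed
    then show ?thesis using f T_l2 by (simp add: W_def)
  qed
  define A where "A = {l2norm M (T f) |f. f \<in> W \<and> l2norm M f \<le> 1}"
  define \<kappa> where "\<kappa> = Sup A"
  have bdd: "bdd_above A"
  proof (rule bdd_aboveI)
    fix a assume "a \<in> A"
    then obtain f where f: "f \<in> W" "l2norm M f \<le> 1" "a = l2norm M (T f)" by (auto simp: A_def)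
    have "a \<le> total * C * l2norm M f" using f T_norm[OF Wl[OF f(1)]] by simp
    also have "\<dots> \<le> total * C * 1" using f total_nonneg C_nonneg by (intro mult_left_mono) auto
    finally show "a \<le> total * C" by simp
  qed
  have TW: "l2norm M (T f) \<le> \<kappa> * l2norm M f" if f: "f \<in> W" for f
  proof (cases "l2norm M f = 0")
    case True
    then show ?thesis using T_norm[OF Wl[OF f]] by simp
  next
    case False
    define g where "g = (\<lambda>x. of_real (1 / l2norm M f) * f x)"
    have g: "g \<in> W" unfolding g_def using Wlin[OF f f, of "of_real (1 / l2norm M f)" 0] by (simp only: mult_zero_left add_0_right)
    have "l2norm M g = 1" unfolding g_def l2norm_scale using False by (simp add: norm_divide)
    then have "l2norm M (T g) \<le> \<kappa>" unfolding \<kappa>_def A_def using g bdd[unfolded A_def] by (intro cSup_upper) auto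
    moreover have "l2norm M (T g) = l2norm M (\<lambda>x. of_real (1 / l2norm M f) * T f x)"
      using T_lincomb[OF Wl[OF f] Wl[OF f], of _ "of_real (1 / l2norm M f)" 0]
      by (intro l2norm_cong_AE AE_I2 T_measurable Wl g l2_measurable[OF l2_scale[OF T_l2[OF Wl[OF f]]]]) (simp add: g_def)
    then have "l2norm M (T g) = l2norm M (T f) / l2norm M f" unfolding l2norm_scale by (simp add: norm_divide)
    ultimately show ?thesis using False less_le l2norm_nonneg[of M f] by (simp add: field_simps)
  qed
  have f0W: "f0 \<in> W" using f0 by (simp add: W_def)
  have f0n: "0 < l2norm M f0"
  proof -
    have "l2norm M f0 \<noteq> 0" using f0(3) T_norm[OF f0(1)] by auto
    then show ?thesis using l2norm_nonneg[of M f0] by (simp add: less_le)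
  qed
  have "\<epsilon> * l2norm M f0 < \<kappa> * l2norm M f0" using f0(3) TW[OF f0W] by linarith
  then have \<kappa>: "\<epsilon> < \<kappa>" using f0n by simp
  then have \<kappa>0: "0 < \<kappa>" using \<epsilon> by linarith
  have "(\<lambda>x. 0) \<in> W" using l2_zero by (simp add: W_def)
  then have "A \<noteq> {}" unfolding A_def by (auto simp: l2norm_def intro!: exI[of _ "\<lambda>x. 0"])
  have "\<exists>f. f \<in> W \<and> l2norm M f \<le> 1 \<and> \<kappa> - 1 / real (Suc n) < l2norm M (T f)" for n
  proof -
    have "\<exists>a\<in>A. \<kappa> - 1 / real (Suc n) < a"
      using less_cSup_iff[OF \<open>A \<noteq> {}\<close> bdd, of "\<kappa> - 1 / real (Suc n)"] by (simp add: \<kappa>_def)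
    then show ?thesis by (auto simp: A_def)
  qed
  then obtain f where f: "\<And>n. f n \<in> W" "\<And>n. l2norm M (f n) \<le> 1" "\<And>n. \<kappa> - 1 / real (Suc n) < l2norm M (T (f n))"
    by metis
  obtain r h where r: "strict_mono r" and unif: "uniform_limit (space M) (\<lambda>n. T (f (r n))) h sequentially"
    using compact[of f] f Wl by blast
  define g where "g n = f (r n)" for n
  have g: "g n \<in> W" "l2norm M (g n) \<le> 1" for n using f by (auto simp: g_def)
  note gl = Wl[OF g(1)] and Tgl = T_l2[OF Wl[OF g(1)]]
  have up: "l2norm M (T (g n)) \<le> \<kappa>" for n
  proof -
    have "\<kappa> * l2norm M (g n) \<le> \<kappa> * 1" using g(2) \<kappa>0 by (intro mult_left_mono) auto
    then show ?thesis using TW[OF g(1), of n] by linarith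
  qed
  have lim_a: "(\<lambda>n. l2norm M (T (g n))) \<longlonglongrightarrow> \<kappa>"
  proof (rule tendsto_sandwich[of "\<lambda>n. \<kappa> - 1 / real (Suc n)" _ _ "\<lambda>n. \<kappa>"])
    have "\<kappa> - 1 / real (Suc n) \<le> l2norm M (T (g n))" for n
    proof -
      have "1 / real (Suc (r n)) \<le> 1 / real (Suc n)" using seq_suble[OF r, of n] by (intro divide_left_mono) auto
      then show ?thesis using f(3)[of "r n"] by (simp add: g_def)
    qed
    then show "eventually (\<lambda>n. \<kappa> - 1 / real (Suc n) \<le> l2norm M (T (g n))) sequentially" by simp
    show "(\<lambda>n. \<kappa> - 1 / real (Suc n)) \<longlonglongrightarrow> \<kappa>"
      using tendsto_diff[OF tendsto_const[of \<kappa>] LIMSEQ_inverse_real_of_nat] by (simp add: inverse_eq_divide)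
  qed (use up in auto)
  have pw: "(\<lambda>n. T (g n) x) \<longlonglongrightarrow> h x" if "x \<in> space M" for x
    using tendsto_uniform_limitI[OF unif that] by (simp add: g_def)
  have hm: "h \<in> borel_measurable M"
    using pw by (intro borel_measurable_LIMSEQ_metric[of "\<lambda>n. T (g n)" M h] T_measurable gl)
  have "norm (h x) \<le> sqrt total * C" if x: "x \<in> space M" for x
  proof (rule LIMSEQ_le_const2[OF tendsto_norm[OF pw[OF x]]])
    have "norm (T (g n) x) \<le> sqrt total * C" for n
    proof -
      have "sqrt total * C * l2norm M (g n) \<le> sqrt total * C * 1"
        using g(2) total_nonneg C_nonneg by (intro mult_left_mono) auto
      then show ?thesis using T_bound[OF gl x, of n] by linarith
    qed
    then show "\<exists>N. \<forall>n\<ge>N. norm (T (g n) x) \<le> sqrt total * C" by blast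
  qed
  then have hl: "h \<in> l2 M" using hm by (rule bounded_l2[rotated])
  define \<delta> where "\<delta> n = l2norm M (\<lambda>x. T (g n) x - h x)" for n
  have \<delta>: "\<delta> \<longlonglongrightarrow> 0"
  proof (rule LIMSEQ_I)
    fix e :: real assume e: "0 < e"
    define d where "d = sqrt total + 1"
    have d: "0 < d" "sqrt total \<le> d" using real_sqrt_ge_zero[OF total_nonneg] unfolding d_def by linarith+
    define e' where "e' = e / (2 * d)"
    have e': "0 < e'" using e d by (simp add: e'_def)
    have "sqrt total * e' \<le> d * e'" using d e' by (intro mult_right_mono) auto
    also have "\<dots> < e" using d e by (simp add: e'_def)
    finally have small: "sqrt total * e' < e" .
    have "eventually (\<lambda>n. \<forall>x\<in>space M. dist (T (g n) x) (h x) < e') sequentially"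
      using uniform_limitD[OF unif e'] by (simp add: g_def)
    then have "eventually (\<lambda>n. \<delta> n < e) sequentially"
    proof eventually_elim
      case (elim n)
      have "\<delta> n \<le> sqrt total * e'" unfolding \<delta>_def total_def
        using elim e' by (intro l2norm_le_bound l2_measurable[OF l2_diff[OF Tgl hl]]) (auto simp: dist_norm less_imp_le)
      then show ?case using small by linarith
    qed
    then show "\<exists>N. \<forall>n\<ge>N. norm (\<delta> n - 0) < e" by (auto simp: \<delta>_def eventually_sequentially)
  qed
  have \<delta>': "l2norm M (\<lambda>x. h x - T (g n) x) = \<delta> n" for n
    using l2norm_scale[of M "-1" "\<lambda>x. T (g n) x - h x"] by (simp add: \<delta>_def algebra_simps)
  have hW: "h \<in> W"
  proof -
    have "ip M h e = 0" if e: "e \<in> F" for e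
    proof -
      have "norm (ip M h e) \<le> \<delta> n * l2norm M e" for n
      proof -
        have "ip M (T (g n)) e = 0" using WT[OF g(1)] e by (auto simp: W_def)
        then have "ip M h e = ip M (\<lambda>x. h x - T (g n) x) e" using ip_diff_left[OF hl Tgl Fl[OF e]] by simp
        then show ?thesis using Cauchy_Schwarz[OF l2_diff[OF hl Tgl] Fl[OF e], of n] \<delta>' by simp
      qed
      moreover have "(\<lambda>n. \<delta> n * l2norm M e) \<longlonglongrightarrow> 0" using tendsto_mult_right[OF \<delta>, of "l2norm M e"] by simp
      ultimately have "norm (ip M h e) \<le> 0" by (intro LIMSEQ_le_const[of _ 0]) auto
      then show ?thesis by simp
    qed
    then show ?thesis using hl by (simp add: W_def)
  qed
  have hn: "l2norm M h = \<kappa>"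
  proof -
    have "\<bar>l2norm M (T (g n)) - l2norm M h\<bar> \<le> \<delta> n" for n
      using l2norm_triangle[OF l2_diff[OF Tgl[of n] hl] hl] l2norm_triangle[OF l2_diff[OF hl Tgl[of n]] Tgl[of n]] \<delta>'[of n]
      by (simp add: \<delta>_def abs_le_iff)
    then have "eventually (\<lambda>n. norm (l2norm M (T (g n)) - l2norm M h) \<le> \<delta> n) sequentially" by simp
    then have "(\<lambda>n. l2norm M (T (g n)) - l2norm M h) \<longlonglongrightarrow> 0" using \<delta> by (rule Lim_null_comparison)
    then have "(\<lambda>n. l2norm M (T (g n))) \<longlonglongrightarrow> l2norm M h" by (simp add: LIM_zero_iff)
    then show ?thesis using lim_a LIMSEQ_unique by blast
  qed
  define u where "u n = l2norm M (\<lambda>x. T (T (g n)) x - of_real (\<kappa>\<^sup>2) * g n x)" for n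
  have u: "u \<longlonglongrightarrow> 0"
  proof -
    have "(u n)\<^sup>2 \<le> \<kappa>\<^sup>2 * (\<kappa>\<^sup>2 - (l2norm M (T (g n)))\<^sup>2)" for n
    proof -
      define p where "p = T (T (g n))"
      have pl: "p \<in> l2 M" unfolding p_def by (intro T_l2 gl)
      define q where "q = (\<lambda>x. p x - of_real (\<kappa>\<^sup>2) * g n x)"
      have cg: "(\<lambda>x. of_real (\<kappa>\<^sup>2) * g n x) \<in> l2 M" by (intro l2_scale gl)
      have ql: "q \<in> l2 M" unfolding q_def by (intro l2_diff pl cg)
      have pg: "ip M p (g n) = of_real ((l2norm M (T (g n)))\<^sup>2)"
        unfolding p_def using T_symmetric[OF Tgl gl, of n n] ip_self[of M "T (g n)"] by simp
      have gp: "ip M (g n) p = of_real ((l2norm M (T (g n)))\<^sup>2)" using pg ip_cnj[of M p "g n"] by simp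
      have "ip M q q = ip M p q - of_real (\<kappa>\<^sup>2) * ip M (g n) q"
        unfolding q_def using ip_diff_left[OF pl cg ql] ip_scale_left[OF gl ql] by (simp add: q_def)
      also have "ip M p q = ip M p p - of_real (\<kappa>\<^sup>2) * ip M p (g n)"
        unfolding q_def using ip_diff_right[OF pl cg pl] ip_scale_right[OF gl pl] by simp
      also have "ip M (g n) q = ip M (g n) p - of_real (\<kappa>\<^sup>2) * ip M (g n) (g n)"
        unfolding q_def using ip_diff_right[OF pl cg gl] ip_scale_right[OF gl gl] by simp
      finally have "complex_of_real ((l2norm M q)\<^sup>2) = of_real ((l2norm M p)\<^sup>2 - \<kappa>\<^sup>2 * (l2norm M (T (g n)))\<^sup>2
          - \<kappa>\<^sup>2 * ((l2norm M (T (g n)))\<^sup>2 - \<kappa>\<^sup>2 * (l2norm M (g n))\<^sup>2))"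
        unfolding pg gp ip_self by (simp only: of_real_diff of_real_mult)
      then have eq: "(l2norm M q)\<^sup>2 = (l2norm M p)\<^sup>2 - \<kappa>\<^sup>2 * (l2norm M (T (g n)))\<^sup>2
          - \<kappa>\<^sup>2 * ((l2norm M (T (g n)))\<^sup>2 - \<kappa>\<^sup>2 * (l2norm M (g n))\<^sup>2)"
        by (simp only: of_real_eq_iff)
      have "(l2norm M p)\<^sup>2 \<le> (\<kappa> * l2norm M (T (g n)))\<^sup>2"
        unfolding p_def using TW[OF WT[OF g(1)]] by (intro power_mono) auto
      moreover have "\<kappa>\<^sup>2 * (\<kappa>\<^sup>2 * (l2norm M (g n))\<^sup>2) \<le> \<kappa>\<^sup>2 * (\<kappa>\<^sup>2 * 1)"
        using g(2) by (intro mult_left_mono power_le_one) auto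
      ultimately show ?thesis using eq unfolding u_def q_def p_def
        by (simp add: power_mult_distrib right_diff_distrib)
    qed
    then have ev: "eventually (\<lambda>n. norm ((u n)\<^sup>2) \<le> \<kappa>\<^sup>2 * (\<kappa>\<^sup>2 - (l2norm M (T (g n)))\<^sup>2)) sequentially" by simp
    have "(\<lambda>n. \<kappa>\<^sup>2 * (\<kappa>\<^sup>2 - (l2norm M (T (g n)))\<^sup>2)) \<longlonglongrightarrow> \<kappa>\<^sup>2 * (\<kappa>\<^sup>2 - \<kappa>\<^sup>2)"
      by (intro tendsto_intros lim_a)
    then have "(\<lambda>n. (u n)\<^sup>2) \<longlonglongrightarrow> 0" using Lim_null_comparison[OF ev] by simp
    then have "(\<lambda>n. sqrt ((u n)\<^sup>2)) \<longlonglongrightarrow> sqrt 0" by (rule tendsto_real_sqrt)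
    moreover have "0 \<le> u n" for n by (simp add: u_def)
    ultimately show ?thesis by simp
  qed
  note Thl = T_l2[OF hl] and TThl = T_l2[OF T_l2[OF hl]] and TTgl = T_l2[OF Tgl]
  define K where "K = total * C"
  have K: "0 \<le> K" using total_nonneg C_nonneg by (simp add: K_def)
  have Tdiff: "l2norm M (\<lambda>x. T a x - c * T b x) \<le> K * l2norm M (\<lambda>x. a x - c * b x)"
    if a: "a \<in> l2 M" and b: "b \<in> l2 M" for a b c
  proof -
    have "l2norm M (\<lambda>x. T a x - c * T b x) = l2norm M (T (\<lambda>x. a x - c * b x))"
      using T_lincomb[OF a b, of _ 1 "-c"] l2_lincomb[OF a b, of 1 "-c"] l2_lincomb[OF T_l2[OF a] T_l2[OF b], of 1 "-c"]
      by (intro l2norm_cong_AE AE_I2) (auto simp: l2_measurable T_measurable)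
    then show ?thesis using T_norm[OF l2_lincomb[OF a b, of 1 "-c"]] by (simp add: K_def)
  qed
  define c2 where "c2 = complex_of_real (\<kappa>\<^sup>2)"
  have c2g: "(\<lambda>x. c2 * g n x) \<in> l2 M" "(\<lambda>x. c2 * T (g n) x) \<in> l2 M" for n by (intro l2_scale gl Tgl)+
  have c2h: "(\<lambda>x. c2 * h x) \<in> l2 M" by (intro l2_scale hl)
  have w: "l2norm M (\<lambda>x. T h x - c2 * g n x) \<le> K * \<delta> n + u n" for n
  proof -
    have "l2norm M (\<lambda>x. T h x - c2 * g n x) \<le> l2norm M (\<lambda>x. T h x - T (T (g n)) x) + l2norm M (\<lambda>x. T (T (g n)) x - c2 * g n x)"
      by (intro l2norm_triangle_diff Thl TTgl c2g)
    then show ?thesis using Tdiff[OF hl Tgl, of 1 n] \<delta>'[of n] by (simp add: u_def c2_def)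
  qed
  have "l2norm M (\<lambda>x. T (T h) x - c2 * h x) \<le> K * (K * \<delta> n + u n) + \<kappa>\<^sup>2 * \<delta> n" for n
  proof -
    have "l2norm M (\<lambda>x. T (T h) x - c2 * h x) \<le> l2norm M (\<lambda>x. T (T h) x - c2 * T (g n) x) + l2norm M (\<lambda>x. c2 * T (g n) x - c2 * h x)"
      by (intro l2norm_triangle_diff TThl c2g c2h)
    also have "l2norm M (\<lambda>x. T (T h) x - c2 * T (g n) x) \<le> K * l2norm M (\<lambda>x. T h x - c2 * g n x)"
      by (rule Tdiff[OF Thl gl])
    also have "\<dots> \<le> K * (K * \<delta> n + u n)" using w K by (rule mult_left_mono)
    also have "l2norm M (\<lambda>x. c2 * T (g n) x - c2 * h x) = \<kappa>\<^sup>2 * \<delta> n"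
      using l2norm_scale[of M c2 "\<lambda>x. T (g n) x - h x"] by (simp add: \<delta>_def right_diff_distrib c2_def norm_power)
    finally show ?thesis by simp
  qed
  moreover have "(\<lambda>n. K * (K * \<delta> n + u n) + \<kappa>\<^sup>2 * \<delta> n) \<longlonglongrightarrow> K * (K * 0 + 0) + \<kappa>\<^sup>2 * 0"
    by (intro tendsto_intros \<delta> u)
  ultimately have "l2norm M (\<lambda>x. T (T h) x - c2 * h x) \<le> K * (K * 0 + 0) + \<kappa>\<^sup>2 * 0"
    by (intro LIMSEQ_le_const[of "\<lambda>n. K * (K * \<delta> n + u n) + \<kappa>\<^sup>2 * \<delta> n"]) auto
  then have "l2norm M (\<lambda>x. T (T h) x - c2 * h x) = 0"
    using l2norm_nonneg[of M "\<lambda>x. T (T h) x - c2 * h x"] by simp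
  then have TTh: "AE x in M. T (T h) x = c2 * h x"
    using l2norm_eq_0_iff[OF l2_diff[OF TThl c2h]] by simp
  define v where "v = (\<lambda>x. 1 * T h x + of_real \<kappa> * h x)"
  have vW: "v \<in> W" unfolding v_def by (rule Wlin[OF WT[OF hW] hW])
  show ?thesis
  proof (cases "l2norm M v = 0")
    case False
    have "AE x in M. T v x = of_real \<kappa> * v x"
      using TTh AE_space
    proof eventually_elim
      case (elim x)
      then have "T v x = c2 * h x + of_real \<kappa> * T h x"
        unfolding v_def using T_lincomb[OF Thl hl, of x 1 "of_real \<kappa>"] by simp
      then show ?case by (simp add: v_def c2_def power2_eq_square algebra_simps)
    qed
    then have "v \<in> eig (of_real \<kappa>)" using Wl[OF vW] by (simp add: eig_def)
    then show ?thesis using False vW \<kappa> \<kappa>0 by (intro exI[of _ v] exI[of _ "of_real \<kappa>"]) (auto simp: W_def)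
  next
    case True
    then have "AE x in M. v x = 0" using l2norm_eq_0_iff[OF Wl[OF vW]] by simp
    then have "AE x in M. T h x = of_real (- \<kappa>) * h x"
      by eventually_elim (simp add: v_def eq_neg_iff_add_eq_0)
    then have "h \<in> eig (of_real (- \<kappa>))" using hl by (simp add: eig_def)
    then show ?thesis using hn \<kappa>0 \<kappa> hW by (intro exI[of _ h] exI[of _ "of_real (- \<kappa>)"]) (auto simp: W_def)
  qed
qed

end

text \<open>The numbers in an infinite set, of which only finitely many exceed any given positive bound in
  absolute value, can be listed by decreasing absolute value: always pick a largest one among those
  not yet listed.\<close>

lemma decreasing_enumeration:
  fixes A :: "complex set"
  assumes inf: "infinite A" and 0: "0 \<notin> A" and fin: "\<And>\<epsilon>. 0 < \<epsilon> \<Longrightarrow> finite {a\<in>A. \<epsilon> \<le> norm a}"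
  obtains \<alpha> :: "nat \<Rightarrow> complex" where "bij_betw \<alpha> UNIV A" "decseq (\<lambda>i. norm (\<alpha> i))" "(\<lambda>i. norm (\<alpha> i)) \<longlonglongrightarrow> 0"
proof -
  have ex: "\<exists>a. a \<in> A - B \<and> (\<forall>b\<in>A - B. norm b \<le> norm a)" if B: "finite B" for B
  proof -
    have "A - B \<noteq> {}" using inf B by (metis Diff_eq_empty_iff finite_subset)
    then obtain c where c: "c \<in> A - B" by blast
    define K where "K = {a\<in>A - B. norm c \<le> norm a}"
    have "0 < norm c" using c 0 by auto
    then have "finite {a\<in>A. norm c \<le> norm a}" by (rule fin)
    then have K: "finite K" by (rule finite_subset[rotated]) (auto simp: K_def)
    have "c \<in> K" using c by (simp add: K_def)
    then obtain a where a: "a \<in> K" "Max (norm ` K) = norm a"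
      using Max_in[of "norm ` K"] K by fastforce
    have "norm b \<le> norm a" if b: "b \<in> A - B" for b
    proof (cases "b \<in> K")
      case True
      then show ?thesis using Max_ge[of "norm ` K" "norm b"] K a(2) by simp
    next
      case False
      then show ?thesis using b a(1) by (simp add: K_def)
    qed
    then show ?thesis using a(1) by (auto simp: K_def)
  qed
  define pick where "pick B = (SOME a. a \<in> A - B \<and> (\<forall>b\<in>A - B. norm b \<le> norm a))" for B
  have pick: "pick B \<in> A - B" "\<And>b. b \<in> A - B \<Longrightarrow> norm b \<le> norm (pick B)" if "finite B" for B
    using someI_ex[OF ex[OF that]] unfolding pick_def by auto
  define L where "L = rec_nat [] (\<lambda>n l. l @ [pick (set l)])"
  define \<alpha> where "\<alpha> n = pick (set (L n))" for n
  have L0: "L 0 = []" and LS: "L (Suc n) = L n @ [\<alpha> n]" for n by (simp_all add: L_def \<alpha>_def)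
  have setL: "set (L n) = \<alpha> ` {..<n}" for n
    by (induction n) (auto simp: L0 LS lessThan_Suc)
  have \<alpha>: "\<alpha> n \<in> A - \<alpha> ` {..<n}" "\<And>b. b \<in> A - \<alpha> ` {..<n} \<Longrightarrow> norm b \<le> norm (\<alpha> n)" for n
    using pick[of "\<alpha> ` {..<n}"] unfolding \<alpha>_def[of n] setL by auto
  have inj: "inj \<alpha>"
  proof (rule linorder_injI)
    fix m n :: nat assume "m < n"
    then show "\<alpha> m \<noteq> \<alpha> n" using \<alpha>(1)[of n] by (metis DiffE imageI lessThan_iff)
  qed
  have dec: "decseq (\<lambda>i. norm (\<alpha> i))"
  proof (rule decseq_SucI)
    fix n
    have "\<alpha> (Suc n) \<in> A - \<alpha> ` {..<n}" using \<alpha>(1)[of "Suc n"] by auto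
    then show "norm (\<alpha> (Suc n)) \<le> norm (\<alpha> n)" by (rule \<alpha>(2))
  qed
  have small: "\<exists>n. norm (\<alpha> n) < \<epsilon>" if "0 < \<epsilon>" for \<epsilon>
  proof (rule ccontr)
    assume "\<not> (\<exists>n. norm (\<alpha> n) < \<epsilon>)"
    then have "range \<alpha> \<subseteq> {a\<in>A. \<epsilon> \<le> norm a}" using \<alpha>(1) by (auto simp: not_less)
    then have "finite (range \<alpha>)" using fin[OF that] by (rule finite_subset)
    then show False using inj by (simp add: finite_image_iff)
  qed
  have "(\<lambda>i. norm (\<alpha> i)) \<longlonglongrightarrow> 0"
  proof (rule LIMSEQ_I)
    fix \<epsilon> :: real assume "0 < \<epsilon>"
    then obtain n where "norm (\<alpha> n) < \<epsilon>" using small by blast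
    then show "\<exists>no. \<forall>n\<ge>no. norm (norm (\<alpha> n) - 0) < \<epsilon>"
      using decseqD[OF dec] by (intro exI[of _ n]) (auto intro: le_less_trans)
  qed
  moreover have "range \<alpha> = A"
  proof
    show "A \<subseteq> range \<alpha>"
    proof (rule ccontr)
      assume "\<not> A \<subseteq> range \<alpha>"
      then obtain a where a: "a \<in> A" "a \<notin> range \<alpha>" by blast
      then have "norm a \<le> norm (\<alpha> n)" for n using \<alpha>(2)[of a n] by auto
      moreover have "0 < norm a" using a 0 by auto
      ultimately show False using small[of "norm a"] by (meson not_less)
    qed
  qed (use \<alpha>(1) in auto)
  ultimately show thesis using that inj dec by (simp add: bij_betw_def)
qed

context compact_symmetric_kernel
begin

definition evs :: "complex set" where
  "evs = {\<alpha>. \<exists>f\<in>eig \<alpha>. l2norm M f \<noteq> 0}"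

lemma eigenvalues_above_finite:
  assumes \<epsilon>: "0 < \<epsilon>"
  shows "finite {\<alpha>\<in>evs. \<epsilon> \<le> norm \<alpha>}"
proof (rule ccontr)
  define N where "N = nat \<lceil>(total * C)\<^sup>2 / \<epsilon>\<^sup>2\<rceil>"
  assume "infinite {\<alpha>\<in>evs. \<epsilon> \<le> norm \<alpha>}"
  then obtain A where A: "A \<subseteq> {\<alpha>\<in>evs. \<epsilon> \<le> norm \<alpha>}" "finite A" "card A = Suc N"
    using infinite_arbitrarily_large by blast
  have "\<exists>e. e \<in> eig \<alpha> \<and> l2norm M e = 1" if \<alpha>: "\<alpha> \<in> evs" for \<alpha>
  proof -
    obtain f where f: "f \<in> eig \<alpha>" "l2norm M f \<noteq> 0" using \<alpha> by (auto simp: evs_def)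
    have "(\<lambda>x. of_real (1 / l2norm M f) * f x) \<in> eig \<alpha>" 
      using eig_lincomb[OF f(1) f(1), of "of_real (1 / l2norm M f)" 0] by (simp only: mult_zero_left add_0_right)
    moreover have "l2norm M (\<lambda>x. of_real (1 / l2norm M f) * f x) = 1" unfolding l2norm_scale using f(2) by (simp add: norm_divide)
    ultimately show ?thesis by blast
  qed
  then obtain e where e: "\<And>\<alpha>. \<alpha> \<in> evs \<Longrightarrow> e \<alpha> \<in> eig \<alpha>" "\<And>\<alpha>. \<alpha> \<in> evs \<Longrightarrow> l2norm M (e \<alpha>) = 1" by metis
  have A': "A \<subseteq> evs" using A by blast
  have one: "ip M (e \<alpha>) (e \<alpha>) = 1" if "\<alpha> \<in> A" for \<alpha> using e(2) A' that by (auto simp: ip_self)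
  have orth: "ip M (e \<alpha>) (e \<beta>) = 0" if "\<alpha> \<in> A" "\<beta> \<in> A" "\<alpha> \<noteq> \<beta>" for \<alpha> \<beta>
    using eig_orthogonal[OF e(1) e(1)] A' that by auto
  have inj: "inj_on e A" by (rule inj_onI) (metis one orth zero_neq_one)
  have "ip M (e \<alpha>) (e \<beta>) = (if e \<alpha> = e \<beta> then 1 else 0)" if "\<alpha> \<in> A" "\<beta> \<in> A" for \<alpha> \<beta>
    using one orth inj_onD[OF inj _ that] that by (cases "\<alpha> = \<beta>") auto
  moreover have "e ` A \<subseteq> l2 M" using e(1) A' eig_l2 by blast
  ultimately have "orthonormal M (e ` A)" by (simp add: orthonormal_def)
  then have "card (e ` A) \<le> N"
    unfolding N_def using A e(1) by (intro eigen_card_bound \<epsilon>) auto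
  then show False using A(3) card_image[OF inj] by simp
qed

lemma evs_countable: "countable evs"
proof -
  have "evs \<subseteq> {0} \<union> (\<Union>n::nat. {\<alpha>\<in>evs. 1 / real (Suc n) \<le> norm \<alpha>})"
  proof
    fix \<alpha> assume \<alpha>: "\<alpha> \<in> evs"
    show "\<alpha> \<in> {0} \<union> (\<Union>n::nat. {\<alpha>\<in>evs. 1 / real (Suc n) \<le> norm \<alpha>})"
    proof (cases "\<alpha> = 0")
      case False
      then obtain n where "inverse (real (Suc n)) < norm \<alpha>" using reals_Archimedean[of "norm \<alpha>"] by auto
      then show ?thesis using \<alpha> by (auto simp: inverse_eq_divide intro!: exI[of _ n])
    qed simp
  qed
  moreover have "countable ({0} \<union> (\<Union>n::nat. {\<alpha>\<in>evs. 1 / real (Suc n) \<le> norm \<alpha>}))"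
    using eigenvalues_above_finite by (intro countable_Un countable_UN) (auto intro: countable_finite)
  ultimately show ?thesis by (rule countable_subset)
qed

lemma evs_real: "\<alpha> \<in> evs \<Longrightarrow> \<alpha> \<in> \<real>"
  unfolding evs_def using eigenvalue_real by blast

definition kernel_finite :: bool where
  "kernel_finite \<longleftrightarrow> (\<exists>N. \<forall>F. finite F \<longrightarrow> F \<subseteq> eig 0 \<longrightarrow> orthonormal M F \<longrightarrow> card F \<le> N)"

lemma eigenspace_basis:
  assumes k: kernel_finite
  shows "\<exists>F. finite F \<and> F \<subseteq> eig \<alpha> \<and> orthonormal M F \<and> (\<forall>f\<in>eig \<alpha>. AE x in M. f x = proj M F f x)"
proof -
  obtain N where N: "\<And>F. finite F \<Longrightarrow> F \<subseteq> eig \<alpha> \<Longrightarrow> orthonormal M F \<Longrightarrow> card F \<le> N"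
  proof (cases "\<alpha> = 0")
    case True
    then show thesis using k that unfolding kernel_finite_def by blast
  next
    case False
    then show thesis using that[of "nat \<lceil>(total * C)\<^sup>2 / (norm \<alpha>)\<^sup>2\<rceil>"] eigen_card_bound[of _ "norm \<alpha>"] by force
  qed
  show ?thesis
    by (rule finite_orthonormal_basis[where N = N]) (use eig_l2 eig_lincomb eig_zero N in auto)
qed

text \<open>The projections of \<open>f\<close> to the sums of the eigenspaces for eigenvalues above \<open>1 / n\<close> converge, by
  Bessel's inequality and completeness. The remainder \<open>r\<close> is orthogonal to all these eigenspaces,
  so that \<open>T r = 0\<close>: otherwise there would be another eigenvector. Hence \<open>r\<close> lies in the kernel.\<close>

lemma eigenbasis_exists:
  assumes k: kernel_finite
  shows "\<exists>E. orthonormal M E \<and> (\<forall>e\<in>E. \<exists>\<alpha>\<in>evs. e \<in> eig \<alpha>) \<and> (\<forall>\<alpha>. finite (E \<inter> eig \<alpha>)) \<and>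
    (\<forall>f\<in>l2 M. \<forall>\<epsilon>>0. \<exists>F c. finite F \<and> F \<subseteq> E \<and> l2norm M (\<lambda>x. f x - (\<Sum>e\<in>F. c e * e x)) < \<epsilon>)"
proof -
  obtain B where B: "\<And>\<alpha>. finite (B \<alpha>)" "\<And>\<alpha>. B \<alpha> \<subseteq> eig \<alpha>" "\<And>\<alpha>. orthonormal M (B \<alpha>)"
    "\<And>\<alpha> f. f \<in> eig \<alpha> \<Longrightarrow> AE x in M. f x = proj M (B \<alpha>) f x"
    using eigenspace_basis[OF k] by metis
  define E where "E = (\<Union>\<alpha>. B \<alpha>)"
  have n1: "ip M e e = 1" if "e \<in> B \<alpha>" for e \<alpha> using B(3)[of \<alpha>] that by (auto simp: orthonormal_def)
  have nz: "l2norm M e \<noteq> 0" if "e \<in> B \<alpha>" for e \<alpha> using n1[OF that] ip_self[of M e] by auto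
  have "ip M e e' = (if e = e' then 1 else 0)" if ee: "e \<in> E" "e' \<in> E" for e e'
  proof -
    obtain \<alpha> \<beta> where ab: "e \<in> B \<alpha>" "e' \<in> B \<beta>" using ee by (auto simp: E_def)
    show ?thesis
    proof (cases "\<alpha> = \<beta>")
      case True
      then show ?thesis using B(3)[of \<alpha>] ab by (auto simp: orthonormal_def)
    next
      case False
      then have "ip M e e' = 0" using eig_orthogonal[of e \<alpha> e' \<beta>] B(2) ab by blast
      then show ?thesis using n1[OF ab(1)] by auto
    qed
  qed
  then have on: "orthonormal M E" using B(3) by (auto simp: orthonormal_def E_def)
  have uniq: "\<alpha> = \<beta>" if "e \<in> B \<alpha>" "e \<in> eig \<beta>" for e \<alpha> \<beta>
    using eig_orthogonal[of e \<alpha> e \<beta>] n1[OF that(1)] B(2) that by (metis subsetD zero_neq_one)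
  have inE: "\<exists>\<alpha>\<in>evs. e \<in> eig \<alpha>" if "e \<in> E" for e
    using that B(2) nz unfolding E_def evs_def by blast
  have "E \<inter> eig \<alpha> \<subseteq> B \<alpha>" for \<alpha> unfolding E_def using uniq by blast
  then have finE: "finite (E \<inter> eig \<alpha>)" for \<alpha> using B(1) finite_subset by blast
  have "\<exists>F c. finite F \<and> F \<subseteq> E \<and> l2norm M (\<lambda>x. f x - (\<Sum>e\<in>F. c e * e x)) < \<epsilon>"
    if f: "f \<in> l2 M" and \<epsilon>: "0 < \<epsilon>" for f \<epsilon>
  proof -
    define F where "F n = (\<Union>\<alpha>\<in>{\<alpha>\<in>evs. 1 / real (Suc n) \<le> norm \<alpha>}. B \<alpha>)" for n
    have finF: "finite (F n)" for n unfolding F_def by (intro finite_UN_I eigenvalues_above_finite B(1)) auto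
    have FE: "F n \<subseteq> E" for n by (auto simp: F_def E_def)
    have onF: "orthonormal M (F n)" for n by (rule orthonormal_subset[OF on FE])
    have mono: "F m \<subseteq> F n" if "m \<le> n" for m n
    proof -
      have "1 / real (Suc n) \<le> 1 / real (Suc m)" using that by (intro divide_left_mono) auto
      then show ?thesis unfolding F_def by (intro UN_mono) auto
    qed
    define b where "b n = (\<Sum>e\<in>F n. (norm (ip M f e))\<^sup>2)" for n
    have bmono: "incseq b" unfolding b_def incseq_def by (auto intro!: sum_mono2 finF mono)
    have "b n \<le> (l2norm M f)\<^sup>2" for n unfolding b_def by (rule Bessel[OF onF finF f])
    then have "convergent b" by (intro Bseq_monoseq_convergent BseqI'[where K = "(l2norm M f)\<^sup>2"] incseq_imp_monoseq bmono)
      (auto simp: b_def sum_nonneg)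
    then have cau: "Cauchy b" by (rule convergent_Cauchy)
    define S where "S n = proj M (F n) f" for n
    have Sl: "S n \<in> l2 M" for n unfolding S_def by (rule proj_l2[OF onF])
    have Sdiff: "(l2norm M (\<lambda>x. S n x - S m x))\<^sup>2 = b n - b m" if "m \<le> n" for m n
    proof -
      have "(\<lambda>x. S n x - S m x) = proj M (F n - F m) f"
        unfolding S_def proj_def by (intro ext) (simp add: sum_diff[OF finF mono[OF that]])
      moreover have "(l2norm M (proj M (F n - F m) f))\<^sup>2 = (\<Sum>e\<in>F n - F m. (norm (ip M f e))\<^sup>2)"
        using finF by (intro proj_self orthonormal_subset[OF onF[of n]] f) auto
      ultimately show ?thesis unfolding b_def using sum_diff[OF finF mono[OF that]] by metis
    qed
    have sw: "l2norm M (\<lambda>x. S n x - S m x) = l2norm M (\<lambda>x. S m x - S n x)" for m n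
      using l2norm_scale[of M "-1" "\<lambda>x. S n x - S m x"] by (simp add: algebra_simps)
    have "\<exists>N. \<forall>m\<ge>N. \<forall>n\<ge>N. l2norm M (\<lambda>x. S m x - S n x) \<le> \<eta>" if \<eta>: "0 < \<eta>" for \<eta>
    proof -
      have "0 < \<eta>\<^sup>2" using \<eta> by simp
      then obtain N where N: "\<And>m n. m \<ge> N \<Longrightarrow> n \<ge> N \<Longrightarrow> dist (b m) (b n) < \<eta>\<^sup>2"
        using cau unfolding Cauchy_def by metis
      have *: "l2norm M (\<lambda>x. S n x - S m x) \<le> \<eta>" if "N \<le> m" "m \<le> n" for m n
      proof (rule power2_le_imp_le)
        have "b n - b m \<le> dist (b n) (b m)" by (simp add: dist_real_def)
        also have "\<dots> < \<eta>\<^sup>2" using that by (intro N) auto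
        finally show "(l2norm M (\<lambda>x. S n x - S m x))\<^sup>2 \<le> \<eta>\<^sup>2" using Sdiff[OF that(2)] by simp
      qed (use \<eta> in simp)
      have "l2norm M (\<lambda>x. S m x - S n x) \<le> \<eta>" if "N \<le> m" "N \<le> n" for m n
        using *[of m n] *[of n m] sw[of m n] that by (cases "m \<le> n") auto
      then show ?thesis by blast
    qed
    then obtain s where s: "s \<in> l2 M" "(\<lambda>n. l2norm M (\<lambda>x. S n x - s x)) \<longlonglongrightarrow> 0"
      using l2_complete[of S] Sl by blast
    define r where "r = (\<lambda>x. f x - s x)"
    have r: "r \<in> l2 M" unfolding r_def by (intro l2_diff f s)
    have rE: "ip M r e = 0" if e: "e \<in> F n" for e n
    proof -
      have el: "e \<in> l2 M" using onF[of n] e by (auto simp: orthonormal_def)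
      have "norm (ip M r e) \<le> l2norm M (\<lambda>x. S m x - s x) * l2norm M e" if m: "n \<le> m" for m
      proof -
        have "ip M (\<lambda>x. f x - S m x) e = 0"
          unfolding S_def using mono[OF m] e by (intro proj_orthogonal onF finF f) auto
        then have "ip M r e = ip M (\<lambda>x. S m x - s x) e"
          using ip_diff_left[OF f s(1) el] ip_diff_left[OF f Sl[of m] el] ip_diff_left[OF Sl[of m] s(1) el] by (simp add: r_def)
        then show ?thesis using Cauchy_Schwarz[OF l2_diff[OF Sl[of m] s(1)] el] by simp
      qed
      moreover have "(\<lambda>m. l2norm M (\<lambda>x. S m x - s x) * l2norm M e) \<longlonglongrightarrow> 0"
        using tendsto_mult_right[OF s(2), of "l2norm M e"] by simp
      ultimately have "norm (ip M r e) \<le> 0" by (intro LIMSEQ_le_const) auto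
      then show ?thesis by simp
    qed
    have Tr: "l2norm M (T r) \<le> 1 / real (Suc n) * l2norm M r" for n
    proof (rule ccontr)
      assume "\<not> l2norm M (T r) \<le> 1 / real (Suc n) * l2norm M r"
      moreover have "\<exists>\<alpha>. e \<in> eig \<alpha>" if "e \<in> F n" for e using inE FE that by blast
      ultimately obtain v \<alpha> where v: "v \<in> eig \<alpha>" "l2norm M v \<noteq> 0" "\<forall>e\<in>F n. ip M v e = 0" "1 / real (Suc n) < norm \<alpha>"
        using eigenvector_exists[of "F n" "1 / real (Suc n)" r] r rE[of _ n] by auto
      then have "\<alpha> \<in> evs" by (auto simp: evs_def)
      then have "B \<alpha> \<subseteq> F n" unfolding F_def using v(4) by auto
      then have "proj M (B \<alpha>) v x = 0" for x using v(3) by (auto simp: proj_def intro!: sum.neutral)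
      then have "AE x in M. v x = 0" using B(4)[OF v(1)] by simp
      then show False using v(2) l2norm_eq_0_iff[OF eig_l2[OF v(1)]] by simp
    qed
    have "(\<lambda>n. 1 / real (Suc n) * l2norm M r) \<longlonglongrightarrow> 0 * l2norm M r"
      using LIMSEQ_inverse_real_of_nat by (intro tendsto_mult tendsto_const) (simp add: inverse_eq_divide)
    then have "l2norm M (T r) \<le> 0" using Tr by (intro LIMSEQ_le_const[of _ "0::real"]) auto
    then have "AE x in M. T r x = 0" using l2norm_eq_0_iff[OF T_l2[OF r]] l2norm_nonneg[of M "T r"] by simp
    then have "r \<in> eig 0" using r by (simp add: eig_def)
    then have rp: "AE x in M. r x = proj M (B 0) r x" by (rule B(4))
    have "eventually (\<lambda>n. l2norm M (\<lambda>x. S n x - s x) < \<epsilon>) sequentially"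
      using order_tendstoD(2)[OF s(2) \<epsilon>] .
    then obtain n where n: "l2norm M (\<lambda>x. S n x - s x) < \<epsilon>" by (auto simp: eventually_sequentially)
    define c where "c e = (if e \<in> F n then ip M f e else ip M r e)" for e
    have "F n \<inter> B 0 = {}"
    proof (rule ccontr)
      assume "F n \<inter> B 0 \<noteq> {}"
      then obtain e \<alpha> where "e \<in> B \<alpha>" "e \<in> B 0" "1 / real (Suc n) \<le> norm \<alpha>" by (auto simp: F_def)
      then have "\<alpha> = 0" using uniq B(2) by blast
      then show False using \<open>1 / real (Suc n) \<le> norm \<alpha>\<close> by simp
    qed
    then have "(\<Sum>e\<in>F n \<union> B 0. c e * e x) = (\<Sum>e\<in>F n. c e * e x) + (\<Sum>e\<in>B 0. c e * e x)" for x
      using finF B(1) by (intro sum.union_disjoint)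
    also have "\<dots> x = S n x + proj M (B 0) r x" for x
      unfolding S_def proj_def c_def using \<open>F n \<inter> B 0 = {}\<close>
      by (intro arg_cong2[where f = "(+)"] sum.cong refl) auto
    finally have sum: "(\<Sum>e\<in>F n \<union> B 0. c e * e x) = S n x + proj M (B 0) r x" for x .
    have pl: "proj M (B 0) r \<in> l2 M" by (rule proj_l2[OF B(3)])
    have "l2norm M (\<lambda>x. f x - (\<Sum>e\<in>F n \<union> B 0. c e * e x)) = l2norm M (\<lambda>x. S n x - s x)"
    proof -
      have "l2norm M (\<lambda>x. f x - (\<Sum>e\<in>F n \<union> B 0. c e * e x)) = l2norm M (\<lambda>x. s x - S n x)"
        unfolding sum
      proof (rule l2norm_cong_AE)
        show "AE x in M. f x - (S n x + proj M (B 0) r x) = s x - S n x"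
          using rp by eventually_elim (simp add: r_def algebra_simps)
        show "(\<lambda>x. f x - (S n x + proj M (B 0) r x)) \<in> borel_measurable M"
          by (intro l2_measurable l2_diff l2_add f Sl pl)
        show "(\<lambda>x. s x - S n x) \<in> borel_measurable M" by (intro l2_measurable l2_diff Sl s)
      qed
      also have "\<dots> = l2norm M (\<lambda>x. S n x - s x)"
        using l2norm_scale[of M "-1" "\<lambda>x. S n x - s x"] by (simp add: algebra_simps)
      finally show ?thesis .
    qed
    then have "l2norm M (\<lambda>x. f x - (\<Sum>e\<in>F n \<union> B 0. c e * e x)) < \<epsilon>" using n by simp
    moreover have "F n \<union> B 0 \<subseteq> E" using FE by (auto simp: E_def)
    ultimately show ?thesis using finF[of n] B(1)[of 0] by (intro exI[of _ "F n \<union> B 0"] exI[of _ c]) auto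
  qed
  then show ?thesis using on inE finE by (intro exI[of _ E]) blast
qed

text \<open>If there are orthonormal families of every finite size, then there are infinitely many eigenvalues:
  otherwise the eigenbasis would be finite, and Parseval's identity for it, combined with Bessel's
  inequality for the given family, bounds the size of the family.\<close>

lemma infinitely_many_eigenvalues:
  assumes k: kernel_finite and H: "\<And>n. \<exists>H. finite H \<and> card H = n \<and> orthonormal M H"
  shows "infinite (evs - {0})"
proof
  assume "finite (evs - {0})"
  then have fe: "finite evs" by simp
  obtain E where on: "orthonormal M E" and ev: "\<forall>e\<in>E. \<exists>\<alpha>\<in>evs. e \<in> eig \<alpha>" and fin: "\<forall>\<alpha>. finite (E \<inter> eig \<alpha>)"
    and dense: "\<forall>f\<in>l2 M. \<forall>\<epsilon>>0. \<exists>F c. finite F \<and> F \<subseteq> E \<and> l2norm M (\<lambda>x. f x - (\<Sum>e\<in>F. c e * e x)) < \<epsilon>"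
    using eigenbasis_exists[OF k] by blast
  have "E = (\<Union>\<alpha>\<in>evs. E \<inter> eig \<alpha>)" using ev by blast
  then have finE: "finite E" using fe fin by (metis finite_UN)
  have El: "e \<in> l2 M" if "e \<in> E" for e using on that by (auto simp: orthonormal_def)
  note n1 = orthonormal_norm
  obtain H where H: "finite H" "card H = Suc (card E)" "orthonormal M H" using H[of "Suc (card E)"] by auto
  have Hl: "h \<in> l2 M" if "h \<in> H" for h using H(3) that by (auto simp: orthonormal_def)
  have parseval: "(\<Sum>e\<in>E. (norm (ip M h e))\<^sup>2) = 1" if h: "h \<in> H" for h
  proof -
    define q where "q = (\<lambda>x. h x - proj M E h x)"
    note hl = Hl[OF h]
    have ql: "q \<in> l2 M" unfolding q_def by (intro l2_diff hl proj_l2 on)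
    have qe: "ip M e q = 0" if e: "e \<in> E" for e
    proof -
      have "ip M q e = 0" unfolding q_def by (rule proj_orthogonal[OF on finE hl e])
      then show ?thesis using ip_cnj[of M q e] by auto
    qed
    have "(l2norm M q)\<^sup>2 \<le> l2norm M q * \<epsilon>" if \<epsilon>: "0 < \<epsilon>" for \<epsilon>
    proof -
      obtain F c where F: "finite F" "F \<subseteq> E" "l2norm M (\<lambda>x. h x - (\<Sum>e\<in>F. c e * e x)) < \<epsilon>"
        using dense[rule_format, OF hl \<epsilon>] by auto
      have pl: "(\<lambda>x. \<Sum>e\<in>F. c e * e x) \<in> l2 M" using F(2) El by (intro l2_sum) auto
      have z: "ip M (\<lambda>x. \<Sum>e\<in>A. d e * e x) q = 0" if "A \<subseteq> E" for A d
      proof -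
        have "ip M (\<lambda>x. \<Sum>e\<in>A. d e * e x) q = (\<Sum>e\<in>A. d e * ip M e q)" using that El by (intro ip_sum_left ql) auto
        also have "\<dots> = 0" using that qe by (intro sum.neutral) auto
        finally show ?thesis .
      qed
      have "ip M q q = ip M h q" using ip_diff_left[OF hl proj_l2[OF on] ql, of h] z[of E "ip M h"]
        by (simp add: q_def proj_def)
      also have "\<dots> = ip M (\<lambda>x. h x - (\<Sum>e\<in>F. c e * e x)) q"
        using ip_diff_left[OF hl pl ql] z[OF F(2)] by simp
      finally have "(l2norm M q)\<^sup>2 = norm (ip M (\<lambda>x. h x - (\<Sum>e\<in>F. c e * e x)) q)"
        by (metis ip_self norm_of_real abs_of_nonneg zero_le_power2)
      also have "\<dots> \<le> l2norm M (\<lambda>x. h x - (\<Sum>e\<in>F. c e * e x)) * l2norm M q"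
        by (intro Cauchy_Schwarz l2_diff hl pl ql)
      also have "\<dots> \<le> \<epsilon> * l2norm M q" using F(3) by (intro mult_right_mono) auto
      finally show ?thesis by (simp add: mult.commute)
    qed
    then have *: "l2norm M q * l2norm M q \<le> l2norm M q * \<epsilon>" if "0 < \<epsilon>" for \<epsilon>
      using that unfolding power2_eq_square by blast
    have "l2norm M q = 0"
    proof (rule ccontr)
      assume "l2norm M q \<noteq> 0"
      then have "0 < l2norm M q" using l2norm_nonneg[of M q] by linarith
      then show False using *[of "l2norm M q / 2"] by simp
    qed
    then have "(l2norm M q)\<^sup>2 = 0" by simp
    then show ?thesis using proj_norm[OF on finE hl] n1[OF H(3) h] by (simp add: q_def)
  qed
  have "real (card H) = (\<Sum>h\<in>H. \<Sum>e\<in>E. (norm (ip M h e))\<^sup>2)" using parseval by simp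
  also have "\<dots> = (\<Sum>e\<in>E. \<Sum>h\<in>H. (norm (ip M h e))\<^sup>2)" by (rule sum.swap)
  also have "\<dots> = (\<Sum>e\<in>E. \<Sum>h\<in>H. (norm (ip M e h))\<^sup>2)"
  proof (intro sum.cong refl)
    fix e h
    have "norm (ip M h e) = norm (cnj (ip M e h))" by (simp add: ip_cnj)
    then show "(norm (ip M h e))\<^sup>2 = (norm (ip M e h))\<^sup>2" by simp
  qed
  also have "\<dots> \<le> (\<Sum>e\<in>E. (l2norm M e)\<^sup>2)" by (intro sum_mono Bessel H El)
  also have "\<dots> = real (card E)" using n1[OF on] by simp
  finally show False using H(2) by simp
qed

end

section \<open>The kernel of the operator\<close>

context metric_graph
begin

lemma dense_sequence: "\<exists>d :: nat \<Rightarrow> 'a. range d \<subseteq> \<Gamma> \<and> (\<forall>x\<in>\<Gamma>. \<forall>\<epsilon>>0. \<exists>i. dist (d i) x < \<epsilon>)"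
proof -
  have "\<exists>k. finite k \<and> k \<subseteq> \<Gamma> \<and> \<Gamma> \<subseteq> (\<Union>x\<in>k. ball x (1 / real (Suc n)))" for n
  proof -
    have "\<Gamma> \<subseteq> (\<Union>x\<in>\<Gamma>. ball x (1 / real (Suc n)))" by (auto intro!: bexI)
    then show ?thesis
      using compactE_image[OF compact_graph, of \<Gamma> "\<lambda>x. ball x (1 / real (Suc n))"] by (metis open_ball)
  qed
  then obtain k where k: "\<And>n. finite (k n)" "\<And>n. k n \<subseteq> \<Gamma>" "\<And>n. \<Gamma> \<subseteq> (\<Union>x\<in>k n. ball x (1 / real (Suc n)))" by metis
  define A where "A = (\<Union>n. k n)"
  have A: "countable A" "A \<subseteq> \<Gamma>" unfolding A_def using k(1,2) by (auto intro: countable_finite)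
  have "A \<noteq> {}" using k(3)[of 0] graph_nonempty by (auto simp: A_def)
  then have r: "range (from_nat_into A) = A" using A(1) by (rule range_from_nat_into)
  have "\<exists>i. dist (from_nat_into A i) x < \<epsilon>" if x: "x \<in> \<Gamma>" and \<epsilon>: "0 < \<epsilon>" for x \<epsilon>
  proof -
    obtain n where n: "inverse (real (Suc n)) < \<epsilon>" using reals_Archimedean[OF \<epsilon>] by blast
    obtain a where a: "a \<in> k n" "dist a x < 1 / real (Suc n)" using k(3)[of n] x by auto
    then have "a \<in> range (from_nat_into A)" unfolding r by (auto simp: A_def)
    then obtain i where "a = from_nat_into A i" by blast
    moreover have "dist a x < \<epsilon>" using a(2) n unfolding inverse_eq_divide by linarith
    ultimately show ?thesis by blast
  qed
  then show ?thesis using r A(2) by (intro exI[of _ "from_nat_into A"]) auto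
qed

text \<open>The ambient metric space need not be separable, so that joint measurability is obtained from
  separate continuity: replacing the first variable by the first term of a dense sequence close to
  it gives a pointwise convergent sequence of measurable functions.\<close>

lemma separately_continuous_measurable:
  fixes K :: "'a \<Rightarrow> 'a \<Rightarrow> real"
  assumes c1: "\<And>y. y \<in> \<Gamma> \<Longrightarrow> continuous_on \<Gamma> (\<lambda>x. K x y)" and c2: "\<And>x. x \<in> \<Gamma> \<Longrightarrow> continuous_on \<Gamma> (K x)"
  shows "(\<lambda>(x, y). K x y) \<in> borel_measurable (borel_on \<Gamma> \<Otimes>\<^sub>M borel_on \<Gamma>)"
proof -
  obtain d :: "nat \<Rightarrow> 'a" where d: "range d \<subseteq> \<Gamma>" "\<forall>x\<in>\<Gamma>. \<forall>\<epsilon>>0. \<exists>i. dist (d i) x < \<epsilon>" using dense_sequence by blast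
  define i where "i n x = (LEAST i. dist (d i) x < 1 / real (Suc n))" for n x
  have dist_m [measurable]: "(\<lambda>x. dist (d j) x) \<in> borel_measurable (borel_on \<Gamma>)" for j
    by (intro continuous_measurable continuous_intros)
  have i_m: "i n \<in> measurable (borel_on \<Gamma>) (count_space UNIV)" for n
    unfolding i_def by measurable
  have close: "dist (d (i n x)) x < 1 / real (Suc n)" if "x \<in> \<Gamma>" for n x
  proof -
    have "(0::real) < 1 / real (Suc n)" by simp
    then obtain j where "dist (d j) x < 1 / real (Suc n)" using d(2)[rule_format, OF \<open>x \<in> \<Gamma>\<close>] by blast
    then show ?thesis
      unfolding i_def by (rule LeastI[where P = "\<lambda>i. dist (d i) x < 1 / real (Suc n)"])
  qed
  define Kn where "Kn n z = K (d (i n (fst z))) (snd z)" for n and z :: "'a \<times> 'a"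
  have "Kn n \<in> borel_measurable (borel_on \<Gamma> \<Otimes>\<^sub>M borel_on \<Gamma>)" for n
    unfolding Kn_def
  proof (rule measurable_compose_countable[where f = "\<lambda>j z. K (d j) (snd z)"])
    fix j
    have "K (d j) \<in> borel_measurable (borel_on \<Gamma>)" using d(1) by (intro continuous_measurable c2) auto
    then show "(\<lambda>z. K (d j) (snd z)) \<in> borel_measurable (borel_on \<Gamma> \<Otimes>\<^sub>M borel_on \<Gamma>)"
      by (rule measurable_compose[OF measurable_snd])
  next
    show "(\<lambda>z. i n (fst z)) \<in> measurable (borel_on \<Gamma> \<Otimes>\<^sub>M borel_on \<Gamma>) (count_space UNIV)"
      by (rule measurable_compose[OF measurable_fst i_m])
  qed
  then show ?thesis
  proof (rule borel_measurable_LIMSEQ_metric)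
    fix z assume "z \<in> space (borel_on \<Gamma> \<Otimes>\<^sub>M borel_on \<Gamma>)"
    then have "fst z \<in> \<Gamma>" "snd z \<in> \<Gamma>" unfolding space_pair_measure space_borel_on mem_Times_iff by simp_all
    then obtain x y where z: "z = (x, y)" "x \<in> \<Gamma>" "y \<in> \<Gamma>" by (cases z) simp
    have "(\<lambda>n. dist (d (i n x)) x) \<longlonglongrightarrow> 0"
    proof (rule tendsto_sandwich[of "\<lambda>_. 0" _ _ "\<lambda>n. inverse (real (Suc n))"])
      show "\<forall>\<^sub>F n in sequentially. dist (d (i n x)) x \<le> inverse (real (Suc n))"
        using close[OF z(2)] by (intro always_eventually allI less_imp_le) (simp add: inverse_eq_divide)
      show "(\<lambda>n. inverse (real (Suc n))) \<longlonglongrightarrow> 0" by (rule LIMSEQ_inverse_real_of_nat)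
    qed auto
    then have "(\<lambda>n. d (i n x)) \<longlonglongrightarrow> x" by (rule tendsto_dist_iff[THEN iffD2])
    then have "(\<lambda>n. K (d (i n x)) y) \<longlonglongrightarrow> K x y"
    proof (rule continuous_on_tendsto_compose[OF c1[OF z(3)]])
      show "x \<in> \<Gamma>" by fact
      show "\<forall>\<^sub>F n in sequentially. d (i n x) \<in> \<Gamma>" using d(1) by (intro always_eventually allI) blast
    qed
    then show "(\<lambda>n. Kn n z) \<longlonglongrightarrow> (case z of (x, y) \<Rightarrow> K x y)" by (simp add: Kn_def z(1))
  qed
qed

end

locale based_graph = metric_graph +
  fixes z0 :: 'a
  assumes z0: "z0 \<in> \<Gamma>"
begin

definition J :: "'a \<Rightarrow> 'a \<Rightarrow> real" where "J x y = Re (j_kernel \<Gamma> z0 x y)"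

lemma j_kernel_J: "x \<in> \<Gamma> \<Longrightarrow> y \<in> \<Gamma> \<Longrightarrow> j_kernel \<Gamma> z0 x y = of_real (J x y)"
  using j_kernel_real[OF z0, of x y] by (simp add: J_def of_real_Re)

lemma J_potential: "y \<in> \<Gamma> \<Longrightarrow> potential \<Gamma> z0 y (\<lambda>x. of_real (J x y))"
  using potential_cong[OF _ j_kernel_potential[OF z0] z0] j_kernel_J by metis

lemma J_symmetric: "x \<in> \<Gamma> \<Longrightarrow> y \<in> \<Gamma> \<Longrightarrow> J x y = J y x"
  using j_kernel_symmetric[OF z0] by (simp add: J_def)

lemma J_lipschitz: "y \<in> \<Gamma> \<Longrightarrow> segment_lipschitz \<Gamma> 1 (\<lambda>x. J x y)"
proof -
  assume y: "y \<in> \<Gamma>"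
  have "segment_lipschitz \<Gamma> 1 (\<lambda>x. complex_of_real (J x y))"
    using potential_lipschitz[OF J_potential[OF y] _ z0 y] by simp
  then show ?thesis unfolding segment_lipschitz_def by (simp flip: of_real_diff)
qed

lemma J_continuous: "y \<in> \<Gamma> \<Longrightarrow> continuous_on \<Gamma> (\<lambda>x. J x y)" "x \<in> \<Gamma> \<Longrightarrow> continuous_on \<Gamma> (J x)"
proof -
  show 1: "continuous_on \<Gamma> (\<lambda>x. J x y)" if "y \<in> \<Gamma>" for y
    using segment_lipschitz_continuous[OF J_lipschitz[OF that]] by simp
  show "continuous_on \<Gamma> (J x)" if "x \<in> \<Gamma>" for x
    using 1[OF that] J_symmetric[OF that] by (simp cong: continuous_on_cong)
qed

lemma J_bounded: "\<exists>B\<ge>0. \<forall>x\<in>\<Gamma>. \<forall>y\<in>\<Gamma>. \<bar>J x y\<bar> \<le> B"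
  by (rule lipschitz_kernel_bounded[OF J_lipschitz]) (auto intro: J_symmetric)

lemma J_measurable: "(\<lambda>(x, y). J x y) \<in> borel_measurable (borel_on \<Gamma> \<Otimes>\<^sub>M borel_on \<Gamma>)"
  by (intro separately_continuous_measurable J_continuous)

end

locale signed_graph = based_graph \<Gamma> z0 + finite_signed_measure "borel_on \<Gamma>" \<mu>
  for \<Gamma> :: "'a::metric_space set" and z0 and \<mu> +
  assumes mass1: "\<mu> \<Gamma> = 1"
begin

abbreviation "P \<equiv> pos_part (borel_on \<Gamma>) \<mu>"
abbreviation "N \<equiv> neg_part (borel_on \<Gamma>) \<mu>"

sublocale P: finite_measure P by (rule pos_part_measure(3))
sublocale N: finite_measure N by (rule neg_part_measure(3))

lemma sets_parts [measurable_cong]: "sets P = sets (borel_on \<Gamma>)" "sets N = sets (borel_on \<Gamma>)"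
  by (rule pos_part_measure(1), rule neg_part_measure(1))

lemma space_parts [simp]: "space P = \<Gamma>" "space N = \<Gamma>"
  using pos_part_measure(2) neg_part_measure(2) by simp_all

definition si :: "('a \<Rightarrow> real) \<Rightarrow> real" where "si f = integral\<^sup>L P f - integral\<^sup>L N f"

definition bounded_measurable :: "('a \<Rightarrow> real) \<Rightarrow> bool" where
  "bounded_measurable f \<longleftrightarrow> f \<in> borel_measurable (borel_on \<Gamma>) \<and> (\<exists>B. \<forall>x\<in>\<Gamma>. \<bar>f x\<bar> \<le> B)"

lemma bounded_measurable_integrable:
  assumes M: "finite_measure M" "sets M = sets (borel_on \<Gamma>)" and f: "bounded_measurable f"
  shows "integrable M f"
proof -
  obtain B where B: "\<forall>x\<in>\<Gamma>. \<bar>f x\<bar> \<le> B" using f by (auto simp: bounded_measurable_def)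
  have "space M = \<Gamma>" using sets_eq_imp_space_eq[OF M(2)] by simp
  moreover have "f \<in> borel_measurable M"
    unfolding measurable_cong_sets[OF M(2) refl] using f by (simp add: bounded_measurable_def)
  ultimately show ?thesis
    using B by (intro finite_measure.integrable_const_bound[OF M(1), of _ B] AE_I2) auto
qed

lemma bm_integrable: "bounded_measurable f \<Longrightarrow> integrable P f" "bounded_measurable f \<Longrightarrow> integrable N f"
  using bounded_measurable_integrable[OF P.finite_measure_axioms sets_parts(1)]
    bounded_measurable_integrable[OF N.finite_measure_axioms sets_parts(2)] by auto

lemma bm_const: "bounded_measurable (\<lambda>_. c)"
  by (auto simp: bounded_measurable_def)

lemma bm_add: "bounded_measurable f \<Longrightarrow> bounded_measurable g \<Longrightarrow> bounded_measurable (\<lambda>x. f x + g x)"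
proof -
  assume f: "bounded_measurable f" and g: "bounded_measurable g"
  obtain B1 B2 where B: "\<forall>x\<in>\<Gamma>. \<bar>f x\<bar> \<le> B1" "\<forall>x\<in>\<Gamma>. \<bar>g x\<bar> \<le> B2"
    using f g unfolding bounded_measurable_def by blast
  have "\<bar>f x + g x\<bar> \<le> B1 + B2" if "x \<in> \<Gamma>" for x
    using B(1)[rule_format, OF that] B(2)[rule_format, OF that] by linarith
  then show ?thesis using f g unfolding bounded_measurable_def by (auto intro!: borel_measurable_add)
qed

lemma bm_minus: "bounded_measurable f \<Longrightarrow> bounded_measurable (\<lambda>x. - f x)"
  unfolding bounded_measurable_def by auto

lemma bm_diff: "bounded_measurable f \<Longrightarrow> bounded_measurable g \<Longrightarrow> bounded_measurable (\<lambda>x. f x - g x)"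
  using bm_add[OF _ bm_minus, of f g] by simp

lemma si_add: "bounded_measurable f \<Longrightarrow> bounded_measurable g \<Longrightarrow> si (\<lambda>x. f x + g x) = si f + si g"
  by (simp add: si_def bm_integrable)

lemma si_diff: "bounded_measurable f \<Longrightarrow> bounded_measurable g \<Longrightarrow> si (\<lambda>x. f x - g x) = si f - si g"
  by (simp add: si_def bm_integrable)

lemma si_const: "si (\<lambda>_. c) = c"
proof -
  have "measure P \<Gamma> - measure N \<Gamma> = 1" using mu_eq_parts[of \<Gamma>] mass1 sets.top[of "borel_on \<Gamma>"] by simp
  then have "(measure P \<Gamma> - measure N \<Gamma>) * c = c" by simp
  then show ?thesis by (simp add: si_def algebra_simps)
qed

lemma si_cong: "(\<And>x. x \<in> \<Gamma> \<Longrightarrow> f x = g x) \<Longrightarrow> si f = si g"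
  unfolding si_def by (intro arg_cong2[where f = "(-)"] Bochner_Integration.integral_cong) auto

lemma signed_integral_real:
  assumes "\<And>x. x \<in> \<Gamma> \<Longrightarrow> f x = of_real (g x)"
  shows "signed_integral (borel_on \<Gamma>) \<mu> f = of_real (si g)"
proof -
  have "integral\<^sup>L P f = (\<integral>x. complex_of_real (g x) \<partial>P)" "integral\<^sup>L N f = (\<integral>x. complex_of_real (g x) \<partial>N)"
    by (intro Bochner_Integration.integral_cong refl, simp add: assms)+
  then show ?thesis by (simp add: signed_integral_def si_def)
qed

lemma bm_J: "y \<in> \<Gamma> \<Longrightarrow> bounded_measurable (\<lambda>x. J x y)" "x \<in> \<Gamma> \<Longrightarrow> bounded_measurable (J x)"
proof -
  obtain B where B: "\<And>x y. x \<in> \<Gamma> \<Longrightarrow> y \<in> \<Gamma> \<Longrightarrow> \<bar>J x y\<bar> \<le> B" using J_bounded by blast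
  show "bounded_measurable (\<lambda>x. J x y)" if "y \<in> \<Gamma>"
    unfolding bounded_measurable_def by (intro conjI continuous_measurable J_continuous that exI[of _ B] ballI B)
  show "bounded_measurable (J x)" if "x \<in> \<Gamma>"
    unfolding bounded_measurable_def by (intro conjI continuous_measurable J_continuous that exI[of _ B] ballI B)
qed

lemma bm_J_diag: "bounded_measurable (\<lambda>x. J x x)"
proof -
  have "(\<lambda>x. (x, x)) \<in> measurable (borel_on \<Gamma>) (borel_on \<Gamma> \<Otimes>\<^sub>M borel_on \<Gamma>)" by measurable
  from measurable_compose[OF this J_measurable] have "(\<lambda>x. J x x) \<in> borel_measurable (borel_on \<Gamma>)" by simp
  then show ?thesis using J_bounded unfolding bounded_measurable_def by blast
qed

definition a :: "'a \<Rightarrow> real" where "a x = si (J x)"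

lemma integral_lipschitz:
  assumes M: "finite_measure M" "sets M = sets (borel_on \<Gamma>)"
    and K: "\<And>y. y \<in> \<Gamma> \<Longrightarrow> segment_lipschitz \<Gamma> C (\<lambda>x. K x y)"
    and int: "\<And>x. x \<in> \<Gamma> \<Longrightarrow> integrable M (\<lambda>y. complex_of_real (K x y) * w y)" and w: "integrable M w"
  shows "segment_lipschitz \<Gamma> (C * (\<integral>y. norm (w y) \<partial>M)) (\<lambda>x. \<integral>y. complex_of_real (K x y) * w y \<partial>M)"
  unfolding segment_lipschitz_def
proof (intro allI impI ballI)
  fix b c \<sigma> s t assume \<sigma>: "segment_in \<Gamma> b c \<sigma>" and st: "s \<in> {b..c}" "t \<in> {b..c}"
  have sp: "space M = \<Gamma>" using sets_eq_imp_space_eq[OF M(2)] by simp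
  have in\<Gamma>: "\<sigma> s \<in> \<Gamma>" "\<sigma> t \<in> \<Gamma>" using segment_inD(2)[OF \<sigma>] st by auto
  have "norm ((\<integral>y. of_real (K (\<sigma> s) y) * w y \<partial>M) - (\<integral>y. of_real (K (\<sigma> t) y) * w y \<partial>M))
      = norm (\<integral>y. of_real (K (\<sigma> s) y) * w y - of_real (K (\<sigma> t) y) * w y \<partial>M)"
    using int in\<Gamma> by simp
  also have "\<dots> \<le> (\<integral>y. C * \<bar>s - t\<bar> * norm (w y) \<partial>M)"
  proof (rule order_trans[OF integral_norm_bound integral_mono])
    show "integrable M (\<lambda>y. norm (of_real (K (\<sigma> s) y) * w y - of_real (K (\<sigma> t) y) * w y))"
      using int in\<Gamma> by (intro integrable_norm Bochner_Integration.integrable_diff)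
    show "integrable M (\<lambda>y. C * \<bar>s - t\<bar> * norm (w y))" using w by simp
    fix y assume "y \<in> space M"
    then have "\<bar>K (\<sigma> s) y - K (\<sigma> t) y\<bar> \<le> C * \<bar>s - t\<bar>"
      using K[of y] \<sigma> st sp unfolding segment_lipschitz_def by auto
    then have "\<bar>K (\<sigma> s) y - K (\<sigma> t) y\<bar> * norm (w y) \<le> C * \<bar>s - t\<bar> * norm (w y)" by (rule mult_right_mono) simp
    then show "norm (of_real (K (\<sigma> s) y) * w y - of_real (K (\<sigma> t) y) * w y) \<le> C * \<bar>s - t\<bar> * norm (w y)"
      by (simp add: norm_mult flip: left_diff_distrib of_real_diff)
  qed
  also have "\<dots> = C * (\<integral>y. norm (w y) \<partial>M) * \<bar>s - t\<bar>" by simp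
  finally show "norm ((\<integral>y. of_real (K (\<sigma> s) y) * w y \<partial>M) - (\<integral>y. of_real (K (\<sigma> t) y) * w y \<partial>M))
      \<le> C * (\<integral>y. norm (w y) \<partial>M) * \<bar>s - t\<bar>" .
qed

lemma a_lipschitz: "segment_lipschitz \<Gamma> (measure P \<Gamma> + measure N \<Gamma>) a"
proof -
  have *: "segment_lipschitz \<Gamma> (measure M \<Gamma>) (\<lambda>x. complex_of_real (\<integral>y. J x y \<partial>M))"
    if M: "finite_measure M" "sets M = sets (borel_on \<Gamma>)" for M
  proof -
    interpret M: finite_measure M by fact
    have sp: "space M = \<Gamma>" using sets_eq_imp_space_eq[OF M(2)] by simp
    have "integrable M (\<lambda>y. complex_of_real (J x y))" if "x \<in> \<Gamma>" for x
      using bounded_measurable_integrable[OF M bm_J(2)[OF that]] by simp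
    then have "segment_lipschitz \<Gamma> (1 * (\<integral>y. norm (1::complex) \<partial>M)) (\<lambda>x. \<integral>y. complex_of_real (J x y) * 1 \<partial>M)"
      by (intro integral_lipschitz M J_lipschitz) auto
    then show ?thesis by (simp add: sp)
  qed
  show ?thesis unfolding segment_lipschitz_def
  proof (intro allI impI ballI)
    fix b c \<sigma> s t assume \<sigma>: "segment_in \<Gamma> b c \<sigma>" and st: "s \<in> {b..c}" "t \<in> {b..c}"
    have "\<bar>(\<integral>y. J (\<sigma> s) y \<partial>P) - (\<integral>y. J (\<sigma> t) y \<partial>P)\<bar> \<le> measure P \<Gamma> * \<bar>s - t\<bar>"
      using *[OF P.finite_measure_axioms sets_parts(1)] \<sigma> st unfolding segment_lipschitz_def
      by (auto simp flip: of_real_diff)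
    moreover have "\<bar>(\<integral>y. J (\<sigma> s) y \<partial>N) - (\<integral>y. J (\<sigma> t) y \<partial>N)\<bar> \<le> measure N \<Gamma> * \<bar>s - t\<bar>"
      using *[OF N.finite_measure_axioms sets_parts(2)] \<sigma> st unfolding segment_lipschitz_def
      by (auto simp flip: of_real_diff)
    ultimately show "norm (a (\<sigma> s) - a (\<sigma> t)) \<le> (measure P \<Gamma> + measure N \<Gamma>) * \<bar>s - t\<bar>"
      unfolding a_def si_def distrib_right real_norm_def by linarith
  qed
qed

lemma bm_continuous:
  assumes "continuous_on \<Gamma> f"
  shows "bounded_measurable f"
proof -
  have "bounded (f ` \<Gamma>)" by (intro compact_imp_bounded compact_continuous_image assms compact_graph)
  then obtain B where "\<forall>x\<in>f ` \<Gamma>. norm x \<le> B" unfolding bounded_iff by blast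
  then show ?thesis using continuous_measurable[OF assms] unfolding bounded_measurable_def by auto
qed

lemma a_continuous: "continuous_on \<Gamma> a"
  by (rule segment_lipschitz_continuous[OF a_lipschitz]) simp

lemma bm_a: "bounded_measurable a"
  by (rule bm_continuous[OF a_continuous])

definition G :: "'a \<Rightarrow> 'a \<Rightarrow> real" where "G x y = J x y - a x - a y + si a"

lemma j_mu_eq:
  assumes x: "x \<in> \<Gamma>" and y: "y \<in> \<Gamma>"
  shows "j_mu \<Gamma> \<mu> x y = of_real (J x y - a x - a y + si (\<lambda>\<zeta>. J \<zeta> \<zeta>))"
proof -
  have "j_mu \<Gamma> \<mu> x y = of_real (si (\<lambda>\<zeta>. J x y - J x \<zeta> - J y \<zeta> + J \<zeta> \<zeta>))"
    unfolding j_mu_def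
  proof (rule signed_integral_real)
    fix \<zeta> assume z: "\<zeta> \<in> \<Gamma>"
    show "j_kernel \<Gamma> \<zeta> x y = of_real (J x y - J x \<zeta> - J y \<zeta> + J \<zeta> \<zeta>)"
      unfolding j_kernel_change_base[OF z0 z x y] using J_symmetric[OF z y] by (simp add: j_kernel_J x y z)
  qed
  also have "si (\<lambda>\<zeta>. J x y - J x \<zeta> - J y \<zeta> + J \<zeta> \<zeta>) = J x y - a x - a y + si (\<lambda>\<zeta>. J \<zeta> \<zeta>)"
    using bm_J(2)[OF x] bm_J(2)[OF y] bm_J_diag
    by (simp add: si_add si_diff si_const bm_diff bm_add bm_const a_def)
  finally show ?thesis .
qed

lemma c_mu_eq: "c_mu \<Gamma> \<mu> = of_real (si (\<lambda>\<zeta>. J \<zeta> \<zeta>) - si a)"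
proof -
  have *: "signed_integral (borel_on \<Gamma>) \<mu> (\<lambda>x. j_mu \<Gamma> \<mu> x y) = of_real (si (\<lambda>\<zeta>. J \<zeta> \<zeta>) - si a)" if y: "y \<in> \<Gamma>" for y
  proof -
    have "signed_integral (borel_on \<Gamma>) \<mu> (\<lambda>x. j_mu \<Gamma> \<mu> x y) = of_real (si (\<lambda>x. J x y - a x - a y + si (\<lambda>\<zeta>. J \<zeta> \<zeta>)))"
      by (intro signed_integral_real j_mu_eq y)
    also have "si (\<lambda>x. J x y - a x - a y + si (\<lambda>\<zeta>. J \<zeta> \<zeta>)) = si (\<lambda>x. J x y) - si a - a y + si (\<lambda>\<zeta>. J \<zeta> \<zeta>)"
      using bm_J(1)[OF y] bm_a by (simp add: si_add si_diff si_const bm_diff bm_add bm_const)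
    also have "si (\<lambda>x. J x y) = a y" unfolding a_def using J_symmetric y by (intro si_cong) auto
    finally show ?thesis by simp
  qed
  show ?thesis unfolding c_mu_def using * z0 by (intro the_equality) auto
qed

lemma g_mu_eq: "x \<in> \<Gamma> \<Longrightarrow> y \<in> \<Gamma> \<Longrightarrow> g_mu \<Gamma> \<mu> x y = of_real (G x y)"
  by (simp add: g_mu_def j_mu_eq c_mu_eq G_def)

lemma si_G: "y \<in> \<Gamma> \<Longrightarrow> si (\<lambda>x. G x y) = 0"
proof -
  assume y: "y \<in> \<Gamma>"
  have "si (\<lambda>x. G x y) = si (\<lambda>x. J x y) - si a - a y + si a"
    unfolding G_def using bm_J(1)[OF y] bm_a by (simp add: si_add si_diff si_const bm_diff bm_add bm_const)
  also have "si (\<lambda>x. J x y) = a y" unfolding a_def using J_symmetric y by (intro si_cong) auto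
  finally show ?thesis by simp
qed

definition LG :: real where "LG = 1 + (measure P \<Gamma> + measure N \<Gamma>)"

lemma LG_nonneg: "0 \<le> LG" by (simp add: LG_def)

lemma G_symmetric: "x \<in> \<Gamma> \<Longrightarrow> y \<in> \<Gamma> \<Longrightarrow> G x y = G y x"
  using J_symmetric by (simp add: G_def)

lemma G_lipschitz: "y \<in> \<Gamma> \<Longrightarrow> segment_lipschitz \<Gamma> LG (\<lambda>x. G x y)"
  unfolding segment_lipschitz_def
proof (intro allI impI ballI)
  fix b c \<sigma> s t assume y: "y \<in> \<Gamma>" and \<sigma>: "segment_in \<Gamma> b c \<sigma>" and st: "s \<in> {b..c}" "t \<in> {b..c}"
  have "norm (J (\<sigma> s) y - J (\<sigma> t) y) \<le> 1 * \<bar>s - t\<bar>"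
    using J_lipschitz[OF y] \<sigma> st unfolding segment_lipschitz_def by blast
  moreover have "norm (a (\<sigma> s) - a (\<sigma> t)) \<le> (measure P \<Gamma> + measure N \<Gamma>) * \<bar>s - t\<bar>"
    using a_lipschitz \<sigma> st unfolding segment_lipschitz_def by blast
  ultimately show "norm (G (\<sigma> s) y - G (\<sigma> t) y) \<le> LG * \<bar>s - t\<bar>"
    unfolding G_def LG_def distrib_right real_norm_def by linarith
qed

lemma G_continuous: "y \<in> \<Gamma> \<Longrightarrow> continuous_on \<Gamma> (\<lambda>x. G x y)" "x \<in> \<Gamma> \<Longrightarrow> continuous_on \<Gamma> (G x)"
proof -
  show 1: "continuous_on \<Gamma> (\<lambda>x. G x y)" if "y \<in> \<Gamma>" for y
    by (rule segment_lipschitz_continuous[OF G_lipschitz[OF that] LG_nonneg])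
  show "continuous_on \<Gamma> (G x)" if "x \<in> \<Gamma>" for x
    using 1[OF that] G_symmetric[OF that] by (simp cong: continuous_on_cong)
qed

lemma G_measurable: "(\<lambda>(x, y). G x y) \<in> borel_measurable (borel_on \<Gamma> \<Otimes>\<^sub>M borel_on \<Gamma>)"
  by (intro separately_continuous_measurable G_continuous)

definition CG :: real where "CG = (SOME B. B \<ge> 0 \<and> (\<forall>x\<in>\<Gamma>. \<forall>y\<in>\<Gamma>. \<bar>G x y\<bar> \<le> B))"

lemma CG: "0 \<le> CG" "x \<in> \<Gamma> \<Longrightarrow> y \<in> \<Gamma> \<Longrightarrow> \<bar>G x y\<bar> \<le> CG"
proof -
  have "\<exists>B\<ge>0. \<forall>x\<in>\<Gamma>. \<forall>y\<in>\<Gamma>. \<bar>G x y\<bar> \<le> B"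
    by (rule lipschitz_kernel_bounded[OF G_lipschitz LG_nonneg G_symmetric])
  then have "CG \<ge> 0 \<and> (\<forall>x\<in>\<Gamma>. \<forall>y\<in>\<Gamma>. \<bar>G x y\<bar> \<le> CG)" unfolding CG_def by (rule someI_ex)
  then show "0 \<le> CG" "x \<in> \<Gamma> \<Longrightarrow> y \<in> \<Gamma> \<Longrightarrow> \<bar>G x y\<bar> \<le> CG" by auto
qed

sublocale ker: symmetric_kernel "arc_length \<Gamma>" G CG
proof
  show "(\<lambda>(x, y). G x y) \<in> borel_measurable (arc_length \<Gamma> \<Otimes>\<^sub>M arc_length \<Gamma>)"
    unfolding measurable_cong_sets[OF sets_pair_measure_cong[OF sets_arc_length sets_arc_length] refl] by (rule G_measurable)
qed (use CG G_symmetric in auto)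

lemma T_lipschitz:
  assumes f: "f \<in> l2 (arc_length \<Gamma>)"
  shows "segment_lipschitz \<Gamma> (LG * (\<integral>y. norm (f y) \<partial>arc_length \<Gamma>)) (ker.T f)"
proof -
  have "integrable (arc_length \<Gamma>) (\<lambda>y. complex_of_real (G x y) * f y)" if "x \<in> \<Gamma>" for x
    using ip_integrable[OF f ker.kernel_section_l2[of x]] that by (simp add: mult.commute)
  then have "segment_lipschitz \<Gamma> (LG * (\<integral>y. norm (f y) \<partial>arc_length \<Gamma>)) (\<lambda>x. \<integral>y. complex_of_real (G x y) * f y \<partial>arc_length \<Gamma>)"
    using arc.finite_measure_axioms sets_arc_length G_lipschitz arc.l2_integrable[OF f]
    by (intro integral_lipschitz)
  then show ?thesis unfolding ker.T_def .
qed

lemma T_continuous: "f \<in> l2 (arc_length \<Gamma>) \<Longrightarrow> continuous_on \<Gamma> (ker.T f)"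
  by (rule segment_lipschitz_continuous[OF T_lipschitz]) (auto intro: mult_nonneg_nonneg LG_nonneg)

sublocale ker: compact_symmetric_kernel "arc_length \<Gamma>" G CG
proof
  fix f :: "nat \<Rightarrow> 'a \<Rightarrow> complex"
  assume f: "\<And>n. f n \<in> l2 (arc_length \<Gamma>)" "\<And>n. l2norm (arc_length \<Gamma>) (f n) \<le> 1"
  define m where "m = sqrt ker.total"
  have m: "0 \<le> m" using ker.total_nonneg by (simp add: m_def)
  have "norm (ker.T (f n) x) \<le> m * CG * 1" if "x \<in> \<Gamma>" for n x
  proof -
    have "norm (ker.T (f n) x) \<le> m * CG * l2norm (arc_length \<Gamma>) (f n)"
      unfolding m_def using ker.T_bound[OF f(1)] that by simp
    also have "\<dots> \<le> m * CG * 1" using f(2) m CG(1) by (intro mult_left_mono) auto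
    finally show ?thesis .
  qed
  moreover have "segment_lipschitz \<Gamma> (LG * m) (ker.T (f n))" for n
  proof -
    have "(\<integral>y. norm (f n y) \<partial>arc_length \<Gamma>) \<le> m * l2norm (arc_length \<Gamma>) (f n)"
      using arc.l1_le_l2norm[OF f(1)] by (simp add: m_def ker.total_def)
    also have "\<dots> \<le> m * 1" using f(2) m by (intro mult_left_mono) auto
    finally have "LG * (\<integral>y. norm (f n y) \<partial>arc_length \<Gamma>) \<le> LG * m" using LG_nonneg by (intro mult_left_mono) auto
    then have "LG * (\<integral>y. norm (f n y) \<partial>arc_length \<Gamma>) * \<bar>s - t\<bar> \<le> LG * m * \<bar>s - t\<bar>" for s t :: real
      by (rule mult_right_mono) simp
    then show ?thesis using T_lipschitz[OF f(1)] unfolding segment_lipschitz_def by (meson order_trans)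
  qed
  ultimately show "\<exists>r h. strict_mono r \<and> uniform_limit (space (arc_length \<Gamma>)) (\<lambda>n. ker.T (f (r n))) h sequentially"
    using segment_lipschitz_compact[of "\<lambda>n. ker.T (f n)" "m * CG * 1" "LG * m"] m LG_nonneg by simp
qed

end

section \<open>Sets with finite boundary\<close>

context metric_graph
begin

lemma bdry_complement: "S \<subseteq> \<Gamma> \<Longrightarrow> bdry \<Gamma> (\<Gamma> - S) = bdry \<Gamma> S"
  unfolding bdry_def by (simp add: double_diff Int_commute Int_left_commute)

lemma bdry_Un: "bdry \<Gamma> (S \<union> T) \<subseteq> bdry \<Gamma> S \<union> bdry \<Gamma> T"
proof -
  have "closure (\<Gamma> - (S \<union> T)) \<subseteq> closure (\<Gamma> - S)" "closure (\<Gamma> - (S \<union> T)) \<subseteq> closure (\<Gamma> - T)"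
    by (intro closure_mono; blast)+
  then show ?thesis unfolding bdry_def closure_Un by blast
qed

lemma bdry_open:
  assumes "openin (top_of_set \<Gamma>) U"
  shows "bdry \<Gamma> U \<inter> U = {}"
proof -
  have "closed (\<Gamma> - U)"
    using openin_closedin_eq[of "top_of_set \<Gamma>" U] assms closed_graph closedin_closed_trans
    by (metis topspace_euclidean_subtopology)
  then show ?thesis by (auto simp: bdry_def)
qed

text \<open>If both ends of a piece of an edge lie outside the connected set \<open>U\<close>, then the piece cuts \<open>U\<close>
  into relatively closed and open parts.\<close>

lemma connected_in_piece:
  assumes U: "connected U" "U \<subseteq> \<Gamma>" and e: "open_segment_in e" and st: "0 \<le> s" "s \<le> t" "t \<le> len e"
    and ends: "param e s \<notin> U" "param e t \<notin> U" and meet: "U \<inter> param e ` {s<..<t} \<noteq> {}"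
  shows "U \<subseteq> param e ` {s<..<t}"
proof -
  have sg: "segment_in \<Gamma> 0 (len e) (param e)" and op: "openin (top_of_set \<Gamma>) (param e ` {s<..<t})"
    using e st by (auto simp: open_segment_in_def)
  have sg': "segment_in \<Gamma> s t (param e)" using sg st by (auto simp: segment_in_def)
  have "{s..t} = insert s (insert t {s<..<t})" using st by auto
  then have eq: "U \<inter> param e ` {s<..<t} = U \<inter> param e ` {s..t}" using ends by auto
  have "closed (param e ` {s..t})" using segment_compact[OF sg'] by (rule compact_imp_closed)
  then have "closedin (top_of_set U) (U \<inter> param e ` {s<..<t})" unfolding eq by (rule closedin_closed_Int)
  moreover have "openin (top_of_set U) (U \<inter> param e ` {s<..<t})"
  proof -
    obtain W where W: "open W" "param e ` {s<..<t} = \<Gamma> \<inter> W" using op by (auto simp: openin_open)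
    then have "U \<inter> param e ` {s<..<t} = U \<inter> W" using U(2) by blast
    then show ?thesis using openin_open_Int[OF W(1), of U] by simp
  qed
  ultimately have "U \<inter> param e ` {s<..<t} = U" using U(1) meet unfolding connected_clopen by blast
  then show ?thesis by blast
qed

lemma at_most_two_boundary_points:
  assumes U: "openin (top_of_set \<Gamma>) U" "connected U" and e: "open_segment_in e"
    and t: "0 < t1" "t1 < t2" "t2 < t3" "t3 < len e" "\<And>t. t \<in> {t1, t2, t3} \<Longrightarrow> param e t \<in> bdry \<Gamma> U"
  shows False
proof -
  have U\<Gamma>: "U \<subseteq> \<Gamma>" using openin_imp_subset[OF U(1)] .
  have sg: "segment_in \<Gamma> 0 (len e) (param e)" using e by (simp add: open_segment_in_def)
  have inj: "inj_on (param e) {0..len e}" using segment_inj[OF sg] .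
  have out: "param e t \<notin> U" "param e t \<in> closure U" if "t \<in> {t1, t2, t3}" for t
    using t(5)[OF that] bdry_open[OF U(1)] by (auto simp: bdry_def)
  have clos: "t \<in> {r..s}" if "U \<subseteq> param e ` {r<..<s}" "t \<in> {t1, t2, t3}" "0 \<le> r" "s \<le> len e" "r \<le> s" for r s t
  proof -
    have "segment_in \<Gamma> r s (param e)" using sg that by (auto simp: segment_in_def)
    then have "closed (param e ` {r..s})" by (intro compact_imp_closed segment_compact)
    moreover have "U \<subseteq> param e ` {r..s}" using that(1) by auto
    ultimately have "param e t \<in> param e ` {r..s}" using out(2)[OF that(2)] closure_minimal by blast
    then obtain u where u: "u \<in> {r..s}" "param e t = param e u" by blast
    have "t = u" using inj u that t by (intro inj_onD[OF inj u(2)]) auto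
    then show ?thesis using u(1) by simp
  qed
  have op: "openin (top_of_set \<Gamma>) (param e ` {t1<..<t3})" using e t by (auto simp: open_segment_in_def)
  have "U \<inter> param e ` {t1<..<t3} \<noteq> {}"
  proof
    assume disj: "U \<inter> param e ` {t1<..<t3} = {}"
    obtain W where W: "open W" "param e ` {t1<..<t3} = \<Gamma> \<inter> W" using op by (auto simp: openin_open)
    have "U \<inter> W = {}" using disj W(2) U\<Gamma> by blast
    then have "closure U \<inter> W = {}" using W(1) open_Int_closure_eq_empty[of W U] by (simp add: Int_commute)
    moreover have "param e t2 \<in> W" using W(2) t by auto
    ultimately show False using out(2)[of t2] by auto
  qed
  then obtain u where u: "param e u \<in> U" "t1 < u" "u < t3" by auto
  have "u \<noteq> t2" using u(1) out(1)[of t2] by auto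
  then consider "u < t2" | "t2 < u" by linarith
  then show False
  proof cases
    case 1
    have "U \<subseteq> param e ` {t1<..<t2}" using 1 u t out by (intro connected_in_piece U U\<Gamma> e) auto
    from clos[OF this, of t3] show False using t by auto
  next
    case 2
    have "U \<subseteq> param e ` {t2<..<t3}" using 2 u t out by (intro connected_in_piece U U\<Gamma> e) auto
    from clos[OF this, of t1] show False using t by auto
  qed
qed

lemma connected_open_finite_bdry:
  assumes U: "openin (top_of_set \<Gamma>) U" "connected U"
  shows "finite (bdry \<Gamma> U)"
proof -
  obtain S where S: "finite S" "\<Gamma> = (\<Union>e\<in>S. closed_edge e)" "\<forall>e\<in>S. open_segment_in e"
    using finite_segment_cover by blast
  define A where "A e = {t. 0 < t \<and> t < len e \<and> param e t \<in> bdry \<Gamma> U}" for e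
  have "finite (A e)" if e: "e \<in> S" for e
  proof (rule ccontr)
    assume "infinite (A e)"
    then obtain B where B: "finite B" "card B = 3" "B \<subseteq> A e" using infinite_arbitrarily_large by metis
    define l where "l = sorted_list_of_set B"
    have l: "sorted_wrt (<) l" "set l = B" "length l = 3" using B(1,2) by (simp_all add: l_def)
    have "l ! 0 < l ! 1" "l ! 1 < l ! 2" using l(3) by (auto intro!: sorted_wrt_nth_less[OF l(1)])
    moreover have "l ! i \<in> A e" if "i < 3" for i using nth_mem[of i l] that l(2,3) B(3) by auto
    then have "l ! 0 \<in> A e" "l ! 1 \<in> A e" "l ! 2 \<in> A e" by simp_all
    ultimately show False
      using at_most_two_boundary_points[OF U, of e "l ! 0" "l ! 1" "l ! 2"] S(3) e by (auto simp: A_def)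
  qed
  then have "finite (\<Union>e\<in>S. param e ` (insert 0 (insert (len e) (A e))))" using S(1) by auto
  moreover have "bdry \<Gamma> U \<subseteq> (\<Union>e\<in>S. param e ` (insert 0 (insert (len e) (A e))))"
  proof
    fix x assume x: "x \<in> bdry \<Gamma> U"
    then have "x \<in> \<Gamma>" by (simp add: bdry_def)
    then obtain e t where et: "e \<in> S" "0 \<le> t" "t \<le> len e" "x = param e t" using S(2) by (auto simp: closed_edge_def)
    have "t \<in> insert 0 (insert (len e) (A e))" using et x by (auto simp: A_def)
    then show "x \<in> (\<Union>e\<in>S. param e ` (insert 0 (insert (len e) (A e))))" using et(1,4) by blast
  qed
  ultimately show ?thesis by (rule finite_subset[rotated])
qed

definition tame :: "'a set \<Rightarrow> bool" where "tame S \<longleftrightarrow> S \<in> sets (borel_on \<Gamma>) \<and> finite (bdry \<Gamma> S)"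

lemma graph_algebra_tame: "S \<in> graph_algebra \<Gamma> \<Longrightarrow> tame S"
proof -
  have sub: "S \<subseteq> \<Gamma>" if "tame S" for S using that by (simp add: tame_def sets_borel_on)
  have "algebra \<Gamma> {S. tame S}"
    unfolding algebra_iff_Un
  proof (intro conjI ballI)
    show "{S. tame S} \<subseteq> Pow \<Gamma>" using sub by blast
    show "{} \<in> {S. tame S}" by (simp add: tame_def bdry_def)
    show "\<Gamma> - S \<in> {S. tame S}" if "S \<in> {S. tame S}" for S
      using that sub[of S] sets.compl_sets[of S "borel_on \<Gamma>"] by (simp add: tame_def bdry_complement)
    show "S \<union> S' \<in> {S. tame S}" if "S \<in> {S. tame S}" "S' \<in> {S. tame S}" for S S'
      using that finite_subset[OF bdry_Un[of S S']] by (simp add: tame_def sets.Un)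
  qed
  then have "graph_algebra \<Gamma> \<subseteq> {S. tame S}"
    unfolding graph_algebra_def
    by (rule hull_minimal[rotated]) (auto simp: tame_def openin_borel_on connected_open_finite_bdry)
  then show "S \<in> graph_algebra \<Gamma> \<Longrightarrow> tame S" by blast
qed

section \<open>Functions of bounded differential variation\<close>

lemma dir_differentiable_deriv:
  "f \<in> dir_differentiable \<Gamma> \<Longrightarrow> p \<in> \<Gamma> \<Longrightarrow> v \<in> Vec \<Gamma> p \<Longrightarrow> has_dir_deriv \<Gamma> f p v (dir_deriv \<Gamma> f p v)"
  unfolding dir_differentiable_def using dir_deriv_unique by blast

lemma has_dir_deriv_lincomb:
  assumes "has_dir_deriv \<Gamma> f p v l" "has_dir_deriv \<Gamma> g p v m"
  shows "has_dir_deriv \<Gamma> (\<lambda>x. a * f x + b * g x + c) p v (a * l + b * m)"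
proof -
  have "((\<lambda>t. a * ((f (move \<Gamma> p v t) - f p) / of_real t) + b * ((g (move \<Gamma> p v t) - g p) / of_real t)) \<longlongrightarrow> a * l + b * m) (at_right 0)"
    using assms unfolding has_dir_deriv_def by (intro tendsto_intros)
  then show ?thesis unfolding has_dir_deriv_def by (simp add: algebra_simps diff_divide_distrib add_divide_distrib)
qed

lemma m_fun_lincomb:
  assumes f: "f \<in> dir_differentiable \<Gamma>" and g: "g \<in> dir_differentiable \<Gamma>"
  shows "m_fun \<Gamma> (\<lambda>x. a * f x + b * g x + c) S = a * m_fun \<Gamma> f S + b * m_fun \<Gamma> g S"
proof -
  have d: "dir_deriv \<Gamma> (\<lambda>x. a * f x + b * g x + c) p v = a * dir_deriv \<Gamma> f p v + b * dir_deriv \<Gamma> g p v"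
    if "p \<in> bdry \<Gamma> S" "v \<in> Vec \<Gamma> p" for p v
  proof -
    have "p \<in> \<Gamma>" using that(1) by (simp add: bdry_def)
    then show ?thesis using that(2) by (intro dir_deriv_unique has_dir_deriv_lincomb dir_differentiable_deriv f g)
  qed
  have d1: "(\<Sum>b'\<in>B. \<Sum>v\<in>V b'. dir_deriv \<Gamma> (\<lambda>x. a * f x + b * g x + c) b' v)
    = a * (\<Sum>b'\<in>B. \<Sum>v\<in>V b'. dir_deriv \<Gamma> f b' v) + b * (\<Sum>b'\<in>B. \<Sum>v\<in>V b'. dir_deriv \<Gamma> g b' v)"
    if "B \<subseteq> bdry \<Gamma> S" "\<And>b'. V b' \<subseteq> Vec \<Gamma> b'" for B V
  proof -
    have "(\<Sum>b'\<in>B. \<Sum>v\<in>V b'. dir_deriv \<Gamma> (\<lambda>x. a * f x + b * g x + c) b' v)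
      = (\<Sum>b'\<in>B. \<Sum>v\<in>V b'. a * dir_deriv \<Gamma> f b' v + b * dir_deriv \<Gamma> g b' v)"
      using that d by (intro sum.cong refl) blast
    then show ?thesis by (simp add: sum.distrib sum_distrib_left)
  qed
  have "In_vec \<Gamma> b' S \<subseteq> Vec \<Gamma> b'" "Out_vec \<Gamma> b' S \<subseteq> Vec \<Gamma> b'" for b' by (auto simp: In_vec_def Out_vec_def)
  then show ?thesis unfolding m_fun_def by (subst (1 2) d1) (auto simp: algebra_simps)
qed

lemma m_fun_cong:
  assumes "\<And>x. x \<in> \<Gamma> \<Longrightarrow> f x = g x"
  shows "m_fun \<Gamma> f S = m_fun \<Gamma> g S"
proof -
  have "dir_deriv \<Gamma> f p v = dir_deriv \<Gamma> g p v" if "p \<in> bdry \<Gamma> S" "v \<in> Vec \<Gamma> p" for p v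
    using that assms by (intro dir_deriv_cong(2)) (auto simp: bdry_def)
  then show ?thesis unfolding m_fun_def
    by (intro arg_cong2[where f = "(-)"] sum.cong refl) (auto simp: In_vec_def Out_vec_def)
qed

lemma BDV_lincomb:
  assumes f: "f \<in> BDV \<Gamma>" and g: "g \<in> BDV \<Gamma>"
  shows "(\<lambda>x. a * f x + b * g x + c) \<in> BDV \<Gamma>"
proof -
  have fd: "f \<in> dir_differentiable \<Gamma>" and gd: "g \<in> dir_differentiable \<Gamma>" using f g by (auto simp: BDV_def)
  obtain B1 B2 where B: "B1 > 0" "B2 > 0"
    and B1: "\<And>S :: nat \<Rightarrow> 'a set. range S \<subseteq> graph_algebra \<Gamma> \<Longrightarrow> disjoint_family S \<Longrightarrow> (\<Sum>i. ennreal (norm (m_fun \<Gamma> f (S i)))) \<le> ennreal B1"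
    and B2: "\<And>S :: nat \<Rightarrow> 'a set. range S \<subseteq> graph_algebra \<Gamma> \<Longrightarrow> disjoint_family S \<Longrightarrow> (\<Sum>i. ennreal (norm (m_fun \<Gamma> g (S i)))) \<le> ennreal B2"
    using f g unfolding BDV_def by blast
  define B where "B = norm a * B1 + norm b * B2 + 1"
  have Bpos: "B > 0" unfolding B_def using B by (intro add_nonneg_pos add_nonneg_nonneg mult_nonneg_nonneg) auto
  have dd: "(\<lambda>x. a * f x + b * g x + c) \<in> dir_differentiable \<Gamma>"
    unfolding dir_differentiable_def using has_dir_deriv_lincomb fd gd unfolding dir_differentiable_def by blast
  have "(\<Sum>i. ennreal (norm (m_fun \<Gamma> (\<lambda>x. a * f x + b * g x + c) (S i)))) \<le> ennreal B"
    if S: "range S \<subseteq> graph_algebra \<Gamma>" "disjoint_family S" for S :: "nat \<Rightarrow> 'a set"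
  proof -
    have "(\<Sum>i. ennreal (norm (m_fun \<Gamma> (\<lambda>x. a * f x + b * g x + c) (S i))))
        \<le> (\<Sum>i. ennreal (norm a) * ennreal (norm (m_fun \<Gamma> f (S i))) + ennreal (norm b) * ennreal (norm (m_fun \<Gamma> g (S i))))"
    proof (rule suminf_le)
      fix i
      have "norm (m_fun \<Gamma> (\<lambda>x. a * f x + b * g x + c) (S i)) \<le> norm a * norm (m_fun \<Gamma> f (S i)) + norm b * norm (m_fun \<Gamma> g (S i))"
        unfolding m_fun_lincomb[OF fd gd] by (metis norm_mult norm_triangle_ineq)
      then have "ennreal (norm (m_fun \<Gamma> (\<lambda>x. a * f x + b * g x + c) (S i)))
        \<le> ennreal (norm a * norm (m_fun \<Gamma> f (S i)) + norm b * norm (m_fun \<Gamma> g (S i)))" by (rule ennreal_leI)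
      then show "ennreal (norm (m_fun \<Gamma> (\<lambda>x. a * f x + b * g x + c) (S i)))
        \<le> ennreal (norm a) * ennreal (norm (m_fun \<Gamma> f (S i))) + ennreal (norm b) * ennreal (norm (m_fun \<Gamma> g (S i)))"
        by (simp add: ennreal_plus ennreal_mult)
    qed auto
    also have "\<dots> = ennreal (norm a) * (\<Sum>i. ennreal (norm (m_fun \<Gamma> f (S i)))) + ennreal (norm b) * (\<Sum>i. ennreal (norm (m_fun \<Gamma> g (S i))))"
      by (simp flip: suminf_add)
    also have "\<dots> \<le> ennreal (norm a) * ennreal B1 + ennreal (norm b) * ennreal B2"
      by (intro add_mono mult_left_mono B1 B2 S) auto
    also have "\<dots> = ennreal (norm a * B1 + norm b * B2)" using B by (simp add: ennreal_plus ennreal_mult)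
    also have "\<dots> \<le> ennreal B" unfolding B_def by (intro ennreal_leI) simp
    finally show ?thesis .
  qed
  then show ?thesis using dd Bpos unfolding BDV_def by blast
qed

lemma BDV_cong:
  assumes eq: "\<And>x. x \<in> \<Gamma> \<Longrightarrow> f x = g x" and g: "g \<in> BDV \<Gamma>"
  shows "f \<in> BDV \<Gamma>"
proof -
  have "has_dir_deriv \<Gamma> f p v = has_dir_deriv \<Gamma> g p v" if "p \<in> \<Gamma>" "v \<in> Vec \<Gamma> p" for p v
    using that eq by (intro ext dir_deriv_cong(1))
  then have "f \<in> dir_differentiable \<Gamma> \<longleftrightarrow> g \<in> dir_differentiable \<Gamma>" by (simp add: dir_differentiable_def)
  moreover have "m_fun \<Gamma> f S = m_fun \<Gamma> g S" for S using eq by (intro m_fun_cong)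
  ultimately show ?thesis using g by (simp add: BDV_def)
qed

end


context based_graph
begin

text \<open>The potential of the density \<open>w\<close> with respect to \<open>M\<close>, normalized to vanish at \<open>z0\<close>.\<close>

definition jpot :: "'a measure \<Rightarrow> ('a \<Rightarrow> complex) \<Rightarrow> 'a \<Rightarrow> complex" where
  "jpot M w x = (\<integral>y. of_real (J x y) * w y \<partial>M)"

context
  fixes M :: "'a measure" and w :: "'a \<Rightarrow> complex"
  assumes M: "finite_measure M" "sets M = sets (borel_on \<Gamma>)" and w: "integrable M w"
begin

lemma space_M: "space M = \<Gamma>"
  using sets_eq_imp_space_eq[OF M(2)] by simp

lemma J_measurable_M: "x \<in> \<Gamma> \<Longrightarrow> J x \<in> borel_measurable M"
  unfolding measurable_cong_sets[OF M(2) refl] by (intro continuous_measurable J_continuous)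

lemma J_complex_measurable: "x \<in> \<Gamma> \<Longrightarrow> (\<lambda>y. complex_of_real (J x y)) \<in> borel_measurable M"
  using J_measurable_M[of x] by measurable

lemma integrable_times:
  assumes "g \<in> borel_measurable M" "\<And>y. y \<in> \<Gamma> \<Longrightarrow> norm (g y) \<le> B"
  shows "integrable M (\<lambda>y. g y * w y)"
proof (rule Bochner_Integration.integrable_bound)
  show "integrable M (\<lambda>y. B * norm (w y))" using w by simp
  show "(\<lambda>y. g y * w y) \<in> borel_measurable M" using assms(1) borel_measurable_integrable[OF w] by simp
  have "norm (g y * w y) \<le> norm (B * norm (w y))" if "y \<in> \<Gamma>" for y
  proof -
    have "norm (g y) * norm (w y) \<le> B * norm (w y)" using assms(2)[OF that] by (intro mult_right_mono) auto
    also have "\<dots> \<le> \<bar>B\<bar> * norm (w y)" by (intro mult_right_mono) auto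
    finally show ?thesis by (simp add: norm_mult abs_mult)
  qed
  then show "AE y in M. norm (g y * w y) \<le> norm (B * norm (w y))" using space_M by (intro AE_I2) auto
qed

lemma J_times_integrable: "x \<in> \<Gamma> \<Longrightarrow> integrable M (\<lambda>y. complex_of_real (J x y) * w y)"
proof -
  assume x: "x \<in> \<Gamma>"
  obtain B where B: "\<And>x y. x \<in> \<Gamma> \<Longrightarrow> y \<in> \<Gamma> \<Longrightarrow> \<bar>J x y\<bar> \<le> B" using J_bounded by blast
  show ?thesis by (rule integrable_times[OF J_complex_measurable[OF x]]) (use B[OF x] in simp)
qed

text \<open>Differentiation under the integral sign: the difference quotients of \<open>J\<close> are bounded by \<open>1\<close>.\<close>

lemma jpot_dir_deriv:
  assumes p: "p \<in> \<Gamma>" and v: "v \<in> Vec \<Gamma> p"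
  shows "integrable M (\<lambda>y. dir_deriv \<Gamma> (\<lambda>x. of_real (J x y)) p v * w y)"
    and "has_dir_deriv \<Gamma> (jpot M w) p v (\<integral>y. dir_deriv \<Gamma> (\<lambda>x. of_real (J x y)) p v * w y \<partial>M)"
proof -
  obtain \<rho> where sb: "star_ball \<Gamma> p \<rho>" using star_ball_exists[OF p] by blast
  note \<rho> = star_ball_move(1)[OF sb]
  define D where "D y = dir_deriv \<Gamma> (\<lambda>x. of_real (J x y)) p v" for y
  define q where "q t y = (if 0 < t \<and> t \<le> \<rho> then (complex_of_real (J (move \<Gamma> p v t) y) - of_real (J p y)) / of_real t else 0)" for t y
  have in\<Gamma>: "move \<Gamma> p v t \<in> \<Gamma>" if "0 < t" "t \<le> \<rho>" for t using star_ball_move(3)[OF sb v] that by simp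
  have qm: "q t \<in> borel_measurable M" for t
  proof (cases "0 < t \<and> t \<le> \<rho>")
    case True
    then have "(\<lambda>y. complex_of_real (J (move \<Gamma> p v t) y)) \<in> borel_measurable M" "(\<lambda>y. complex_of_real (J p y)) \<in> borel_measurable M"
      using J_complex_measurable[OF p] J_complex_measurable[OF in\<Gamma>, of t] by simp_all
    moreover have "q t = (\<lambda>y. (complex_of_real (J (move \<Gamma> p v t) y) - of_real (J p y)) / of_real t)"
      using True by (simp add: q_def fun_eq_iff)
    ultimately show ?thesis by simp
  next
    case False
    then have "q t = (\<lambda>y. 0)" by (auto simp: q_def)
    then show ?thesis by simp
  qed
  have qb: "norm (q t y) \<le> 1" if y: "y \<in> \<Gamma>" for t y
  proof (cases "0 < t \<and> t \<le> \<rho>")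
    case True
    have "segment_in \<Gamma> 0 \<rho> (move \<Gamma> p v)" using star_ball_segment[OF sb v] \<rho> by simp
    then have "norm (J (move \<Gamma> p v t) y - J (move \<Gamma> p v 0) y) \<le> 1 * \<bar>t - 0\<bar>"
      using J_lipschitz[OF y] True \<rho> unfolding segment_lipschitz_def
      by (metis atLeastAtMost_iff less_imp_le order_refl)
    then have "\<bar>J (move \<Gamma> p v t) y - J p y\<bar> \<le> t" using True star_ball_move(2)[OF sb v] by simp
    then have "norm (complex_of_real (J (move \<Gamma> p v t) y - J p y)) \<le> t" by (simp only: norm_of_real)
    then show ?thesis using True by (simp add: q_def norm_divide)
  qed (auto simp: q_def)
  have ev: "eventually (\<lambda>t. 0 < t \<and> t \<le> \<rho>) (at_right 0)"
    using eventually_at_right_real[OF \<rho>] by eventually_elim auto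
  have lim: "((\<lambda>t. q t y) \<longlongrightarrow> D y) (at_right 0)" if y: "y \<in> \<Gamma>" for y
  proof -
    have "(\<lambda>x. complex_of_real (J x y)) \<in> CPA \<Gamma>" using J_potential[OF y] by (simp add: potential_def)
    from CPA_dir_deriv[OF this p v]
    have "((\<lambda>t. (complex_of_real (J (move \<Gamma> p v t) y) - of_real (J p y)) / of_real t) \<longlongrightarrow> D y) (at_right 0)"
      unfolding has_dir_deriv_def D_def .
    then show ?thesis
      by (rule Lim_transform_eventually) (use ev in eventually_elim, simp add: q_def)
  qed
  have seq: "(\<lambda>n. q (X n) y) \<longlonglongrightarrow> D y" if "y \<in> \<Gamma>" "filterlim X (at_right 0) sequentially" for X y
    using filterlim_compose[OF lim[OF that(1)] that(2)] .
  have X0: "filterlim (\<lambda>n. 1 / real (Suc n)) (at_right 0) sequentially"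
    unfolding filterlim_at_right_to_top filterlim_at using LIMSEQ_inverse_real_of_nat
    by (auto simp: inverse_eq_divide)
  have Dm: "D \<in> borel_measurable M"
    by (rule borel_measurable_LIMSEQ_metric[where f = "\<lambda>n. q (1 / real (Suc n))"]) (use qm seq[OF _ X0] space_M in auto)
  have Db: "norm (D y) \<le> 1" if "y \<in> \<Gamma>" for y
    using seq[OF that X0] qb[OF that] by (intro LIMSEQ_le_const2[OF tendsto_norm]) auto
  show "integrable M (\<lambda>y. dir_deriv \<Gamma> (\<lambda>x. of_real (J x y)) p v * w y)"
    using integrable_times[OF Dm Db] unfolding D_def by simp
  have wm: "w \<in> borel_measurable M" using w by (rule borel_measurable_integrable)
  have qint: "(\<integral>y. q t y * w y \<partial>M) = (jpot M w (move \<Gamma> p v t) - jpot M w p) / of_real t" if t: "0 < t" "t \<le> \<rho>" for t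
  proof -
    have "(\<integral>y. q t y * w y \<partial>M) = (\<integral>y. (of_real (J (move \<Gamma> p v t) y) * w y - of_real (J p y) * w y) / of_real t \<partial>M)"
      using t by (intro Bochner_Integration.integral_cong refl) (simp add: q_def left_diff_distrib)
    also have "\<dots> = (\<integral>y. of_real (J (move \<Gamma> p v t) y) * w y - of_real (J p y) * w y \<partial>M) / of_real t"
      by (rule integral_divide_zero)
    also have "\<dots> = (jpot M w (move \<Gamma> p v t) - jpot M w p) / of_real t"
      unfolding jpot_def by (subst Bochner_Integration.integral_diff) (intro J_times_integrable in\<Gamma> t p refl)+
    finally show ?thesis .
  qed
  have "((\<lambda>t. (\<integral>y. q t y * w y \<partial>M)) \<longlongrightarrow> (\<integral>y. D y * w y \<partial>M)) (at_right 0)"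
    unfolding tendsto_at_iff_sequentially comp_def
  proof (intro allI impI)
    fix X :: "nat \<Rightarrow> real" assume X: "\<forall>i. X i \<in> {0<..} - {0}" "X \<longlonglongrightarrow> 0"
    have X': "filterlim X (at_right 0) sequentially"
      unfolding filterlim_at using X(1) by (intro conjI always_eventually allI X(2)) (metis DiffD1, metis DiffD2 singletonI)
    show "(\<lambda>n. \<integral>y. q (X n) y * w y \<partial>M) \<longlonglongrightarrow> (\<integral>y. D y * w y \<partial>M)"
    proof (rule integral_dominated_convergence[where w = "\<lambda>y. norm (w y)"])
      show "(\<lambda>y. D y * w y) \<in> borel_measurable M" using Dm wm by simp
      show "(\<lambda>y. q (X n) y * w y) \<in> borel_measurable M" for n using qm wm by simp
      show "integrable M (\<lambda>y. norm (w y))" using w by (rule integrable_norm)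
      show "AE y in M. (\<lambda>n. q (X n) y * w y) \<longlonglongrightarrow> D y * w y"
        using seq[OF _ X'] space_M by (intro AE_I2 tendsto_mult tendsto_const) auto
      have "norm (q (X n) y * w y) \<le> norm (w y)" if "y \<in> \<Gamma>" for n y
        using mult_right_mono[OF qb[OF that, of "X n"] norm_ge_zero[of "w y"]] by (simp add: norm_mult)
      then show "AE y in M. norm (q (X n) y * w y) \<le> norm (w y)" for n using space_M by (intro AE_I2) auto
    qed
  qed
  then show "has_dir_deriv \<Gamma> (jpot M w) p v (\<integral>y. dir_deriv \<Gamma> (\<lambda>x. of_real (J x y)) p v * w y \<partial>M)"
    unfolding has_dir_deriv_def D_def[symmetric]
    by (rule Lim_transform_eventually) (use ev in eventually_elim, simp add: qint)
qed

lemma jpot_differentiable: "jpot M w \<in> dir_differentiable \<Gamma>"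
  unfolding dir_differentiable_def using jpot_dir_deriv(2) by blast

lemma m_fun_J:
  assumes y: "y \<in> \<Gamma>" and S: "tame S"
  shows "m_fun \<Gamma> (\<lambda>x. of_real (J x y)) S = indicator S y - indicator S z0"
proof -
  have pot: "potential \<Gamma> z0 y (\<lambda>x. of_real (J x y))" using J_potential[OF y] .
  have "m_fun \<Gamma> (\<lambda>x. of_real (J x y)) S = - (\<Sum>p\<in>{z0, y} \<inter> S. slope_sum \<Gamma> (\<lambda>x. of_real (J x y)) p)"
    using S pot y z0 by (intro m_fun_CPA) (auto simp: tame_def sets_borel_on potential_def)
  also have "(\<Sum>p\<in>{z0, y} \<inter> S. slope_sum \<Gamma> (\<lambda>x. of_real (J x y)) p) = (\<Sum>p\<in>{z0, y} \<inter> S. of_bool (p = z0) - of_bool (p = y))"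
    using pot y z0 by (intro sum.cong) (auto simp: potential_def)
  also have "- \<dots> = indicator S y - indicator S z0"
    by (cases "z0 = y"; cases "z0 \<in> S"; cases "y \<in> S") (auto simp: Int_insert_left)
  finally show ?thesis .
qed

lemma m_fun_jpot:
  assumes S: "tame S"
  shows "m_fun \<Gamma> (jpot M w) S = (\<integral>y. (indicator S y - indicator S z0) * w y \<partial>M)"
proof -
  define D where "D p v y = dir_deriv \<Gamma> (\<lambda>x. of_real (J x y)) p v * w y" for p v y
  have DI: "integrable M (D p v)" "dir_deriv \<Gamma> (jpot M w) p v = integral\<^sup>L M (D p v)" if "p \<in> \<Gamma>" "v \<in> Vec \<Gamma> p" for p v
    using jpot_dir_deriv(1)[OF that] dir_deriv_unique[OF jpot_dir_deriv(2)[OF that]] unfolding D_def by auto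
  have b: "bdry \<Gamma> S \<subseteq> \<Gamma>" by (auto simp: bdry_def)
  have V: "In_vec \<Gamma> b' S \<subseteq> Vec \<Gamma> b'" "Out_vec \<Gamma> b' S \<subseteq> Vec \<Gamma> b'" for b' by (auto simp: In_vec_def Out_vec_def)
  have part: "integrable M (\<lambda>y. \<Sum>b'\<in>B. \<Sum>v\<in>W b'. D b' v y)"
    "(\<Sum>b'\<in>B. \<Sum>v\<in>W b'. dir_deriv \<Gamma> (jpot M w) b' v) = (\<integral>y. (\<Sum>b'\<in>B. \<Sum>v\<in>W b'. D b' v y) \<partial>M)"
    if BW: "B \<subseteq> bdry \<Gamma> S" "\<And>b'. W b' \<subseteq> Vec \<Gamma> b'" for B W
  proof -
    have inn: "integrable M (D b' v)" "dir_deriv \<Gamma> (jpot M w) b' v = integral\<^sup>L M (D b' v)" if "b' \<in> B" "v \<in> W b'" for b' v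
      using DI[of b' v] that BW b by blast+
    show "integrable M (\<lambda>y. \<Sum>b'\<in>B. \<Sum>v\<in>W b'. D b' v y)" using inn(1) by (intro Bochner_Integration.integrable_sum)
    have "(\<integral>y. (\<Sum>b'\<in>B. \<Sum>v\<in>W b'. D b' v y) \<partial>M) = (\<Sum>b'\<in>B. \<integral>y. (\<Sum>v\<in>W b'. D b' v y) \<partial>M)"
      using inn(1) by (intro Bochner_Integration.integral_sum Bochner_Integration.integrable_sum)
    also have "\<dots> = (\<Sum>b'\<in>B. \<Sum>v\<in>W b'. integral\<^sup>L M (D b' v))"
      using inn(1) by (intro sum.cong refl Bochner_Integration.integral_sum)
    also have "\<dots> = (\<Sum>b'\<in>B. \<Sum>v\<in>W b'. dir_deriv \<Gamma> (jpot M w) b' v)"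
      using inn(2) by (intro sum.cong refl) simp
    finally show "(\<Sum>b'\<in>B. \<Sum>v\<in>W b'. dir_deriv \<Gamma> (jpot M w) b' v) = (\<integral>y. (\<Sum>b'\<in>B. \<Sum>v\<in>W b'. D b' v y) \<partial>M)" ..
  qed
  have sub: "bdry \<Gamma> S - S \<subseteq> bdry \<Gamma> S" "bdry \<Gamma> S \<inter> S \<subseteq> bdry \<Gamma> S" by auto
  have "m_fun \<Gamma> (jpot M w) S = (\<integral>y. (\<Sum>b'\<in>bdry \<Gamma> S - S. \<Sum>v\<in>In_vec \<Gamma> b' S. D b' v y) -
      (\<Sum>b'\<in>bdry \<Gamma> S \<inter> S. \<Sum>v\<in>Out_vec \<Gamma> b' S. D b' v y) \<partial>M)"
    unfolding m_fun_def part(2)[OF sub(1) V(1)] part(2)[OF sub(2) V(2)]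
    using part(1)[OF sub(1) V(1)] part(1)[OF sub(2) V(2)] by (rule Bochner_Integration.integral_diff[symmetric])
  also have "\<dots> = (\<integral>y. m_fun \<Gamma> (\<lambda>x. of_real (J x y)) S * w y \<partial>M)"
    by (simp add: m_fun_def D_def left_diff_distrib sum_distrib_right)
  also have "\<dots> = (\<integral>y. (indicator S y - indicator S z0) * w y \<partial>M)"
    using space_M by (intro Bochner_Integration.integral_cong refl) (simp add: m_fun_J[OF _ S])
  finally show ?thesis .
qed

text \<open>The set function of a potential is a complex measure up to a point mass at \<open>z0\<close>; its total
  variation is at most twice that of the density.\<close>

lemma jpot_BDV: "jpot M w \<in> BDV \<Gamma>"
proof -
  define W where "W = (\<integral>y. norm (w y) \<partial>M)"
  have W: "0 \<le> W" by (simp add: W_def)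
  have wi: "integrable M (\<lambda>y. norm (w y))" using w by (rule integrable_norm)
  have "(\<Sum>i. ennreal (norm (m_fun \<Gamma> (jpot M w) (S i)))) \<le> ennreal (2 * W + 1)"
    if S: "range S \<subseteq> graph_algebra \<Gamma>" "disjoint_family S" for S :: "nat \<Rightarrow> 'a set"
  proof (rule suminf_le_const)
    fix n
    have t: "tame (S i)" for i using S(1) graph_algebra_tame by blast
    then have Sm: "S i \<in> sets M" for i using M(2) by (simp add: tame_def)
    have ii: "integrable M (\<lambda>y. indicator (S i) y * norm (w y))" for i
      using integrable_mult_indicator[OF Sm wi, of i] by simp
    have each: "norm (m_fun \<Gamma> (jpot M w) (S i)) \<le> (\<integral>y. indicator (S i) y * norm (w y) \<partial>M) + indicator (S i) z0 * W" for i
    proof -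
      have "norm (m_fun \<Gamma> (jpot M w) (S i)) \<le> (\<integral>y. norm ((indicator (S i) y - indicator (S i) z0) * w y) \<partial>M)"
        unfolding m_fun_jpot[OF t] by (rule integral_norm_bound)
      also have "\<dots> \<le> (\<integral>y. indicator (S i) y * norm (w y) + indicator (S i) z0 * norm (w y) \<partial>M)"
      proof (rule integral_mono)
        have "integrable M (\<lambda>y. complex_of_real (indicator (S i) y - indicator (S i) z0) * w y)"
          using Sm by (intro integrable_times[of _ 1]) (measurable, auto simp: indicator_def)
        then show "integrable M (\<lambda>y. norm ((indicator (S i) y - indicator (S i) z0) * w y))"
          by (intro integrable_norm) (simp add: of_real_indicator)
        show "integrable M (\<lambda>y. indicator (S i) y * norm (w y) + indicator (S i) z0 * norm (w y))"
          using ii wi by (intro Bochner_Integration.integrable_add) auto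
        show "norm ((indicator (S i) y - indicator (S i) z0) * w y) \<le> indicator (S i) y * norm (w y) + indicator (S i) z0 * norm (w y)" for y
          by (auto simp: indicator_def norm_mult)
      qed
      also have "\<dots> = (\<integral>y. indicator (S i) y * norm (w y) \<partial>M) + indicator (S i) z0 * W"
        unfolding W_def using ii wi by (subst Bochner_Integration.integral_add) auto
      finally show ?thesis .
    qed
    have ind: "(\<Sum>i<n. indicator (S i) y) \<le> (1::real)" for y
    proof -
      have "disjoint_family_on S {..<n}" using S(2) by (rule disjoint_family_on_mono[rotated]) simp
      then have "(\<Sum>i<n. indicator (S i) y) = (indicator (\<Union>i<n. S i) y :: real)"
        by (simp add: indicator_UN_disjoint)
      then show ?thesis by (simp add: indicator_def)
    qed
    have "(\<Sum>i<n. norm (m_fun \<Gamma> (jpot M w) (S i))) \<le> (\<Sum>i<n. (\<integral>y. indicator (S i) y * norm (w y) \<partial>M) + indicator (S i) z0 * W)"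
      by (intro sum_mono each)
    also have "\<dots> = (\<integral>y. (\<Sum>i<n. indicator (S i) y * norm (w y)) \<partial>M) + (\<Sum>i<n. indicator (S i) z0) * W"
      using ii by (subst Bochner_Integration.integral_sum) (auto simp: sum.distrib sum_distrib_right)
    also have "\<dots> \<le> W + 1 * W"
    proof (intro add_mono mult_right_mono ind W)
      show "(\<integral>y. (\<Sum>i<n. indicator (S i) y * norm (w y)) \<partial>M) \<le> W" unfolding W_def
      proof (rule integral_mono)
        show "integrable M (\<lambda>y. \<Sum>i<n. indicator (S i) y * norm (w y))" using ii by (intro Bochner_Integration.integrable_sum)
        show "(\<Sum>i<n. indicator (S i) y * norm (w y)) \<le> norm (w y)" for y
          using mult_right_mono[OF ind[of y] norm_ge_zero[of "w y"]] by (simp add: sum_distrib_right)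
      qed (rule wi)
    qed
    finally have "(\<Sum>i<n. norm (m_fun \<Gamma> (jpot M w) (S i))) \<le> 2 * W + 1" by simp
    then have "ennreal (\<Sum>i<n. norm (m_fun \<Gamma> (jpot M w) (S i))) \<le> ennreal (2 * W + 1)" by (rule ennreal_leI)
    then show "(\<Sum>i<n. ennreal (norm (m_fun \<Gamma> (jpot M w) (S i)))) \<le> ennreal (2 * W + 1)" by (simp add: sum_ennreal)
  qed auto
  then show ?thesis using jpot_differentiable W unfolding BDV_def
    by (intro CollectI conjI exI[of _ "2 * W + 1"]) auto
qed

end

end

section \<open>Eigenfunctions of the integral operator\<close>

context metric_graph
begin

lemma edge_piece:
  assumes e: "open_segment_in e" and ab: "0 \<le> a" "a < b" "b \<le> len e"
  shows "tame (param e ` {a<..<b})" "emeasure (arc_length \<Gamma>) (param e ` {a<..<b}) = ennreal (b - a)"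
proof -
  have sg: "segment_in \<Gamma> a b (param e)" and op: "openin (top_of_set \<Gamma>) (param e ` {a<..<b})"
    using e ab by (auto simp: open_segment_in_def segment_in_def)
  have "closed (param e ` {a..b})" by (intro compact_imp_closed segment_compact[OF sg])
  then have "closure (param e ` {a<..<b}) \<subseteq> param e ` {a..b}" by (intro closure_minimal) auto
  then have "bdry \<Gamma> (param e ` {a<..<b}) \<subseteq> param e ` {a..b} - param e ` {a<..<b}"
    using bdry_open[OF op] by (auto simp: bdry_def)
  also have "{a..b} = {a<..<b} \<union> {a, b}" using ab by auto
  also have "param e ` ({a<..<b} \<union> {a, b}) - param e ` {a<..<b} \<subseteq> {param e a, param e b}" by auto
  finally have "finite (bdry \<Gamma> (param e ` {a<..<b}))" by (rule finite_subset) simp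
  then show "tame (param e ` {a<..<b})" using openin_borel_on[OF op] by (simp add: tame_def)
  show "emeasure (arc_length \<Gamma>) (param e ` {a<..<b}) = ennreal (b - a)"
    by (rule is_arc_length_open_piece(1)[OF arc_length sg ab(2)]) (use openin_borel_on[OF op] sets_arc_length in simp)
qed

lemma zero_on_edge_pieces:
  fixes g :: "'a \<Rightarrow> real"
  assumes g: "integrable (arc_length \<Gamma>) g"
    and z: "\<And>e a b. open_segment_in e \<Longrightarrow> 0 \<le> a \<Longrightarrow> a < b \<Longrightarrow> b \<le> len e \<Longrightarrow>
      (\<integral>x. indicator (param e ` {a<..<b}) x * g x \<partial>arc_length \<Gamma>) = 0"
  shows "AE x in arc_length \<Gamma>. g x = 0"
proof -
  have gm [measurable]: "g \<in> borel_measurable (arc_length \<Gamma>)" using g by (rule borel_measurable_integrable)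
  define D where "D s = density (arc_length \<Gamma>) (\<lambda>x. ennreal (max 0 (s * g x)))" for s :: real
  have pm: "(\<lambda>x. ennreal (max 0 (s * g x))) \<in> borel_measurable (arc_length \<Gamma>)" for s :: real by measurable
  have pint: "integrable (arc_length \<Gamma>) (\<lambda>x. max 0 (s * g x))" for s :: real using g by simp
  have Dem: "emeasure (D s) A = ennreal (\<integral>x. indicator A x * max 0 (s * g x) \<partial>arc_length \<Gamma>)"
    if A: "A \<in> sets (borel_on \<Gamma>)" for s A
  proof -
    have Am: "A \<in> sets (arc_length \<Gamma>)" using A sets_arc_length by simp
    have ii: "integrable (arc_length \<Gamma>) (\<lambda>x. indicator A x * max 0 (s * g x))"
      using integrable_mult_indicator[OF Am pint, of s] by simp
    have "emeasure (D s) A = (\<integral>\<^sup>+x. ennreal (max 0 (s * g x)) * indicator A x \<partial>arc_length \<Gamma>)"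
      unfolding D_def by (rule emeasure_density[OF pm Am])
    also have "\<dots> = (\<integral>\<^sup>+x. ennreal (indicator A x * max 0 (s * g x)) \<partial>arc_length \<Gamma>)"
      by (intro nn_integral_cong) (auto simp: indicator_def)
    also have "\<dots> = ennreal (\<integral>x. indicator A x * max 0 (s * g x) \<partial>arc_length \<Gamma>)"
      by (rule nn_integral_eq_integral[OF ii]) (auto simp: indicator_def)
    finally show ?thesis .
  qed
  have sD: "sets (D s) = sets (borel_on \<Gamma>)" for s unfolding D_def using sets_arc_length by simp
  have fD: "finite_measure (D s)" for s
  proof
    have "space (D s) = \<Gamma>" by (simp add: D_def)
    moreover have "\<Gamma> \<in> sets (borel_on \<Gamma>)" using sets.top[of "borel_on \<Gamma>"] by simp
    ultimately show "emeasure (D s) (space (D s)) \<noteq> \<infinity>" by (simp add: Dem)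
  qed
  obtain S where S: "finite S" "\<Gamma> = (\<Union>e\<in>S. closed_edge e)" "\<forall>e\<in>S. open_segment_in e"
    using finite_segment_cover by blast
  have "D 1 = D (-1)"
  proof (rule measure_determined_by_segments[OF sD sD fD fD _ S(1) S(2) S(3)])
    show "emeasure (D 1) {x} = emeasure (D (-1)) {x}" if x: "x \<in> \<Gamma>" for x
    proof -
      have "{x} \<in> null_sets (arc_length \<Gamma>)"
        using arc_length_point[OF x] sets_arc_length closed_borel_on[of "{x}"] x by (auto intro!: null_setsI)
      then have "{x} \<in> null_sets (D s)" for s
        using absolutely_continuousI_density[OF pm, of s] unfolding D_def absolutely_continuous_def by blast
      then show ?thesis by (metis null_setsD1)
    qed
    fix e a b assume e: "e \<in> S" "0 \<le> a" "a < b" "b \<le> len e"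
    let ?A = "param e ` {a<..<b}"
    have A: "?A \<in> sets (borel_on \<Gamma>)" using edge_piece(1)[of e a b] S(3) e by (auto simp: tame_def)
    then have Am: "?A \<in> sets (arc_length \<Gamma>)" using sets_arc_length by simp
    have ii: "integrable (arc_length \<Gamma>) (\<lambda>x. indicator ?A x * max 0 (s * g x))" for s :: real
      using integrable_mult_indicator[OF Am pint, of s] by simp
    have "(\<integral>x. indicator ?A x * max 0 (1 * g x) \<partial>arc_length \<Gamma>) - (\<integral>x. indicator ?A x * max 0 (-1 * g x) \<partial>arc_length \<Gamma>)
      = (\<integral>x. indicator ?A x * max 0 (1 * g x) - indicator ?A x * max 0 (-1 * g x) \<partial>arc_length \<Gamma>)"
      by (rule Bochner_Integration.integral_diff[symmetric, OF ii ii])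
    also have "\<dots> = (\<integral>x. indicator ?A x * g x \<partial>arc_length \<Gamma>)"
      by (intro Bochner_Integration.integral_cong refl) (auto simp: max_def indicator_def)
    also have "\<dots> = 0" using z S(3) e by blast
    finally show "emeasure (D 1) ?A = emeasure (D (-1)) ?A" unfolding Dem[OF A] by simp
  qed
  then have "AE x in arc_length \<Gamma>. ennreal (max 0 (1 * g x)) = ennreal (max 0 (-1 * g x))"
    unfolding D_def by (intro arc.density_unique pm)
  then show ?thesis by eventually_elim (auto simp: max_def split: if_splits)
qed

lemma orthonormal_family_exists: "\<exists>H. finite H \<and> card H = n \<and> orthonormal (arc_length \<Gamma>) H"
proof (cases "n = 0")
  case True
  then show ?thesis by (intro exI[of _ "{}"]) (simp add: orthonormal_def)
next
  case False
  obtain S where S: "finite S" "\<Gamma> = (\<Union>e\<in>S. closed_edge e)" "\<forall>e\<in>S. open_segment_in e"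
    using finite_segment_cover by blast
  then obtain e where "e \<in> S" using graph_nonempty by blast
  then have e: "open_segment_in e" "0 < len e" using S(3) by (auto simp: open_segment_in_def)
  have inj: "inj_on (param e) {0..len e}" using e(1) segment_inj by (auto simp: open_segment_in_def)
  define \<delta> where "\<delta> = len e / n"
  have \<delta>: "0 < \<delta>" "real n * \<delta> = len e" using e False by (auto simp: \<delta>_def)
  define A where "A k = param e ` {real k * \<delta><..<real (Suc k) * \<delta>}" for k
  have top: "real (Suc k) * \<delta> \<le> len e" if "k < n" for k
    using that \<delta>(1) unfolding \<delta>(2)[symmetric] by (intro mult_right_mono) auto
  have piece: "tame (A k)" "emeasure (arc_length \<Gamma>) (A k) = ennreal \<delta>" if "k < n" for k
    using edge_piece[OF e(1), of "real k * \<delta>" "real (Suc k) * \<delta>"] top[OF that] \<delta>(1)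
    unfolding A_def by (auto simp: algebra_simps)
  have Am: "A k \<in> sets (arc_length \<Gamma>)" if "k < n" for k
    using piece(1)[OF that] sets_arc_length by (simp add: tame_def)
  have disj: "A j \<inter> A k = {}" if jk: "j < k" "k < n" for j k
  proof (rule ccontr)
    assume "A j \<inter> A k \<noteq> {}"
    then obtain s t where s: "real j * \<delta> < s" "s < real (Suc j) * \<delta>" and t: "real k * \<delta> < t" "t < real (Suc k) * \<delta>"
      and st: "param e s = param e t" unfolding A_def by auto
    have "0 \<le> real j * \<delta>" "0 \<le> real k * \<delta>" using \<delta>(1) by auto
    moreover have "real (Suc j) * \<delta> \<le> real k * \<delta>" using jk(1) \<delta>(1) by (intro mult_right_mono) auto
    moreover have "t < len e" using t(2) top[OF jk(2)] by linarith
    moreover from calculation have "s < len e" using s(2) t(1) by linarith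
    ultimately have "s = t" using s t by (intro inj_onD[OF inj st]) auto
    then show False using s(2) t(1) \<open>real (Suc j) * \<delta> \<le> real k * \<delta>\<close> by linarith
  qed
  define h where "h k x = complex_of_real (indicator (A k) x / sqrt \<delta>)" for k x
  have hl: "h k \<in> l2 (arc_length \<Gamma>)" if "k < n" for k
  proof (rule arc.bounded_l2[where B = "1 / sqrt \<delta>"])
    show "h k \<in> borel_measurable (arc_length \<Gamma>)" unfolding h_def using Am[OF that] by measurable
    show "norm (h k x) \<le> 1 / sqrt \<delta>" for x
      using \<delta>(1) unfolding h_def norm_of_real by (auto simp: indicator_def)
  qed
  have ip: "ip (arc_length \<Gamma>) (h j) (h k) = (if j = k then 1 else 0)" if jk: "j < n" "k < n" for j k
  proof -
    have "ip (arc_length \<Gamma>) (h j) (h k) = (\<integral>x. complex_of_real (indicator (A j \<inter> A k) x / \<delta>) \<partial>arc_length \<Gamma>)"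
      unfolding ip_def using \<delta>(1)
      by (intro Bochner_Integration.integral_cong refl) (auto simp: h_def indicator_def simp flip: of_real_mult)
    also have "\<dots> = complex_of_real (measure (arc_length \<Gamma>) (A j \<inter> A k) / \<delta>)"
      using Am[OF jk(1)] Am[OF jk(2)] sets.Int_space_eq2[of "A j \<inter> A k" "arc_length \<Gamma>"]
      by (simp only: integral_complex_of_real) simp
    also have "measure (arc_length \<Gamma>) (A j \<inter> A k) = (if j = k then \<delta> else 0)"
    proof (cases "j = k")
      case True
      then show ?thesis using piece(2)[OF jk(1)] \<delta>(1) by (simp add: measure_def)
    next
      case False
      then have "A j \<inter> A k = {}" using disj[of j k] disj[of k j] jk by (metis Int_commute linorder_neqE_nat)
      then show ?thesis using False by simp
    qed
    finally show ?thesis using \<delta>(1) by simp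
  qed
  have "inj_on h {..<n}" using ip by (intro inj_onI) (metis lessThan_iff zero_neq_one)
  then have "card (h ` {..<n}) = n" by (simp add: card_image)
  moreover have "orthonormal (arc_length \<Gamma>) (h ` {..<n})"
    unfolding orthonormal_def using hl ip \<open>inj_on h {..<n}\<close> by (auto simp: inj_on_eq_iff)
  ultimately show ?thesis by blast
qed

end

context signed_graph
begin

lemma arc_integrable_times:
  assumes f: "f \<in> l2 (arc_length \<Gamma>)" and g: "bounded_measurable g"
  shows "integrable (arc_length \<Gamma>) (\<lambda>y. complex_of_real (g y) * f y)"
proof -
  obtain B where B: "\<forall>x\<in>\<Gamma>. \<bar>g x\<bar> \<le> B" using g by (auto simp: bounded_measurable_def)
  have "g \<in> borel_measurable (arc_length \<Gamma>)"
    unfolding measurable_cong_sets[OF sets_arc_length refl] using g by (simp add: bounded_measurable_def)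
  then have "(\<lambda>y. complex_of_real (g y)) \<in> borel_measurable (arc_length \<Gamma>)" by measurable
  then show ?thesis
    by (rule integrable_times[OF arc.finite_measure_axioms sets_arc_length arc.l2_integrable[OF f], where B = B]) (use B in simp)
qed

lemma T_decomposition:
  assumes f: "f \<in> l2 (arc_length \<Gamma>)" and x: "x \<in> \<Gamma>"
  defines "I \<equiv> integral\<^sup>L (arc_length \<Gamma>) f"
  shows "ker.T f x = jpot (arc_length \<Gamma>) f x - of_real (a x) * I
    - (\<integral>y. of_real (a y) * f y \<partial>arc_length \<Gamma>) + of_real (si a) * I"
proof -
  note fi = arc.l2_integrable[OF f]
  note i1 = arc_integrable_times[OF f bm_J(2)[OF x]] and i2 = arc_integrable_times[OF f bm_a]
  have "ker.T f x = (\<integral>y. (of_real (J x y) * f y - of_real (a x) * f y) - of_real (a y) * f y + of_real (si a) * f y \<partial>arc_length \<Gamma>)"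
    unfolding ker.T_def G_def by (intro Bochner_Integration.integral_cong refl) (simp add: algebra_simps)
  also have "\<dots> = jpot (arc_length \<Gamma>) f x - of_real (a x) * I
    - (\<integral>y. of_real (a y) * f y \<partial>arc_length \<Gamma>) + of_real (si a) * I"
    unfolding jpot_def I_def using fi i1 i2 by simp
  finally show ?thesis .
qed

lemma a_eq_jpot: "x \<in> \<Gamma> \<Longrightarrow> complex_of_real (a x) = jpot P (\<lambda>_. 1) x - jpot N (\<lambda>_. 1) x"
  by (simp add: a_def si_def jpot_def)

lemma T_BDV:
  assumes f: "f \<in> l2 (arc_length \<Gamma>)"
  shows "ker.T f \<in> BDV \<Gamma>"
proof -
  define I where "I = integral\<^sup>L (arc_length \<Gamma>) f"
  define c where "c = of_real (si a) * I - (\<integral>y. of_real (a y) * f y \<partial>arc_length \<Gamma>)"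
  have "jpot P (\<lambda>_. 1) \<in> BDV \<Gamma>" by (rule jpot_BDV[OF P.finite_measure_axioms sets_parts(1)]) simp
  moreover have "jpot N (\<lambda>_. 1) \<in> BDV \<Gamma>" by (rule jpot_BDV[OF N.finite_measure_axioms sets_parts(2)]) simp
  ultimately have 1: "(\<lambda>x. 1 * jpot P (\<lambda>_. 1) x + (-1) * jpot N (\<lambda>_. 1) x + 0) \<in> BDV \<Gamma>" by (rule BDV_lincomb)
  have "jpot (arc_length \<Gamma>) f \<in> BDV \<Gamma>"
    by (rule jpot_BDV[OF arc.finite_measure_axioms sets_arc_length arc.l2_integrable[OF f]])
  from BDV_lincomb[OF this 1, of 1 "- I" c]
  show ?thesis
  proof (rule BDV_cong[rotated])
    fix x assume x: "x \<in> \<Gamma>"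
    show "ker.T f x = 1 * jpot (arc_length \<Gamma>) f x + (- I) * (1 * jpot P (\<lambda>_. 1) x + (-1) * jpot N (\<lambda>_. 1) x + 0) + c"
      unfolding T_decomposition[OF f x] a_eq_jpot[OF x] I_def[symmetric] c_def by (simp add: algebra_simps)
  qed
qed

text \<open>The sections of \<open>G\<close> have integral \<open>0\<close> against \<open>\<mu>\<close>; by Fubini so has every function in the range
  of the operator.\<close>

lemma T_fubini:
  assumes M: "finite_measure M" "sets M = sets (borel_on \<Gamma>)" and f: "f \<in> l2 (arc_length \<Gamma>)"
  shows "integrable (arc_length \<Gamma>) (\<lambda>y. of_real (\<integral>x. G x y \<partial>M) * f y)"
    and "integral\<^sup>L M (ker.T f) = (\<integral>y. of_real (\<integral>x. G x y \<partial>M) * f y \<partial>arc_length \<Gamma>)"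
proof -
  interpret M: finite_measure M by fact
  interpret Q: pair_sigma_finite M "arc_length \<Gamma>" ..
  have sp: "space M = \<Gamma>" using sets_eq_imp_space_eq[OF M(2)] by simp
  have fm: "f \<in> borel_measurable (arc_length \<Gamma>)" using f by (rule l2_measurable)
  note fi = arc.l2_integrable[OF f]
  define h where "h x y = complex_of_real (G x y) * f y" for x y
  have Gm: "(\<lambda>(x, y). G x y) \<in> borel_measurable (M \<Otimes>\<^sub>M arc_length \<Gamma>)"
    unfolding measurable_cong_sets[OF sets_pair_measure_cong[OF M(2) sets_arc_length] refl] by (rule G_measurable)
  have "(\<lambda>z. complex_of_real ((\<lambda>(x, y). G x y) z) * f (snd z)) \<in> borel_measurable (M \<Otimes>\<^sub>M arc_length \<Gamma>)"
    using Gm measurable_compose[OF measurable_snd fm] by measurable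
  then have hm: "case_prod h \<in> borel_measurable (M \<Otimes>\<^sub>M arc_length \<Gamma>)"
    by (simp add: h_def case_prod_beta')
  have bd: "norm (h x y) \<le> CG * norm (f y)" if "x \<in> \<Gamma>" "y \<in> \<Gamma>" for x y
    using mult_right_mono[OF CG(2)[OF that], of "norm (f y)"] by (simp add: h_def norm_mult)
  have inner: "integrable (arc_length \<Gamma>) (h x)" if x: "x \<in> \<Gamma>" for x
    using arc_integrable_times[OF f bm_continuous[OF G_continuous(2)[OF x]]] unfolding h_def .
  have hi: "integrable (M \<Otimes>\<^sub>M arc_length \<Gamma>) (case_prod h)"
  proof (rule Q.Fubini_integrable[OF hm])
    show "integrable M (\<lambda>x. \<integral>y. norm (case (x, y) of (x, y) \<Rightarrow> h x y) \<partial>arc_length \<Gamma>)"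
    proof (rule M.integrable_const_bound[where B = "CG * (\<integral>y. norm (f y) \<partial>arc_length \<Gamma>)"])
      show "(\<lambda>x. \<integral>y. norm (case (x, y) of (x, y) \<Rightarrow> h x y) \<partial>arc_length \<Gamma>) \<in> borel_measurable M" using hm by measurable
      have "(\<integral>y. norm (h x y) \<partial>arc_length \<Gamma>) \<le> (\<integral>y. CG * norm (f y) \<partial>arc_length \<Gamma>)" if x: "x \<in> \<Gamma>" for x
        using inner[OF x] fi bd[OF x] by (intro integral_mono) auto
      then show "AE x in M. norm (\<integral>y. norm (case (x, y) of (x, y) \<Rightarrow> h x y) \<partial>arc_length \<Gamma>) \<le> CG * (\<integral>y. norm (f y) \<partial>arc_length \<Gamma>)"
        using sp by (intro AE_I2) simp
    qed
    show "AE x in M. integrable (arc_length \<Gamma>) (\<lambda>y. case (x, y) of (x, y) \<Rightarrow> h x y)"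
      using inner sp by (intro AE_I2) simp
  qed
  have eq: "(\<integral>x. h x y \<partial>M) = of_real (\<integral>x. G x y \<partial>M) * f y" for y
    unfolding h_def by simp
  show "integrable (arc_length \<Gamma>) (\<lambda>y. of_real (\<integral>x. G x y \<partial>M) * f y)"
    using Q.integrable_snd[OF hi] unfolding eq .
  show "integral\<^sup>L M (ker.T f) = (\<integral>y. of_real (\<integral>x. G x y \<partial>M) * f y \<partial>arc_length \<Gamma>)"
    using Q.Fubini_integral[OF hi] unfolding eq by (simp add: ker.T_def[abs_def] h_def)
qed

lemma T_mean_zero:
  assumes f: "f \<in> l2 (arc_length \<Gamma>)"
  shows "signed_integral (borel_on \<Gamma>) \<mu> (ker.T f) = 0"
proof -
  note P = T_fubini[OF P.finite_measure_axioms sets_parts(1) f]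
  note N = T_fubini[OF N.finite_measure_axioms sets_parts(2) f]
  have "signed_integral (borel_on \<Gamma>) \<mu> (ker.T f)
    = (\<integral>y. of_real (\<integral>x. G x y \<partial>P) * f y - of_real (\<integral>x. G x y \<partial>N) * f y \<partial>arc_length \<Gamma>)"
    unfolding signed_integral_def P(2) N(2) by (rule Bochner_Integration.integral_diff[symmetric, OF P(1) N(1)])
  also have "\<dots> = (\<integral>y. of_real (si (\<lambda>x. G x y)) * f y \<partial>arc_length \<Gamma>)"
    by (simp add: si_def left_diff_distrib)
  also have "\<dots> = (\<integral>y. 0 \<partial>arc_length \<Gamma>)"
    by (intro Bochner_Integration.integral_cong refl) (simp add: si_G)
  finally show ?thesis by simp
qed

lemma eigenfunction_BDV_mu:
  assumes f: "f \<in> ker.eig \<alpha>" and \<alpha>: "\<alpha> \<noteq> 0"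
  shows "\<exists>h\<in>BDV_mu \<Gamma> \<mu>. AE x in arc_length \<Gamma>. f x = h x"
proof -
  note fl = ker.eig_l2[OF f]
  define h where "h = (\<lambda>x. (1 / \<alpha>) * ker.T f x + 0 * ker.T f x + 0)"
  have "h \<in> BDV \<Gamma>" unfolding h_def by (intro BDV_lincomb T_BDV fl)
  moreover have "signed_integral (borel_on \<Gamma>) \<mu> h = (1 / \<alpha>) * signed_integral (borel_on \<Gamma>) \<mu> (ker.T f)"
    unfolding signed_integral_def h_def by (simp add: diff_divide_distrib)
  then have "signed_integral (borel_on \<Gamma>) \<mu> h = 0" by (simp add: T_mean_zero[OF fl])
  moreover have "AE x in arc_length \<Gamma>. ker.T f x = \<alpha> * f x" using f by (simp add: ker.eig_def)
  then have "AE x in arc_length \<Gamma>. f x = h x" by eventually_elim (simp add: h_def \<alpha>)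
  ultimately show ?thesis unfolding BDV_mu_def by blast
qed

text \<open>If \<open>T f = 0\<close> and \<open>f\<close> has mean \<open>0\<close>, then the potential of \<open>f\<close> is constant, so that its Laplacian,
  the measure with density \<open>f\<close>, vanishes.\<close>

lemma kernel_mean_zero:
  assumes f: "f \<in> ker.eig 0" and I: "integral\<^sup>L (arc_length \<Gamma>) f = 0"
  shows "AE x in arc_length \<Gamma>. f x = 0"
proof -
  note fl = ker.eig_l2[OF f]
  note fi = arc.l2_integrable[OF fl]
  have "AE x in arc_length \<Gamma>. ker.T f x = 0" using f by (simp add: ker.eig_def)
  have T0: "ker.T f x = 0" if x: "x \<in> \<Gamma>" for x
  proof (rule ccontr)
    assume nz: "ker.T f x \<noteq> 0"
    define U where "U = \<Gamma> \<inter> ker.T f -` (- {0})"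
    have op: "openin (top_of_set \<Gamma>) U" unfolding U_def
      by (rule continuous_openin_preimage_gen[OF T_continuous[OF fl]]) (simp add: open_Compl)
    have "U \<noteq> {}" using x nz by (auto simp: U_def)
    moreover have "U \<in> sets (arc_length \<Gamma>)" using openin_borel_on[OF op] sets_arc_length by simp
    moreover have "U = {x \<in> space (arc_length \<Gamma>). \<not> ker.T f x = 0}" by (auto simp: U_def)
    ultimately have "emeasure (arc_length \<Gamma>) U = 0"
      using \<open>AE x in arc_length \<Gamma>. ker.T f x = 0\<close> by (metis AE_iff_measurable)
    then show False using arc_length_open_positive[OF op \<open>U \<noteq> {}\<close>] by simp
  qed
  define c where "c = (\<integral>y. of_real (a y) * f y \<partial>arc_length \<Gamma>)"
  have jc: "jpot (arc_length \<Gamma>) f x = 0 * ker.T f x + 0 * ker.T f x + c" if x: "x \<in> \<Gamma>" for x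
    using T_decomposition[OF fl x] T0[OF x] I by (simp add: c_def)
  have Td: "ker.T f \<in> dir_differentiable \<Gamma>" using T_BDV[OF fl] by (simp add: BDV_def)
  have mean: "(\<integral>y. indicator S y * f y \<partial>arc_length \<Gamma>) = 0" if S: "tame S" for S
  proof -
    have Sm: "S \<in> sets (arc_length \<Gamma>)" using S sets_arc_length by (simp add: tame_def)
    have ii: "integrable (arc_length \<Gamma>) (\<lambda>y. indicator S y * f y)"
      using integrable_mult_indicator[OF Sm fi] by (simp add: scaleR_conv_of_real of_real_indicator)
    have "m_fun \<Gamma> (jpot (arc_length \<Gamma>) f) S = 0"
      using m_fun_cong[of "jpot (arc_length \<Gamma>) f" "\<lambda>x. 0 * ker.T f x + 0 * ker.T f x + c" S, OF jc]
        m_fun_lincomb[OF Td Td, of 0 0 c S] by simp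
    then have "0 = (\<integral>y. (indicator S y - indicator S z0) * f y \<partial>arc_length \<Gamma>)"
      using m_fun_jpot[OF arc.finite_measure_axioms sets_arc_length fi S] by simp
    also have "\<dots> = (\<integral>y. indicator S y * f y \<partial>arc_length \<Gamma>) - indicator S z0 * integral\<^sup>L (arc_length \<Gamma>) f"
      using ii fi by (simp add: left_diff_distrib)
    finally show ?thesis using I by simp
  qed
  have pieces: "(\<integral>x. indicator (param e ` {a<..<b}) x * f x \<partial>arc_length \<Gamma>) = 0"
      "integrable (arc_length \<Gamma>) (\<lambda>x. indicator (param e ` {a<..<b}) x * f x)"
    if "open_segment_in e" "0 \<le> a" "a < b" "b \<le> len e" for e a b
  proof -
    have S: "tame (param e ` {a<..<b})" using edge_piece(1)[OF that] .
    show "(\<integral>x. indicator (param e ` {a<..<b}) x * f x \<partial>arc_length \<Gamma>) = 0" by (rule mean[OF S])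
    have Sm: "param e ` {a<..<b} \<in> sets (arc_length \<Gamma>)" using S sets_arc_length by (simp add: tame_def)
    show "integrable (arc_length \<Gamma>) (\<lambda>x. indicator (param e ` {a<..<b}) x * f x)"
      using integrable_mult_indicator[OF Sm fi] by (simp add: scaleR_conv_of_real of_real_indicator)
  qed
  have "AE x in arc_length \<Gamma>. Re (f x) = 0"
  proof (rule zero_on_edge_pieces)
    show "integrable (arc_length \<Gamma>) (\<lambda>x. Re (f x))" using fi by simp
    fix e a b assume e: "open_segment_in e" "0 \<le> a" "a < b" "b \<le> len e"
    have "(\<integral>x. Re (indicator (param e ` {a<..<b}) x * f x) \<partial>arc_length \<Gamma>) = 0"
      using integral_Re[OF pieces(2)[OF e]] pieces(1)[OF e] by simp
    moreover have "Re (indicator (param e ` {a<..<b}) x * f x) = indicator (param e ` {a<..<b}) x * Re (f x)" for x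
      by (simp add: indicator_def)
    ultimately show "(\<integral>x. indicator (param e ` {a<..<b}) x * Re (f x) \<partial>arc_length \<Gamma>) = 0" by simp
  qed
  moreover have "AE x in arc_length \<Gamma>. Im (f x) = 0"
  proof (rule zero_on_edge_pieces)
    show "integrable (arc_length \<Gamma>) (\<lambda>x. Im (f x))" using fi by simp
    fix e a b assume e: "open_segment_in e" "0 \<le> a" "a < b" "b \<le> len e"
    have "(\<integral>x. Im (indicator (param e ` {a<..<b}) x * f x) \<partial>arc_length \<Gamma>) = 0"
      using integral_Im[OF pieces(2)[OF e]] pieces(1)[OF e] by simp
    moreover have "Im (indicator (param e ` {a<..<b}) x * f x) = indicator (param e ` {a<..<b}) x * Im (f x)" for x
      by (simp add: indicator_def)
    ultimately show "(\<integral>x. indicator (param e ` {a<..<b}) x * Im (f x) \<partial>arc_length \<Gamma>) = 0" by simp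
  qed
  ultimately show ?thesis by eventually_elim (simp add: complex_eq_iff)
qed

lemma kernel_finite: "ker.kernel_finite"
proof -
  have "card F \<le> Suc 0" if F: "finite F" "F \<subseteq> ker.eig 0" "orthonormal (arc_length \<Gamma>) F" for F
    unfolding card_le_Suc0_iff_eq[OF F(1)]
  proof (intro ballI, rule ccontr)
    fix e e' assume e: "e \<in> F" "e' \<in> F" "e \<noteq> e'"
    have el: "e \<in> ker.eig 0" "e' \<in> ker.eig 0" using e F(2) by auto
    note l = ker.eig_l2[OF el(1)] ker.eig_l2[OF el(2)]
    define I where "I = integral\<^sup>L (arc_length \<Gamma>) e"
    define I' where "I' = integral\<^sup>L (arc_length \<Gamma>) e'"
    define g where "g = (\<lambda>x. I' * e x + (- I) * e' x)"
    have gl: "g \<in> ker.eig 0" unfolding g_def by (rule ker.eig_lincomb[OF el])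
    have "integral\<^sup>L (arc_length \<Gamma>) g = 0"
      unfolding g_def using arc.l2_integrable[OF l(1)] arc.l2_integrable[OF l(2)] by (simp add: I_def I'_def)
    then have g0: "AE x in arc_length \<Gamma>. g x = 0" by (rule kernel_mean_zero[OF gl])
    have "ip (arc_length \<Gamma>) g e = ip (arc_length \<Gamma>) (\<lambda>x. 0) e"
      using g0 l(1) ker.eig_l2[OF gl] by (intro ip_cong_AE) (auto simp: l2_measurable)
    moreover have "ip (arc_length \<Gamma>) g e = I' * ip (arc_length \<Gamma>) e e + (- I) * ip (arc_length \<Gamma>) e' e"
      unfolding g_def by (rule ip_lincomb_left[OF l l(1)])
    moreover have "ip (arc_length \<Gamma>) e e = 1" "ip (arc_length \<Gamma>) e' e = 0" using F(3) e by (auto simp: orthonormal_def)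
    ultimately have "I' = 0" by simp
    then have "AE x in arc_length \<Gamma>. e' x = 0" unfolding I'_def by (rule kernel_mean_zero[OF el(2)])
    then have "l2norm (arc_length \<Gamma>) e' = 0" using l2norm_eq_0_iff[OF l(2)] by simp
    then show False using orthonormal_norm[OF F(3) e(2)] by simp
  qed
  then show ?thesis unfolding ker.kernel_finite_def by blast
qed

section \<open>The spectral theorem for the operator\<close>

lemma phi_mu_eq: "x \<in> \<Gamma> \<Longrightarrow> phi_mu \<Gamma> \<mu> f x = ker.T f x"
  unfolding phi_mu_def ker.T_def by (intro Bochner_Integration.integral_cong refl) (simp add: g_mu_eq)

lemma L2_eq: "L2 \<Gamma> = l2 (arc_length \<Gamma>)" "L2_inner \<Gamma> = ip (arc_length \<Gamma>)" "L2_norm \<Gamma> = l2norm (arc_length \<Gamma>)"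
  by (simp_all add: L2_def l2_def L2_inner_def ip_def L2_norm_def l2norm_def fun_eq_iff)

lemma eigenspace_eq: "eigenspace \<Gamma> \<mu> \<alpha> = ker.eig \<alpha>"
proof -
  have "(AE x in arc_length \<Gamma>. phi_mu \<Gamma> \<mu> f x = \<alpha> * f x) \<longleftrightarrow> (AE x in arc_length \<Gamma>. ker.T f x = \<alpha> * f x)" for f
    by (intro AE_cong) (simp add: phi_mu_eq)
  then show ?thesis by (simp add: eigenspace_def ker.eig_def L2_eq)
qed

lemma eigenfunction_iff: "eigenfunction \<Gamma> \<mu> \<alpha> f \<longleftrightarrow> f \<in> ker.eig \<alpha> \<and> l2norm (arc_length \<Gamma>) f \<noteq> 0"
  unfolding eigenfunction_def eigenspace_eq using l2norm_eq_0_iff ker.eig_l2 by blast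

lemma eigenvalues_eq: "eigenvalues \<Gamma> \<mu> = ker.evs"
  unfolding eigenvalues_def ker.evs_def eigenfunction_iff by blast

theorem finite_multiplicity: "finite_multiplicity \<Gamma> \<mu> \<alpha>"
proof -
  obtain F where F: "finite F" "F \<subseteq> ker.eig \<alpha>" "\<forall>f\<in>ker.eig \<alpha>. AE x in arc_length \<Gamma>. f x = proj (arc_length \<Gamma>) F f x"
    using ker.eigenspace_basis[OF kernel_finite] by blast
  have "\<exists>c. AE x in arc_length \<Gamma>. f x = (\<Sum>h\<in>F. c h * h x)" if "f \<in> ker.eig \<alpha>" for f
    using F(3)[rule_format, OF that] unfolding proj_def by (rule exI[of _ "ip (arc_length \<Gamma>) f"])
  then show ?thesis unfolding finite_multiplicity_def eigenspace_eq using F(1,2) by blast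
qed

theorem nonzero_eigenvalues_enumeration:
  "\<exists>\<alpha> :: nat \<Rightarrow> complex. bij_betw \<alpha> UNIV (eigenvalues \<Gamma> \<mu> - {0}) \<and>
     decseq (\<lambda>i. norm (\<alpha> i)) \<and> (\<lambda>i. norm (\<alpha> i)) \<longlonglongrightarrow> 0"
proof -
  have inf: "infinite (ker.evs - {0})"
    by (rule ker.infinitely_many_eigenvalues[OF kernel_finite orthonormal_family_exists])
  have fin: "finite {\<alpha> \<in> ker.evs - {0}. \<epsilon> \<le> norm \<alpha>}" if "0 < \<epsilon>" for \<epsilon>
    by (rule finite_subset[OF _ ker.eigenvalues_above_finite[OF that]]) auto
  have "0 \<notin> ker.evs - {0}" by simp
  from decreasing_enumeration[OF inf this fin] show ?thesis unfolding eigenvalues_eq by blast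
qed

theorem eigenfunction_basis: "\<exists>E. orthonormal_basis \<Gamma> E \<and> (\<forall>e\<in>E. \<exists>\<alpha>. eigenfunction \<Gamma> \<mu> \<alpha> e)"
proof -
  obtain E where E: "orthonormal (arc_length \<Gamma>) E" "\<forall>e\<in>E. \<exists>\<alpha>\<in>ker.evs. e \<in> ker.eig \<alpha>"
    "\<forall>f\<in>l2 (arc_length \<Gamma>). \<forall>\<epsilon>>0. \<exists>F c. finite F \<and> F \<subseteq> E \<and> l2norm (arc_length \<Gamma>) (\<lambda>x. f x - (\<Sum>e\<in>F. c e * e x)) < \<epsilon>"
    using ker.eigenbasis_exists[OF kernel_finite] by blast
  have "orthonormal_basis \<Gamma> E" using E(1,3) unfolding orthonormal_basis_def L2_eq orthonormal_def by blast
  moreover have "\<exists>\<alpha>. eigenfunction \<Gamma> \<mu> \<alpha> e" if e: "e \<in> E" for e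
    using E(2) e orthonormal_norm[OF E(1) e] unfolding eigenfunction_iff by (metis zero_neq_one)
  ultimately show ?thesis by blast
qed

end

theorem theorem1p4:
  fixes \<Gamma> :: "'a::metric_space set" and \<mu> :: "'a set \<Rightarrow> real"
  assumes "metrized_graph \<Gamma>"
    and "signed_measure (borel_on \<Gamma>) \<mu>"
    and "\<mu> \<Gamma> = 1"
    and "total_variation (borel_on \<Gamma>) \<mu> \<Gamma> < \<infinity>"
  shows "countable (eigenvalues \<Gamma> \<mu>) \<and>
    (\<forall>\<alpha>\<in>eigenvalues \<Gamma> \<mu>. \<alpha> \<in> \<real> \<and> finite_multiplicity \<Gamma> \<mu> \<alpha>) \<and>
    (\<exists>\<alpha> :: nat \<Rightarrow> complex. bij_betw \<alpha> UNIV (eigenvalues \<Gamma> \<mu> - {0}) \<and>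
       decseq (\<lambda>i. norm (\<alpha> i)) \<and> (\<lambda>i. norm (\<alpha> i)) \<longlonglongrightarrow> 0) \<and>
    (\<exists>E. orthonormal_basis \<Gamma> E \<and> (\<forall>e\<in>E. \<exists>\<alpha>. eigenfunction \<Gamma> \<mu> \<alpha> e)) \<and>
    (\<forall>\<alpha> f. \<alpha> \<noteq> 0 \<longrightarrow> eigenfunction \<Gamma> \<mu> \<alpha> f \<longrightarrow>
       (\<exists>h\<in>BDV_mu \<Gamma> \<mu>. AE x in arc_length \<Gamma>. f x = h x))"
proof -
  obtain z0 where z0: "z0 \<in> \<Gamma>" using assms(1) by (auto simp: metrized_graph_def)
  interpret graph: metric_graph \<Gamma> by (rule metric_graph.intro) fact
  interpret signed_graph \<Gamma> z0 \<mu>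
  proof
    show "total_variation (borel_on \<Gamma>) \<mu> (space (borel_on \<Gamma>)) < \<infinity>" using assms(4) by simp
  qed (fact z0 assms)+
  show ?thesis
  proof (intro conjI)
    show "countable (eigenvalues \<Gamma> \<mu>)" unfolding eigenvalues_eq by (rule ker.evs_countable)
    show "\<forall>\<alpha>\<in>eigenvalues \<Gamma> \<mu>. \<alpha> \<in> \<real> \<and> finite_multiplicity \<Gamma> \<mu> \<alpha>"
      using ker.evs_real finite_multiplicity unfolding eigenvalues_eq by blast
    show "\<forall>\<alpha> f. \<alpha> \<noteq> 0 \<longrightarrow> eigenfunction \<Gamma> \<mu> \<alpha> f \<longrightarrow>
       (\<exists>h\<in>BDV_mu \<Gamma> \<mu>. AE x in arc_length \<Gamma>. f x = h x)"
      using eigenfunction_BDV_mu unfolding eigenfunction_iff by blast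
  qed (rule nonzero_eigenvalues_enumeration, rule eigenfunction_basis)
qed

end
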